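(* Let $n$ be an integer with $3\le n<9$. Let $(M,g)$ be a spatially homogeneous solution of the vacuum Einstein equations in $n+1$ spacetime dimensions whose homogeneity is defined by a group of the form $G_3\times(\mathbb{R}\rtimes\mathbb{Z}_2)^{n-3}$ for some three-dimensional Lie group $G_3$ whose Bianchi type is neither IX nor VI${}_{-1/9}$. Suppose that the solution is expanding at some time and is maximally extended to the future. Then $(M,g)$ is future geodesically complete.
   Context: Vacuum Einstein equations: the Ricci tensor of the Lorentzian metric vanishes. All objects are smooth. Setting. $G_3$ is a connected and simply connected three-dimensional Lie group with a basis $\theta^1,\theta^2,\theta^3$ of left-invariant one-forms, and $y^1,\dots,y^{n-3}$ are the standard coordinates on $\mathbb{R}^{n-3}$. Each factor $\mathbb{Z}_2$ acts on the corresponding factor $\mathbb{R}$ by reflection $y^I\mapsto -y^I$. That the homogeneity is defined by $G_3\times(\mathbb{R}\rtimes\mathbb{Z}_2)^{n-3}$ means that $M=I\times(G_3\times\mathbb{R}^{n-3})$ for an interval $I\subset\mathbb{R}$, and that this group acts by isometries preserving the hypersurfaces of constant $t$ and the product decomposition of these hypersurfaces. Thus the spacetime metric can be written as $$-dt^2+\sum_{i,j=1}^3 g_{ij}(t)\,\theta^i\otimes\theta^j+\sum_{I=1}^{n-3}e^{2\phi^I(t)}(dy^I)^2,$$ with $(g_{ij}(t))$ symmetric positive definite and $\phi^I$ real functions of $t\in I$. Sign convention and expansion. Write the spatial metric as $g_{ab}(t)$ in the left-invariant coframe of $G_3\times\mathbb{R}^{n-3}$. The second fundamental form $k_{ab}$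 of the hypersurfaces of constant $t$ is defined by $\partial_t g_{ab}=-2k_{ab}$, and $\mathrm{tr}\,k=g^{ab}k_{ab}$. The solution is expanding at time $t$ if $\mathrm{tr}\,k(t)<0$. Maximally extended to the future means that the solution cannot be extended, as a solution of this form, to a larger interval in the direction of increasing $t$. Future geodesically complete: every future-inextendible, future-directed timelike or null geodesic is defined for arbitrarily large values of its affine parameter. Bianchi types. Three-dimensional real Lie algebras are classified into Bianchi types I to IX. Type IX is the Lie algebra $su(2)$. Type VI${}_h$ is the Lie algebra with basis $e_1,e_2,e_3$ and $[e_2,e_3]=0$, $[e_1,e_2]=\alpha e_2$, $[e_1,e_3]=\beta e_3$, where $\alpha\neq\beta$ are non-zero reals and $h=-\left(\frac{\alpha+\beta}{\alpha-\beta}\right)^2$. In particular type VI${}_{-1/9}$ is the case $\alpha/\beta\in\{-2,-\tfrac12\}$. The Bianchi type of $G_3$ is that of its Lie algebra. *)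

theory Defs
  imports "HOL-Analysis.Analysis"
begin

section \<open>Smooth maps and three-dimensional Lie groups\<close>

text \<open>Differentiability classes; these are only meant to be used on open sets.\<close>

primrec Ck_on ::
  "nat \<Rightarrow> 'a::real_normed_vector set \<Rightarrow> ('a \<Rightarrow> 'b::real_normed_vector) \<Rightarrow> bool"
where
  "Ck_on 0 S f \<longleftrightarrow> continuous_on S f"
| "Ck_on (Suc k) S f \<longleftrightarrow> (\<forall>x\<in>S. f differentiable (at x)) \<and>
     (\<forall>v. Ck_on k S (\<lambda>x. frechet_derivative f (at x) v))"

definition smooth_on ::
  "'a::real_normed_vector set \<Rightarrow> ('a \<Rightarrow> 'b::real_normed_vector) \<Rightarrow> bool" where
  "smooth_on S f \<longleftrightarrow> (\<forall>k. Ck_on k S f)"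

type_synonym 'g chart = "'g set \<times> ('g \<Rightarrow> real^3)"

definition smooth_atlas :: "'g::topological_space chart set \<Rightarrow> bool" where
  "smooth_atlas A \<longleftrightarrow>
     (\<Union>(U, \<phi>)\<in>A. U) = UNIV \<and>
     (\<forall>(U, \<phi>)\<in>A. open U \<and> open (\<phi> ` U) \<and> homeomorphism U (\<phi> ` U) \<phi> (inv_into U \<phi>)) \<and>
     (\<forall>(U, \<phi>)\<in>A. \<forall>(V, \<psi>)\<in>A. smooth_on (\<phi> ` (U \<inter> V)) (\<psi> \<circ> inv_into U \<phi>))"

definition smooth_at ::
  "'g::topological_space chart set \<Rightarrow> ('g \<Rightarrow> real) \<Rightarrow> 'g \<Rightarrow> bool" where
  "smooth_at A f p \<longleftrightarrow> (\<exists>W. open W \<and> p \<in> W \<and>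
     (\<forall>(U, \<phi>)\<in>A. smooth_on (\<phi> ` (U \<inter> W)) (f \<circ> inv_into U \<phi>)))"

text \<open>The group operation is written additively, as is usual for the type class
  \<^class>\<open>group_add\<close>, which does not require commutativity.\<close>

definition lie_group3 :: "'g::{group_add, topological_space} chart set \<Rightarrow> bool" where
  "lie_group3 A \<longleftrightarrow> smooth_atlas A \<and>
     (\<forall>(U, \<phi>)\<in>A. \<forall>(V, \<psi>)\<in>A. \<forall>(W, \<eta>)\<in>A.
        smooth_on {(u, v). u \<in> \<phi> ` U \<and> v \<in> \<psi> ` V \<and> inv_into U \<phi> u + inv_into V \<psi> v \<in> W}
          (\<lambda>(u, v). \<eta> (inv_into U \<phi> u + inv_into V \<psi> v))) \<and>
     (\<forall>(U, \<phi>)\<in>A. \<forall>(W, \<eta>)\<in>A.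
        smooth_on {u. u \<in> \<phi> ` U \<and> - inv_into U \<phi> u \<in> W} (\<lambda>u. \<eta> (- inv_into U \<phi> u)))"

text \<open>Vector fields act as differential operators on functions. The value of \<open>X f p\<close> is
  relevant only if \<open>f\<close> is smooth near \<open>p\<close>; then it is the derivative of \<open>f\<close> in the direction
  whose components \<open>\<xi>\<close> depend smoothly on the point.\<close>

type_synonym 'g vector_field = "('g \<Rightarrow> real) \<Rightarrow> 'g \<Rightarrow> real"

definition smooth_vector_field ::
  "'g::topological_space chart set \<Rightarrow> 'g vector_field \<Rightarrow> bool" where
  "smooth_vector_field A X \<longleftrightarrow>
     (\<forall>(U, \<phi>)\<in>A. \<exists>\<xi>. smooth_on (\<phi> ` U) \<xi> \<and>
        (\<forall>p\<in>U. \<forall>f. smooth_at A f p \<longrightarrow>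
           X f p = frechet_derivative (f \<circ> inv_into U \<phi>) (at (\<phi> p)) (\<xi> (\<phi> p))))"

definition left_invariant ::
  "'g::{group_add, topological_space} chart set \<Rightarrow> 'g vector_field \<Rightarrow> bool" where
  "left_invariant A X \<longleftrightarrow>
     (\<forall>a p f. smooth_at A f (a + p) \<longrightarrow> X (\<lambda>x. f (a + x)) p = X f (a + p))"

text \<open>Three linearly independent left-invariant vector fields form a basis of the Lie algebra.
  The left-invariant one-forms \<open>\<theta>\<^sup>1, \<theta>\<^sup>2, \<theta>\<^sup>3\<close> are its dual basis, \<open>\<theta>\<^sup>i(e\<^sub>j) = \<delta>\<^sup>i\<^sub>j\<close>.\<close>

definition left_invariant_frame ::
  "'g::{group_add, topological_space} chart set \<Rightarrow> (3 \<Rightarrow> 'g vector_field) \<Rightarrow> bool" where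
  "left_invariant_frame A e \<longleftrightarrow>
     (\<forall>i. smooth_vector_field A (e i) \<and> left_invariant A (e i)) \<and>
     (\<forall>w::real^3. (\<forall>p f. smooth_at A f p \<longrightarrow> (\<Sum>i\<in>UNIV. w $ i * e i f p) = 0) \<longrightarrow> w = 0)"

text \<open>\<open>[e\<^sub>i, e\<^sub>j] = \<Sum>\<^sub>k c i j k e\<^sub>k\<close>; a left-invariant frame determines \<open>c\<close>.\<close>

definition structure_constants ::
  "'g::topological_space chart set \<Rightarrow> (3 \<Rightarrow> 'g vector_field) \<Rightarrow> (3 \<Rightarrow> 3 \<Rightarrow> 3 \<Rightarrow> real) \<Rightarrow> bool" where
  "structure_constants A e c \<longleftrightarrow>
     (\<forall>i j p f. smooth_at A f p \<longrightarrow>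
        e i (e j f) p - e j (e i f) p = (\<Sum>k\<in>UNIV. c i j k * e k f p))"


section \<open>Bianchi types\<close>

text \<open>\<open>u :: real^3\<close> stands for the element \<open>\<Sum>\<^sub>i u\<^sub>i e\<^sub>i\<close> of the Lie algebra.\<close>

definition lie_bracket :: "(3 \<Rightarrow> 3 \<Rightarrow> 3 \<Rightarrow> real) \<Rightarrow> real^3 \<Rightarrow> real^3 \<Rightarrow> real^3" where
  "lie_bracket c u v = (\<chi> k. \<Sum>i\<in>UNIV. \<Sum>j\<in>UNIV. c i j k * u $ i * v $ j)"

definition su2 :: "(complex^2^2) set" where
  "su2 = {X. (\<forall>i j. X $ j $ i = - cnj (X $ i $ j)) \<and> trace X = 0}"

definition bianchi_IX :: "(3 \<Rightarrow> 3 \<Rightarrow> 3 \<Rightarrow> real) \<Rightarrow> bool" where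
  "bianchi_IX c \<longleftrightarrow>
     (\<exists>F :: real^3 \<Rightarrow> complex^2^2. linear F \<and> bij_betw F UNIV su2 \<and>
        (\<forall>u v. F (lie_bracket c u v) = F u ** F v - F v ** F u))"

definition bianchi_VI :: "real \<Rightarrow> (3 \<Rightarrow> 3 \<Rightarrow> 3 \<Rightarrow> real) \<Rightarrow> bool" where
  "bianchi_VI h c \<longleftrightarrow>
     (\<exists>b1 b2 b3 \<alpha> \<beta>. distinct [b1, b2, b3] \<and> independent {b1, b2, b3} \<and>
        \<alpha> \<noteq> 0 \<and> \<beta> \<noteq> 0 \<and> \<alpha> \<noteq> \<beta> \<and> h = - (((\<alpha> + \<beta>) / (\<alpha> - \<beta>))\<^sup>2) \<and>
        lie_bracket c b2 b3 = 0 \<and>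
        lie_bracket c b1 b2 = \<alpha> *\<^sub>R b2 \<and>
        lie_bracket c b1 b3 = \<beta> *\<^sub>R b3)"


section \<open>The spacetime and its global frame\<close>

text \<open>The manifold is \<open>I \<times> G \<times> \<real>\<^sup>n\<^sup>-\<^sup>3\<close>, where a point of \<open>\<real>\<^sup>n\<^sup>-\<^sup>3\<close> is a function supported
  on \<open>{1..n-3}\<close> (so that \<open>n = 3\<close> is allowed). It has the global frame consisting of
  \<open>\<partial>\<^sub>t\<close>, the left-invariant vector fields \<open>e\<^sub>i\<close> and the \<open>\<partial>/\<partial>y\<^sup>K\<close>; its dual coframe is
  \<open>dt, \<theta>\<^sup>i, dy\<^sup>K\<close>. Tensor components always refer to this frame.\<close>

type_synonym 'g event = "real \<times> 'g \<times> (nat \<Rightarrow> real)"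

definition spacetime :: "nat \<Rightarrow> real set \<Rightarrow> 'g event set" where
  "spacetime n I = {(t, x, y). t \<in> I \<and> (\<forall>K. K \<notin> {1..n-3} \<longrightarrow> y K = 0)}"

datatype idx = Time | Grp 3 | Flat nat

definition spatial_idx :: "nat \<Rightarrow> idx set" where
  "spatial_idx n = range Grp \<union> Flat ` {1..n-3}"

definition all_idx :: "nat \<Rightarrow> idx set" where
  "all_idx n = insert Time (spatial_idx n)"

text \<open>The derivative of a function on the spacetime along a frame vector field.\<close>

fun frame_deriv :: "(3 \<Rightarrow> 'g vector_field) \<Rightarrow> idx \<Rightarrow> ('g event \<Rightarrow> real) \<Rightarrow> 'g event \<Rightarrow> real" where
  "frame_deriv e Time f (t, x, y) = deriv (\<lambda>s. f (s, x, y)) t"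
| "frame_deriv e (Grp i) f (t, x, y) = e i (\<lambda>z. f (t, z, y)) x"
| "frame_deriv e (Flat K) f (t, x, y) = deriv (\<lambda>s. f (t, x, y(K := s))) (y K)"

text \<open>\<open>[E\<^sub>a, E\<^sub>b] = \<Sum>\<^sub>d frame_comm c a b d E\<^sub>d\<close> for the frame fields \<open>E\<^sub>a\<close>: all brackets
  other than those of the \<open>e\<^sub>i\<close> vanish.\<close>

fun frame_comm :: "(3 \<Rightarrow> 3 \<Rightarrow> 3 \<Rightarrow> real) \<Rightarrow> idx \<Rightarrow> idx \<Rightarrow> idx \<Rightarrow> real" where
  "frame_comm c (Grp i) (Grp j) (Grp k) = c i j k"
| "frame_comm c _ _ _ = 0"

text \<open>\<open>-dt\<^sup>2 + \<Sum> g\<^sub>i\<^sub>j(t) \<theta>\<^sup>i \<otimes> \<theta>\<^sup>j + \<Sum> exp (2 \<phi>\<^sup>K(t)) (dy\<^sup>K)\<^sup>2\<close>\<close>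

fun metric_comp :: "(real \<Rightarrow> real^3^3) \<Rightarrow> (nat \<Rightarrow> real \<Rightarrow> real) \<Rightarrow> real \<Rightarrow> idx \<Rightarrow> idx \<Rightarrow> real" where
  "metric_comp g \<phi> t Time Time = - 1"
| "metric_comp g \<phi> t (Grp i) (Grp j) = g t $ i $ j"
| "metric_comp g \<phi> t (Flat K) (Flat L) = (if K = L then exp (2 * \<phi> K t) else 0)"
| "metric_comp g \<phi> t _ _ = 0"

definition metric_at ::
  "(real \<Rightarrow> real^3^3) \<Rightarrow> (nat \<Rightarrow> real \<Rightarrow> real) \<Rightarrow> 'g event \<Rightarrow> idx \<Rightarrow> idx \<Rightarrow> real" where
  "metric_at g \<phi> p = metric_comp g \<phi> (fst p)"


section \<open>Levi-Civita connection, Ricci tensor and geodesics\<close>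

text \<open>Inverse of a matrix indexed by the finite set \<open>S\<close>; its entries with indices in \<open>S\<close> are
  uniquely determined if the matrix is regular.\<close>

definition inverse_matrix :: "idx set \<Rightarrow> (idx \<Rightarrow> idx \<Rightarrow> real) \<Rightarrow> idx \<Rightarrow> idx \<Rightarrow> real" where
  "inverse_matrix S h = (SOME k. \<forall>a\<in>S. \<forall>b\<in>S. (\<Sum>d\<in>S. h a d * k d b) = of_bool (a = b))"

text \<open>In this section \<open>h\<close> is an arbitrary metric, given by its components, which may depend on
  the point. Koszul's formula for \<open>h(\<nabla>\<^bsub>E\<^sub>a\<^esub> E\<^sub>b, E\<^sub>d)\<close>:\<close>

definition koszul ::
  "nat \<Rightarrow> (3 \<Rightarrow> 'g vector_field) \<Rightarrow> (3 \<Rightarrow> 3 \<Rightarrow> 3 \<Rightarrow> real) \<Rightarrow> ('g event \<Rightarrow> idx \<Rightarrow> idx \<Rightarrow> real) \<Rightarrow>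
    idx \<Rightarrow> idx \<Rightarrow> idx \<Rightarrow> 'g event \<Rightarrow> real" where
  "koszul n e c h a b d p =
     (frame_deriv e a (\<lambda>q. h q b d) p + frame_deriv e b (\<lambda>q. h q a d) p
        - frame_deriv e d (\<lambda>q. h q a b) p
        + (\<Sum>m\<in>all_idx n. frame_comm c a b m * h p m d
             - frame_comm c a d m * h p m b - frame_comm c b d m * h p m a)) / 2"

text \<open>\<open>\<nabla>\<^bsub>E\<^sub>a\<^esub> E\<^sub>b = \<Sum>\<^sub>d connection n e c h a b d E\<^sub>d\<close>\<close>

definition connection ::
  "nat \<Rightarrow> (3 \<Rightarrow> 'g vector_field) \<Rightarrow> (3 \<Rightarrow> 3 \<Rightarrow> 3 \<Rightarrow> real) \<Rightarrow> ('g event \<Rightarrow> idx \<Rightarrow> idx \<Rightarrow> real) \<Rightarrow>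
    idx \<Rightarrow> idx \<Rightarrow> idx \<Rightarrow> 'g event \<Rightarrow> real" where
  "connection n e c h a b d p =
     (\<Sum>m\<in>all_idx n. inverse_matrix (all_idx n) (h p) d m * koszul n e c h a b m p)"

text \<open>The component along \<open>E\<^sub>d\<close> of
  \<open>\<nabla>\<^bsub>E\<^sub>a\<^esub> \<nabla>\<^bsub>E\<^sub>b\<^esub> E\<^sub>f - \<nabla>\<^bsub>E\<^sub>b\<^esub> \<nabla>\<^bsub>E\<^sub>a\<^esub> E\<^sub>f - \<nabla>\<^bsub>[E\<^sub>a, E\<^sub>b]\<^esub> E\<^sub>f\<close>:\<close>

definition riemann ::
  "nat \<Rightarrow> (3 \<Rightarrow> 'g vector_field) \<Rightarrow> (3 \<Rightarrow> 3 \<Rightarrow> 3 \<Rightarrow> real) \<Rightarrow> ('g event \<Rightarrow> idx \<Rightarrow> idx \<Rightarrow> real) \<Rightarrow>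
    idx \<Rightarrow> idx \<Rightarrow> idx \<Rightarrow> idx \<Rightarrow> 'g event \<Rightarrow> real" where
  "riemann n e c h a b f d p =
     (let \<Gamma> = connection n e c h in
      frame_deriv e a (\<Gamma> b f d) p - frame_deriv e b (\<Gamma> a f d) p
        + (\<Sum>m\<in>all_idx n. \<Gamma> b f m p * \<Gamma> a m d p - \<Gamma> a f m p * \<Gamma> b m d p
             - frame_comm c a b m * \<Gamma> m f d p))"

text \<open>\<open>Ric(Y, Z)\<close> is the trace of \<open>X \<mapsto> R(X, Y) Z\<close>.\<close>

definition ricci ::
  "nat \<Rightarrow> (3 \<Rightarrow> 'g vector_field) \<Rightarrow> (3 \<Rightarrow> 3 \<Rightarrow> 3 \<Rightarrow> real) \<Rightarrow> ('g event \<Rightarrow> idx \<Rightarrow> idx \<Rightarrow> real) \<Rightarrow>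
    idx \<Rightarrow> idx \<Rightarrow> 'g event \<Rightarrow> real" where
  "ricci n e c h a b p = (\<Sum>d\<in>all_idx n. riemann n e c h d a b d p)"

text \<open>\<open>v s a\<close> are the frame components of the velocity of the curve \<open>\<gamma>\<close> at parameter \<open>s\<close>, where
  \<open>J\<close> is an interval, possibly containing end points (derivatives are one-sided there).\<close>

definition has_velocity ::
  "nat \<Rightarrow> 'g::topological_space chart set \<Rightarrow> (3 \<Rightarrow> 'g vector_field) \<Rightarrow>
    real set \<Rightarrow> (real \<Rightarrow> 'g event) \<Rightarrow> (real \<Rightarrow> idx \<Rightarrow> real) \<Rightarrow> bool" where
  "has_velocity n A e J \<gamma> v \<longleftrightarrow> (\<forall>s\<in>J.
     ((\<lambda>r. fst (\<gamma> r)) has_real_derivative v s Time) (at s within J) \<and>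
     (\<forall>f. smooth_at A f (fst (snd (\<gamma> s))) \<longrightarrow>
        ((\<lambda>r. f (fst (snd (\<gamma> r)))) has_real_derivative
           (\<Sum>i\<in>UNIV. v s (Grp i) * e i f (fst (snd (\<gamma> s))))) (at s within J)) \<and>
     (\<forall>K\<in>{1..n-3}.
        ((\<lambda>r. snd (snd (\<gamma> r)) K) has_real_derivative v s (Flat K)) (at s within J)))"

text \<open>Affinely parametrized geodesics, \<open>\<nabla>\<^sub>v v = 0\<close>.\<close>

definition geodesic ::
  "nat \<Rightarrow> 'g::topological_space chart set \<Rightarrow> (3 \<Rightarrow> 'g vector_field) \<Rightarrow> (3 \<Rightarrow> 3 \<Rightarrow> 3 \<Rightarrow> real) \<Rightarrow>
    real set \<Rightarrow> ('g event \<Rightarrow> idx \<Rightarrow> idx \<Rightarrow> real) \<Rightarrow>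
    real set \<Rightarrow> (real \<Rightarrow> 'g event) \<Rightarrow> (real \<Rightarrow> idx \<Rightarrow> real) \<Rightarrow> bool" where
  "geodesic n A e c I h J \<gamma> v \<longleftrightarrow>
     is_interval J \<and> (\<exists>a\<in>J. \<exists>b\<in>J. a < b) \<and> \<gamma> ` J \<subseteq> spacetime n I \<and> has_velocity n A e J \<gamma> v \<and>
     (\<forall>s\<in>J. \<forall>d\<in>all_idx n.
        ((\<lambda>r. v r d) has_real_derivative
           - (\<Sum>a\<in>all_idx n. \<Sum>b\<in>all_idx n. connection n e c h a b d (\<gamma> s) * v s a * v s b))
          (at s within J))"

definition norm_sq ::
  "nat \<Rightarrow> ('g event \<Rightarrow> idx \<Rightarrow> idx \<Rightarrow> real) \<Rightarrow> 'g event \<Rightarrow> (idx \<Rightarrow> real) \<Rightarrow> real" where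
  "norm_sq n h p u = (\<Sum>a\<in>all_idx n. \<Sum>b\<in>all_idx n. h p a b * u a * u b)"

definition timelike_vec ::
  "nat \<Rightarrow> ('g event \<Rightarrow> idx \<Rightarrow> idx \<Rightarrow> real) \<Rightarrow> 'g event \<Rightarrow> (idx \<Rightarrow> real) \<Rightarrow> bool" where
  "timelike_vec n h p u \<longleftrightarrow> norm_sq n h p u < 0"

definition null_vec ::
  "nat \<Rightarrow> ('g event \<Rightarrow> idx \<Rightarrow> idx \<Rightarrow> real) \<Rightarrow> 'g event \<Rightarrow> (idx \<Rightarrow> real) \<Rightarrow> bool" where
  "null_vec n h p u \<longleftrightarrow> norm_sq n h p u = 0 \<and> (\<exists>a\<in>all_idx n. u a \<noteq> 0)"

definition future_inextendible ::
  "nat \<Rightarrow> 'g::topological_space chart set \<Rightarrow> (3 \<Rightarrow> 'g vector_field) \<Rightarrow> (3 \<Rightarrow> 3 \<Rightarrow> 3 \<Rightarrow> real) \<Rightarrow>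
    real set \<Rightarrow> ('g event \<Rightarrow> idx \<Rightarrow> idx \<Rightarrow> real) \<Rightarrow> real set \<Rightarrow> (real \<Rightarrow> 'g event) \<Rightarrow> bool" where
  "future_inextendible n A e c I h J \<gamma> \<longleftrightarrow>
     \<not> (\<exists>J' \<gamma>' v'. geodesic n A e c I h J' \<gamma>' v' \<and> J \<subseteq> J' \<and>
          (\<exists>s'\<in>J'. \<forall>s\<in>J. s < s') \<and> (\<forall>s\<in>J. \<gamma>' s = \<gamma> s))"

definition future_geodesically_complete ::
  "nat \<Rightarrow> 'g::topological_space chart set \<Rightarrow> (3 \<Rightarrow> 'g vector_field) \<Rightarrow> (3 \<Rightarrow> 3 \<Rightarrow> 3 \<Rightarrow> real) \<Rightarrow>
    real set \<Rightarrow> ('g event \<Rightarrow> idx \<Rightarrow> idx \<Rightarrow> real) \<Rightarrow> bool" where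
  "future_geodesically_complete n A e c I h \<longleftrightarrow>
     (\<forall>J \<gamma> v. geodesic n A e c I h J \<gamma> v \<and>
        ((\<forall>s\<in>J. timelike_vec n h (\<gamma> s) (v s)) \<or> (\<forall>s\<in>J. null_vec n h (\<gamma> s) (v s))) \<and>
        (\<forall>s\<in>J. v s Time > 0) \<and>
        future_inextendible n A e c I h J \<gamma>
        \<longrightarrow> (\<forall>r. \<exists>s\<in>J. r < s))"


section \<open>Spatially homogeneous vacuum solutions\<close>

definition vacuum_solution ::
  "nat \<Rightarrow> (3 \<Rightarrow> 'g vector_field) \<Rightarrow> (3 \<Rightarrow> 3 \<Rightarrow> 3 \<Rightarrow> real) \<Rightarrow>
    real set \<Rightarrow> (real \<Rightarrow> real^3^3) \<Rightarrow> (nat \<Rightarrow> real \<Rightarrow> real) \<Rightarrow> bool" where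
  "vacuum_solution n e c I g \<phi> \<longleftrightarrow>
     open I \<and> is_interval I \<and> I \<noteq> {} \<and>
     smooth_on I g \<and> (\<forall>K\<in>{1..n-3}. smooth_on I (\<phi> K)) \<and>
     (\<forall>t\<in>I. transpose (g t) = g t \<and> (\<forall>w. w \<noteq> 0 \<longrightarrow> w \<bullet> (g t *v w) > 0)) \<and>
     (\<forall>p\<in>spacetime n I. \<forall>a\<in>all_idx n. \<forall>b\<in>all_idx n. ricci n e c (metric_at g \<phi>) a b p = 0)"

definition future_maximal ::
  "nat \<Rightarrow> (3 \<Rightarrow> 'g vector_field) \<Rightarrow> (3 \<Rightarrow> 3 \<Rightarrow> 3 \<Rightarrow> real) \<Rightarrow>
    real set \<Rightarrow> (real \<Rightarrow> real^3^3) \<Rightarrow> (nat \<Rightarrow> real \<Rightarrow> real) \<Rightarrow> bool" where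
  "future_maximal n e c I g \<phi> \<longleftrightarrow>
     \<not> (\<exists>I' g' \<phi>'. vacuum_solution n e c I' g' \<phi>' \<and> I \<subseteq> I' \<and> (\<exists>t'\<in>I'. \<forall>t\<in>I. t < t') \<and>
          (\<forall>t\<in>I. g' t = g t \<and> (\<forall>K\<in>{1..n-3}. \<phi>' K t = \<phi> K t)))"

definition second_fundamental_form ::
  "(real \<Rightarrow> real^3^3) \<Rightarrow> (nat \<Rightarrow> real \<Rightarrow> real) \<Rightarrow> real \<Rightarrow> idx \<Rightarrow> idx \<Rightarrow> real" where
  "second_fundamental_form g \<phi> t a b = - deriv (\<lambda>s. metric_comp g \<phi> s a b) t / 2"

definition mean_curvature ::
  "nat \<Rightarrow> (real \<Rightarrow> real^3^3) \<Rightarrow> (nat \<Rightarrow> real \<Rightarrow> real) \<Rightarrow> real \<Rightarrow> real" where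
  "mean_curvature n g \<phi> t = (\<Sum>a\<in>spatial_idx n. \<Sum>b\<in>spatial_idx n.
     inverse_matrix (spatial_idx n) (metric_comp g \<phi> t) a b * second_fundamental_form g \<phi> t a b)"

definition expanding_at ::
  "nat \<Rightarrow> (real \<Rightarrow> real^3^3) \<Rightarrow> (nat \<Rightarrow> real \<Rightarrow> real) \<Rightarrow> real \<Rightarrow> bool" where
  "expanding_at n g \<phi> t \<longleftrightarrow> mean_curvature n g \<phi> t < 0"

end

theory Submission
  imports Defs
begin

text \<open>
  Let \<open>S = - tr k\<close> be the expansion. The vacuum equations give \<open>S' = - |k|\<^sup>2\<close>, and
  \<open>|k|\<^sup>2 \<le> S\<^sup>2\<close> by the Hamiltonian constraint, because the scalar curvature of a left-invariant
  metric on a three-dimensional Lie group is positive only in type IX. Hence \<open>S\<close> stays positive and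
  decreases at most like \<open>1 / t\<close>. On a bounded time interval the metric, its inverse and \<open>k\<close> are
  therefore bounded, so that the evolution equations can be continued; the constraints propagate, and
  a solution that is maximal to the future exists for all large \<open>t\<close>.

  For a causal geodesic with energy \<open>p = dt/ds\<close> one has \<open>dp/ds = k(v, v)\<close>, where \<open>v\<close> is the spatial
  velocity, \<open>|v| \<le> p\<close>. The inequality \<open>S k(v, v) \<le> |k|\<^sup>2 |v|\<^sup>2\<close>, which holds in spatial dimension
  \<open>n \<le> 9\<close>, shows that \<open>p S\<close> does not increase along the geodesic. As \<open>\<integral> S dt\<close> diverges, \<open>t\<close> remains
  bounded on a bounded range of the affine parameter; then the velocity is bounded and the geodesic
  can be continued.
\<close>

section \<open>Calculus of smooth maps\<close>

text \<open>With \<open>q = - k\<close>, so that \<open>g' = 2 q\<close>, curvature is handled for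
  all Bianchi types at once: the bracket is encoded by a symmetric matrix \<open>N\<close> and a
  vector \<open>a\<close>, and adjugates turn Ricci tensor, scalar curvature and divergence into
  polynomial matrix expressions in \<open>g\<close>, its inverse \<open>h\<close>, \<open>N\<close>
  and \<open>a\<close>. Bianchi identities become matrix identities, and the sign of the scalar
  curvature follows by comparing an operator norm with a Hilbert-Schmidt norm. Two obstacles shape
  the continuation arguments. The number of flat directions varies, while a differential equation
  needs a fixed Euclidean state space; all \<open>\<phi>_K'\<close> are multiples of one function,
  and flat momenta are conserved along geodesics, so the flat directions drop out of the state. The
  group has only local charts; a left translation moves the last piece of a geodesic into one chart
  around the identity. The inequality for \<open>k(v, v)\<close> compares \<open>|k|^2\<close> with
  the least squared norm of a symmetric map with given trace and given value on \<open>v\<close>;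
  this leaves a binary quadratic form in these two numbers whose discriminant changes sign at
  \<open>n = 9\<close>.\<close>

lemma Ck_on_cong:
  assumes "open S" "\<And>x. x \<in> S \<Longrightarrow> f x = g x" "Ck_on k S f"
  shows "Ck_on k S g"
  using assms(2,3)
proof (induction k arbitrary: f g)
  case 0
  then show ?case by (simp cong: continuous_on_cong)
next
  case (Suc k)
  have D: "(g has_derivative frechet_derivative f (at x)) (at x)" if x: "x \<in> S" for x
  proof -
    have "(f has_derivative frechet_derivative f (at x)) (at x)"
      using Suc.prems(2) x frechet_derivative_works by auto
    then show ?thesis
      using has_derivative_transform_within_open[OF _ assms(1) x] Suc.prems(1) by blast
  qed
  have "Ck_on k S (\<lambda>x. frechet_derivative g (at x) v)" for v
  proof (rule Suc.IH)
    show "Ck_on k S (\<lambda>x. frechet_derivative f (at x) v)" using Suc.prems(2) by simp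
  qed (metis D frechet_derivative_at)
  then show ?case using D by (auto simp: differentiable_def)
qed

lemma Ck_on_SucI:
  assumes "open S" "\<And>x. x \<in> S \<Longrightarrow> (f has_derivative f' x) (at x)"
    "\<And>v. Ck_on k S (\<lambda>x. f' x v)"
  shows "Ck_on (Suc k) S f"
proof -
  have "Ck_on k S (\<lambda>x. frechet_derivative f (at x) v)" for v
    by (rule Ck_on_cong[OF assms(1) _ assms(3)[of v]]) (metis assms(2) frechet_derivative_at)
  then show ?thesis using assms(2) by (auto simp: differentiable_def)
qed

lemma Ck_on_SucD:
  assumes "Ck_on (Suc k) S f"
  shows "x \<in> S \<Longrightarrow> (f has_derivative frechet_derivative f (at x)) (at x)"
    "Ck_on k S (\<lambda>x. frechet_derivative f (at x) v)"
  using assms frechet_derivative_works by auto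

lemma Ck_on_Suc_imp: "Ck_on (Suc k) S f \<Longrightarrow> Ck_on k S f"
proof (induction k arbitrary: f)
  case 0
  then show ?case
    by (auto intro!: continuous_at_imp_continuous_on differentiable_imp_continuous_within)
next
  case (Suc k)
  then show ?case by (metis Ck_on.simps(2))
qed

lemma Ck_on_imp_continuous_on: "Ck_on k S f \<Longrightarrow> continuous_on S f"
  by (induction k) (use Ck_on_Suc_imp in auto)

lemma Ck_on_const: "open S \<Longrightarrow> Ck_on k S (\<lambda>x. a)"
proof (induction k arbitrary: a)
  case (Suc k)
  show ?case by (rule Ck_on_SucI[where f' = "\<lambda>x v. 0"]) (use Suc in auto)
qed auto

lemma Ck_on_ident: "open S \<Longrightarrow> Ck_on k S (\<lambda>x. x)"
proof (cases k)
  case (Suc m)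
  assume "open S"
  then show ?thesis unfolding Suc
    by (rule Ck_on_SucI[where f' = "\<lambda>x v. v"]) (simp_all add: Ck_on_const \<open>open S\<close>)
qed simp

lemma Ck_on_bounded_linear:
  assumes "bounded_linear L" "open S" "Ck_on k S f"
  shows "Ck_on k S (\<lambda>x. L (f x))"
  using assms(3)
proof (induction k arbitrary: f)
  case 0
  then show ?case using bounded_linear.continuous_on[OF assms(1)] by auto
next
  case (Suc k)
  show ?case
    by (rule Ck_on_SucI[where f' = "\<lambda>x v. L (frechet_derivative f (at x) v)", OF assms(2)])
      (use Suc Ck_on_SucD[OF Suc.prems] in \<open>auto intro!: bounded_linear.has_derivative[OF assms(1)]\<close>)
qed

lemma Ck_on_add:
  assumes "open S" "Ck_on k S f" "Ck_on k S g"
  shows "Ck_on k S (\<lambda>x. f x + g x)"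
  using assms(2,3)
proof (induction k arbitrary: f g)
  case 0
  then show ?case by (auto intro: continuous_intros)
next
  case (Suc k)
  show ?case
    by (rule Ck_on_SucI[where f' = "\<lambda>x v. frechet_derivative f (at x) v + frechet_derivative g (at x) v", OF assms(1)])
      (use Suc.IH Ck_on_SucD[OF Suc.prems(1)] Ck_on_SucD[OF Suc.prems(2)] in
        \<open>auto intro!: derivative_intros\<close>)
qed

lemma Ck_on_bilinear:
  assumes B: "bounded_bilinear B" and S: "open S" and "Ck_on k S f" "Ck_on k S g"
  shows "Ck_on k S (\<lambda>x. B (f x) (g x))"
  using assms(3,4)
proof (induction k arbitrary: f g)
  case 0
  then show ?case using bounded_bilinear.continuous_on[OF B] by auto
next
  case (Suc k)
  note Df = Ck_on_SucD[OF Suc.prems(1)] and Dg = Ck_on_SucD[OF Suc.prems(2)]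
  show ?case
  proof (rule Ck_on_SucI[OF S])
    show "((\<lambda>x. B (f x) (g x)) has_derivative
        (\<lambda>v. B (f x) (frechet_derivative g (at x) v) + B (frechet_derivative f (at x) v) (g x))) (at x)"
      if "x \<in> S" for x
      by (rule bounded_bilinear.FDERIV[OF B Df(1)[OF that] Dg(1)[OF that]])
  next
    fix v
    show "Ck_on k S (\<lambda>x. B (f x) (frechet_derivative g (at x) v) + B (frechet_derivative f (at x) v) (g x))"
      using Ck_on_Suc_imp[OF Suc.prems(1)] Ck_on_Suc_imp[OF Suc.prems(2)]
      by (intro Ck_on_add[OF S] Suc.IH Df(2) Dg(2))
  qed
qed

lemma Ck_on_sum:
  assumes "open S" "\<And>i. i \<in> A \<Longrightarrow> Ck_on k S (f i)"
  shows "Ck_on k S (\<lambda>x. \<Sum>i\<in>A. f i x)"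
  using assms(2)
  by (induction A rule: infinite_finite_induct) (auto intro: Ck_on_const Ck_on_add assms(1))

lemma Ck_on_componentwise:
  fixes f :: "'a::real_normed_vector \<Rightarrow> 'b::euclidean_space"
  assumes "open S" "\<And>b. b \<in> Basis \<Longrightarrow> Ck_on k S (\<lambda>x. f x \<bullet> b)"
  shows "Ck_on k S f"
proof -
  have "Ck_on k S (\<lambda>x. \<Sum>b\<in>Basis. (f x \<bullet> b) *\<^sub>R b)"
    by (intro Ck_on_sum[OF assms(1)] Ck_on_bounded_linear[OF bounded_linear_scaleR_left assms(1)] assms(2))
  then show ?thesis by (simp add: euclidean_representation)
qed

lemma Ck_on_inverse:
  fixes f :: "'a::real_normed_vector \<Rightarrow> real"
  assumes S: "open S" and "Ck_on k S f" and nz: "\<And>x. x \<in> S \<Longrightarrow> f x \<noteq> 0"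
  shows "Ck_on k S (\<lambda>x. inverse (f x))"
  using assms(2)
proof (induction k)
  case 0
  then show ?case using nz by (auto intro!: continuous_intros)
next
  case (Suc k)
  note Df = Ck_on_SucD[OF Suc.prems]
  show ?case
  proof (rule Ck_on_SucI[OF S])
    show "((\<lambda>x. inverse (f x)) has_derivative
        (\<lambda>v. - (inverse (f x) * frechet_derivative f (at x) v * inverse (f x)))) (at x)" if "x \<in> S" for x
      by (rule Deriv.has_derivative_inverse[OF nz[OF that] Df(1)[OF that]])
  next
    fix v
    have "Ck_on k S (\<lambda>x. - ((inverse (f x) * frechet_derivative f (at x) v) * inverse (f x)))"
      using Suc.IH[OF Ck_on_Suc_imp[OF Suc.prems]]
      by (intro Ck_on_bounded_linear[OF bounded_linear_minus[OF bounded_linear_ident] S]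
          Ck_on_bilinear[OF bounded_bilinear_mult S] Df(2))
    then show "Ck_on k S (\<lambda>x. - (inverse (f x) * frechet_derivative f (at x) v * inverse (f x)))"
      by (simp add: mult.assoc)
  qed
qed

text \<open>\<open>Ck_on\<close> only speaks of derivatives in a fixed direction, whereas the chain
  rule yields \<open>Dg (f x) (Df x v)\<close> with a moving direction. Expanding
  \<open>Df x v\<close> in a basis leaves fixed basis directions, to which the induction hypothesis
  applies.\<close>

lemma Ck_on_compose:
  fixes f :: "'a::real_normed_vector \<Rightarrow> 'b::euclidean_space"
  assumes S: "open S" and T: "open T" and fS: "f ` S \<subseteq> T" and "Ck_on k T g" "Ck_on k S f"
  shows "Ck_on k S (\<lambda>x. g (f x))"
  using assms(4,5)
proof (induction k arbitrary: g)
  case 0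
  then show ?case using continuous_on_compose2 fS by (metis Ck_on.simps(1))
next
  case (Suc k)
  note Dg = Ck_on_SucD[OF Suc.prems(1)] and Df = Ck_on_SucD[OF Suc.prems(2)]
  let ?Df = "\<lambda>x. frechet_derivative f (at x)" and ?Dg = "\<lambda>y. frechet_derivative g (at y)"
  show ?case
  proof (rule Ck_on_SucI[OF S])
    show "((\<lambda>x. g (f x)) has_derivative (\<lambda>v. \<Sum>b\<in>Basis. (?Df x v \<bullet> b) *\<^sub>R ?Dg (f x) b)) (at x)"
      if x: "x \<in> S" for x
    proof -
      have fx: "f x \<in> T" using fS x by auto
      have "((\<lambda>x. g (f x)) has_derivative (\<lambda>v. ?Dg (f x) (?Df x v))) (at x)"
        using has_derivative_compose[OF Df(1)[OF x] Dg(1)[OF fx]] .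
      moreover have "?Dg (f x) (?Df x v) = (\<Sum>b\<in>Basis. (?Df x v \<bullet> b) *\<^sub>R ?Dg (f x) b)" for v
      proof -
        interpret linear "?Dg (f x)" using Dg(1)[OF fx] has_derivative_linear by blast
        show ?thesis
          by (subst euclidean_representation[symmetric, of "?Df x v"]) (simp add: sum scale)
      qed
      ultimately show ?thesis by simp
    qed
  next
    fix v
    show "Ck_on k S (\<lambda>x. \<Sum>b\<in>Basis. (?Df x v \<bullet> b) *\<^sub>R ?Dg (f x) b)"
      by (intro Ck_on_sum[OF S] Ck_on_bilinear[OF bounded_bilinear_scaleR S] Suc.IH[OF Dg(2)]
          Ck_on_bounded_linear[OF bounded_linear_inner_left S] Df(2) Ck_on_Suc_imp[OF Suc.prems(2)])
  qed
qed

lemma Ck_on_exp: "open S \<Longrightarrow> Ck_on k S (exp :: real \<Rightarrow> real)"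
proof (induction k)
  case (Suc k)
  show ?case
    by (rule Ck_on_SucI[where f' = "\<lambda>x v. exp x * v"])
      (use Suc in \<open>auto intro!: derivative_eq_intros Ck_on_bounded_linear[OF bounded_linear_mult_left]\<close>)
qed (auto intro: continuous_intros)

lemma smooth_on_cong: "open S \<Longrightarrow> (\<And>x. x \<in> S \<Longrightarrow> f x = g x) \<Longrightarrow> smooth_on S f \<Longrightarrow> smooth_on S g"
  unfolding smooth_on_def using Ck_on_cong by blast

lemma smooth_on_imp_continuous_on: "smooth_on S f \<Longrightarrow> continuous_on S f"
  unfolding smooth_on_def using Ck_on_imp_continuous_on by blast

lemma smooth_on_frechet_derivative:
  assumes "smooth_on S f"
  shows "x \<in> S \<Longrightarrow> (f has_derivative frechet_derivative f (at x)) (at x)"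
    "smooth_on S (\<lambda>x. frechet_derivative f (at x) v)"
  using assms Ck_on_SucD unfolding smooth_on_def by blast+

lemma smooth_on_const: "open S \<Longrightarrow> smooth_on S (\<lambda>x. a)"
  and smooth_on_ident: "open S \<Longrightarrow> smooth_on S (\<lambda>x. x)"
  and smooth_on_exp: "open T \<Longrightarrow> smooth_on T (exp :: real \<Rightarrow> real)"
  unfolding smooth_on_def by (auto intro: Ck_on_const Ck_on_ident Ck_on_exp)

lemma smooth_on_bounded_linear:
  "bounded_linear L \<Longrightarrow> open S \<Longrightarrow> smooth_on S f \<Longrightarrow> smooth_on S (\<lambda>x. L (f x))"
  unfolding smooth_on_def by (metis Ck_on_bounded_linear)

lemma smooth_on_add: "open S \<Longrightarrow> smooth_on S f \<Longrightarrow> smooth_on S g \<Longrightarrow> smooth_on S (\<lambda>x. f x + g x)"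
  unfolding smooth_on_def by (metis Ck_on_add)

lemma smooth_on_minus: "open S \<Longrightarrow> smooth_on S f \<Longrightarrow> smooth_on S (\<lambda>x. - f x)"
  by (rule smooth_on_bounded_linear[OF bounded_linear_minus[OF bounded_linear_ident]])

lemma smooth_on_diff:
  "open S \<Longrightarrow> smooth_on S f \<Longrightarrow> smooth_on S g \<Longrightarrow> smooth_on S (\<lambda>x. f x - g x)"
  using smooth_on_add[of S f "\<lambda>x. - g x"] smooth_on_minus by auto

lemma smooth_on_bilinear:
  "bounded_bilinear B \<Longrightarrow> open S \<Longrightarrow> smooth_on S f \<Longrightarrow> smooth_on S g \<Longrightarrow> smooth_on S (\<lambda>x. B (f x) (g x))"
  unfolding smooth_on_def by (metis Ck_on_bilinear)

lemmas smooth_on_mult = smooth_on_bilinear[OF bounded_bilinear_mult]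
lemmas smooth_on_scaleR = smooth_on_bilinear[OF bounded_bilinear_scaleR]

lemma smooth_on_sum:
  "open S \<Longrightarrow> (\<And>i. i \<in> A \<Longrightarrow> smooth_on S (f i)) \<Longrightarrow> smooth_on S (\<lambda>x. \<Sum>i\<in>A. f i x)"
  unfolding smooth_on_def by (metis Ck_on_sum)

lemma smooth_on_componentwise:
  fixes f :: "'a::real_normed_vector \<Rightarrow> 'b::euclidean_space"
  shows "open S \<Longrightarrow> (\<And>b. b \<in> Basis \<Longrightarrow> smooth_on S (\<lambda>x. f x \<bullet> b)) \<Longrightarrow> smooth_on S f"
  unfolding smooth_on_def by (metis Ck_on_componentwise)

lemma smooth_on_inverse:
  fixes f :: "'a::real_normed_vector \<Rightarrow> real"
  shows "open S \<Longrightarrow> smooth_on S f \<Longrightarrow> (\<And>x. x \<in> S \<Longrightarrow> f x \<noteq> 0) \<Longrightarrow> smooth_on S (\<lambda>x. inverse (f x))"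
  unfolding smooth_on_def by (metis Ck_on_inverse)

lemma smooth_on_compose:
  fixes f :: "'a::real_normed_vector \<Rightarrow> 'b::euclidean_space"
  shows "open S \<Longrightarrow> open T \<Longrightarrow> f ` S \<subseteq> T \<Longrightarrow> smooth_on T g \<Longrightarrow> smooth_on S f \<Longrightarrow> smooth_on S (\<lambda>x. g (f x))"
  unfolding smooth_on_def by (metis Ck_on_compose)

lemma smooth_on_nth:
  fixes f :: "'a::real_normed_vector \<Rightarrow> 'b::real_normed_vector^'n"
  shows "open S \<Longrightarrow> smooth_on S f \<Longrightarrow> smooth_on S (\<lambda>x. f x $ i)"
  by (rule smooth_on_bounded_linear[OF bounded_linear_vec_nth])

lemma smooth_on_vec_lambda:
  fixes f :: "'a::real_normed_vector \<Rightarrow> 'n::finite \<Rightarrow> 'b::euclidean_space"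
  assumes "open S" "\<And>i. smooth_on S (\<lambda>x. f x i)"
  shows "smooth_on S (\<lambda>x. \<chi> i. f x i)"
proof (rule smooth_on_componentwise[OF assms(1)])
  fix b :: "'b^'n" assume "b \<in> Basis"
  then obtain i u where b: "b = axis i u" by (auto simp: Basis_vec_def)
  have "smooth_on S (\<lambda>x. f x i \<bullet> u)"
    by (rule smooth_on_bounded_linear[OF bounded_linear_inner_left assms(1) assms(2)])
  then show "smooth_on S (\<lambda>x. (\<chi> i. f x i) \<bullet> b)" by (simp add: b inner_axis)
qed

lemma smooth_on_Pair:
  fixes f :: "'a::real_normed_vector \<Rightarrow> 'b::real_normed_vector" and g :: "'a \<Rightarrow> 'c::real_normed_vector"
  assumes "open S" "smooth_on S f" "smooth_on S g"
  shows "smooth_on S (\<lambda>x. (f x, g x))"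
proof -
  have "smooth_on S (\<lambda>x. (f x, 0::'c) + (0::'b, g x))"
    by (intro smooth_on_add assms
        smooth_on_bounded_linear[where L = "\<lambda>y. (y, 0)"] smooth_on_bounded_linear[where L = "\<lambda>y. (0, y)"]
        bounded_linear_Pair bounded_linear_ident bounded_linear_zero)
  then show ?thesis by simp
qed

lemma smooth_on_fst: "open S \<Longrightarrow> smooth_on S f \<Longrightarrow> smooth_on S (\<lambda>x. fst (f x))"
  and smooth_on_snd: "open S \<Longrightarrow> smooth_on S f \<Longrightarrow> smooth_on S (\<lambda>x. snd (f x))"
  by (metis smooth_on_bounded_linear bounded_linear_fst, metis smooth_on_bounded_linear bounded_linear_snd)

text \<open>On a compact ball the finitely many basis derivatives are bounded, and the sum of these
  bounds controls the operator norm; the mean value inequality on the convex ball does the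
  rest.\<close>

lemma smooth_on_imp_local_Lipschitz:
  fixes f :: "'a::euclidean_space \<Rightarrow> 'b::real_normed_vector"
  assumes "open S" "smooth_on S f" "x \<in> S"
  obtains r L where "r > 0" "L > 0" "cball x r \<subseteq> S"
    "\<And>y z. y \<in> cball x r \<Longrightarrow> z \<in> cball x r \<Longrightarrow> norm (f y - f z) \<le> L * norm (y - z)"
proof -
  obtain r where r: "r > 0" "cball x r \<subseteq> S" using assms open_contains_cball by blast
  let ?D = "\<lambda>y. frechet_derivative f (at y)"
  have "\<exists>M. \<forall>y\<in>cball x r. norm (?D y b) \<le> M" for b
  proof -
    have "continuous_on (cball x r) (\<lambda>y. ?D y b)"
      using smooth_on_imp_continuous_on[OF smooth_on_frechet_derivative(2)[OF assms(2)]] r(2)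
        continuous_on_subset by blast
    then have "bounded ((\<lambda>y. ?D y b) ` cball x r)"
      by (intro compact_imp_bounded compact_continuous_image compact_cball)
    then show ?thesis by (auto simp: bounded_iff)
  qed
  then obtain M where M: "\<And>b y. y \<in> cball x r \<Longrightarrow> norm (?D y b) \<le> M b" by metis
  have on: "onorm (?D y) \<le> (\<Sum>b\<in>Basis. M b)" if y: "y \<in> cball x r" for y
  proof -
    have D: "(f has_derivative ?D y) (at y)"
      using smooth_on_frechet_derivative(1)[OF assms(2)] y r(2) by blast
    interpret linear "?D y" using D has_derivative_linear by blast
    show ?thesis
    proof (rule onorm_le)
      fix v
      have "norm (?D y v) = norm (\<Sum>b\<in>Basis. (v \<bullet> b) *\<^sub>R ?D y b)"
        by (subst euclidean_representation[symmetric, of v]) (simp add: sum scale)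
      also have "\<dots> \<le> (\<Sum>b\<in>Basis. norm ((v \<bullet> b) *\<^sub>R ?D y b))" by (rule norm_sum)
      also have "\<dots> \<le> (\<Sum>b\<in>Basis. norm v * M b)"
        by (intro sum_mono) (simp add: mult_mono Basis_le_norm M[OF y])
      finally show "norm (?D y v) \<le> (\<Sum>b\<in>Basis. M b) * norm v"
        by (simp add: sum_distrib_left mult.commute)
    qed
  qed
  \<comment> \<open>The absolute value and the \<open>+ 1\<close> make the constant positive, as
    later divisions by it require.\<close>
  have "norm (f y - f z) \<le> (\<bar>\<Sum>b\<in>Basis. M b\<bar> + 1) * norm (y - z)" if "y \<in> cball x r" "z \<in> cball x r" for y z
  proof -
    have "norm (f y - f z) \<le> (\<Sum>b\<in>Basis. M b) * norm (y - z)"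
    proof (rule differentiable_bound[OF convex_cball _ on that])
      show "(f has_derivative ?D w) (at w within cball x r)" if "w \<in> cball x r" for w
        using smooth_on_frechet_derivative(1)[OF assms(2)] that r(2) has_derivative_at_withinI by blast
    qed
    also have "\<dots> \<le> (\<bar>\<Sum>b\<in>Basis. M b\<bar> + 1) * norm (y - z)" by (intro mult_right_mono) auto
    finally show ?thesis .
  qed
  then show ?thesis using that[of r "\<bar>\<Sum>b\<in>Basis. M b\<bar> + 1"] r by auto
qed

lemma smooth_on_real_derivative:
  fixes f :: "real \<Rightarrow> 'b::real_normed_vector"
  assumes "open S" "smooth_on S f"
  shows "t \<in> S \<Longrightarrow> (f has_vector_derivative frechet_derivative f (at t) 1) (at t)"
    "smooth_on S (\<lambda>t. frechet_derivative f (at t) 1)"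
proof -
  assume t: "t \<in> S"
  have D: "(f has_derivative frechet_derivative f (at t)) (at t)"
    using smooth_on_frechet_derivative(1)[OF assms(2) t] .
  then interpret linear "frechet_derivative f (at t)" using has_derivative_linear by blast
  have "frechet_derivative f (at t) v = v *\<^sub>R frechet_derivative f (at t) 1" for v
    using scale[of v 1] by simp
  then show "(f has_vector_derivative frechet_derivative f (at t) 1) (at t)"
    unfolding has_vector_derivative_def using D by (metis ext)
qed (rule smooth_on_frechet_derivative(2)[OF assms(2)])

text \<open>Bootstrapping: if \<open>X\<close> is of class \<open>k\<close>, so is the composition
  of \<open>F\<close> with \<open>X\<close>, which is the derivative of \<open>X\<close>; hence
  \<open>X\<close> is of class \<open>k + 1\<close>.\<close>

lemma smooth_on_ode_solution:
  fixes X :: "real \<Rightarrow> 'b::euclidean_space"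
  assumes "open S" "open O'" "smooth_on O' F"
    "\<And>t. t \<in> S \<Longrightarrow> X t \<in> O'" "\<And>t. t \<in> S \<Longrightarrow> (X has_vector_derivative F (X t)) (at t)"
  shows "smooth_on S X"
  unfolding smooth_on_def
proof
  fix k show "Ck_on k S X"
  proof (induction k)
    case 0
    show ?case using assms(5)
      by (auto intro!: continuous_at_imp_continuous_on has_vector_derivative_continuous)
  next
    case (Suc k)
    show ?case
    proof (rule Ck_on_SucI[OF assms(1)])
      show "(X has_derivative (\<lambda>v. v *\<^sub>R F (X t))) (at t)" if "t \<in> S" for t
        using assms(5)[OF that] by (simp add: has_vector_derivative_def)
      fix v
      have "Ck_on k S (\<lambda>t. F (X t))"
        using Ck_on_compose[OF assms(1,2) _ _ Suc] assms(3,4) by (auto simp: smooth_on_def)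
      then show "Ck_on k S (\<lambda>t. v *\<^sub>R F (X t))"
        by (rule Ck_on_bounded_linear[OF bounded_linear_scaleR_right assms(1)])
    qed
  qed
qed

section \<open>Ordinary differential equations\<close>

lemma interval_Icc_subset: "is_interval S \<Longrightarrow> s \<in> S \<Longrightarrow> t \<in> S \<Longrightarrow> {s..t} \<subseteq> S" for S :: "real set"
  by (metis atLeastAtMost_iff is_interval_1 subsetI)

text \<open>Derivatives are taken within \<open>S\<close>, so that intervals with end points, such
  as the parameter interval of a geodesic, are covered.\<close>

lemma antimono_if_deriv_nonpos:
  fixes f :: "real \<Rightarrow> real"
  assumes S: "is_interval S" and D: "\<And>t. t \<in> S \<Longrightarrow> (f has_real_derivative f' t) (at t within S)"
    and le: "\<And>t. t \<in> S \<Longrightarrow> f' t \<le> 0" and st: "s \<in> S" "t \<in> S" "s \<le> t"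
  shows "f t \<le> f s"
proof (cases "s = t")
  case False
  then have lt: "s < t" using st by simp
  note sub = interval_Icc_subset[OF S st(1,2)]
  obtain u where u: "u \<in> {s<..<t}" "f t - f s = f' u * (t - s)"
    using mvt_simple[OF lt, of f "\<lambda>x. (*) (f' x)"] DERIV_subset[OF D sub] sub
    unfolding has_field_derivative_def by (metis atLeastAtMost_iff subsetD)
  then have "f' u \<le> 0" using le[of u] sub by (auto simp: subset_iff)
  then show ?thesis using u lt mult_nonpos_nonneg[of "f' u" "t - s"] by linarith
qed simp

lemma mono_if_deriv_nonneg:
  fixes f :: "real \<Rightarrow> real"
  assumes S: "is_interval S" and D: "\<And>t. t \<in> S \<Longrightarrow> (f has_real_derivative f' t) (at t within S)"
    and le: "\<And>t. t \<in> S \<Longrightarrow> f' t \<ge> 0" and st: "s \<in> S" "t \<in> S" "s \<le> t"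
  shows "f s \<le> f t"
  using antimono_if_deriv_nonpos[OF S, of "\<lambda>t. - f t" "\<lambda>t. - f' t"] assms by (auto intro: derivative_intros)

text \<open>Gronwall's argument: \<open>exp (- 2 M t) |D|^2\<close> does not increase, is
  nonnegative and starts at zero. This is how algebraic relations and constraints are shown to
  persist along solutions.\<close>

lemma linear_ode_zero:
  fixes D :: "real \<Rightarrow> 'a::real_inner"
  assumes D: "\<And>t. t \<in> {a..b} \<Longrightarrow> (D has_vector_derivative D' t) (at t within {a..b})"
    and le: "\<And>t. t \<in> {a..b} \<Longrightarrow> norm (D' t) \<le> M * norm (D t)" and D0: "D a = 0" and t: "t \<in> {a..b}"
  shows "D t = 0"
proof -
  let ?f = "\<lambda>t. (D t \<bullet> D t) * exp (- 2 * M * t)"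
  have "?f t \<le> ?f a"
  proof (rule antimono_if_deriv_nonpos[of "{a..b}" ?f "\<lambda>t. (2 * (D t \<bullet> D' t) - 2 * M * (D t \<bullet> D t)) * exp (- 2 * M * t)"])
    fix s assume s: "s \<in> {a..b}"
    have "((\<lambda>t. D t \<bullet> D t) has_vector_derivative (D s \<bullet> D' s + D' s \<bullet> D s)) (at s within {a..b})"
      using bounded_bilinear.has_vector_derivative[OF bounded_bilinear_inner D[OF s] D[OF s]] .
    then have "((\<lambda>t. D t \<bullet> D t) has_real_derivative (D s \<bullet> D' s + D' s \<bullet> D s)) (at s within {a..b})"
      by (simp add: has_real_derivative_iff_has_vector_derivative)
    then show "(?f has_real_derivative (2 * (D s \<bullet> D' s) - 2 * M * (D s \<bullet> D s)) * exp (- 2 * M * s)) (at s within {a..b})"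
      by (auto intro!: derivative_eq_intros simp: inner_commute algebra_simps)
    have "D s \<bullet> D' s \<le> norm (D s) * norm (D' s)" by (rule norm_cauchy_schwarz)
    also have "\<dots> \<le> norm (D s) * (M * norm (D s))" by (intro mult_left_mono le s) auto
    also have "\<dots> = M * (D s \<bullet> D s)" by (simp add: dot_square_norm power2_eq_square)
    finally show "(2 * (D s \<bullet> D' s) - 2 * M * (D s \<bullet> D s)) * exp (- 2 * M * s) \<le> 0"
      by (intro mult_nonpos_nonneg) auto
  qed (use t in \<open>auto simp: is_interval_cc\<close>)
  then have "D t \<bullet> D t \<le> 0" using D0 by (simp add: mult_le_0_iff)
  then show ?thesis by (metis inner_eq_zero_iff inner_ge_zero order_antisym)
qed

text \<open>Composing \<open>F\<close> with the nearest point projection onto a closed ball makes it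
  globally Lipschitz and bounded without changing it on the ball. The Picard operator is then a
  contraction on all bounded continuous functions, and its fixed point does not leave the ball,
  where the modification is invisible.\<close>

lemma picard_lindelof:
  fixes F :: "'a::euclidean_space \<Rightarrow> 'a"
  assumes O': "open O'" "smooth_on O' F" "x0 \<in> O'"
  obtains \<delta> Z where "\<delta> > 0" "Z b = x0" "\<And>t. t \<in> {b..b + \<delta>} \<Longrightarrow> Z t \<in> O'"
    "\<And>t. t \<in> {b..b + \<delta>} \<Longrightarrow> (Z has_vector_derivative F (Z t)) (at t within {b..b + \<delta>})"
proof -
  obtain r L where r: "r > 0" "L > 0" "cball x0 r \<subseteq> O'"
    and L: "\<And>y z. y \<in> cball x0 r \<Longrightarrow> z \<in> cball x0 r \<Longrightarrow> norm (F y - F z) \<le> L * norm (y - z)"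
    using smooth_on_imp_local_Lipschitz[OF O'] by metis
  define p where "p = closest_point (cball x0 r)"
  define G where "G y = F (p y)" for y
  have ne: "closed (cball x0 r)" "cball x0 r \<noteq> {}" using r by auto
  have pin: "p y \<in> cball x0 r" for y unfolding p_def by (rule closest_point_in_set[OF ne])
  have GL: "norm (G y - G z) \<le> L * norm (y - z)" for y z
  proof -
    have "norm (G y - G z) \<le> L * norm (p y - p z)" unfolding G_def by (rule L[OF pin pin])
    also have "\<dots> \<le> L * norm (y - z)"
      using closest_point_lipschitz[OF convex_cball ne, of y z] r(2)
      by (intro mult_left_mono) (auto simp: p_def dist_norm)
    finally show ?thesis .
  qed
  define M where "M = norm (F x0) + L * r + 1"
  have M: "M > 0" using r by (auto simp: M_def add_nonneg_pos)
  have GM: "norm (G y) \<le> M" for y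
  proof -
    have "norm (G y - F x0) \<le> L * norm (p y - x0)" unfolding G_def using L pin r(1) by auto
    also have "\<dots> \<le> L * r" using pin[of y] r by (intro mult_left_mono) (auto simp: dist_norm norm_minus_commute)
    finally show ?thesis using norm_triangle_ineq2[of "G y" "F x0"] by (simp add: M_def)
  qed
  have Gcont: "continuous_on UNIV G"
  proof (rule continuous_onI)
    fix y e :: _ assume "(e::real) > 0"
    then show "\<exists>d>0. \<forall>x'\<in>UNIV. dist x' y < d \<longrightarrow> dist (G x') (G y) \<le> e"
    proof (intro exI[of _ "e / L"] conjI ballI impI)
      fix x' assume "dist x' y < e / L"
      then have "L * norm (x' - y) \<le> e" using r(2) by (simp add: dist_norm field_simps)
      then show "dist (G x') (G y) \<le> e" using GL[of x' y] by (simp add: dist_norm)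
    qed (use r in auto)
  qed
  \<comment> \<open>\<open>r / M\<close> keeps the solution in the ball, since \<open>M\<close>
    bounds its speed; \<open>1 / (2 * L)\<close> yields the contraction factor one half.\<close>
  define \<delta> where "\<delta> = min (r / M) (1 / (2 * L))"
  have \<delta>: "\<delta> > 0" "M * \<delta> \<le> r" "L * \<delta> \<le> 1 / 2"
    using M r by (auto simp: \<delta>_def min_def field_simps)
  \<comment> \<open>Time is clamped to the interval, so that the fixed point can be sought among the
    bounded continuous functions on the whole line.\<close>
  define cl where "cl t = min (max t b) (b + \<delta>)" for t
  have cl: "cl t \<in> {b..b + \<delta>}" for t using \<delta>(1) by (auto simp: cl_def)
  define \<Phi> where "\<Phi> f t = x0 + integral {b..cl t} (\<lambda>s. G (f s))" for f t
  have intg: "(\<lambda>s. G (f s)) integrable_on {b..c}" if "continuous_on UNIV f" for f :: "real \<Rightarrow> 'a" and c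
    by (intro integrable_continuous_interval continuous_on_compose2[OF Gcont] continuous_on_subset[OF that]) auto
  have bc: "\<Phi> f \<in> bcontfun" if f: "continuous_on UNIV f" for f
  proof (rule bcontfun_normI)
    have "continuous_on {b..b + \<delta>} (\<lambda>u. integral {b..u} (\<lambda>s. G (f s)))"
      by (rule indefinite_integral_continuous_1[OF intg[OF f]])
    then have "continuous_on UNIV (\<lambda>t. integral {b..cl t} (\<lambda>s. G (f s)))"
      by (rule continuous_on_compose2) (use cl in \<open>auto simp: cl_def intro!: continuous_intros\<close>)
    then show "continuous_on UNIV (\<Phi> f)" unfolding \<Phi>_def by (intro continuous_intros)
    fix t
    have "norm (integral {b..cl t} (\<lambda>s. G (f s))) \<le> M * (cl t - b)"
      by (rule integral_bound) (use cl[of t] GM f in \<open>auto intro!: continuous_on_compose2[OF Gcont] intro: continuous_on_subset\<close>)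
    also have "\<dots> \<le> M * \<delta>" using cl[of t] M by (intro mult_left_mono) auto
    finally show "norm (\<Phi> f t) \<le> norm x0 + M * \<delta>" unfolding \<Phi>_def using norm_triangle_ineq[of x0] by (meson add_left_mono order_trans)
  qed
  have contr: "dist (Bcontfun (\<Phi> f)) (Bcontfun (\<Phi> g)) \<le> 1 / 2 * dist f g" for f g :: "real \<Rightarrow>\<^sub>C 'a"
  proof (rule dist_bound)
    fix t
    have c: "continuous_on UNIV f" "continuous_on UNIV g" by auto
    have "dist (\<Phi> f t) (\<Phi> g t) = norm (integral {b..cl t} (\<lambda>s. G (f s) - G (g s)))"
      unfolding \<Phi>_def dist_norm by (simp add: integral_diff[OF intg[OF c(1)] intg[OF c(2)]])
    also have "\<dots> \<le> (L * dist f g) * (cl t - b)"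
    proof (rule integral_bound)
      show "continuous_on {b..cl t} (\<lambda>s. G (f s) - G (g s))"
        by (intro continuous_intros continuous_on_compose2[OF Gcont]) auto
      fix s
      have "norm (G (f s) - G (g s)) \<le> L * norm (f s - g s)" by (rule GL)
      also have "\<dots> \<le> L * dist f g" using dist_bounded[of f s g] r(2) by (simp add: dist_norm)
      finally show "norm (G (f s) - G (g s)) \<le> L * dist f g" .
    qed (use cl[of t] in auto)
    also have "\<dots> \<le> (L * dist f g) * \<delta>" using cl[of t] r by (intro mult_left_mono) auto
    also have "\<dots> \<le> 1 / 2 * dist f g" using mult_right_mono[OF \<delta>(3), of "dist f g"] by (simp add: mult.commute mult.left_commute)
    finally show "dist (apply_bcontfun (Bcontfun (\<Phi> f)) t) (apply_bcontfun (Bcontfun (\<Phi> g)) t) \<le> 1 / 2 * dist f g"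
      by (simp add: Bcontfun_inverse bc)
  qed
  have "\<exists>!f\<in>(UNIV :: (real \<Rightarrow>\<^sub>C 'a) set). Bcontfun (\<Phi> f) = f"
    by (rule Banach_fix[where c = "1/2"]) (use contr in \<open>auto simp: complete_UNIV\<close>)
  then obtain f :: "real \<Rightarrow>\<^sub>C 'a" where "Bcontfun (\<Phi> f) = f" by auto
  then have f: "f t = \<Phi> f t" for t
    using Bcontfun_inverse[OF bc[OF continuous_on_apply_bcontfun[of UNIV f]]] by metis
  have ft: "f t = x0 + integral {b..t} (\<lambda>s. G (f s))" if "t \<in> {b..b + \<delta>}" for t
    using f[of t] that by (simp add: \<Phi>_def cl_def)
  have inb: "f t \<in> cball x0 r" if t: "t \<in> {b..b + \<delta>}" for t
  proof -
    have "norm (integral {b..t} (\<lambda>s. G (f s))) \<le> M * (t - b)"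
      by (rule integral_bound) (use t GM in \<open>auto intro!: continuous_on_compose2[OF Gcont]\<close>)
    also have "\<dots> \<le> M * \<delta>" using t M by (intro mult_left_mono) auto
    finally have "norm (integral {b..t} (\<lambda>s. G (f s))) \<le> r" using \<delta> by linarith
    then show ?thesis using ft[OF t] by (simp add: dist_norm)
  qed
  have GF: "G (f t) = F (f t)" if "t \<in> {b..b + \<delta>}" for t
    using inb[OF that] by (simp add: G_def p_def closest_point_self)
  show thesis
  proof (rule that[OF \<delta>(1), of f])
    show "f b = x0" using ft[of b] \<delta> by simp
    show "f t \<in> O'" if "t \<in> {b..b + \<delta>}" for t using inb[OF that] r by auto
    fix t assume t: "t \<in> {b..b + \<delta>}"
    have "((\<lambda>u. integral {b..u} (\<lambda>s. G (f s))) has_vector_derivative G (f t)) (at t within {b..b + \<delta>})"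
      by (rule integral_has_vector_derivative[OF _ t]) (auto intro!: continuous_on_compose2[OF Gcont])
    then have "((\<lambda>u. x0 + integral {b..u} (\<lambda>s. G (f s))) has_vector_derivative 0 + F (f t)) (at t within {b..b + \<delta>})"
      using GF[OF t] by (intro derivative_intros) auto
    then show "(f has_vector_derivative F (f t)) (at t within {b..b + \<delta>})"
      by (intro has_vector_derivative_transform[OF t, of f "\<lambda>u. x0 + integral {b..u} (\<lambda>s. G (f s))"]) (auto simp: ft)
  qed
qed

text \<open>Bounded speed makes \<open>X\<close> Lipschitz, so it has a limit at \<open>b\<close>,
  which lies in the compact set \<open>K\<close> and serves as initial value of a local
  solution.\<close>

lemma ode_continuation:
  fixes F :: "'a::euclidean_space \<Rightarrow> 'a"
  assumes O': "open O'" "smooth_on O' F" and K: "compact K" "K \<subseteq> O'" and ab: "a < b"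
    and X: "\<And>t. t \<in> {a..<b} \<Longrightarrow> X t \<in> K"
      "\<And>t. t \<in> {a..<b} \<Longrightarrow> (X has_vector_derivative F (X t)) (at t within {a..<b})"
  obtains \<delta> Y where "\<delta> > 0" "\<And>t. t \<in> {a..<b} \<Longrightarrow> Y t = X t" "\<And>t. t \<in> {a..b + \<delta>} \<Longrightarrow> Y t \<in> O'"
    "\<And>t. t \<in> {a..b + \<delta>} \<Longrightarrow> (Y has_vector_derivative F (Y t)) (at t within {a..b + \<delta>})"
proof -
  have Fc: "continuous_on O' F" using smooth_on_imp_continuous_on[OF O'(2)] .
  have "bounded (F ` K)"
    by (intro compact_imp_bounded compact_continuous_image K continuous_on_subset[OF Fc])
  then obtain M where M: "\<And>x. x \<in> K \<Longrightarrow> norm (F x) \<le> M" by (auto simp: bounded_iff)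
  have "norm (X s - X t) \<le> M * norm (s - t)" if "s \<in> {a..<b}" "t \<in> {a..<b}" for s t
  proof (rule differentiable_bound[of "{a..<b}" X "\<lambda>t v. v *\<^sub>R F (X t)"])
    show "(X has_derivative (\<lambda>v. v *\<^sub>R F (X t))) (at t within {a..<b})" if "t \<in> {a..<b}" for t
      using X(2)[OF that] by (simp add: has_vector_derivative_def)
    show "onorm (\<lambda>v. v *\<^sub>R F (X t)) \<le> M" if "t \<in> {a..<b}" for t
      by (rule onorm_le) (use M[OF X(1)[OF that]] in \<open>auto simp: mult.commute[of M] intro!: mult_left_mono\<close>)
  qed (use that in auto)
  then have lip: "dist (X s) (X t) \<le> M * dist s t" if "s \<in> {a..<b}" "t \<in> {a..<b}" for s t
    using that by (simp add: dist_norm)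
  have "uniformly_continuous_on {a..<b} X"
  unfolding uniformly_continuous_on_def
  proof (intro allI impI)
    fix e :: real assume e: "e > 0"
    show "\<exists>d>0. \<forall>x\<in>{a..<b}. \<forall>x'\<in>{a..<b}. dist x' x < d \<longrightarrow> dist (X x') (X x) < e"
    proof (intro exI[of _ "e / (\<bar>M\<bar> + 1)"] conjI ballI impI)
      fix s t assume st: "s \<in> {a..<b}" "t \<in> {a..<b}" "dist t s < e / (\<bar>M\<bar> + 1)"
      have "dist (X t) (X s) \<le> M * dist t s" using lip st by auto
      also have "\<dots> \<le> (\<bar>M\<bar> + 1) * dist t s" by (intro mult_right_mono) auto
      also have "\<dots> < e" using st(3) by (simp add: field_simps add_pos_nonneg)
      finally show "dist (X t) (X s) < e" .
    qed (use e in \<open>auto simp: add_nonneg_pos\<close>)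
  qed
  then obtain X' where X': "uniformly_continuous_on (closure {a..<b}) X'" "\<And>t. t \<in> {a..<b} \<Longrightarrow> X t = X' t"
    by (rule uniformly_continuous_on_extension_on_closure) blast
  have cl: "closure {a..<b} = {a..b}" using ab by simp
  have X'c: "continuous_on {a..b} X'" using X'(1) cl uniformly_continuous_imp_continuous by metis
  have "X' ` closure {a..<b} \<subseteq> K"
    by (rule image_closure_subset) (use X'c cl K X(1) X'(2) in \<open>auto simp: compact_imp_closed\<close>)
  then have xb: "X' b \<in> K" using ab cl by auto
  obtain \<delta> Z where \<delta>: "\<delta> > 0" and Z: "Z b = X' b" "\<And>t. t \<in> {b..b + \<delta>} \<Longrightarrow> Z t \<in> O'"
    "\<And>t. t \<in> {b..b + \<delta>} \<Longrightarrow> (Z has_vector_derivative F (Z t)) (at t within {b..b + \<delta>})"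
    using picard_lindelof[OF O', of "X' b"] xb K(2) by blast
  define Y where "Y t = (if t \<le> b then X' t else Z t)" for t
  have YX: "Y t = X t" if "t \<in> {a..<b}" for t using that X'(2) by (auto simp: Y_def)
  have YZ: "Y t = Z t" if "t \<in> {b..b + \<delta>}" for t using that Z(1) by (auto simp: Y_def)
  have YO: "Y t \<in> O'" if "t \<in> {a..b + \<delta>}" for t
  proof (cases "t < b")
    case True then show ?thesis using YX[of t] X(1)[of t] that K(2) by auto
  next
    case False then show ?thesis using YZ[of t] Z(2)[of t] that by auto
  qed
  have Yc: "continuous_on {a..b + \<delta>} Y"
  proof -
    have "continuous_on ({a..b} \<union> {b..b + \<delta>}) (\<lambda>t. if t \<le> b then X' t else Z t)"
      by (rule continuous_on_If)
        (use X'c Z(1) continuous_on_vector_derivative[OF Z(3)] in auto)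
    then show ?thesis unfolding Y_def using ab \<delta> by (simp add: ivl_disj_un_two_touch)
  qed
  have FYc: "continuous_on {a..b + \<delta>} (\<lambda>t. F (Y t))"
    by (rule continuous_on_compose2[OF Fc Yc]) (use YO in auto)
  have D: "(Y has_vector_derivative F (Y t)) (at t)" if t: "t \<in> {a<..<b + \<delta>} - {b}" for t
  proof (cases "t < b")
    case True
    have "(X has_vector_derivative F (Y t)) (at t)"
      using X(2)[of t] YX[of t] True t at_within_interior[of t "{a..<b}"] by auto
    then show ?thesis
      by (rule has_vector_derivative_transform_within_open[where S = "{a<..<b}"]) (use True t YX in auto)
  next
    case False
    have "(Z has_vector_derivative F (Y t)) (at t)"
      using Z(3)[of t] YZ[of t] False t at_within_interior[of t "{b..b + \<delta>}"] by auto
    then show ?thesis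
      by (rule has_vector_derivative_transform_within_open[where S = "{b<..<b + \<delta>}"]) (use False t YZ in auto)
  qed
  \<comment> \<open>No derivative is computed at the seam \<open>b\<close>: the fundamental theorem
    tolerates one exceptional point, and differentiating the resulting integral equation gives the
    derivative everywhere.\<close>
  have Yint: "Y t = Y a + integral {a..t} (\<lambda>s. F (Y s))" if t: "t \<in> {a..b + \<delta>}" for t
  proof -
    have "((\<lambda>s. F (Y s)) has_integral Y t - Y a) {a..t}"
      by (rule fundamental_theorem_of_calculus_interior_strong[of "{b}"])
        (use t D in \<open>auto intro: continuous_on_subset[OF Yc]\<close>)
    then show ?thesis by (simp add: integral_unique)
  qed
  show thesis
  proof (rule that[OF \<delta>, of Y, OF YX YO], assumption, assumption)
    fix t assume t: "t \<in> {a..b + \<delta>}"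
    have "((\<lambda>u. Y a + integral {a..u} (\<lambda>s. F (Y s))) has_vector_derivative 0 + F (Y t)) (at t within {a..b + \<delta>})"
      by (intro derivative_intros integral_has_vector_derivative FYc t)
    then show "(Y has_vector_derivative F (Y t)) (at t within {a..b + \<delta>})"
      unfolding add_0 by (rule has_vector_derivative_transform[OF t Yint, rotated]) assumption
  qed
qed

section \<open>Algebra of three-by-three matrices\<close>

lemmas matrix3_simps = vec_eq_iff forall_3 sum_3 matrix_matrix_mult_def matrix_vector_mult_def
  transpose_def trace_def inner_vec_def vector_3 mat_def

definition pos_def :: "real^'n^'n \<Rightarrow> bool" where
  "pos_def g \<longleftrightarrow> transpose g = g \<and> (\<forall>w. w \<noteq> 0 \<longrightarrow> w \<bullet> (g *v w) > 0)"

lemma symmetricD: "transpose A = A \<Longrightarrow> A $ i $ j = A $ j $ i"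
  by (drule arg_cong[where f = "\<lambda>A. A $ j $ i"]) (simp add: transpose_def)

text \<open>Completion of squares: \<open>a\<close>, \<open>b\<close>, \<open>d\<close> are the
  pivots, and each is the value of the form at a vector on which the squares split off before it
  vanish.\<close>

lemma cholesky3:
  fixes g :: "real^3^3"
  assumes "pos_def g"
  obtains L where "g = transpose L ** L" "det L \<noteq> 0"
proof -
  have sym: "g$2$1 = g$1$2" "g$3$1 = g$1$3" "g$3$2 = g$2$3"
    using assms symmetricD unfolding pos_def_def by blast+
  have pos: "w \<noteq> 0 \<Longrightarrow> w \<bullet> (g *v w) > 0" for w using assms by (auto simp: pos_def_def)
  define a where "a = g$1$1"
  have a: "a > 0" using pos[of "vector [1,0,0]"] by (simp add: matrix3_simps a_def)
  define b where "b = g$2$2 - (g$1$2)\<^sup>2 / a"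
  have "(vector [- g$1$2 / a, 1, 0] :: real^3) \<bullet> (g *v vector [- g$1$2 / a, 1, 0]) = b"
    using a by (simp add: matrix3_simps sym b_def a_def field_simps power2_eq_square)
  then have b: "b > 0" using pos[of "vector [- g$1$2 / a, 1, 0]"] by (simp add: matrix3_simps)
  define u where "u = g$2$3 - g$1$2 * g$1$3 / a"
  define d where "d = g$3$3 - (g$1$3)\<^sup>2 / a - u\<^sup>2 / b"
  let ?x = "- g$1$3 / a + g$1$2 * u / (a * b)" and ?y = "- u / b"
  have e2: "g$2$2 = b + (g$1$2)\<^sup>2 / a" and e3: "g$2$3 = u + g$1$2 * g$1$3 / a"
    and e4: "g$3$3 = d + (g$1$3)\<^sup>2 / a + u\<^sup>2 / b" and e1: "g$1$1 = a"
    by (simp_all add: b_def u_def d_def a_def)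
  have "(vector [?x, ?y, 1] :: real^3) \<bullet> (g *v vector [?x, ?y, 1]) = d"
    using a b by (simp add: matrix3_simps sym e1 e2 e3 e4 field_simps power2_eq_square)
  then have d: "d > 0" using pos[of "vector [?x, ?y, 1]"] by (simp add: matrix3_simps)
  let ?L = "vector [vector [sqrt a, g$1$2 / sqrt a, g$1$3 / sqrt a], vector [0, sqrt b, u / sqrt b],
    vector [0, 0, sqrt d]] :: real^3^3"
  have "g = transpose ?L ** ?L"
    using a b d by (simp add: matrix3_simps sym e1 e2 e3 e4 power2_eq_square)
  moreover have "det ?L \<noteq> 0" using a b d by (simp add: det_3 vector_3)
  ultimately show thesis using that by blast
qed

text \<open>Writing \<open>g = L^T L\<close> turns the trace into the squared Frobenius norm of the
  symmetric matrix \<open>L A L^T\<close>.\<close>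

lemma trace_sym_sq_nonneg:
  fixes g A :: "real^3^3"
  assumes "pos_def g" "transpose A = A"
  shows "trace (A ** g ** A ** g) \<ge> 0"
proof -
  obtain L where L: "g = transpose L ** L" "det L \<noteq> 0" by (rule cholesky3[OF assms(1)])
  let ?X = "L ** A ** transpose L"
  have "trace (A ** g ** A ** g) = trace ((A ** transpose L ** L ** A ** transpose L) ** L)"
    by (simp add: L matrix_mul_assoc)
  also have "\<dots> = trace (L ** (A ** transpose L ** L ** A ** transpose L))" by (rule trace_mul_sym)
  also have "\<dots> = trace (?X ** ?X)" by (simp add: matrix_mul_assoc)
  also have "\<dots> = (\<Sum>i\<in>UNIV. \<Sum>j\<in>UNIV. (?X $ i $ j)\<^sup>2)"
  proof -
    have "transpose ?X = ?X" by (simp add: matrix_transpose_mul assms(2) matrix_mul_assoc)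
    then have "?X $ j $ i = ?X $ i $ j" for i j by (rule symmetricD)
    then show ?thesis by (simp add: trace_def matrix_matrix_mult_def[of ?X ?X] power2_eq_square)
  qed
  also have "\<dots> \<ge> 0" by (intro sum_nonneg) auto
  finally show ?thesis .
qed

section \<open>Adjugates, cross product matrices and axial vectors\<close>

definition outer :: "real^3 \<Rightarrow> real^3 \<Rightarrow> real^3^3" where
  "outer u v = (\<chi> i j. u $ i * v $ j)"

text \<open>The adjugate, that is, the transposed cofactor matrix, written out so that identities
  about it are polynomial identities of the entries.\<close>

definition adj3 :: "real^3^3 \<Rightarrow> real^3^3" where
  "adj3 A = vector
    [vector [A$2$2 * A$3$3 - A$2$3 * A$3$2, A$1$3 * A$3$2 - A$1$2 * A$3$3, A$1$2 * A$2$3 - A$1$3 * A$2$2],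
     vector [A$2$3 * A$3$1 - A$2$1 * A$3$3, A$1$1 * A$3$3 - A$1$3 * A$3$1, A$1$3 * A$2$1 - A$1$1 * A$2$3],
     vector [A$2$1 * A$3$2 - A$2$2 * A$3$1, A$1$2 * A$3$1 - A$1$1 * A$3$2, A$1$1 * A$2$2 - A$1$2 * A$2$1]]"

definition cross_mat :: "real^3 \<Rightarrow> real^3^3" where
  "cross_mat v = vector [vector [0, - v$3, v$2], vector [v$3, 0, - v$1], vector [- v$2, v$1, 0]]"

text \<open>The skew part in vector form, without a factor one half:
  \<open>X - transpose X = cross_mat (axial X)\<close>.\<close>

definition axial :: "real^3^3 \<Rightarrow> real^3" where
  "axial X = vector [X$3$2 - X$2$3, X$1$3 - X$3$1, X$2$1 - X$1$2]"

lemmas matrix3_defs = matrix3_simps outer_def adj3_def cross_mat_def axial_def cross3_def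

lemma cross_mat_mult: "cross_mat v *v w = cross3 v w"
  by (simp add: matrix3_defs)

lemma transpose_cross_mat: "transpose (cross_mat v) = - cross_mat v"
  by (simp add: matrix3_defs)

lemma transpose_adj3: "transpose (adj3 A) = adj3 (transpose A)"
  by (simp add: matrix3_defs)

lemma adj3_mult: "adj3 (A ** B) = adj3 B ** adj3 A"
  by (simp add: matrix3_defs) algebra

text \<open>In this form the adjugate can be evaluated on eigenvectors and is visibly smooth as a
  function of the matrix.\<close>

lemma adj3_cayley_hamilton:
  "adj3 A = A ** A - trace A *\<^sub>R A + (((trace A)\<^sup>2 - trace (A ** A)) / 2) *\<^sub>R mat 1"
  by (simp add: matrix3_defs field_simps power2_eq_square)

lemma mult_adj3: "A ** adj3 A = det A *\<^sub>R mat 1" "adj3 A ** A = det A *\<^sub>R mat 1"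
  by (simp_all add: matrix3_defs det_3 algebra_simps)

text \<open>The transposed adjugate is the cofactor matrix, which describes how \<open>A\<close>
  acts on cross products.\<close>

lemma cross_mat_conj: "A ** cross_mat v ** transpose A = cross_mat (transpose (adj3 A) *v v)"
  by (simp add: matrix3_defs algebra_simps)

text \<open>The infinitesimal version of \<open>cross_mat_conj\<close>.\<close>

lemma cross_mat_anticomm:
  "transpose M ** cross_mat s + cross_mat s ** M = cross_mat (trace M *\<^sub>R s - M *v s)"
  by (simp add: matrix3_defs algebra_simps)

lemma trace_cross_mat_conj:
  assumes "transpose b = b"
  shows "trace (cross_mat x ** b ** cross_mat y ** b) = - 2 * (x \<bullet> (adj3 b *v y))"
proof -
  have "b$2$1 = b$1$2" "b$3$1 = b$1$3" "b$3$2 = b$2$3"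
    using symmetricD[OF assms] by blast+
  then show ?thesis by (simp add: matrix3_defs algebra_simps)
qed

lemma axial_cross_mat: "axial (cross_mat v) = 2 *\<^sub>R v"
  by (simp add: matrix3_defs)

lemma axial_mult_cross_mat: "axial (Z ** cross_mat v) = trace Z *\<^sub>R v - transpose Z *v v"
  by (simp add: matrix3_defs algebra_simps)

lemma trace_mult_cross_mat: "trace (X ** cross_mat v) = - (axial X \<bullet> v)"
  by (simp add: matrix3_defs algebra_simps)

lemma axial_sym:
  assumes "transpose X = X"
  shows "axial X = 0"
proof -
  have "X$3$2 = X$2$3" "X$1$3 = X$3$1" "X$2$1 = X$1$2" by (rule symmetricD[OF assms])+
  then show ?thesis by (simp add: axial_def vec_eq_iff forall_3 vector_3)
qed

lemma trace_skew_sym: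
  assumes "transpose b = b" shows "trace (b ** cross_mat v) = 0"
  using trace_mult_cross_mat[of b v] axial_sym[OF assms] by simp

lemma matrix_scaleR [simp]:
  fixes A B :: "real^3^3"
  shows "(k *\<^sub>R A) ** B = k *\<^sub>R (A ** B)" "A ** (k *\<^sub>R B) = k *\<^sub>R (A ** B)"
    "(k *\<^sub>R A) *v x = k *\<^sub>R (A *v x)" "A *v (k *\<^sub>R x) = k *\<^sub>R (A *v x)"
    "transpose (k *\<^sub>R A) = k *\<^sub>R transpose A" "trace (k *\<^sub>R A) = k * trace A"
    "axial (k *\<^sub>R A) = k *\<^sub>R axial A" "cross_mat (k *\<^sub>R x) = k *\<^sub>R cross_mat x"
  by (simp_all add: matrix3_defs algebra_simps)

lemma matrix_additive [simp]:
  fixes A B C :: "real^3^3"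
  shows "(A + B) ** C = A ** C + B ** C" "C ** (A + B) = C ** A + C ** B"
    "(A - B) ** C = A ** C - B ** C" "C ** (A - B) = C ** A - C ** B"
    "(- A) ** C = - (A ** C)" "C ** (- A) = - (C ** A)"
    "(A + B) *v x = A *v x + B *v x" "(A - B) *v x = A *v x - B *v x" "(- A) *v x = - (A *v x)"
    "A *v (x - y) = A *v x - A *v y" "A *v (x + y) = A *v x + A *v y"
    "A *v (- x) = - (A *v x)"
    "transpose (A + B) = transpose A + transpose B" "transpose (A - B) = transpose A - transpose B"
    "transpose (- A) = - transpose A"
    "trace (A + B) = trace A + trace B" "trace (A - B) = trace A - trace B" "trace (- A) = - trace A"
    "axial (A + B) = axial A + axial B" "axial (A - B) = axial A - axial B" "axial (- A) = - axial A"
  by (simp_all add: matrix3_defs algebra_simps)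

lemma trace_mat3 [simp]: "trace (mat 1 :: real^3^3) = 3"
  by (simp add: matrix3_simps)

lemma trace_adj3: "trace (adj3 Z) = ((trace Z)\<^sup>2 - trace (Z ** Z)) / 2"
  by (simp add: matrix3_defs field_simps power2_eq_square)

lemma trace_transpose: "trace (transpose A) = trace (A :: real^3^3)"
  by (simp add: matrix3_simps)

lemma inner_matrix_sym:
  fixes A :: "real^3^3"
  assumes "transpose A = A"
  shows "(A *v x) \<bullet> y = x \<bullet> (A *v y)"
  by (metis assms dot_lmul_matrix transpose_matrix_vector)

section \<open>Left-invariant metrics on three-dimensional Lie groups\<close>

text \<open>By antisymmetry the bracket of a three-dimensional Lie algebra has the form
  \<open>[x, y] = N (x \<times> y) + (a \<bullet> x) y - (a \<bullet> y) x\<close> with a symmetric matrix \<open>N\<close>. The Jacobi identity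
  amounts to \<open>N a = 0\<close>.\<close>

definition bracket_sym :: "(3 \<Rightarrow> 3 \<Rightarrow> 3 \<Rightarrow> real) \<Rightarrow> real^3^3" where
  "bracket_sym c = (let C = vector [\<chi> k. c 2 3 k, \<chi> k. c 3 1 k, \<chi> k. c 1 2 k] :: real^3^3
     in (1 / 2) *\<^sub>R (C + transpose C))"

text \<open>For antisymmetric \<open>c\<close>, the number
  \<open>bracket_trace c \<bullet> x\<close> is half the trace of \<open>ad x\<close>; so the vector
  vanishes exactly for unimodular algebras.\<close>

definition bracket_trace :: "(3 \<Rightarrow> 3 \<Rightarrow> 3 \<Rightarrow> real) \<Rightarrow> real^3" where
  "bracket_trace c = (\<chi> m. - (\<Sum>k\<in>UNIV. c k m k) / 2)"

definition bracket :: "real^3^3 \<Rightarrow> real^3 \<Rightarrow> real^3 \<Rightarrow> real^3 \<Rightarrow> real^3" where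
  "bracket N a x y = N *v cross3 x y + (a \<bullet> x) *\<^sub>R y - (a \<bullet> y) *\<^sub>R x"

lemma transpose_bracket_sym: "transpose (bracket_sym c) = bracket_sym c"
  by (simp add: bracket_sym_def Let_def add.commute)

lemma structure_constants_eq_bracket:
  assumes "\<And>i j k. c i j k = - c j i k"
  shows "c i j k = bracket (bracket_sym c) (bracket_trace c) (axis i 1) (axis j 1) $ k"
proof -
  have z: "c i i k = 0" for i k using assms[of i i k] by simp
  have s: "c 2 1 k = - c 1 2 k" "c 3 2 k = - c 2 3 k" "c 1 3 k = - c 3 1 k" for k
    using assms by blast+
  have "\<forall>i j k. c i j k = bracket (bracket_sym c) (bracket_trace c) (axis i 1) (axis j 1) $ k"
    by (simp add: forall_3 bracket_def bracket_sym_def bracket_trace_def Let_def matrix3_defs axis_def s z field_simps)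
  then show ?thesis by blast
qed

lemma lie_bracket_eq_bracket:
  assumes "\<And>i j k. c i j k = - c j i k"
  shows "lie_bracket c x y = bracket (bracket_sym c) (bracket_trace c) x y"
proof -
  have z: "c i i k = 0" for i k using assms[of i i k] by simp
  have s: "c 2 1 k = - c 1 2 k" "c 3 2 k = - c 2 3 k" "c 1 3 k = - c 3 1 k" for k
    using assms by blast+
  show ?thesis
    by (simp add: lie_bracket_def bracket_def bracket_sym_def bracket_trace_def Let_def matrix3_defs s z field_simps)
qed

definition brk_tau :: "real^3^3 \<Rightarrow> real^3^3 \<Rightarrow> real" where
  "brk_tau N g = trace (N ** g) / 2"

text \<open>The Koszul formula for the bracket given by \<open>N\<close> and \<open>a\<close>
  produces the operator \<open>\<tau> - N g\<close> (see \<open>koszul3_eq\<close>). Multiplying it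
  by \<open>h\<close> from the right gives \<open>\<beta>\<close>, which has the advantage of being
  symmetric.\<close>

definition brk_beta :: "real^3^3 \<Rightarrow> real^3^3 \<Rightarrow> real^3^3 \<Rightarrow> real^3^3" where
  "brk_beta N g h = brk_tau N g *\<^sub>R h - N"

text \<open>A closed formula for the Ricci tensor of the left-invariant metric, justified by
  \<open>ricci3_index_eq\<close>. Symmetry is not built in: the skew part measures the failure of
  the Jacobi identity.\<close>

definition ricci3 :: "real^3^3 \<Rightarrow> real^3 \<Rightarrow> real^3^3 \<Rightarrow> real^3^3 \<Rightarrow> real^3^3" where
  "ricci3 N a g h = 2 *\<^sub>R adj3 (brk_beta N g h) - (2 * (a \<bullet> (h *v a))) *\<^sub>R g
     + 2 *\<^sub>R (g ** brk_beta N g h ** cross_mat (h *v a))"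

text \<open>The matrix of \<open>x \<mapsto> \<nabla>_x y\<close>, the covariant derivative of the
  left-invariant field \<open>y\<close>.\<close>

definition levi_civita3 :: "real^3^3 \<Rightarrow> real^3 \<Rightarrow> real^3^3 \<Rightarrow> real^3^3 \<Rightarrow> real^3 \<Rightarrow> real^3^3" where
  "levi_civita3 N a g h y = - (h ** cross_mat y ** brk_beta N g h ** g) + outer (h *v a) (g *v y) - (a \<bullet> y) *\<^sub>R mat 1"

text \<open>For \<open>P = h q\<close> with symmetric \<open>q\<close> this is the divergence of the
  left-invariant field \<open>P\<close>; see \<open>momentum3_index\<close>. As traces are constant
  on the hypersurfaces, its vanishing is the momentum constraint.\<close>

definition momentum3 :: "real^3^3 \<Rightarrow> real^3 \<Rightarrow> real^3^3 \<Rightarrow> real^3" where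
  "momentum3 N a P = trace P *\<^sub>R a - 3 *\<^sub>R (transpose P *v a) - axial (P ** N)"

text \<open>The inverse is a parameter of its own, tied to \<open>g\<close> by two matrix equations,
  so that the formulas remain polynomial in \<open>g\<close>, \<open>h\<close>, \<open>N\<close> and
  \<open>a\<close>.\<close>

locale invariant_metric =
  fixes N :: "real^3^3" and a :: "real^3" and g h :: "real^3^3"
  assumes sym_N: "transpose N = N" and sym_g: "transpose g = g" and sym_h: "transpose h = h"
    and gh: "g ** h = mat 1" and hg: "h ** g = mat 1"
begin

abbreviation "\<tau> \<equiv> brk_tau N g"
abbreviation "\<beta> \<equiv> brk_beta N g h"
abbreviation "s \<equiv> h *v a"

lemma gh_assoc: "A ** g ** h = A" "A ** h ** g = A" "g *v (h *v x) = x" "h *v (g *v x) = x"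
  by (simp_all add: gh hg matrix_vector_mul_assoc flip: matrix_mul_assoc)

lemma sym_beta: "transpose \<beta> = \<beta>"
  by (simp add: brk_beta_def sym_N sym_h)

lemma beta_g: "\<beta> ** g = \<tau> *\<^sub>R mat 1 - N ** g"
  by (simp add: brk_beta_def hg)

lemma N_eq: "N = \<tau> *\<^sub>R h - \<beta>"
  by (simp add: brk_beta_def)

lemma trace_beta_g: "trace (\<beta> ** g) = \<tau>"
  unfolding beta_g by (simp add: brk_tau_def)

lemma beta_a:
  assumes "N *v a = 0" shows "\<beta> *v a = \<tau> *\<^sub>R s"
  using assms by (simp add: brk_beta_def)

lemma det_gh: "det g * det h = 1" "det g \<noteq> 0" "det h \<noteq> 0"
proof -
  have "det (g ** h) = 1" by (simp add: gh)
  then show "det g * det h = 1" by (simp add: det_mul)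
  then show "det g \<noteq> 0" "det h \<noteq> 0" by auto
qed

lemma adj3_g: "adj3 g = det g *\<^sub>R h"
proof -
  have "adj3 g = adj3 g ** g ** h" by (simp add: gh_assoc)
  then show ?thesis by (simp add: mult_adj3)
qed

lemma adj3_h: "adj3 h = det h *\<^sub>R g"
proof -
  have "adj3 h = adj3 h ** h ** g" by (simp add: gh_assoc)
  then show ?thesis by (simp add: mult_adj3)
qed

lemma h_adj3_beta: "h ** adj3 \<beta> = det h *\<^sub>R adj3 (\<beta> ** g)"
proof -
  have "det h *\<^sub>R adj3 (\<beta> ** g) = (det g * det h) *\<^sub>R (h ** adj3 \<beta>)"
    by (simp add: adj3_mult adj3_g)
  then show ?thesis by (simp add: det_gh)
qed

lemma h_cross_h: "h ** cross_mat s ** h = det h *\<^sub>R cross_mat a"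
  using cross_mat_conj[of h s] by (simp add: sym_h transpose_adj3 adj3_h gh_assoc sym_g)

definition "ricci_mixed = (2 * det h) *\<^sub>R adj3 (\<beta> ** g) - (2 * (a \<bullet> s)) *\<^sub>R mat 1
  + 2 *\<^sub>R (\<beta> ** cross_mat s)"

lemma h_ricci3: "h ** ricci3 N a g h = ricci_mixed"
  by (simp add: ricci3_def ricci_mixed_def h_adj3_beta matrix_mul_assoc hg)

lemma trace_ricci_mixed: "trace ricci_mixed = 2 * det h * trace (adj3 (\<beta> ** g)) - 6 * (a \<bullet> s)"
  by (simp add: ricci_mixed_def trace_skew_sym sym_beta)

lemma trace_adj3_beta_g: "trace (adj3 (\<beta> ** g)) = \<tau>\<^sup>2 - trace (N ** g ** N ** g) / 2"
proof -
  have "trace ((\<beta> ** g) ** (\<beta> ** g)) = trace (N ** g ** N ** g) - \<tau>\<^sup>2"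
    unfolding beta_g by (simp add: matrix_mul_assoc) (simp add: brk_tau_def power2_eq_square)
  then show ?thesis by (simp add: trace_adj3 trace_beta_g field_simps)
qed

lemma scalar_curvature_eq:
  "trace (h ** ricci3 N a g h) = det h * ((trace (N ** g))\<^sup>2 / 2 - trace (N ** g ** N ** g)) - 6 * (a \<bullet> (h *v a))"
  by (simp add: h_ricci3 trace_ricci_mixed trace_adj3_beta_g brk_tau_def field_simps power2_eq_square)

text \<open>Only the product of \<open>\<beta>\<close> with the cross product matrix fails to be
  symmetric, and \<open>cross_mat_anticomm\<close> evaluates its skew part. Thus the Jacobi identity
  can be read off from the symmetry of the Ricci tensor, which the field equations enforce.\<close>

lemma ricci3_antisym: "ricci3 N a g h - transpose (ricci3 N a g h) = 2 *\<^sub>R cross_mat (N *v a)"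
proof -
  have "ricci3 N a g h - transpose (ricci3 N a g h)
      = 2 *\<^sub>R (transpose (\<beta> ** g) ** cross_mat s + cross_mat s ** (\<beta> ** g))"
    by (simp add: ricci3_def matrix_transpose_mul transpose_adj3 sym_beta sym_g transpose_cross_mat
        matrix_mul_assoc scaleR_add_right)
  also have "\<dots> = 2 *\<^sub>R cross_mat (\<tau> *\<^sub>R s - (\<beta> ** g) *v s)"
    by (simp only: cross_mat_anticomm trace_beta_g)
  also have "\<tau> *\<^sub>R s - (\<beta> ** g) *v s = N *v a"
    unfolding beta_g by (simp add: gh_assoc flip: matrix_vector_mul_assoc)
  finally show ?thesis .
qed

lemma ricci3_symmetric_iff: "transpose (ricci3 N a g h) = ricci3 N a g h \<longleftrightarrow> N *v a = 0"
proof -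
  have "transpose (ricci3 N a g h) = ricci3 N a g h \<longleftrightarrow> cross_mat (N *v a) = 0"
    using ricci3_antisym by (metis eq_iff_diff_eq_0 scaleR_eq_0_iff zero_neq_numeral)
  also have "\<dots> \<longleftrightarrow> N *v a = 0"
    by (auto simp: cross_mat_def vec_eq_iff forall_3 vector_3)
  finally show ?thesis .
qed

lemma transpose_beta_g_a:
  assumes "N *v a = 0" shows "transpose (\<beta> ** g) *v a = \<tau> *\<^sub>R a"
  using beta_a[OF assms]
  by (simp add: matrix_transpose_mul sym_beta sym_g gh_assoc flip: matrix_vector_mul_assoc)

text \<open>\<open>a\<close> is an eigenvector of the transpose of \<open>\<beta> g\<close>, and its
  eigenvalue is the full trace; so the first two terms of the Cayley-Hamilton form of the adjugate
  cancel on \<open>a\<close>.\<close>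

lemma transpose_adj3_beta_g_a:
  assumes "N *v a = 0" shows "transpose (adj3 (\<beta> ** g)) *v a = trace (adj3 (\<beta> ** g)) *\<^sub>R a"
proof -
  let ?W = "transpose (\<beta> ** g)"
  have W: "?W *v a = \<tau> *\<^sub>R a" by (rule transpose_beta_g_a[OF assms])
  have "trace ?W = \<tau>" by (simp add: trace_transpose trace_beta_g)
  then have "adj3 ?W *v a = trace (adj3 ?W) *\<^sub>R a"
    unfolding trace_adj3 by (subst adj3_cayley_hamilton) (simp add: W del: transpose_matrix_vector flip: matrix_vector_mul_assoc)
  then show ?thesis by (simp only: transpose_adj3[symmetric] trace_transpose)
qed

text \<open>The contracted Bianchi identity; the scalar curvature is spatially constant.\<close>

lemma momentum3_ricci:
  assumes "N *v a = 0" shows "momentum3 N a ricci_mixed = 0"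
proof -
  let ?d = "det h" and ?\<sigma> = "trace (adj3 (\<beta> ** g))" and ?A = "a \<bullet> s"
  have P_a: "transpose ricci_mixed *v a = (2 * ?d * ?\<sigma> - 2 * ?A) *\<^sub>R a"
  proof -
    have "cross_mat s *v (\<beta> *v a) = 0"
      by (simp add: beta_a[OF assms] cross_mat_mult)
    then show ?thesis
      by (simp add: ricci_mixed_def transpose_adj3_beta_g_a[OF assms] matrix_transpose_mul
          transpose_cross_mat sym_beta scaleR_diff_left del: transpose_matrix_vector flip: matrix_vector_mul_assoc)
  qed
  have 1: "axial (adj3 (\<beta> ** g) ** N) = 0"
  proof (rule axial_sym)
    have "?d *\<^sub>R (adj3 (\<beta> ** g) ** N) = h ** adj3 \<beta> ** (\<tau> *\<^sub>R h - \<beta>)"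
      by (simp only: matrix_scaleR[symmetric] h_adj3_beta[symmetric] N_eq[symmetric])
    also have "\<dots> = \<tau> *\<^sub>R (h ** adj3 \<beta> ** h) - det \<beta> *\<^sub>R h"
      by (simp add: mult_adj3 flip: matrix_mul_assoc)
    finally have e: "?d *\<^sub>R (adj3 (\<beta> ** g) ** N) = \<tau> *\<^sub>R (h ** adj3 \<beta> ** h) - det \<beta> *\<^sub>R h" .
    have "transpose (?d *\<^sub>R (adj3 (\<beta> ** g) ** N)) = ?d *\<^sub>R (adj3 (\<beta> ** g) ** N)"
      unfolding e by (simp add: matrix_transpose_mul transpose_adj3 sym_beta sym_h matrix_mul_assoc)
    then show "transpose (adj3 (\<beta> ** g) ** N) = adj3 (\<beta> ** g) ** N"
      using det_gh(3) by (simp only: matrix_scaleR scaleR_cancel_left) blast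
  qed
  \<comment> \<open>\<open>N = \<tau> h - \<beta>\<close> splits the term in two. The first part has
    no axial vector because \<open>a\<close> is an eigenvector whose eigenvalue is the full trace;
    the second is a conjugated cross product matrix.\<close>
  have 2: "axial (\<beta> ** cross_mat s ** N) = - (2 * ?d * ?\<sigma>) *\<^sub>R a"
  proof -
    have b1: "\<beta> ** cross_mat s ** h = ?d *\<^sub>R ((\<beta> ** g) ** cross_mat a)"
    proof -
      have "\<beta> ** cross_mat s ** h = \<beta> ** g ** (h ** cross_mat s ** h)"
        by (simp add: matrix_mul_assoc gh_assoc)
      then show ?thesis by (simp add: h_cross_h)
    qed
    have b2: "\<beta> ** cross_mat s ** \<beta> = ?d *\<^sub>R ((\<beta> ** g) ** cross_mat a ** transpose (\<beta> ** g))"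
    proof -
      have "\<beta> ** cross_mat s ** \<beta> = \<beta> ** cross_mat s ** (h ** transpose (\<beta> ** g))"
        by (simp add: matrix_transpose_mul sym_beta sym_g matrix_mul_assoc gh_assoc hg)
      then show ?thesis by (simp add: matrix_mul_assoc b1)
    qed
    have "axial (\<beta> ** cross_mat s ** h) = 0"
      unfolding b1 by (simp only: matrix_scaleR axial_mult_cross_mat trace_beta_g transpose_beta_g_a[OF assms]) simp
    moreover have "axial (\<beta> ** cross_mat s ** \<beta>) = (2 * ?d * ?\<sigma>) *\<^sub>R a"
      unfolding b2 by (simp only: matrix_scaleR cross_mat_conj transpose_adj3_beta_g_a[OF assms] axial_cross_mat) simp
    moreover have "\<beta> ** cross_mat s ** N = \<tau> *\<^sub>R (\<beta> ** cross_mat s ** h) - \<beta> ** cross_mat s ** \<beta>"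
      by (subst N_eq) simp
    ultimately show ?thesis by simp
  qed
  have "axial (ricci_mixed ** N) = - (4 * ?d * ?\<sigma>) *\<^sub>R a"
    by (simp add: ricci_mixed_def 1 2 axial_sym sym_N)
  \<comment> \<open>The coefficients \<open>2 - 6 + 4\<close> of the trace of the adjugate and
    \<open>- 6 + 6\<close> of \<open>a \<bullet> s\<close> cancel.\<close>
  then have "momentum3 N a ricci_mixed = ((2 * ?d * ?\<sigma> - 6 * ?A) - 3 * (2 * ?d * ?\<sigma> - 2 * ?A) + 4 * ?d * ?\<sigma>) *\<^sub>R a"
    by (simp only: momentum3_def P_a trace_ricci_mixed scaleR_diff_left scaleR_add_left scaleR_scaleR scaleR_minus_left)
      (simp add: scaleR_diff_left scaleR_add_left scaleR_diff_right)
  then show ?thesis by simp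
qed

text \<open>The left-hand side is the derivative of the scalar curvature in the direction
  \<open>g' = 2q\<close>, \<open>h' = -2hqh\<close>.\<close>

lemma scalar_curvature_variation:
  assumes q: "transpose q = q"
  shows "- 2 * trace (h ** q) * det h * ((trace (N ** g))\<^sup>2 / 2 - trace (N ** g ** N ** g))
    + det h * (2 * trace (N ** g) * trace (N ** q) - 4 * trace (N ** q ** N ** g)) + 12 * (s \<bullet> (q *v s))
    = - 2 * trace (h ** q ** ricci_mixed) - 4 * (s \<bullet> momentum3 N a (h ** q))"
proof -
  let ?d = "det h" and ?A = "a \<bullet> s"
  \<comment> \<open>The trace of the adjugate, in the form in which the Cayley-Hamilton formula
    supplies it.\<close>
  define \<sigma> where "\<sigma> = ((trace (\<beta> ** g))\<^sup>2 - trace (\<beta> ** g ** (\<beta> ** g))) / 2"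
  have \<sigma>: "\<sigma> = \<tau>\<^sup>2 - trace (N ** g ** N ** g) / 2"
    using trace_adj3_beta_g by (simp add: trace_adj3 \<sigma>_def)
  have Z: "adj3 (\<beta> ** g) = N ** g ** N ** g - \<tau> *\<^sub>R (N ** g) + \<sigma> *\<^sub>R mat 1"
  proof -
    have "adj3 (\<beta> ** g) = \<beta> ** g ** (\<beta> ** g) - trace (\<beta> ** g) *\<^sub>R (\<beta> ** g) + \<sigma> *\<^sub>R mat 1"
      by (simp only: adj3_cayley_hamilton \<sigma>_def)
    then show ?thesis
      unfolding trace_beta_g unfolding beta_g by (simp add: matrix_mul_assoc scaleR_diff_right)
  qed
  have t1: "trace (h ** q ** N ** g) = trace (N ** q)"
  proof -
    have "trace (h ** q ** N ** g) = trace (g ** (h ** q ** N))" by (rule trace_mul_sym)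
    also have "\<dots> = trace (q ** N)" by (simp add: matrix_mul_assoc gh)
    also have "\<dots> = trace (N ** q)" by (rule trace_mul_sym)
    finally show ?thesis .
  qed
  have t2: "trace (h ** q ** N ** g ** N ** g) = trace (N ** q ** N ** g)"
  proof -
    have "trace (h ** q ** N ** g ** N ** g) = trace (g ** (h ** q ** N ** g ** N))" by (rule trace_mul_sym)
    also have "\<dots> = trace (q ** N ** g ** N)" by (simp add: matrix_mul_assoc gh)
    also have "\<dots> = trace (N ** (q ** N ** g))" by (rule trace_mul_sym)
    finally show ?thesis by (simp add: matrix_mul_assoc)
  qed
  have t3: "trace (h ** q ** \<beta> ** cross_mat s) = s \<bullet> axial (h ** q ** N)"
  proof -
    have "transpose (h ** q ** h) = h ** q ** h" by (simp add: matrix_transpose_mul q sym_h matrix_mul_assoc)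
    then have "axial (h ** q ** h) = 0" by (rule axial_sym)
    then have "axial (h ** q ** \<beta>) = - axial (h ** q ** N)"
      by (simp add: brk_beta_def)
    then show ?thesis by (simp add: trace_mult_cross_mat inner_commute)
  qed
  have P: "trace (h ** q ** ricci_mixed) = 2 * ?d * (trace (N ** q ** N ** g) - \<tau> * trace (N ** q) + \<sigma> * trace (h ** q))
      - 2 * ?A * trace (h ** q) + 2 * (s \<bullet> axial (h ** q ** N))"
    unfolding ricci_mixed_def Z by (simp add: matrix_mul_assoc t1 t2 t3 field_simps)
  have M: "s \<bullet> momentum3 N a (h ** q) = trace (h ** q) * ?A - 3 * (s \<bullet> (q *v s)) - s \<bullet> axial (h ** q ** N)"
    by (simp add: momentum3_def inner_diff_right inner_commute matrix_transpose_mul q sym_h flip: matrix_vector_mul_assoc)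
  show ?thesis
    unfolding P M \<sigma> by (simp add: brk_tau_def field_simps power2_eq_square)
qed

end

section \<open>The index formulas for the connection and the Ricci tensor\<close>

definition christoffel3 ::
  "(3 \<Rightarrow> 3 \<Rightarrow> 3 \<Rightarrow> real) \<Rightarrow> real^3^3 \<Rightarrow> real^3^3 \<Rightarrow> 3 \<Rightarrow> 3 \<Rightarrow> 3 \<Rightarrow> real" where
  "christoffel3 c g h i j k =
     (\<Sum>m\<in>UNIV. h$k$m * (\<Sum>l\<in>UNIV. c i j l * g$l$m - c i m l * g$l$j - c j m l * g$l$i)) / 2"

text \<open>The contracted curvature of a left-invariant connection: its coefficients are constant,
  so that no derivatives appear.\<close>

definition ricci3_index :: "(3 \<Rightarrow> 3 \<Rightarrow> 3 \<Rightarrow> real) \<Rightarrow> real^3^3 \<Rightarrow> real^3^3 \<Rightarrow> 3 \<Rightarrow> 3 \<Rightarrow> real" where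
  "ricci3_index c g h i j = (let \<gamma> = christoffel3 c g h in
     \<Sum>k\<in>UNIV. \<Sum>m\<in>UNIV. \<gamma> i j m * \<gamma> k m k - \<gamma> k j m * \<gamma> i m k - c k i m * \<gamma> m j k)"

lemma outer_simps:
  "A ** outer u v = outer (A *v u) v" "outer u v ** A = outer u (transpose A *v v)"
  "trace (outer u v) = u \<bullet> v" "outer u v *v x = (v \<bullet> x) *\<^sub>R u"
  "transpose (outer u v) = outer v u"
  by (simp_all add: matrix3_defs algebra_simps)

text \<open>The determinant to first order: applying \<open>M\<close> to one factor of a triple
  product at a time and adding gives \<open>trace M\<close> times the product.\<close>

lemma cross3_derivation:
  "cross3 (M *v x) y + cross3 x (M *v y) = trace M *\<^sub>R cross3 x y - transpose M *v cross3 x y"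
  by (simp add: matrix3_defs algebra_simps)

text \<open>A polynomial identity for each of the 27 index triples; the tables \<open>c'\<close> and
  \<open>c''\<close> express the structure constants by \<open>N\<close> and
  \<open>a\<close>.\<close>

lemma koszul3_eq:
  assumes N: "transpose N = N" and g: "transpose g = g"
    and c: "\<And>i j k. c i j k = bracket N a (axis i 1) (axis j 1) $ k"
  shows "(\<Sum>l\<in>UNIV. c i j l * g$l$m - c i m l * g$l$j - c j m l * g$l$i) =
    2 * (cross3 ((brk_tau N g *\<^sub>R mat 1 - N ** g) *v axis i 1) (axis j 1)
      + g$i$j *\<^sub>R a - a$j *\<^sub>R (g *v axis i 1)) $ m"
proof -
  have s: "N$2$1 = N$1$2" "N$3$1 = N$1$3" "N$3$2 = N$2$3" "g$2$1 = g$1$2" "g$3$1 = g$1$3" "g$3$2 = g$2$3"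
    by (rule symmetricD[OF N] symmetricD[OF g])+
  have "\<forall>i j m. (\<Sum>l\<in>UNIV. c i j l * g$l$m - c i m l * g$l$j - c j m l * g$l$i) =
    2 * (cross3 ((brk_tau N g *\<^sub>R mat 1 - N ** g) *v axis i 1) (axis j 1)
      + g$i$j *\<^sub>R a - a$j *\<^sub>R (g *v axis i 1)) $ m"
  proof -
    have c': "c 1 2 1 = N$1$3 - a$2" "c 1 2 2 = N$2$3 + a$1" "c 1 2 3 = N$3$3"
      "c 2 3 1 = N$1$1" "c 2 3 2 = N$1$2 - a$3" "c 2 3 3 = N$1$3 + a$2"
      "c 3 1 1 = N$1$2 + a$3" "c 3 1 2 = N$2$2" "c 3 1 3 = N$2$3 - a$1"
      by (simp_all add: c bracket_def matrix3_defs axis_def s)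
    have c'': "c 2 1 k = - c 1 2 k" "c 3 2 k = - c 2 3 k" "c 1 3 k = - c 3 1 k"
      "c 1 1 k = 0" "c 2 2 k = 0" "c 3 3 k = 0" for k
      by (simp_all add: c bracket_def cross_skew[of "axis 2 1" "axis 1 1"]
          cross_skew[of "axis 3 1" "axis 2 1"] cross_skew[of "axis 1 1" "axis 3 1"])
    have T: "brk_tau N g = (N$1$1 * g$1$1 + N$2$2 * g$2$2 + N$3$3 * g$3$3) / 2 + N$1$2 * g$1$2 + N$1$3 * g$1$3 + N$2$3 * g$2$3"
      by (simp add: brk_tau_def matrix3_simps s)
    show ?thesis
      by (simp add: forall_3 matrix3_defs axis_def s c' c'' T) (simp add: algebra_simps)
  qed
  then show ?thesis by blast
qed

context invariant_metric
begin

abbreviation "\<D> \<equiv> levi_civita3 N a g h"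

lemma levi_civita3_mult:
  "\<D> y *v x = h *v (cross3 (\<beta> *v (g *v x)) y + (x \<bullet> (g *v y)) *\<^sub>R a) - (a \<bullet> y) *\<^sub>R x"
  by (simp add: levi_civita3_def outer_simps cross_mat_mult inner_commute cross_skew[of y]
      flip: matrix_vector_mul_assoc)

text \<open>Antisymmetrisation leaves \<open>\<beta> g\<close> acting as a derivation on a cross
  product; by \<open>cross3_derivation\<close> the result is \<open>trace (\<beta> g)\<close> minus
  the transpose of \<open>\<beta> g\<close>, which is \<open>g N\<close>.\<close>

lemma torsion_free: "\<D> y *v x - \<D> x *v y = bracket N a x y"
proof -
  have "cross3 (\<beta> *v (g *v x)) y - cross3 (\<beta> *v (g *v y)) x = trace (\<beta> ** g) *\<^sub>R cross3 x y - transpose (\<beta> ** g) *v cross3 x y"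
    using cross3_derivation[of "\<beta> ** g" x y] by (simp add: cross_skew[of x] matrix_vector_mul_assoc)
  also have "\<dots> = g *v (N *v cross3 x y)"
    unfolding trace_beta_g beta_g
    by (simp add: brk_tau_def matrix_transpose_mul sym_N sym_g del: transpose_matrix_vector flip: matrix_vector_mul_assoc)
  finally have e: "cross3 (\<beta> *v (g *v x)) y - cross3 (\<beta> *v (g *v y)) x = g *v (N *v cross3 x y)" .
  have "x \<bullet> (g *v y) = y \<bullet> (g *v x)" by (metis inner_matrix_sym sym_g inner_commute)
  then have "\<D> y *v x - \<D> x *v y
      = h *v (cross3 (\<beta> *v (g *v x)) y - cross3 (\<beta> *v (g *v y)) x) + (a \<bullet> x) *\<^sub>R y - (a \<bullet> y) *\<^sub>R x"
    by (simp add: levi_civita3_mult)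
  then show ?thesis by (simp add: e gh_assoc bracket_def)
qed

lemma trace_levi_civita3: "trace (\<D> y) = - 2 * (a \<bullet> y)"
proof -
  have "trace (h ** cross_mat y ** \<beta> ** g) = trace (g ** (h ** cross_mat y ** \<beta>))" by (rule trace_mul_sym)
  also have "\<dots> = trace (cross_mat y ** \<beta>)" by (simp add: matrix_mul_assoc gh)
  also have "\<dots> = trace (\<beta> ** cross_mat y)" by (rule trace_mul_sym)
  also have "\<dots> = 0" by (rule trace_skew_sym[OF sym_beta])
  finally have "trace (h ** cross_mat y ** \<beta> ** g) = 0" .
  moreover have "s \<bullet> (g *v y) = a \<bullet> y" by (metis inner_matrix_sym sym_h gh_assoc(4))
  ultimately show ?thesis by (simp add: levi_civita3_def outer_simps)
qed

text \<open>The left-hand side is the Ricci tensor: \<open>- 2 (a \<bullet> z)\<close> is the trace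
  of \<open>\<D> z\<close>, and the remaining terms in the trace of the curvature combine, by
  torsion-freeness, to \<open>- trace (\<D> x \<D> y)\<close> and the trace of a commutator.\<close>

lemma ricci3_eq_trace: "- 2 * (a \<bullet> (\<D> y *v x)) - trace (\<D> x ** \<D> y) = x \<bullet> (ricci3 N a g h *v y)"
proof -
  let ?K = "\<lambda>y. h ** cross_mat y ** \<beta> ** g"
  have t0: "trace (?K y) = 0" for y
  proof -
    have "trace (?K y) = trace (g ** (h ** cross_mat y ** \<beta>))" by (rule trace_mul_sym)
    also have "\<dots> = trace (cross_mat y ** \<beta>)" by (simp add: matrix_mul_assoc gh)
    also have "\<dots> = trace (\<beta> ** cross_mat y)" by (rule trace_mul_sym)
    also have "\<dots> = 0" by (rule trace_skew_sym[OF sym_beta])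
    finally show ?thesis .
  qed
  have sg: "s \<bullet> (g *v y) = a \<bullet> y" for y by (metis inner_matrix_sym sym_h gh_assoc(4))
  have t1: "trace (?K x ** ?K y) = - 2 * (x \<bullet> (adj3 \<beta> *v y))"
  proof -
    have "trace (?K x ** ?K y) = trace ((h ** cross_mat x ** \<beta> ** cross_mat y ** \<beta>) ** g)"
      by (simp add: matrix_mul_assoc gh_assoc)
    also have "\<dots> = trace (g ** (h ** cross_mat x ** \<beta> ** cross_mat y ** \<beta>))" by (rule trace_mul_sym)
    also have "\<dots> = trace (cross_mat x ** \<beta> ** cross_mat y ** \<beta>)" by (simp add: matrix_mul_assoc gh)
    finally show ?thesis by (simp only: trace_cross_mat_conj[OF sym_beta])
  qed
  have Ks: "?K x *v s = h *v (cross3 x (\<beta> *v a))" for x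
    by (simp add: gh_assoc cross_mat_mult flip: matrix_vector_mul_assoc)
  have hg': "(h *v z) \<bullet> (g *v y) = z \<bullet> y" for z y by (metis inner_matrix_sym sym_h gh_assoc(4))
  have t2: "trace (?K x ** outer s (g *v y)) = cross3 x (\<beta> *v a) \<bullet> y"
    by (simp only: outer_simps Ks hg')
  have t3: "trace (outer s (g *v x) ** ?K y) = cross3 y (\<beta> *v a) \<bullet> x"
  proof -
    have "trace (outer s (g *v x) ** ?K y) = trace (?K y ** outer s (g *v x))" by (rule trace_mul_sym)
    then show ?thesis by (simp only: outer_simps Ks hg')
  qed
  have t23: "cross3 y (\<beta> *v a) \<bullet> x = - (cross3 x (\<beta> *v a) \<bullet> y)"
    by (simp add: cross3_simps)
  have t4: "trace (outer s (g *v x) ** outer s (g *v y)) = (a \<bullet> x) * (a \<bullet> y)"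
    by (simp add: outer_simps sg inner_commute[of "g *v x" s] inner_commute[of "g *v y" s])
  have "trace (\<D> x ** \<D> y) = - 2 * (x \<bullet> (adj3 \<beta> *v y)) + 2 * (a \<bullet> x) * (a \<bullet> y)"
    unfolding levi_civita3_def matrix_additive matrix_scaleR t1 t2 t3 t23 t4
    by (simp add: t0 outer_simps sg)
  moreover have "a \<bullet> (\<D> y *v x) = s \<bullet> cross3 (\<beta> *v (g *v x)) y + (x \<bullet> (g *v y)) * (a \<bullet> s) - (a \<bullet> x) * (a \<bullet> y)"
    by (simp add: levi_civita3_mult inner_add_right inner_diff_right inner_matrix_sym[OF sym_h])
  moreover have "x \<bullet> (g *v (\<beta> *v cross3 s y)) = - (s \<bullet> cross3 (\<beta> *v (g *v x)) y)"
  proof -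
    have "x \<bullet> (g *v (\<beta> *v cross3 s y)) = (\<beta> *v (g *v x)) \<bullet> cross3 s y"
      by (simp add: inner_matrix_sym[OF sym_g] inner_matrix_sym[OF sym_beta])
    also have "\<dots> = - (s \<bullet> cross3 (\<beta> *v (g *v x)) y)"
      by (simp add: cross3_simps)
    finally show ?thesis .
  qed
  ultimately show ?thesis
    by (simp add: ricci3_def inner_add_right inner_diff_right cross_mat_mult algebra_simps flip: matrix_vector_mul_assoc)
qed

lemma ricci3_index_eq:
  assumes c: "\<And>i j k. c i j k = bracket N a (axis i 1) (axis j 1) $ k"
  shows "christoffel3 c g h i j k = \<D> (axis j 1) $ k $ i" (is ?C)
    "ricci3_index c g h i j = ricci3 N a g h $ i $ j" (is ?R)
proof -
  have col: "(A *v axis i 1) $ k = A $ k $ i" for A :: "real^3^3" and i k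
    by (simp add: matrix_vector_mult_basis column_def)
  have gij: "axis i 1 \<bullet> (g *v axis j 1) = g $ i $ j" for i j
    by (simp add: col inner_axis' )
  have C: "christoffel3 c g h i j k = \<D> (axis j 1) $ k $ i" for i j k
  proof -
    let ?Y = "cross3 ((\<beta> ** g) *v axis i 1) (axis j 1) + g$i$j *\<^sub>R a - a$j *\<^sub>R (g *v axis i 1)"
    have "christoffel3 c g h i j k = (\<Sum>m\<in>UNIV. h$k$m * ?Y $ m)"
      unfolding christoffel3_def koszul3_eq[OF sym_N sym_g c] beta_g
      by (simp add: sum_distrib_left algebra_simps flip: sum_divide_distrib)
    also have "\<dots> = (h *v ?Y) $ k" by (simp add: matrix_vector_mult_def)
    also have "h *v ?Y = \<D> (axis j 1) *v axis i 1"
      by (simp add: levi_civita3_mult gij gh_assoc hg inner_axis matrix_vector_mul_assoc)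
    finally show ?thesis by (simp only: col)
  qed
  show ?C by (rule C)
  \<comment> \<open>Torsion-freeness absorbs the structure constants, so that the last two sums
    become the trace of a single product.\<close>
  have T: "\<D> (axis m 1) $ k $ i + c m i k = \<D> (axis i 1) $ k $ m" for i k m
    using arg_cong[OF torsion_free[of "axis i 1" "axis m 1"], of "\<lambda>v. v $ k"] by (simp add: c col)
  have "ricci3_index c g h i j = (\<Sum>k\<in>UNIV. \<Sum>m\<in>UNIV. \<D> (axis j 1) $ m $ i * \<D> (axis m 1) $ k $ k)
      - (\<Sum>k\<in>UNIV. \<Sum>m\<in>UNIV. \<D> (axis j 1) $ m $ k * \<D> (axis m 1) $ k $ i)
      - (\<Sum>k\<in>UNIV. \<Sum>m\<in>UNIV. c k i m * \<D> (axis j 1) $ k $ m)"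
    by (simp add: ricci3_index_def C sum_subtractf)
  also have "(\<Sum>k\<in>UNIV. \<Sum>m\<in>UNIV. c k i m * \<D> (axis j 1) $ k $ m) = (\<Sum>k\<in>UNIV. \<Sum>m\<in>UNIV. c m i k * \<D> (axis j 1) $ m $ k)"
    by (rule sum.swap)
  also have "(\<Sum>k\<in>UNIV. \<Sum>m\<in>UNIV. \<D> (axis j 1) $ m $ i * \<D> (axis m 1) $ k $ k)
      = (\<Sum>m\<in>UNIV. \<D> (axis j 1) $ m $ i * (\<Sum>k\<in>UNIV. \<D> (axis m 1) $ k $ k))"
    by (subst sum.swap) (simp add: sum_distrib_left)
  also have "\<dots> = (\<Sum>m\<in>UNIV. \<D> (axis j 1) $ m $ i * (- 2 * a $ m))"
    using trace_levi_civita3 by (simp add: trace_def inner_axis)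
  also have "\<dots> = - 2 * (a \<bullet> (\<D> (axis j 1) *v axis i 1))"
    by (simp add: inner_vec_def col sum_distrib_left algebra_simps)
  finally have "ricci3_index c g h i j = - 2 * (a \<bullet> (\<D> (axis j 1) *v axis i 1))
      - (\<Sum>k\<in>UNIV. \<Sum>m\<in>UNIV. \<D> (axis j 1) $ m $ k * (\<D> (axis m 1) $ k $ i + c m i k))"
    by (simp add: sum_subtractf sum.distrib algebra_simps)
  also have "(\<Sum>k\<in>UNIV. \<Sum>m\<in>UNIV. \<D> (axis j 1) $ m $ k * (\<D> (axis m 1) $ k $ i + c m i k))
      = trace (\<D> (axis i 1) ** \<D> (axis j 1))"
    unfolding T by (simp add: trace_def matrix_matrix_mult_def mult.commute)
  also have "- 2 * (a \<bullet> (\<D> (axis j 1) *v axis i 1)) - trace (\<D> (axis i 1) ** \<D> (axis j 1)) = ricci3 N a g h $ i $ j"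
    unfolding ricci3_eq_trace by (simp add: inner_axis' col)
  finally show ?R .
qed

end

section \<open>Inequalities for quadratic forms and the sign of the scalar curvature\<close>

lemma pos_def_inverse:
  fixes g h :: "real^3^3"
  assumes "pos_def g" "g ** h = mat 1" "transpose h = h"
  shows "pos_def h"
  unfolding pos_def_def
proof (intro conjI allI impI)
  fix w :: "real^3" assume "w \<noteq> 0"
  have gw: "g *v (h *v w) = w" by (simp add: matrix_vector_mul_assoc assms)
  then have "h *v w \<noteq> 0" using \<open>w \<noteq> 0\<close> by auto
  then have "(h *v w) \<bullet> (g *v (h *v w)) > 0" using assms(1) by (auto simp: pos_def_def)
  then show "w \<bullet> (h *v w) > 0" by (simp add: gw inner_commute)
qed (rule assms(3))

text \<open>The right-hand side is the squared norm, with respect to \<open>H\<close>, of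
  \<open>q\<close> minus a multiple of the metric and a multiple of the rank one form of
  \<open>v\<close>. The coefficients stay free so that each application can choose the best
  ones.\<close>

lemma trace_sq_weighted:
  fixes G H q :: "real^3^3"
  assumes H: "pos_def H" and GH: "G ** H = mat 1" "H ** G = mat 1" and G: "transpose G = G"
    and q: "transpose q = q"
  shows "0 \<le> trace (H ** q ** H ** q) - 2 * x * trace (H ** q) - 2 * y * (v \<bullet> (q *v v))
    + 3 * x\<^sup>2 + 2 * x * y * (v \<bullet> (G *v v)) + y\<^sup>2 * (v \<bullet> (G *v v))\<^sup>2"
proof -
  let ?o = "outer (G *v v) (G *v v)"
  let ?A = "q - x *\<^sub>R G - y *\<^sub>R ?o"
  have HT: "transpose H = H" using H by (simp add: pos_def_def)
  have HG: "H *v (G *v z) = z" "A ** H ** G = A" "A ** G ** H = A" for z A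
    by (simp_all add: GH matrix_vector_mul_assoc flip: matrix_mul_assoc)
  have "transpose ?A = ?A" by (simp add: q G outer_simps)
  then have "0 \<le> trace (?A ** H ** ?A ** H)" by (rule trace_sym_sq_nonneg[OF H])
  also have "trace (?A ** H ** ?A ** H) = trace (H ** (?A ** H ** ?A))" by (rule trace_mul_sym)
  also have "H ** (?A ** H ** ?A) = (H ** ?A) ** (H ** ?A)" by (simp only: matrix_mul_assoc)
  also have "H ** ?A = H ** q - x *\<^sub>R mat 1 - y *\<^sub>R outer v (G *v v)"
    by (simp add: outer_simps GH HG)
  also have "trace ((H ** q - x *\<^sub>R mat 1 - y *\<^sub>R outer v (G *v v)) ** (H ** q - x *\<^sub>R mat 1 - y *\<^sub>R outer v (G *v v)))
    = trace (H ** q ** H ** q) - 2 * x * trace (H ** q) - 2 * y * (v \<bullet> (q *v v))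
    + 3 * x\<^sup>2 + 2 * x * y * (v \<bullet> (G *v v)) + y\<^sup>2 * (v \<bullet> (G *v v))\<^sup>2"
  proof -
    have 1: "trace ((H ** q) ** outer v (G *v v)) = v \<bullet> (q *v v)"
    proof -
      have "trace ((H ** q) ** outer v (G *v v)) = (H *v (q *v v)) \<bullet> (G *v v)"
        by (simp add: outer_simps flip: matrix_vector_mul_assoc)
      also have "\<dots> = (q *v v) \<bullet> v" by (simp add: inner_matrix_sym[OF HT] HG)
      finally show ?thesis by (simp add: inner_commute)
    qed
    have 2: "trace (outer v (G *v v) ** (H ** q)) = v \<bullet> (q *v v)"
      using 1 trace_mul_sym[of "H ** q"] by simp
    have 3: "trace (outer v (G *v v) ** outer v (G *v v)) = (v \<bullet> (G *v v))\<^sup>2"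
      by (simp add: outer_simps inner_commute power2_eq_square)
    show ?thesis
      unfolding matrix_additive matrix_scaleR 1 2 3
      by (simp add: 1 2 3 outer_simps(3) matrix_mul_assoc power2_eq_square algebra_simps)
  qed
  finally show ?thesis .
qed

text \<open>The operator norm is at most the Hilbert-Schmidt norm. The value
  \<open>q(v, v) / G(v, v)^2\<close> minimises \<open>trace_sq_weighted\<close> over
  \<open>y\<close> when \<open>x = 0\<close>.\<close>

lemma quadratic_form_le_trace_sq:
  fixes G H q :: "real^3^3"
  assumes H: "pos_def H" and GH: "G ** H = mat 1" "H ** G = mat 1" and G: "transpose G = G"
    and q: "transpose q = q"
  shows "(v \<bullet> (q *v v))\<^sup>2 \<le> trace (H ** q ** H ** q) * (v \<bullet> (G *v v))\<^sup>2"
proof (cases "v = 0")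
  case False
  have "pos_def G" using pos_def_inverse[OF H GH(2) G] .
  then have p: "v \<bullet> (G *v v) > 0" using False by (auto simp: pos_def_def)
  let ?b = "v \<bullet> (G *v v)" and ?a = "v \<bullet> (q *v v)"
  have "0 \<le> trace (H ** q ** H ** q) - 2 * (?a / ?b\<^sup>2) * ?a + (?a / ?b\<^sup>2)\<^sup>2 * ?b\<^sup>2"
    using trace_sq_weighted[OF assms, of 0 "?a / ?b\<^sup>2" v] by simp
  also have "\<dots> = trace (H ** q ** H ** q) - ?a\<^sup>2 / ?b\<^sup>2"
    using p by (simp add: field_simps power2_eq_square)
  finally show ?thesis using p by (simp add: field_simps)
qed simp

text \<open>This is \<open>- i / 2\<close> times the combination of the Pauli matrices with
  coefficients \<open>w\<close>; the normalisation turns the cross product into the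
  commutator.\<close>

definition su2_of :: "real^3 \<Rightarrow> complex^2^2" where
  "su2_of w = vector [vector [Complex 0 (- w$3 / 2), Complex (- w$2 / 2) (- w$1 / 2)],
     vector [Complex (w$2 / 2) (- w$1 / 2), Complex 0 (w$3 / 2)]]"

lemmas matrix2_simps = vec_eq_iff forall_2 sum_2 matrix_matrix_mult_def trace_def vector_2

lemma linear_su2_of: "linear su2_of"
  by (rule linearI) (simp_all add: su2_of_def matrix2_simps complex_eq_iff field_simps)

lemma bij_su2_of: "bij_betw su2_of UNIV su2"
proof (intro bij_betw_imageI set_eqI iffI)
  show "inj su2_of"
    by (rule injI) (simp add: su2_of_def vec_eq_iff[where 'b = 2] vector_2 forall_2 complex_eq_iff vec_eq_iff forall_3)
next
  fix X assume "X \<in> range su2_of"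
  then show "X \<in> su2" by (auto simp: su2_def su2_of_def trace_def sum_2 vector_2 forall_2 complex_eq_iff)
next
  fix X :: "complex^2^2" assume "X \<in> su2"
  then have X: "X $ j $ i = - cnj (X $ i $ j)" "trace X = 0" for i j
    unfolding su2_def by blast+
  have r: "Re (X$1$1) = 0" using arg_cong[OF X(1)[of 1 1], of Re] by simp
  have e: "X$2$2 = - X$1$1" using X(2) by (simp add: trace_def sum_2 add_eq_0_iff)
  have o: "X$2$1 = - cnj (X$1$2)" by (rule X(1))
  have "X = su2_of (vector [- 2 * Im (X$1$2), - 2 * Re (X$1$2), - 2 * Im (X$1$1)])"
    by (simp add: su2_of_def vec_eq_iff vector_2 vector_3 forall_2 complex_eq_iff e o r)
  then show "X \<in> range su2_of" by blast
qed

lemma su2_of_cross3: "su2_of (cross3 u v) = su2_of u ** su2_of v - su2_of v ** su2_of u"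
  by (simp add: su2_of_def matrix2_simps complex_eq_iff cross3_def vector_3 field_simps)

text \<open>A Cholesky factor of the definite matrix \<open>\<kappa> N\<close> provides a change of
  basis after which the bracket is the cross product, that is, the bracket of su(2).\<close>

lemma bianchi_IX_if_definite:
  assumes c: "\<And>i j k. c i j k = - c j i k" and a: "bracket_trace c = 0"
    and pos: "pos_def (\<kappa> *\<^sub>R bracket_sym c)" and \<kappa>: "\<kappa>\<^sup>2 = 1"
  shows "bianchi_IX c"
proof -
  define N where "N = bracket_sym c"
  obtain L where L: "\<kappa> *\<^sub>R N = transpose L ** L" "det L \<noteq> 0"
    using pos unfolding N_def by (rule cholesky3)
  then have "invertible L" by (simp add: invertible_det_nz)
  then obtain K where K: "L ** K = mat 1" "K ** L = mat 1" by (auto simp: invertible_def)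
  have KT: "transpose K ** transpose L = mat 1" by (simp add: K(1) flip: matrix_transpose_mul)
  have "N = (\<kappa> * \<kappa>) *\<^sub>R N" using \<kappa> by (simp add: power2_eq_square)
  also have "\<dots> = \<kappa> *\<^sub>R (transpose L ** L)" by (simp flip: L(1))
  finally have N: "N = \<kappa> *\<^sub>R (transpose L ** L)" .
  \<comment> \<open>An invertible \<open>M\<close> carries the bracket to the cross product iff
    \<open>M^T M N\<close> is \<open>det M\<close> times the identity. For \<open>M\<close> equal to
    \<open>k\<close> times the inverse transpose of \<open>L\<close> this reads
    \<open>k^2 \<kappa> = k^3 / det L\<close>, which determines \<open>k\<close>.\<close>
  define k where "k = \<kappa> * det L"
  define M where "M = k *\<^sub>R transpose K"
  have k0: "k \<noteq> 0" using L(2) \<kappa> by (auto simp: k_def)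
  have "det L * det K = 1" using K(1) det_mul[of L K] by simp
  then have dK: "det K = 1 / det L" using L(2) by (simp add: field_simps)
  have "det (k *\<^sub>R transpose K) = k ^ 3 * det K"
    by (simp add: det_3 transpose_def algebra_simps power3_eq_cube)
  then have detM: "det M = k\<^sup>2 * \<kappa>"
    using L(2) \<kappa> by (simp add: M_def dK k_def power3_eq_cube power2_eq_square)
  have "transpose M ** M ** N = det M *\<^sub>R mat 1"
  proof -
    have "transpose M ** M ** N = (k\<^sup>2 * \<kappa>) *\<^sub>R (K ** (transpose K ** transpose L) ** L)"
      by (simp add: M_def N matrix_mul_assoc power2_eq_square mult_ac)
    then show ?thesis by (simp add: KT K detM)
  qed
  then have MN: "transpose M *v (M *v (N *v z)) = det M *\<^sub>R z" for z
    by (metis matrix_vector_mul_assoc matrix_scaleR(3) matrix_vector_mul_lid)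
  have cancel: "x = y" if "transpose M *v x = transpose M *v y" for x y
  proof -
    have "L ** transpose M = k *\<^sub>R mat 1" by (simp add: M_def K)
    then have "k *\<^sub>R x = k *\<^sub>R y"
      using arg_cong[OF that, of "\<lambda>z. L *v z"] by (simp add: matrix_vector_mul_assoc del: transpose_matrix_vector)
    then show ?thesis using k0 by simp
  qed
  have hom: "M *v (N *v cross3 x y) = cross3 (M *v x) (M *v y)" for x y
    by (rule cancel) (simp only: MN cross_matrix_mult)
  have inv: "invertible M" using k0 L(2) by (simp add: invertible_det_nz detM) (use \<kappa> in auto)
  have "linear (\<lambda>u. su2_of (M *v u))"
    using linear_compose[OF matrix_vector_mul_linear[of M] linear_su2_of] by (simp add: o_def)
  moreover have "bij_betw (\<lambda>u. su2_of (M *v u)) UNIV su2"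
  proof -
    have "bij ((*v) M)" using inv invertible_eq_bij by blast
    then show ?thesis using bij_betw_trans[OF _ bij_su2_of] by (simp add: o_def)
  qed
  moreover have "su2_of (M *v lie_bracket c u v) = su2_of (M *v u) ** su2_of (M *v v) - su2_of (M *v v) ** su2_of (M *v u)" for u v
    by (simp add: lie_bracket_eq_bracket[OF c] bracket_def a hom su2_of_cross3 flip: N_def)
  ultimately show ?thesis unfolding bianchi_IX_def by blast
qed

text \<open>Positive scalar curvature forces the squared norm of \<open>\<beta>\<close> below
  \<open>\<tau>^2\<close>, hence \<open>\<beta>\<close> below \<open>|\<tau>| h\<close> as a
  quadratic form. So \<open>N = \<tau> h - \<beta>\<close> is definite with the sign of
  \<open>\<tau>\<close>; then \<open>N a = 0\<close> leaves only \<open>a = 0\<close>, and the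
  algebra is of type IX.\<close>

lemma (in invariant_metric) scalar_curvature_nonpos:
  assumes c: "\<And>i j k. c i j k = - c j i k" and Nc: "N = bracket_sym c" and ac: "a = bracket_trace c"
    and pos: "pos_def g" and jacobi: "N *v a = 0" and not_IX: "\<not> bianchi_IX c"
  shows "trace (h ** ricci3 N a g h) \<le> 0"
proof (rule ccontr)
  assume "\<not> trace (h ** ricci3 N a g h) \<le> 0"
  then have R: "2 * det h * trace (adj3 (\<beta> ** g)) - 6 * (a \<bullet> s) > 0"
    by (simp add: h_ricci3 trace_ricci_mixed)
  have pos_h: "pos_def h" by (rule pos_def_inverse[OF pos gh sym_h])
  then have "a \<bullet> s \<ge> 0" unfolding pos_def_def by (cases "a = 0") (auto simp: less_imp_le)
  then have "det h * trace (adj3 (\<beta> ** g)) > 0" using R by linarith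
  moreover have "det h > 0"
  proof -
    obtain L where "h = transpose L ** L" "det L \<noteq> 0" by (rule cholesky3[OF pos_h])
    then show ?thesis by (simp add: det_mul det_transpose flip: power2_eq_square)
  qed
  ultimately have "trace (adj3 (\<beta> ** g)) > 0" by (simp add: zero_less_mult_iff)
  then have \<tau>: "trace (\<beta> ** g ** (\<beta> ** g)) < \<tau>\<^sup>2" by (simp add: trace_adj3 trace_beta_g)
  have t: "trace (g ** \<beta> ** g ** \<beta>) = trace (\<beta> ** g ** (\<beta> ** g))"
    using trace_mul_sym[of g "\<beta> ** g ** \<beta>"] by (simp add: matrix_mul_assoc)
  have N_pos: "w \<bullet> ((sgn \<tau> *\<^sub>R N) *v w) > 0" if w: "w \<noteq> 0" for w
  proof -
    have p: "w \<bullet> (h *v w) > 0" using pos_h w by (auto simp: pos_def_def)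
    have "(w \<bullet> (\<beta> *v w))\<^sup>2 \<le> trace (\<beta> ** g ** (\<beta> ** g)) * (w \<bullet> (h *v w))\<^sup>2"
      using quadratic_form_le_trace_sq[OF pos hg gh sym_h sym_beta] t by simp
    also have "\<dots> < \<tau>\<^sup>2 * (w \<bullet> (h *v w))\<^sup>2" using \<tau> p by simp
    finally have "\<bar>w \<bullet> (\<beta> *v w)\<bar> < \<bar>\<tau> * (w \<bullet> (h *v w))\<bar>"
      by (metis abs_le_square_iff linorder_not_le power_mult_distrib)
    then have "\<bar>w \<bullet> (\<beta> *v w)\<bar> < \<bar>\<tau>\<bar> * (w \<bullet> (h *v w))" using p by (simp add: abs_mult)
    moreover have "w \<bullet> (N *v w) = \<tau> * (w \<bullet> (h *v w)) - w \<bullet> (\<beta> *v w)"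
      by (subst N_eq) (simp add: inner_diff_right)
    ultimately show ?thesis by (cases "\<tau> > 0"; cases "\<tau> = 0") (auto simp: sgn_if abs_if split: if_splits)
  qed
  have "a = 0"
    using N_pos[of a] by (cases "a = 0") (auto simp: jacobi)
  have "\<tau> \<noteq> 0" using N_pos[of "axis 1 1"] by (auto simp: axis_eq_0_iff)
  have "bianchi_IX c"
  proof (rule bianchi_IX_if_definite[OF c])
    show "bracket_trace c = 0" using \<open>a = 0\<close> ac by simp
    show "pos_def (sgn \<tau> *\<^sub>R bracket_sym c)"
      using N_pos by (simp add: pos_def_def sym_N flip: Nc)
    show "(sgn \<tau>)\<^sup>2 = 1" using \<open>\<tau> \<noteq> 0\<close> by (simp add: sgn_if)
  qed
  then show False using not_IX by simp
qed

text \<open>This is where the bound on the dimension enters: the discriminant of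
  \<open>S\<^sup>2 + m S l + (m + 3) l\<^sup>2\<close>, where \<open>m\<close> is the number of flat directions, is \<open>(m - 6) (m + 2)\<close>.\<close>

lemma quadratic_nonneg:
  fixes m S l :: real
  assumes "0 \<le> m" "m \<le> 6"
  shows "0 \<le> S\<^sup>2 + m * S * l + (m + 3) * l\<^sup>2"
proof -
  have "m + 3 - m\<^sup>2 / 4 = (6 - m) * (m + 2) / 4" by (simp add: power2_eq_square algebra_simps)
  moreover have "(6 - m) * (m + 2) / 4 \<ge> 0" using assms by simp
  ultimately have "m + 3 - m\<^sup>2 / 4 \<ge> 0" by simp
  then have "0 \<le> (S + m * l / 2)\<^sup>2 + (m + 3 - m\<^sup>2 / 4) * l\<^sup>2" by (intro add_nonneg_nonneg mult_nonneg_nonneg) auto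
  then show ?thesis by (simp add: power2_eq_square algebra_simps)
qed

text \<open>\<open>S\<close>, \<open>B\<close>, \<open>V\<close>, \<open>Q\<close> stand for
  \<open>- tr k\<close>, \<open>|k|^2\<close>, \<open>|v|^2\<close>, \<open>- k(v, v)\<close>, and
  \<open>f K\<close> for the squared length of the component of \<open>v\<close> in a flat
  direction. With \<open>m\<close> flat directions, a symmetric map with trace \<open>S\<close> and
  normalised value \<open>l = Q / V\<close> on \<open>v\<close> has squared norm at least
  \<open>l^2 + (S - l)^2 / (m + 2)\<close>.\<close>

lemma expansion_inequality:
  fixes G H q :: "real^3^3" and v :: "real^3" and \<psi> f :: "nat \<Rightarrow> real"
  assumes H: "pos_def H" and GH: "G ** H = mat 1" "H ** G = mat 1" and G: "transpose G = G"
    and q: "transpose q = q" and F: "finite F" "card F \<le> 6" and f: "\<And>K. K \<in> F \<Longrightarrow> f K \<ge> 0"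
  defines "S \<equiv> trace (H ** q) + sum \<psi> F"
    and "B \<equiv> trace (H ** q ** H ** q) + (\<Sum>K\<in>F. (\<psi> K)\<^sup>2)"
    and "V \<equiv> v \<bullet> (G *v v) + sum f F" and "Q \<equiv> v \<bullet> (q *v v) + (\<Sum>K\<in>F. \<psi> K * f K)"
  shows "0 \<le> S * Q + B * V"
proof -
  have "pos_def G" using pos_def_inverse[OF H GH(2) G] .
  then have vv: "v \<bullet> (G *v v) \<ge> 0" and v0: "v \<bullet> (G *v v) = 0 \<Longrightarrow> v = 0"
    unfolding pos_def_def by (cases "v = 0"; force simp: less_imp_le)+
  have ff: "sum f F \<ge> 0" using f by (rule sum_nonneg)
  have V: "V \<ge> 0" using vv ff by (simp add: V_def)
  show ?thesis
  proof (cases "V = 0")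
    case True
    then have "v \<bullet> (G *v v) = 0" "sum f F = 0" using vv ff by (auto simp: V_def)
    then have "v = 0" "\<forall>K\<in>F. f K = 0" using v0 f F(1) by (auto simp: sum_nonneg_eq_0_iff)
    then have "Q = 0" by (simp add: Q_def)
    then show ?thesis using True by simp
  next
    case False
    then have V: "V > 0" using V by simp
    define m where "m = real (card F)"
    have m: "0 \<le> m" "m \<le> 6" using F(2) by (auto simp: m_def)
    \<comment> \<open>Sum of \<open>trace_sq_weighted\<close> and its diagonal analogue in the flat
      directions. Of the rank one form of \<open>v\<close> only the group block and the flat
      diagonal are subtracted; \<open>VV\<close> bounds their squares by \<open>V^2\<close>.\<close>
    have *: "0 \<le> B - 2 * x * S - 2 * y * Q + (m + 3) * x\<^sup>2 + 2 * x * y * V + y\<^sup>2 * V\<^sup>2" for x y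
    proof -
      let ?b = "v \<bullet> (G *v v)"
      have "(\<Sum>K\<in>F. (f K)\<^sup>2) \<le> (\<Sum>K\<in>F. f K * sum f F)"
        unfolding power2_eq_square using F(1) f by (intro sum_mono mult_left_mono member_le_sum) auto
      then have "?b\<^sup>2 + (\<Sum>K\<in>F. (f K)\<^sup>2) \<le> ?b\<^sup>2 + (sum f F)\<^sup>2"
        by (simp add: power2_eq_square flip: sum_distrib_right)
      also have "\<dots> \<le> V\<^sup>2"
        using mult_nonneg_nonneg[OF vv ff] by (simp add: V_def power2_eq_square algebra_simps)
      finally have VV: "y\<^sup>2 * (?b\<^sup>2 + (\<Sum>K\<in>F. (f K)\<^sup>2)) \<le> y\<^sup>2 * V\<^sup>2" by (intro mult_left_mono) auto
      have "0 \<le> (\<Sum>K\<in>F. (\<psi> K - x - y * f K)\<^sup>2)" by (intro sum_nonneg) auto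
      also have "\<dots> = (\<Sum>K\<in>F. (\<psi> K)\<^sup>2) - 2 * x * sum \<psi> F - 2 * y * (\<Sum>K\<in>F. \<psi> K * f K)
          + m * x\<^sup>2 + 2 * x * y * sum f F + y\<^sup>2 * (\<Sum>K\<in>F. (f K)\<^sup>2)"
      proof -
        have "(\<psi> K - x - y * f K)\<^sup>2 = (\<psi> K)\<^sup>2 - 2 * x * \<psi> K - 2 * y * (\<psi> K * f K) + x\<^sup>2 + 2 * x * y * f K + y\<^sup>2 * (f K)\<^sup>2" for K
          by (simp add: power2_eq_square algebra_simps)
        then show ?thesis by (simp add: sum.distrib sum_subtractf m_def flip: sum_distrib_left)
      qed
      finally have "0 \<le> \<dots>" .
      then show ?thesis
        using trace_sq_weighted[OF H GH G q, of x y v] VV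
        by (simp add: B_def S_def Q_def V_def[symmetric] algebra_simps) (simp add: V_def algebra_simps)
    qed
    \<comment> \<open>The extremal map has the eigenvalue \<open>l\<close> along \<open>v\<close>
      and \<open>x\<close> on the orthogonal complement, whose dimension is \<open>m + 2\<close>. So
      the trace fixes \<open>x\<close>, and \<open>y V\<close> is the difference of the two
      eigenvalues.\<close>
    define l where "l = Q / V"
    define x where "x = (S - l) / (m + 2)"
    define y where "y = (l - x) / V"
    have "y * V = l - x" "y * Q = (l - x) * l" using V by (auto simp: y_def l_def)
    then have "0 \<le> B - 2 * x * S - 2 * ((l - x) * l) + (m + 3) * x\<^sup>2 + 2 * x * (l - x) + (l - x)\<^sup>2"
      using *[of x y] by (simp add: mult.assoc flip: power_mult_distrib)
    also have "\<dots> = B - l\<^sup>2 - (S - l)\<^sup>2 / (m + 2)"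
    proof -
      have "(m + 2) * x = S - l" using m by (simp add: x_def)
      moreover have "(S - l)\<^sup>2 / (m + 2) = (S - l) * x" by (simp add: x_def power2_eq_square)
      ultimately show ?thesis by algebra
    qed
    finally have "0 \<le> (m + 2) * (B - l\<^sup>2 - (S - l)\<^sup>2 / (m + 2))" using m by simp
    also have "\<dots> = (m + 2) * (B + S * l) - (S\<^sup>2 + m * S * l + (m + 3) * l\<^sup>2)"
      using m by (simp add: field_simps power2_eq_square)
    finally have "0 \<le> (m + 2) * (B + S * l)" using quadratic_nonneg[OF m, of S l] by linarith
    then have "0 \<le> B + S * l" using m by (simp add: zero_le_mult_iff)
    then have "0 \<le> (B + S * l) * V" using V by simp
    then show ?thesis using V by (simp add: l_def algebra_simps)
  qed
qed

section \<open>The Ricci tensor in the invariant frame\<close>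

lemma finite_idx: "finite (spatial_idx n)" "finite (all_idx n)"
  by (auto simp: spatial_idx_def all_idx_def)

lemma idx_mem [simp]:
  "Time \<in> all_idx n" "Grp i \<in> all_idx n" "Flat K \<in> all_idx n \<longleftrightarrow> K \<in> {1..n-3}"
  "Time \<notin> spatial_idx n" "Grp i \<in> spatial_idx n" "Flat K \<in> spatial_idx n \<longleftrightarrow> K \<in> {1..n-3}"
  by (auto simp: all_idx_def spatial_idx_def)

lemma sum_spatial_idx:
  "(\<Sum>d\<in>spatial_idx n. f d) = (\<Sum>i\<in>UNIV. f (Grp i)) + (\<Sum>K\<in>{1..n-3}. f (Flat K))"
proof -
  have "(\<Sum>d\<in>spatial_idx n. f d) = sum f (range Grp) + sum f (Flat ` {1..n-3})"
    unfolding spatial_idx_def by (rule sum.union_disjoint) auto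
  then show ?thesis by (simp add: sum.reindex inj_on_def)
qed

lemma sum_all_idx:
  "(\<Sum>d\<in>all_idx n. f d) = f Time + (\<Sum>i\<in>UNIV. f (Grp i)) + (\<Sum>K\<in>{1..n-3}. f (Flat K))"
  using sum_spatial_idx[of f n] by (simp add: all_idx_def finite_idx add.assoc)

text \<open>\<open>inverse_matrix\<close> is a choice among right inverses; a left inverse on
  \<open>S\<close> makes the chosen one unique there.\<close>

lemma inverse_matrix_eq:
  assumes S: "finite S"
    and l: "\<And>a b. a \<in> S \<Longrightarrow> b \<in> S \<Longrightarrow> (\<Sum>d\<in>S. k a d * h d b) = of_bool (a = b)"
    and r: "\<And>a b. a \<in> S \<Longrightarrow> b \<in> S \<Longrightarrow> (\<Sum>d\<in>S. h a d * k d b) = of_bool (a = b)"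
    and ab: "a \<in> S" "b \<in> S"
  shows "inverse_matrix S h a b = k a b"
proof -
  let ?k = "inverse_matrix S h"
  have K: "\<forall>a\<in>S. \<forall>b\<in>S. (\<Sum>d\<in>S. h a d * ?k d b) = of_bool (a = b)"
    unfolding inverse_matrix_def by (rule someI[of _ k]) (use r in blast)
  have "k a b = (\<Sum>m\<in>S. k a m * of_bool (m = b))" using S ab by simp
  also have "\<dots> = (\<Sum>m\<in>S. k a m * (\<Sum>d\<in>S. h m d * ?k d b))" using K ab by simp
  also have "\<dots> = (\<Sum>d\<in>S. (\<Sum>m\<in>S. k a m * h m d) * ?k d b)"
    by (simp add: sum_distrib_left sum_distrib_right mult.assoc) (rule sum.swap)
  also have "\<dots> = (\<Sum>d\<in>S. of_bool (a = d) * ?k d b)" using l ab by simp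
  also have "\<dots> = ?k a b" using S ab by simp
  finally show ?thesis by simp
qed

text \<open>The inverse metric has the same block shape, so it is again expressed by
  \<open>metric_comp\<close>, with the constant family \<open>h\<close> and negated
  exponents.\<close>

lemma metric_comp_inverse:
  fixes h :: "real^3^3"
  assumes gh: "g t ** h = mat 1"
  shows "a \<in> all_idx n \<Longrightarrow> b \<in> all_idx n \<Longrightarrow>
      (\<Sum>d\<in>all_idx n. metric_comp g \<phi> t a d * metric_comp (\<lambda>t. h) (\<lambda>K t. - \<phi> K t) t d b) = of_bool (a = b)"
    "a \<in> spatial_idx n \<Longrightarrow> b \<in> spatial_idx n \<Longrightarrow>
      (\<Sum>d\<in>spatial_idx n. metric_comp g \<phi> t a d * metric_comp (\<lambda>t. h) (\<lambda>K t. - \<phi> K t) t d b) = of_bool (a = b)"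
proof -
  have G: "(\<Sum>k\<in>UNIV. g t $ i $ k * h $ k $ j) = of_bool (i = j)" for i j
    using arg_cong[OF gh, of "\<lambda>A. A $ i $ j"] by (simp add: matrix_matrix_mult_def mat_def)
  have E: "exp (2 * x) * exp (- (2 * x)) = (1::real)" for x
    by (simp flip: exp_add)
  show "a \<in> spatial_idx n \<Longrightarrow> b \<in> spatial_idx n \<Longrightarrow>
      (\<Sum>d\<in>spatial_idx n. metric_comp g \<phi> t a d * metric_comp (\<lambda>t. h) (\<lambda>K t. - \<phi> K t) t d b) = of_bool (a = b)"
    unfolding sum_spatial_idx
    by (cases a; cases b) (auto simp: G E sum.delta if_distrib[of "\<lambda>x. x * _"] cong: if_cong)
  then show "a \<in> all_idx n \<Longrightarrow> b \<in> all_idx n \<Longrightarrow>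
      (\<Sum>d\<in>all_idx n. metric_comp g \<phi> t a d * metric_comp (\<lambda>t. h) (\<lambda>K t. - \<phi> K t) t d b) = of_bool (a = b)"
    unfolding sum_all_idx
    by (cases a; cases b) (auto simp: G E sum.delta if_distrib[of "\<lambda>x. x * _"] cong: if_cong)
qed

lemma inverse_metric_comp:
  fixes h :: "real^3^3"
  assumes "g t ** h = mat 1" "h ** g t = mat 1"
  shows "a \<in> all_idx n \<Longrightarrow> b \<in> all_idx n \<Longrightarrow>
      inverse_matrix (all_idx n) (metric_comp g \<phi> t) a b = metric_comp (\<lambda>t. h) (\<lambda>K t. - \<phi> K t) t a b"
    "a \<in> spatial_idx n \<Longrightarrow> b \<in> spatial_idx n \<Longrightarrow>
      inverse_matrix (spatial_idx n) (metric_comp g \<phi> t) a b = metric_comp (\<lambda>t. h) (\<lambda>K t. - \<phi> K t) t a b"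
proof -
  have m': "metric_comp (\<lambda>u. g t) \<phi> t a b = metric_comp g \<phi> t a b" for a b
    by (cases a; cases b) auto
  note r = metric_comp_inverse[of g t h _ n _ \<phi>, OF assms(1)]
  note l = metric_comp_inverse[of "\<lambda>t. h" t "g t" _ n _ "\<lambda>K t. - \<phi> K t", OF assms(2), unfolded minus_minus m']
  show "a \<in> all_idx n \<Longrightarrow> b \<in> all_idx n \<Longrightarrow>
      inverse_matrix (all_idx n) (metric_comp g \<phi> t) a b = metric_comp (\<lambda>t. h) (\<lambda>K t. - \<phi> K t) t a b"
    by (rule inverse_matrix_eq[OF finite_idx(2) l(1) r(1)])
  show "a \<in> spatial_idx n \<Longrightarrow> b \<in> spatial_idx n \<Longrightarrow>
      inverse_matrix (spatial_idx n) (metric_comp g \<phi> t) a b = metric_comp (\<lambda>t. h) (\<lambda>K t. - \<phi> K t) t a b"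
    by (rule inverse_matrix_eq[OF finite_idx(1) l(2) r(2)])
qed

lemma smooth_at_const:
  assumes "smooth_atlas A" shows "smooth_at A (\<lambda>x. k) p"
  unfolding smooth_at_def
proof (intro exI[of _ UNIV] conjI ballI)
  fix ch assume "ch \<in> A"
  then show "case ch of (U, \<phi>) \<Rightarrow> smooth_on (\<phi> ` (U \<inter> UNIV)) ((\<lambda>x. k) \<circ> inv_into U \<phi>)"
    using assms smooth_on_const by (fastforce simp: smooth_atlas_def comp_def)
qed auto

lemma atlas_chart:
  assumes "smooth_atlas A"
  obtains U \<phi> where "(U, \<phi>) \<in> A" "p \<in> U" "open U" "open (\<phi> ` U)" "inj_on \<phi> U"
proof -
  have "p \<in> (\<Union>(U, \<phi>)\<in>A. U)" using assms by (simp add: smooth_atlas_def)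
  then obtain U \<phi> where U: "(U, \<phi>) \<in> A" "p \<in> U" by auto
  then have "open U" "open (\<phi> ` U)" "homeomorphism U (\<phi> ` U) \<phi> (inv_into U \<phi>)"
    using assms unfolding smooth_atlas_def by fastforce+
  moreover from this have "inj_on \<phi> U" by (metis homeomorphism_def inj_on_inverseI)
  ultimately show thesis using that U by blast
qed

lemma vector_field_const:
  assumes A: "smooth_atlas A" and X: "smooth_vector_field A X"
  shows "X (\<lambda>x. k) p = 0"
proof -
  obtain U \<phi> where U: "(U, \<phi>) \<in> A" "p \<in> U" using atlas_chart[OF A] by metis
  then obtain \<xi> where "X (\<lambda>x. k) p = frechet_derivative ((\<lambda>x. k) \<circ> inv_into U \<phi>) (at (\<phi> p)) (\<xi> (\<phi> p))"
    using X smooth_at_const[OF A] unfolding smooth_vector_field_def by blast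
  then show ?thesis by (simp add: comp_def frechet_derivative_const)
qed

lemma frame_deriv_Grp_Flat:
  assumes "smooth_atlas A" "\<And>i. smooth_vector_field A (e i)" "\<And>z. f (t, z) = k"
  shows "frame_deriv e (Grp i) f (t, x, y) = 0" "frame_deriv e (Flat K) f (t, x, y) = 0"
  using vector_field_const[OF assms(1,2)] by (simp_all add: assms(3))

text \<open>The complete table of Koszul terms. With \<open>g' = 2 q\<close> and
  \<open>\<phi>' = \<psi>\<close> the factor one half of the Koszul formula disappears from all
  entries that involve \<open>Time\<close>.\<close>

fun koszul_comp :: "(3 \<Rightarrow> 3 \<Rightarrow> 3 \<Rightarrow> real) \<Rightarrow> (real \<Rightarrow> real^3^3) \<Rightarrow> (real \<Rightarrow> real^3^3) \<Rightarrow>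
  (nat \<Rightarrow> real \<Rightarrow> real) \<Rightarrow> (nat \<Rightarrow> real \<Rightarrow> real) \<Rightarrow> real \<Rightarrow> idx \<Rightarrow> idx \<Rightarrow> idx \<Rightarrow> real" where
  "koszul_comp c g q \<phi> \<psi> t Time (Grp i) (Grp j) = q t $ i $ j"
| "koszul_comp c g q \<phi> \<psi> t (Grp i) Time (Grp j) = q t $ i $ j"
| "koszul_comp c g q \<phi> \<psi> t (Grp i) (Grp j) Time = - q t $ i $ j"
| "koszul_comp c g q \<phi> \<psi> t (Grp i) (Grp j) (Grp m) =
     (\<Sum>l\<in>UNIV. c i j l * g t$l$m - c i m l * g t$l$j - c j m l * g t$l$i) / 2"
| "koszul_comp c g q \<phi> \<psi> t Time (Flat K) (Flat L) = (if K = L then \<psi> K t * exp (2 * \<phi> K t) else 0)"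
| "koszul_comp c g q \<phi> \<psi> t (Flat K) Time (Flat L) = (if K = L then \<psi> K t * exp (2 * \<phi> K t) else 0)"
| "koszul_comp c g q \<phi> \<psi> t (Flat K) (Flat L) Time = (if K = L then - \<psi> K t * exp (2 * \<phi> K t) else 0)"
| "koszul_comp c g q \<phi> \<psi> t _ _ _ = 0"

fun connection_comp :: "(3 \<Rightarrow> 3 \<Rightarrow> 3 \<Rightarrow> real) \<Rightarrow> (real \<Rightarrow> real^3^3) \<Rightarrow> (real \<Rightarrow> real^3^3) \<Rightarrow> (real \<Rightarrow> real^3^3) \<Rightarrow>
  (nat \<Rightarrow> real \<Rightarrow> real) \<Rightarrow> (nat \<Rightarrow> real \<Rightarrow> real) \<Rightarrow> real \<Rightarrow> idx \<Rightarrow> idx \<Rightarrow> idx \<Rightarrow> real" where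
  "connection_comp c g h q \<phi> \<psi> t Time (Grp i) (Grp j) = (h t ** q t) $ j $ i"
| "connection_comp c g h q \<phi> \<psi> t (Grp i) Time (Grp j) = (h t ** q t) $ j $ i"
| "connection_comp c g h q \<phi> \<psi> t (Grp i) (Grp j) Time = q t $ i $ j"
| "connection_comp c g h q \<phi> \<psi> t (Grp i) (Grp j) (Grp k) = christoffel3 c (g t) (h t) i j k"
| "connection_comp c g h q \<phi> \<psi> t Time (Flat K) (Flat L) = (if K = L then \<psi> K t else 0)"
| "connection_comp c g h q \<phi> \<psi> t (Flat K) Time (Flat L) = (if K = L then \<psi> K t else 0)"
| "connection_comp c g h q \<phi> \<psi> t (Flat K) (Flat L) Time = (if K = L then \<psi> K t * exp (2 * \<phi> K t) else 0)"
| "connection_comp c g h q \<phi> \<psi> t _ _ _ = 0"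

text \<open>Kinematics only, without field equations. The inverse and the derivatives are
  parameters, so that the same results apply to a given solution and to a continuation glued from
  two pieces.\<close>

locale homogeneous_metric =
  fixes n :: nat and A :: "'g::topological_space chart set" and e :: "3 \<Rightarrow> 'g vector_field"
    and c :: "3 \<Rightarrow> 3 \<Rightarrow> 3 \<Rightarrow> real" and I :: "real set"
    and g h q q' :: "real \<Rightarrow> real^3^3" and \<phi> \<psi> \<psi>' :: "nat \<Rightarrow> real \<Rightarrow> real"
  assumes atlas: "smooth_atlas A" and field: "\<And>i. smooth_vector_field A (e i)"
    and c_skew: "\<And>i j k. c i j k = - c j i k" and open_I: "open I"
    and pos: "\<And>t. t \<in> I \<Longrightarrow> pos_def (g t)"
    and gh: "\<And>t. t \<in> I \<Longrightarrow> g t ** h t = mat 1" "\<And>t. t \<in> I \<Longrightarrow> h t ** g t = mat 1"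
    and sym_h: "\<And>t. t \<in> I \<Longrightarrow> transpose (h t) = h t"
    and sym_q: "\<And>t. t \<in> I \<Longrightarrow> transpose (q t) = q t"
    and g_deriv: "\<And>t. t \<in> I \<Longrightarrow> (g has_vector_derivative 2 *\<^sub>R q t) (at t)"
    and h_deriv: "\<And>t. t \<in> I \<Longrightarrow> (h has_vector_derivative - 2 *\<^sub>R (h t ** q t ** h t)) (at t)"
    and q_deriv: "\<And>t. t \<in> I \<Longrightarrow> (q has_vector_derivative q' t) (at t)"
    and \<phi>_deriv: "\<And>t K. t \<in> I \<Longrightarrow> K \<in> {1..n-3} \<Longrightarrow> (\<phi> K has_real_derivative \<psi> K t) (at t)"
    and \<psi>_deriv: "\<And>t K. t \<in> I \<Longrightarrow> K \<in> {1..n-3} \<Longrightarrow> (\<psi> K has_real_derivative \<psi>' K t) (at t)"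
begin

abbreviation "N \<equiv> bracket_sym c"
abbreviation "a \<equiv> bracket_trace c"

lemma invariant_metric: "t \<in> I \<Longrightarrow> invariant_metric N (g t) (h t)"
  using pos gh sym_h by unfold_locales (auto simp: transpose_bracket_sym pos_def_def)

lemma c_eq: "c i j k = bracket N a (axis i 1) (axis j 1) $ k"
  by (rule structure_constants_eq_bracket[OF c_skew])

lemma entry_deriv:
  assumes "t \<in> I"
  shows "((\<lambda>s. g s $ i $ j) has_real_derivative 2 * q t $ i $ j) (at t)"
    "((\<lambda>s. q s $ i $ j) has_real_derivative q' t $ i $ j) (at t)"
    "((\<lambda>s. h s $ i $ j) has_real_derivative - 2 * (h t ** q t ** h t) $ i $ j) (at t)"
proof -
  have *: "((\<lambda>s. X s $ i $ j) has_real_derivative X' $ i $ j) (at t)"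
    if "(X has_vector_derivative X') (at t)" for X :: "real \<Rightarrow> real^3^3" and X'
    using bounded_linear.has_vector_derivative[OF bounded_linear_compose[OF bounded_linear_vec_nth[of j] bounded_linear_vec_nth[of i]] that]
    by (simp add: has_real_derivative_iff_has_vector_derivative)
  show "((\<lambda>s. g s $ i $ j) has_real_derivative 2 * q t $ i $ j) (at t)" using *[OF g_deriv[OF assms]] by simp
  show "((\<lambda>s. q s $ i $ j) has_real_derivative q' t $ i $ j) (at t)" using *[OF q_deriv[OF assms]] .
  show "((\<lambda>s. h s $ i $ j) has_real_derivative - 2 * (h t ** q t ** h t) $ i $ j) (at t)" using *[OF h_deriv[OF assms]] by simp
qed

lemma metric_deriv:
  assumes t: "t \<in> I" and "b \<in> all_idx n" "d \<in> all_idx n"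
  shows "deriv (\<lambda>s. metric_comp g \<phi> s b d) t = 2 * koszul_comp c g q \<phi> \<psi> t Time b d"
proof -
  have "((\<lambda>s. exp (2 * \<phi> K s)) has_real_derivative 2 * (\<psi> K t * exp (2 * \<phi> K t))) (at t)" if "K \<in> {1..n-3}" for K
    by (auto intro!: derivative_eq_intros \<phi>_deriv[OF t that])
  then show ?thesis using assms entry_deriv(1)[OF t]
    by (cases b; cases d) (auto intro!: DERIV_imp_deriv)
qed

lemma koszul_eq:
  assumes t: "t \<in> I" and abd: "a' \<in> all_idx n" "b \<in> all_idx n" "d \<in> all_idx n"
  shows "koszul n e c (metric_at g \<phi>) a' b d (t, x, y) = koszul_comp c g q \<phi> \<psi> t a' b d"
proof -
  \<comment> \<open>The components depend on time alone, so only the derivative along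
    \<open>Time\<close> survives.\<close>
  have D: "frame_deriv e k (\<lambda>p. metric_at g \<phi> p b d) (t, x, y) = (if k = Time then 2 * koszul_comp c g q \<phi> \<psi> t Time b d else 0)"
    if "b \<in> all_idx n" "d \<in> all_idx n" for k b d
  proof (cases k)
    case Time
    then show ?thesis using metric_deriv[OF t that] by (simp add: metric_at_def)
  next
    case (Grp i)
    show ?thesis unfolding Grp
      by (subst frame_deriv_Grp_Flat(1)[OF atlas field, where k = "metric_comp g \<phi> t b d"]) (simp_all add: metric_at_def)
  next
    case (Flat K)
    show ?thesis unfolding Flat
      by (subst frame_deriv_Grp_Flat(2)[OF atlas field, where k = "metric_comp g \<phi> t b d"]) (simp_all add: metric_at_def)
  qed
  have q: "q t $ i $ j = q t $ j $ i" for i j by (rule symmetricD[OF sym_q[OF t]])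
  show ?thesis
    using abd unfolding koszul_def D[OF abd(2,3)] D[OF abd(1,3)] D[OF abd(1,2)]
    unfolding sum_all_idx metric_at_def fst_conv
    by (cases a'; cases b; cases d) (auto simp: q sum_subtractf)
qed

lemma connection_eq:
  assumes t: "t \<in> I" and abd: "a' \<in> all_idx n" "b \<in> all_idx n" "d \<in> all_idx n"
  shows "connection n e c (metric_at g \<phi>) a' b d (t, x, y) = connection_comp c g h q \<phi> \<psi> t a' b d"
proof -
  have "connection n e c (metric_at g \<phi>) a' b d (t, x, y)
      = (\<Sum>m\<in>all_idx n. metric_comp (\<lambda>_. h t) (\<lambda>K t. - \<phi> K t) t d m * koszul_comp c g q \<phi> \<psi> t a' b m)"
    unfolding connection_def
    by (intro sum.cong refl arg_cong2[where f = "(*)"] koszul_eq t abd)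
      (simp_all add: metric_at_def inverse_metric_comp(1)[of g t "h t", OF gh[OF t] abd(3)])
  also have "\<dots> = connection_comp c g h q \<phi> \<psi> t a' b d"
  proof -
    have E: "exp (- (2 * x)) * (y * exp (2 * x)) = y" for x y :: real
      by (simp add: exp_minus field_simps)
    have q: "q t $ i $ j = q t $ j $ i" for i j by (rule symmetricD[OF sym_q[OF t]])
    show ?thesis using abd unfolding sum_all_idx
      by (cases a'; cases b; cases d)
        (auto simp: matrix_matrix_mult_def christoffel3_def E q
            if_distrib[of "\<lambda>x. x * _"] simp flip: sum_divide_distrib cong: if_cong)
  qed
  finally show ?thesis .
qed

end

lemma matrix_mult_nth: "(A ** B) $ i $ j = (\<Sum>k\<in>UNIV. A $ i $ k * B $ k $ j)"
  by (simp add: matrix_matrix_mult_def)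

context invariant_metric
begin

lemma trace_mult_levi_civita3:
  assumes q: "transpose q = q"
  shows "trace ((h ** q) ** \<D> y) = (axial (h ** q ** N) + q *v s - trace (h ** q) *\<^sub>R a) \<bullet> y"
proof -
  have "trace (h ** q ** h ** cross_mat y ** \<beta> ** g) = trace ((\<beta> ** g) ** (h ** q ** h ** cross_mat y))"
    using trace_mul_sym[of "h ** q ** h ** cross_mat y" "\<beta> ** g"] by (simp add: matrix_mul_assoc)
  also have "\<dots> = - (axial (\<beta> ** q ** h) \<bullet> y)"
    by (simp add: matrix_mul_assoc gh_assoc trace_mult_cross_mat)
  also have "axial (\<beta> ** q ** h) = axial (h ** q ** N)"
  proof -
    have "transpose (h ** q ** h) = h ** q ** h" by (simp add: matrix_transpose_mul q sym_h matrix_mul_assoc)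
    then have 1: "axial (h ** q ** h) = 0" by (rule axial_sym)
    have ax: "axial (transpose X) = - axial X" for X by (simp add: matrix3_defs)
    have "axial (N ** q ** h) = - axial (h ** q ** N)"
      using ax[of "h ** q ** N"] by (simp add: matrix_transpose_mul q sym_h sym_N matrix_mul_assoc)
    then show ?thesis by (simp add: brk_beta_def 1)
  qed
  finally have 1: "trace (h ** q ** h ** cross_mat y ** \<beta> ** g) = - (axial (h ** q ** N) \<bullet> y)" .
  have 2: "trace (h ** q ** outer s (g *v y)) = (q *v s) \<bullet> y"
  proof -
    have "(h *v (q *v s)) \<bullet> (g *v y) = (q *v s) \<bullet> y"
      by (metis inner_matrix_sym sym_h gh_assoc(4))
    then show ?thesis by (simp add: outer_simps flip: matrix_vector_mul_assoc)
  qed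
  show ?thesis
    by (simp add: levi_civita3_def matrix_mul_assoc 1 2 inner_add_left inner_diff_left)
qed

text \<open>The two orders of a mixed Ricci component lead to different contractions;
  torsion-freeness shows that both equal the same divergence. The third identity expresses that the
  contracted Christoffel symbol does not depend on the metric.\<close>

lemma momentum3_index:
  assumes q: "transpose q = q" and c: "\<And>i j k. c i j k = bracket N a (axis i 1) (axis j 1) $ k"
  defines "P \<equiv> h ** q" and "\<gamma> \<equiv> christoffel3 c g h"
  shows "(\<Sum>k\<in>UNIV. \<Sum>m\<in>UNIV. P$m$i * \<gamma> k m k - \<gamma> k i m * P$k$m) = momentum3 N a P $ i" (is ?A)
    "(\<Sum>k\<in>UNIV. \<Sum>m\<in>UNIV. P$m$i * \<gamma> k m k - P$m$k * \<gamma> i m k - c k i m * P$k$m) = momentum3 N a P $ i" (is ?B)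
    "(\<Sum>k\<in>UNIV. \<gamma> k i k) = - 2 * a $ i" (is ?C)
proof -
  have \<gamma>: "\<gamma> i j k = \<D> (axis j 1) $ k $ i" for i j k
    unfolding \<gamma>_def by (rule ricci3_index_eq(1)[OF c])
  have col: "(A *v axis i 1) $ k = A $ k $ i" for A :: "real^3^3" and i k
    by (simp add: matrix_vector_mult_basis column_def)
  have T: "\<gamma> i m k + c m i k = \<gamma> m i k" for i k m
    using arg_cong[OF torsion_free[of "axis i 1" "axis m 1"], of "\<lambda>v. v $ k"] by (simp add: c col \<gamma>)
  have C: "(\<Sum>k\<in>UNIV. \<gamma> k m k) = - 2 * a $ m" for m
    using trace_levi_civita3[of "axis m 1"] by (simp add: \<gamma> trace_def inner_axis)
  then show ?C .
  have Pa: "transpose P *v a = q *v s"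
    by (simp add: P_def matrix_transpose_mul q sym_h del: transpose_matrix_vector flip: matrix_vector_mul_assoc)
  have 1: "(\<Sum>k\<in>UNIV. \<Sum>m\<in>UNIV. P$m$i * \<gamma> k m k) = - 2 * (q *v s) $ i"
  proof -
    have "(\<Sum>k\<in>UNIV. \<Sum>m\<in>UNIV. P$m$i * \<gamma> k m k) = (\<Sum>m\<in>UNIV. P$m$i * (\<Sum>k\<in>UNIV. \<gamma> k m k))"
      by (subst sum.swap) (simp add: sum_distrib_left)
    also have "\<dots> = - 2 * (transpose P *v a) $ i"
      by (simp add: C matrix_vector_mult_def transpose_def sum_distrib_left mult_ac del: transpose_matrix_vector)
    finally show ?thesis by (simp only: Pa)
  qed
  have 2: "(\<Sum>k\<in>UNIV. \<Sum>m\<in>UNIV. \<gamma> k i m * P$k$m) = (axial (P ** N) + q *v s - trace P *\<^sub>R a) $ i"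
  proof -
    have "(\<Sum>k\<in>UNIV. \<Sum>m\<in>UNIV. \<gamma> k i m * P$k$m) = trace (P ** \<D> (axis i 1))"
      by (simp add: \<gamma> trace_def matrix_mult_nth mult.commute)
    then show ?thesis using trace_mult_levi_civita3[OF q, of "axis i 1"] by (simp add: P_def inner_axis)
  qed
  have 3: "(\<Sum>k\<in>UNIV. \<Sum>m\<in>UNIV. P$m$k * \<gamma> i m k + c k i m * P$k$m) = (\<Sum>k\<in>UNIV. \<Sum>m\<in>UNIV. \<gamma> k i m * P$k$m)"
  proof -
    have "(\<Sum>k\<in>UNIV. \<Sum>m\<in>UNIV. P$m$k * \<gamma> i m k) = (\<Sum>k\<in>UNIV. \<Sum>m\<in>UNIV. P$k$m * \<gamma> i k m)"
      by (rule sum.swap)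
    then have "(\<Sum>k\<in>UNIV. \<Sum>m\<in>UNIV. P$m$k * \<gamma> i m k + c k i m * P$k$m)
        = (\<Sum>k\<in>UNIV. \<Sum>m\<in>UNIV. (\<gamma> i k m + c k i m) * P$k$m)"
      by (simp add: sum.distrib algebra_simps)
    then show ?thesis by (simp only: T)
  qed
  have M: "momentum3 N a P $ i = - 2 * (q *v s) $ i - (axial (P ** N) + q *v s - trace P *\<^sub>R a) $ i"
    by (simp add: momentum3_def Pa del: transpose_matrix_vector)
  show ?A using 1 2 M by (simp add: sum_subtractf)
  show ?B using 1 2 3 M by (simp add: sum_subtractf sum.distrib)
qed

end

section \<open>The components of the Ricci tensor\<close>

context homogeneous_metric
begin

abbreviation "cc \<equiv> connection_comp c g h q \<phi> \<psi>"

definition "expansion t = trace (h t ** q t) + (\<Sum>K\<in>{1..n-3}. \<psi> K t)"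
definition "k_norm_sq t = trace (h t ** q t ** h t ** q t) + (\<Sum>K\<in>{1..n-3}. (\<psi> K t)\<^sup>2)"

lemma ricci_eq:
  assumes t: "t \<in> I" and ab: "a' \<in> all_idx n" "b \<in> all_idx n"
  shows "ricci n e c (metric_at g \<phi>) a' b (t, x, y) =
    (\<Sum>d\<in>all_idx n. (if d = Time then deriv (\<lambda>s. cc s a' b d) t else 0)
      - (if a' = Time then deriv (\<lambda>s. cc s d b d) t else 0)
      + (\<Sum>m\<in>all_idx n. cc t a' b m * cc t d m d - cc t d b m * cc t a' m d
          - frame_comm c d a' m * cc t m b d))"
proof -
  have D: "frame_deriv e k (connection n e c (metric_at g \<phi>) i j l) (t, x, y)
      = (if k = Time then deriv (\<lambda>s. cc s i j l) t else 0)"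
    if "i \<in> all_idx n" "j \<in> all_idx n" "l \<in> all_idx n" for i j k l
  proof (cases k)
    case Time
    have "eventually (\<lambda>s. s \<in> I) (nhds t)" using open_I t eventually_nhds_in_open by blast
    then have "deriv (\<lambda>s. connection n e c (metric_at g \<phi>) i j l (s, x, y)) t = deriv (\<lambda>s. cc s i j l) t"
      by (intro deriv_cong_ev) (auto elim!: eventually_mono simp: connection_eq[OF _ that])
    then show ?thesis by (simp add: Time)
  next
    case (Grp i')
    have "connection n e c (metric_at g \<phi>) i j l (t, z) = cc t i j l" for z
      using connection_eq[OF t that] by (cases z) simp
    then show ?thesis unfolding Grp
      by (subst frame_deriv_Grp_Flat(1)[OF atlas field, where k = "cc t i j l"]) simp_all
  next
    case (Flat K)
    have "connection n e c (metric_at g \<phi>) i j l (t, z) = cc t i j l" for z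
      using connection_eq[OF t that] by (cases z) simp
    then show ?thesis unfolding Flat
      by (subst frame_deriv_Grp_Flat(2)[OF atlas field, where k = "cc t i j l"]) simp_all
  qed
  show ?thesis
    unfolding ricci_def riemann_def Let_def
    by (intro sum.cong refl arg_cong2[where f = "(+)"] arg_cong2[where f = "(-)"])
      (simp_all add: D connection_eq[OF t] ab)
qed

lemma hq_deriv:
  assumes t: "t \<in> I"
  shows "((\<lambda>s. (h s ** q s) $ i $ j) has_real_derivative (h t ** q' t - 2 *\<^sub>R (h t ** q t ** h t ** q t)) $ i $ j) (at t)"
proof -
  have "((\<lambda>s. \<Sum>k\<in>UNIV. h s $ i $ k * q s $ k $ j) has_real_derivative
      (\<Sum>k\<in>UNIV. - 2 * (h t ** q t ** h t) $ i $ k * q t $ k $ j + q' t $ k $ j * h t $ i $ k)) (at t)"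
    by (intro DERIV_sum DERIV_mult entry_deriv[OF t])
  moreover have "(\<Sum>k\<in>UNIV. - 2 * (h t ** q t ** h t) $ i $ k * q t $ k $ j + q' t $ k $ j * h t $ i $ k)
      = (h t ** q' t - 2 *\<^sub>R (h t ** q t ** h t ** q t)) $ i $ j"
    by (simp add: matrix_mult_nth[of "h t ** q t ** h t"] matrix_mult_nth[of "h t" "q' t"]
        sum.distrib sum_distrib_left sum_subtractf sum_negf mult_ac)
  ultimately show ?thesis by (simp add: matrix_mult_nth[of "h _" "q _"])
qed

lemma ricci_Time_Time:
  assumes t: "t \<in> I"
  shows "ricci n e c (metric_at g \<phi>) Time Time (t, x, y)
    = 2 * trace (h t ** q t ** h t ** q t) - trace (h t ** q' t) - (\<Sum>K\<in>{1..n-3}. \<psi>' K t) - k_norm_sq t"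
proof -
  have d: "deriv (\<lambda>s. (h s ** q s) $ i $ i) t = (h t ** q' t - 2 *\<^sub>R (h t ** q t ** h t ** q t)) $ i $ i" for i
    using hq_deriv[OF t] by (rule DERIV_imp_deriv)
  have d': "deriv (\<lambda>s. \<psi> K s) t = \<psi>' K t" if "K \<in> {1..n-3}" for K
    using \<psi>_deriv[OF t that] by (rule DERIV_imp_deriv)
  have tr: "trace (h t ** q t ** h t ** q t) = (\<Sum>i\<in>UNIV. \<Sum>j\<in>UNIV. (h t ** q t) $ j $ i * (h t ** q t) $ i $ j)"
  proof -
    have "trace (h t ** q t ** h t ** q t) = trace ((h t ** q t) ** (h t ** q t))" by (simp add: matrix_mul_assoc)
    then show ?thesis by (simp add: trace_def matrix_matrix_mult_def[of "h t ** q t" "h t ** q t"] mult.commute)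
  qed
  have tr2: "trace (h t ** q' t) - 2 * trace (h t ** q t ** h t ** q t)
      = (\<Sum>i\<in>UNIV. (h t ** q' t - 2 *\<^sub>R (h t ** q t ** h t ** q t)) $ i $ i)"
    by (simp add: trace_def sum_subtractf sum_distrib_left)
  show ?thesis
    unfolding ricci_eq[OF t idx_mem(1) idx_mem(1)] sum_all_idx
    using tr2 by (simp add: d d' k_norm_sq_def tr sum.distrib sum_subtractf sum_negf power2_eq_square
        sum.delta if_distrib[of "\<lambda>x. x * _"] if_distrib[of uminus] cong: if_cong)
qed

lemma ricci_Grp_Grp:
  assumes t: "t \<in> I"
  shows "ricci n e c (metric_at g \<phi>) (Grp i) (Grp j) (t, x, y)
    = (q' t - 2 *\<^sub>R (q t ** h t ** q t) + expansion t *\<^sub>R q t + ricci3 N a (g t) (h t)) $ i $ j"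
proof -
  interpret m: invariant_metric N a "g t" "h t" by (rule invariant_metric[OF t])
  have d: "deriv (\<lambda>s. q s $ i $ j) t = q' t $ i $ j"
    using entry_deriv(2)[OF t] by (rule DERIV_imp_deriv)
  have sq: "q t $ i $ j = q t $ j $ i" for i j by (rule symmetricD[OF sym_q[OF t]])
  have qhq: "(q t ** h t ** q t) $ i $ j = (\<Sum>m\<in>UNIV. q t $ i $ m * (h t ** q t) $ m $ j)" for i j
    by (subst matrix_mul_assoc[symmetric]) (simp add: matrix_matrix_mult_def[of "q t"])
  have "transpose (q t ** h t ** q t) = q t ** h t ** q t"
    by (simp add: matrix_transpose_mul sym_q[OF t] sym_h[OF t] matrix_mul_assoc)
  then have qhq': "(q t ** h t ** q t) $ i $ j = (\<Sum>m\<in>UNIV. q t $ j $ m * (h t ** q t) $ m $ i)"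
    using symmetricD qhq by metis
  have ric: "ricci3 N a (g t) (h t) $ i $ j = (\<Sum>k\<in>UNIV. \<Sum>m\<in>UNIV.
      christoffel3 c (g t) (h t) i j m * christoffel3 c (g t) (h t) k m k
      - christoffel3 c (g t) (h t) k j m * christoffel3 c (g t) (h t) i m k
      - c k i m * christoffel3 c (g t) (h t) m j k)"
    using m.ricci3_index_eq(2)[OF c_eq] by (simp add: ricci3_index_def Let_def)
  have s1: "(\<Sum>m\<in>UNIV. q t $ m $ j * (h t ** q t) $ m $ i) = (q t ** h t ** q t) $ i $ j"
    unfolding qhq' by (intro sum.cong refl arg_cong2[where f = "(*)"] sq)
  show ?thesis
    unfolding ricci_eq[OF t idx_mem(2) idx_mem(2)] sum_all_idx
    apply (simp add: d sum.distrib sum_subtractf sum_negf ric)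
    apply (simp add: expansion_def trace_def sum.distrib sum_distrib_left algebra_simps)
    using qhq[of i j] s1 by simp
qed

lemma ricci_Flat_Flat:
  assumes t: "t \<in> I" and K: "K \<in> {1..n-3}" "L \<in> {1..n-3}"
  shows "ricci n e c (metric_at g \<phi>) (Flat K) (Flat L) (t, x, y)
    = (if K = L then exp (2 * \<phi> K t) * (\<psi>' K t + expansion t * \<psi> K t) else 0)"
proof -
  have d: "deriv (\<lambda>s. \<psi> K s * exp (2 * \<phi> K s)) t = exp (2 * \<phi> K t) * (\<psi>' K t + 2 * (\<psi> K t)\<^sup>2)"
    by (rule DERIV_imp_deriv)
      (auto intro!: derivative_eq_intros \<phi>_deriv[OF t K(1)] \<psi>_deriv[OF t K(1)] simp: power2_eq_square algebra_simps)
  have idx: "Flat K \<in> all_idx n" "Flat L \<in> all_idx n" using K by auto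
  show ?thesis
  proof (cases "K = L")
    case True
    then show ?thesis using K
      unfolding ricci_eq[OF t idx] sum_all_idx
      apply (simp add: d[unfolded True] sum.distrib sum_subtractf sum_negf expansion_def trace_def
          sum.delta sum.delta' if_distrib[of "\<lambda>x. x * _"] if_distrib[of "\<lambda>x. _ * x"] if_distrib[of uminus] cong: if_cong)
      by (simp add: sum_distrib_left algebra_simps power2_eq_square)
  next
    case False
    then show ?thesis using K
      unfolding ricci_eq[OF t idx] sum_all_idx
      by (simp add: sum.distrib sum_subtractf sum_negf
          sum.delta sum.delta' if_distrib[of "\<lambda>x. x * _"] if_distrib[of "\<lambda>x. _ * x"] if_distrib[of uminus] cong: if_cong)
  qed
qed

text \<open>No nonvanishing connection coefficient has an odd number of flat indices, which reflects
  the invariance under reflections of the flat coordinates.\<close>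

lemma ricci_Flat_other:
  assumes t: "t \<in> I" and K: "K \<in> {1..n-3}"
  shows "ricci n e c (metric_at g \<phi>) (Flat K) Time (t, x, y) = 0"
    "ricci n e c (metric_at g \<phi>) Time (Flat K) (t, x, y) = 0"
    "ricci n e c (metric_at g \<phi>) (Flat K) (Grp i) (t, x, y) = 0"
    "ricci n e c (metric_at g \<phi>) (Grp i) (Flat K) (t, x, y) = 0"
proof -
  have K': "Flat K \<in> all_idx n" using K by simp
  show "ricci n e c (metric_at g \<phi>) (Flat K) Time (t, x, y) = 0"
    unfolding ricci_eq[OF t K' idx_mem(1)] sum_all_idx by simp
  show "ricci n e c (metric_at g \<phi>) Time (Flat K) (t, x, y) = 0"
    unfolding ricci_eq[OF t idx_mem(1) K'] sum_all_idx by simp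
  show "ricci n e c (metric_at g \<phi>) (Flat K) (Grp i) (t, x, y) = 0"
    unfolding ricci_eq[OF t K' idx_mem(2)] sum_all_idx by simp
  show "ricci n e c (metric_at g \<phi>) (Grp i) (Flat K) (t, x, y) = 0"
    unfolding ricci_eq[OF t idx_mem(2) K'] sum_all_idx by simp
qed

lemma ricci_Grp_Time:
  assumes t: "t \<in> I"
  shows "ricci n e c (metric_at g \<phi>) (Grp i) Time (t, x, y) = momentum3 N a (h t ** q t) $ i"
    "ricci n e c (metric_at g \<phi>) Time (Grp i) (t, x, y) = momentum3 N a (h t ** q t) $ i"
proof -
  interpret m: invariant_metric N a "g t" "h t" by (rule invariant_metric[OF t])
  note M = m.momentum3_index[OF sym_q[OF t] c_eq, of i]
  show "ricci n e c (metric_at g \<phi>) (Grp i) Time (t, x, y) = momentum3 N a (h t ** q t) $ i"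
    unfolding ricci_eq[OF t idx_mem(2) idx_mem(1)] sum_all_idx
    by (simp flip: M(2))
  \<comment> \<open>The Ricci formula contains the time derivative of each term
    \<open>christoffel3 c (g s) (h s) k i k\<close> separately. The terms are differentiable and
    their sum is constant by \<open>momentum3_index\<close>, so that these derivatives add up to
    zero.\<close>
  have "\<exists>D. ((\<lambda>s. christoffel3 c (g s) (h s) k i k) has_real_derivative D) (at t)" for k
  proof -
    have "(\<lambda>s. g s $ i $ j) differentiable (at t)" "(\<lambda>s. h s $ i $ j) differentiable (at t)" for i j
      using entry_deriv(1,3)[OF t] unfolding real_differentiable_def by blast+
    then show ?thesis
      unfolding christoffel3_def divide_inverse real_differentiable_def[symmetric]
      by (intro differentiable_mult differentiable_sum differentiable_diff differentiable_const ballI) auto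
  qed
  then obtain D where D: "\<And>k. ((\<lambda>s. christoffel3 c (g s) (h s) k i k) has_real_derivative D k) (at t)"
    by metis
  have "((\<lambda>s. \<Sum>k\<in>UNIV. christoffel3 c (g s) (h s) k i k) has_real_derivative (\<Sum>k\<in>UNIV. D k)) (at t)"
    by (intro DERIV_sum D)
  moreover have "((\<lambda>s. \<Sum>k\<in>UNIV. christoffel3 c (g s) (h s) k i k) has_real_derivative 0) (at t)"
  proof (rule has_field_derivative_transform_within_open[OF DERIV_const open_I t])
    fix s assume "s \<in> I"
    interpret ms: invariant_metric N a "g s" "h s" by (rule invariant_metric[OF \<open>s \<in> I\<close>])
    show "- 2 * a $ i = (\<Sum>k\<in>UNIV. christoffel3 c (g s) (h s) k i k)"
      using ms.momentum3_index(3)[OF sym_q[OF \<open>s \<in> I\<close>] c_eq] by simp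
  qed
  ultimately have "(\<Sum>k\<in>UNIV. D k) = 0" by (rule DERIV_unique)
  moreover have "deriv (\<lambda>s. christoffel3 c (g s) (h s) k i k) t = D k" for k
    by (rule DERIV_imp_deriv[OF D])
  ultimately show "ricci n e c (metric_at g \<phi>) Time (Grp i) (t, x, y) = momentum3 N a (h t ** q t) $ i"
    unfolding ricci_eq[OF t idx_mem(1) idx_mem(2)] sum_all_idx
    by (simp add: sum_negf sum.distrib sum_subtractf flip: M(1))
qed

end

section \<open>The vacuum equations as an evolution problem with constraints\<close>

lemma trace_adj3_mult:
  fixes X X' :: "real^3^3"
  shows "trace (adj3 X ** X') =
    X'$1$1 * X$2$2 * X$3$3 + X$1$1 * X'$2$2 * X$3$3 + X$1$1 * X$2$2 * X'$3$3
    + X'$1$2 * X$2$3 * X$3$1 + X$1$2 * X'$2$3 * X$3$1 + X$1$2 * X$2$3 * X'$3$1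
    + X'$1$3 * X$2$1 * X$3$2 + X$1$3 * X'$2$1 * X$3$2 + X$1$3 * X$2$1 * X'$3$2
    - X'$1$1 * X$2$3 * X$3$2 - X$1$1 * X'$2$3 * X$3$2 - X$1$1 * X$2$3 * X'$3$2
    - X'$1$2 * X$2$1 * X$3$3 - X$1$2 * X'$2$1 * X$3$3 - X$1$2 * X$2$1 * X'$3$3
    - X'$1$3 * X$2$2 * X$3$1 - X$1$3 * X'$2$2 * X$3$1 - X$1$3 * X$2$2 * X'$3$1"
  by (simp add: matrix3_defs algebra_simps)

lemma has_vector_derivative_entry:
  fixes X :: "real \<Rightarrow> real^3^3"
  assumes "(X has_vector_derivative X') F"
  shows "((\<lambda>s. X s $ i $ j) has_real_derivative X' $ i $ j) F"
  using bounded_linear.has_vector_derivative[OF bounded_linear_compose[OF bounded_linear_vec_nth[of j] bounded_linear_vec_nth[of i]] assms]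
  by (simp add: has_real_derivative_iff_has_vector_derivative)

lemma det_has_derivative:
  fixes X :: "real \<Rightarrow> real^3^3"
  assumes "(X has_vector_derivative X') (at t)"
  shows "((\<lambda>s. det (X s)) has_real_derivative trace (adj3 (X t) ** X')) (at t)"
  unfolding det_3 trace_adj3_mult
  by (rule derivative_eq_intros has_vector_derivative_entry[OF assms] refl)+ (simp add: algebra_simps)

lemma bounded_bilinear_matrix_mult: "bounded_bilinear ((**) :: real^3^3 \<Rightarrow> real^3^3 \<Rightarrow> real^3^3)"
  unfolding bilinear_conv_bounded_bilinear[symmetric] bilinear_def
  by (auto intro!: linearI)

lemma bounded_linear_trace: "bounded_linear (trace :: real^3^3 \<Rightarrow> real)"
  unfolding linear_conv_bounded_linear[symmetric] by (auto intro!: linearI)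

lemma bounded_linear_transpose: "bounded_linear (transpose :: real^3^3 \<Rightarrow> real^3^3)"
  unfolding linear_conv_bounded_linear[symmetric] by (auto intro!: linearI)

lemma bounded_linear_matrix_vector: "bounded_linear (\<lambda>A :: real^3^3. A *v x)"
  unfolding linear_conv_bounded_linear[symmetric] by (auto intro!: linearI)

lemma bounded_linear_momentum3: "bounded_linear (momentum3 N a)"
  unfolding linear_conv_bounded_linear[symmetric]
  by (auto intro!: linearI simp: momentum3_def algebra_simps scaleR_diff_right simp del: transpose_matrix_vector)

lemmas matrix_mult_has_derivative = bounded_bilinear.has_vector_derivative[OF bounded_bilinear_matrix_mult]
lemmas trace_has_derivative = bounded_linear.has_vector_derivative[OF bounded_linear_trace,
    folded has_real_derivative_iff_has_vector_derivative]

context homogeneous_metric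
begin

definition "scalar3 t = trace (h t ** ricci3 N a (g t) (h t))"

definition "evolution t \<longleftrightarrow>
  q' t = 2 *\<^sub>R (q t ** h t ** q t) - expansion t *\<^sub>R q t - ricci3 N a (g t) (h t) \<and>
  (\<forall>K\<in>{1..n-3}. \<psi>' K t = - expansion t * \<psi> K t)"

definition "constraints t \<longleftrightarrow>
  momentum3 N a (h t ** q t) = 0 \<and> scalar3 t + (expansion t)\<^sup>2 = k_norm_sq t"

text \<open>The evolution equations eliminate the second time derivatives, and what remains is the
  Hamiltonian constraint.\<close>

lemma ricci_Time_Time_evolution:
  assumes t: "t \<in> I" and ev: "evolution t"
  shows "ricci n e c (metric_at g \<phi>) Time Time (t, x, y) = scalar3 t + (expansion t)\<^sup>2 - k_norm_sq t"
proof -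
  have "h t ** q' t = 2 *\<^sub>R (h t ** q t ** h t ** q t) - expansion t *\<^sub>R (h t ** q t) - h t ** ricci3 N a (g t) (h t)"
    using ev by (simp add: evolution_def matrix_mul_assoc)
  then have "trace (h t ** q' t) = 2 * trace (h t ** q t ** h t ** q t) - expansion t * trace (h t ** q t) - scalar3 t"
    by (simp add: scalar3_def)
  moreover have "(\<Sum>K\<in>{1..n-3}. \<psi>' K t) = - expansion t * (\<Sum>K\<in>{1..n-3}. \<psi> K t)"
    using ev by (simp add: evolution_def sum_distrib_left)
  ultimately show ?thesis
    by (simp add: ricci_Time_Time[OF t] expansion_def power2_eq_square algebra_simps)
qed

text \<open>By homogeneity the tensor equation at one event, with any \<open>x\<close> and
  \<open>y\<close>, is a statement about \<open>t\<close> alone. This reduces the vacuum equations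
  to ordinary differential equations with constraints.\<close>

lemma vacuum_iff:
  assumes t: "t \<in> I"
  shows "(\<forall>a'\<in>all_idx n. \<forall>b\<in>all_idx n. ricci n e c (metric_at g \<phi>) a' b (t, x, y) = 0)
    \<longleftrightarrow> evolution t \<and> constraints t" (is "?V \<longleftrightarrow> _")
proof (intro iffI conjI)
  assume V: ?V
  have "(q' t - 2 *\<^sub>R (q t ** h t ** q t) + expansion t *\<^sub>R q t + ricci3 N a (g t) (h t)) $ i $ j = 0" for i j
    unfolding ricci_Grp_Grp[OF t, of i j x y, symmetric] using V by simp
  then have "q' t - 2 *\<^sub>R (q t ** h t ** q t) + expansion t *\<^sub>R q t + ricci3 N a (g t) (h t) = 0"
    unfolding vec_eq_iff by simp
  then have "q' t = 2 *\<^sub>R (q t ** h t ** q t) - expansion t *\<^sub>R q t - ricci3 N a (g t) (h t)"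
    by (simp add: algebra_simps add_eq_0_iff)
  moreover have "\<psi>' K t = - expansion t * \<psi> K t" if "K \<in> {1..n-3}" for K
    using V ricci_Flat_Flat[OF t that that, of x y] that by (simp add: add_eq_0_iff)
  ultimately show ev: "evolution t" unfolding evolution_def by blast
  have "momentum3 N a (h t ** q t) $ i = 0" for i
    using V ricci_Grp_Time(1)[OF t, of i x y] by simp
  then have "momentum3 N a (h t ** q t) = 0" by (simp add: vec_eq_iff)
  then show "constraints t"
    using V ricci_Time_Time_evolution[OF t ev, of x y] by (simp add: constraints_def)
next
  assume EC: "evolution t \<and> constraints t"
  then have "q' t - 2 *\<^sub>R (q t ** h t ** q t) + expansion t *\<^sub>R q t + ricci3 N a (g t) (h t) = 0"
    by (simp add: evolution_def)
  then have GG: "ricci n e c (metric_at g \<phi>) (Grp i) (Grp j) (t, x, y) = 0" for i j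
    by (simp add: ricci_Grp_Grp[OF t])
  have TT: "ricci n e c (metric_at g \<phi>) Time Time (t, x, y) = 0"
    using EC ricci_Time_Time_evolution[OF t] by (simp add: constraints_def)
  have GT: "ricci n e c (metric_at g \<phi>) (Grp i) Time (t, x, y) = 0"
    "ricci n e c (metric_at g \<phi>) Time (Grp i) (t, x, y) = 0" for i
    using EC by (simp_all add: ricci_Grp_Time[OF t] constraints_def)
  have FF: "ricci n e c (metric_at g \<phi>) (Flat K) (Flat L) (t, x, y) = 0"
    if "K \<in> {1..n-3}" "L \<in> {1..n-3}" for K L
    using EC that by (simp add: ricci_Flat_Flat[OF t that] evolution_def)
  show ?V
  proof (intro ballI)
    fix a' b assume "a' \<in> all_idx n" "b \<in> all_idx n"
    then show "ricci n e c (metric_at g \<phi>) a' b (t, x, y) = 0"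
      by (cases a'; cases b) (simp_all add: GG TT GT FF ricci_Flat_other[OF t])
  qed
qed

lemma sym_q': "t \<in> I \<Longrightarrow> transpose (q' t) = q' t"
proof -
  assume t: "t \<in> I"
  have "((\<lambda>s. transpose (q s)) has_vector_derivative transpose (q' t)) (at t)"
    by (rule bounded_linear.has_vector_derivative[OF bounded_linear_transpose q_deriv[OF t]])
  then have "(q has_vector_derivative transpose (q' t)) (at t)"
    by (rule has_vector_derivative_transform_within_open[OF _ open_I t sym_q])
  then show ?thesis using q_deriv[OF t] vector_derivative_unique_at by blast
qed

text \<open>The antisymmetric part of the evolution equation is the Jacobi identity.\<close>

lemma jacobi_if_evolution:
  assumes t: "t \<in> I" and ev: "evolution t"
  shows "N *v a = 0"
proof -
  interpret m: invariant_metric N a "g t" "h t" by (rule invariant_metric[OF t])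
  have r: "ricci3 N a (g t) (h t) = 2 *\<^sub>R (q t ** h t ** q t) - expansion t *\<^sub>R q t - q' t"
    using ev by (simp add: evolution_def)
  show ?thesis unfolding m.ricci3_symmetric_iff[symmetric] r
    by (simp add: matrix_transpose_mul sym_q[OF t] sym_h[OF t] sym_q'[OF t] matrix_mul_assoc)
qed

text \<open>For the mixed form \<open>h q\<close> the term \<open>2 q h q\<close> in
  \<open>q'\<close> is cancelled by the derivative of \<open>h\<close>; only the damping by
  \<open>expansion\<close> and the curvature remain.\<close>

lemma hq_has_derivative:
  assumes t: "t \<in> I" and ev: "evolution t"
  shows "((\<lambda>s. h s ** q s) has_vector_derivative
    - expansion t *\<^sub>R (h t ** q t) - h t ** ricci3 N a (g t) (h t)) (at t)"
proof -
  have "((\<lambda>s. h s ** q s) has_vector_derivative h t ** q' t + (- 2 *\<^sub>R (h t ** q t ** h t)) ** q t) (at t)"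
    by (rule matrix_mult_has_derivative[OF h_deriv[OF t] q_deriv[OF t]])
  moreover have "h t ** q' t + (- 2 *\<^sub>R (h t ** q t ** h t)) ** q t
      = - expansion t *\<^sub>R (h t ** q t) - h t ** ricci3 N a (g t) (h t)"
    using ev by (simp add: evolution_def matrix_mul_assoc)
  ultimately show ?thesis by simp
qed

lemma expansion_has_derivative:
  assumes t: "t \<in> I" and ev: "evolution t"
  shows "(expansion has_real_derivative - (expansion t)\<^sup>2 - scalar3 t) (at t)"
proof -
  have "((\<lambda>s. trace (h s ** q s) + (\<Sum>K\<in>{1..n-3}. \<psi> K s)) has_real_derivative
      trace (- expansion t *\<^sub>R (h t ** q t) - h t ** ricci3 N a (g t) (h t)) + (\<Sum>K\<in>{1..n-3}. \<psi>' K t)) (at t)"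
    by (intro DERIV_add DERIV_sum trace_has_derivative hq_has_derivative assms \<psi>_deriv)
  moreover have "(\<Sum>K\<in>{1..n-3}. \<psi>' K t) = - expansion t * (\<Sum>K\<in>{1..n-3}. \<psi> K t)"
    using ev by (simp add: evolution_def sum_distrib_left)
  ultimately show ?thesis
    unfolding expansion_def[abs_def] scalar3_def
    by (simp add: expansion_def[symmetric] power2_eq_square)
      (simp add: expansion_def algebra_simps)
qed

text \<open>The divergence of the Ricci tensor vanishes by \<open>momentum3_ricci\<close>, so the
  constraint satisfies a homogeneous linear equation.\<close>

lemma momentum_has_derivative:
  assumes t: "t \<in> I" and ev: "evolution t"
  shows "((\<lambda>s. momentum3 N a (h s ** q s)) has_vector_derivative
    - expansion t *\<^sub>R momentum3 N a (h t ** q t)) (at t)"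
proof -
  interpret m: invariant_metric N a "g t" "h t" by (rule invariant_metric[OF t])
  interpret L: bounded_linear "momentum3 N a" by (rule bounded_linear_momentum3)
  have "momentum3 N a (h t ** ricci3 N a (g t) (h t)) = 0"
    unfolding m.h_ricci3 by (rule m.momentum3_ricci[OF jacobi_if_evolution[OF t ev]])
  then show ?thesis
    using L.has_vector_derivative[OF hq_has_derivative[OF t ev]] by (simp add: L.diff L.scaleR L.neg)
qed

text \<open>The closed formula \<open>scalar_curvature_eq\<close> is differentiated with
  \<open>g' = 2 q\<close>, \<open>h' = - 2 h q h\<close> and Jacobi's formula for
  \<open>det h\<close>; the remaining algebra is \<open>scalar_curvature_variation\<close>.\<close>

lemma scalar3_has_derivative:
  assumes t: "t \<in> I"
  shows "(scalar3 has_real_derivative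
    - 2 * trace (h t ** q t ** h t ** ricci3 N a (g t) (h t)) - 4 * ((h t *v a) \<bullet> momentum3 N a (h t ** q t))) (at t)"
proof -
  interpret m: invariant_metric N a "g t" "h t" by (rule invariant_metric[OF t])
  let ?f = "\<lambda>s. det (h s) * ((trace (N ** g s))\<^sup>2 / 2 - trace (N ** g s ** N ** g s)) - 6 * (a \<bullet> (h s *v a))"
  have eq: "?f s = scalar3 s" if "s \<in> I" for s
  proof -
    interpret ms: invariant_metric N a "g s" "h s" by (rule invariant_metric[OF that])
    show ?thesis by (simp only: ms.scalar_curvature_eq scalar3_def)
  qed
  have d1: "((\<lambda>s. det (h s)) has_real_derivative - 2 * trace (h t ** q t) * det (h t)) (at t)"
  proof -
    have "trace (adj3 (h t) ** (- 2 *\<^sub>R (h t ** q t ** h t))) = - 2 * det (h t) * trace (q t ** h t)"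
      by (simp add: m.adj3_h matrix_mul_assoc m.gh)
    also have "trace (q t ** h t) = trace (h t ** q t)" by (rule trace_mul_sym)
    finally show ?thesis using det_has_derivative[OF h_deriv[OF t]] by (simp add: mult_ac)
  qed
  have Ng: "((\<lambda>s. N ** g s) has_vector_derivative 2 *\<^sub>R (N ** q t)) (at t)"
    using bounded_linear.has_vector_derivative[OF bounded_bilinear.bounded_linear_right[OF bounded_bilinear_matrix_mult] g_deriv[OF t], of N] by simp
  have d2: "((\<lambda>s. trace (N ** g s)) has_real_derivative 2 * trace (N ** q t)) (at t)"
    using trace_has_derivative[OF Ng] by simp
  have d3: "((\<lambda>s. trace (N ** g s ** N ** g s)) has_real_derivative 4 * trace (N ** q t ** N ** g t)) (at t)"
  proof -
    have "trace (N ** g t ** N ** q t) = trace (N ** q t ** N ** g t)"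
      using trace_mul_sym[of "N ** g t" "N ** q t"] by (simp add: matrix_mul_assoc)
    then show ?thesis
      using trace_has_derivative[OF matrix_mult_has_derivative[OF Ng Ng]] by (simp add: matrix_mul_assoc)
  qed
  have d4: "((\<lambda>s. a \<bullet> (h s *v a)) has_real_derivative - 2 * ((h t *v a) \<bullet> (q t *v (h t *v a)))) (at t)"
  proof -
    have "((\<lambda>s. a \<bullet> (h s *v a)) has_real_derivative a \<bullet> ((- 2 *\<^sub>R (h t ** q t ** h t)) *v a)) (at t)"
      unfolding has_real_derivative_iff_has_vector_derivative
      by (intro bounded_linear.has_vector_derivative[OF bounded_linear_inner_right]
          bounded_linear.has_vector_derivative[OF bounded_linear_matrix_vector] h_deriv t)
    moreover have "a \<bullet> (h t *v (q t *v (h t *v a))) = (h t *v a) \<bullet> (q t *v (h t *v a))"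
      by (simp add: inner_matrix_sym[OF m.sym_h])
    ultimately show ?thesis by (simp flip: matrix_vector_mul_assoc)
  qed
  have "(?f has_real_derivative
      - 2 * trace (h t ** q t) * det (h t) * ((trace (N ** g t))\<^sup>2 / 2 - trace (N ** g t ** N ** g t))
      + (2 * (2 * trace (N ** q t)) * trace (N ** g t) / 2 - 4 * trace (N ** q t ** N ** g t)) * det (h t)
      - 6 * (- 2 * ((h t *v a) \<bullet> (q t *v (h t *v a))))) (at t)"
    by (auto intro!: derivative_eq_intros d1 d2 d3 d4)
  moreover have "- 2 * trace (h t ** q t) * det (h t) * ((trace (N ** g t))\<^sup>2 / 2 - trace (N ** g t ** N ** g t))
      + (2 * (2 * trace (N ** q t)) * trace (N ** g t) / 2 - 4 * trace (N ** q t ** N ** g t)) * det (h t)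
      - 6 * (- 2 * ((h t *v a) \<bullet> (q t *v (h t *v a))))
    = - 2 * trace (h t ** q t ** h t ** ricci3 N a (g t) (h t)) - 4 * ((h t *v a) \<bullet> momentum3 N a (h t ** q t))"
    using m.scalar_curvature_variation[OF sym_q[OF t], folded m.h_ricci3]
    by (simp add: matrix_mul_assoc algebra_simps)
  ultimately have "(?f has_real_derivative
      - 2 * trace (h t ** q t ** h t ** ricci3 N a (g t) (h t)) - 4 * ((h t *v a) \<bullet> momentum3 N a (h t ** q t))) (at t)"
    by (simp only:)
  then show ?thesis by (rule has_field_derivative_transform_within_open[OF _ open_I t eq])
qed

lemma k_norm_sq_has_derivative:
  assumes t: "t \<in> I" and ev: "evolution t"
  shows "(k_norm_sq has_real_derivative
    - 2 * expansion t * k_norm_sq t - 2 * trace (h t ** q t ** h t ** ricci3 N a (g t) (h t))) (at t)"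
proof -
  let ?P = "h t ** q t" and ?R = "h t ** ricci3 N a (g t) (h t)"
  have "((\<lambda>s. trace (h s ** q s ** (h s ** q s)) + (\<Sum>K\<in>{1..n-3}. \<psi> K s * \<psi> K s)) has_real_derivative
      trace (?P ** (- expansion t *\<^sub>R ?P - ?R) + (- expansion t *\<^sub>R ?P - ?R) ** ?P)
      + (\<Sum>K\<in>{1..n-3}. \<psi>' K t * \<psi> K t + \<psi>' K t * \<psi> K t)) (at t)"
    by (intro DERIV_add DERIV_sum trace_has_derivative matrix_mult_has_derivative hq_has_derivative assms DERIV_mult \<psi>_deriv)
  moreover have "trace (?P ** (- expansion t *\<^sub>R ?P - ?R) + (- expansion t *\<^sub>R ?P - ?R) ** ?P)
      = - 2 * expansion t * trace (?P ** ?P) - 2 * trace (?P ** ?R)"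
    using trace_mul_sym[of ?R ?P] by (simp only: matrix_additive matrix_scaleR)
  moreover have "(\<Sum>K\<in>{1..n-3}. \<psi>' K t * \<psi> K t + \<psi>' K t * \<psi> K t) = - 2 * expansion t * (\<Sum>K\<in>{1..n-3}. (\<psi> K t)\<^sup>2)"
    using ev by (simp add: evolution_def sum_distrib_left power2_eq_square mult_ac)
  ultimately have "((\<lambda>s. trace (h s ** q s ** (h s ** q s)) + (\<Sum>K\<in>{1..n-3}. \<psi> K s * \<psi> K s)) has_real_derivative
      - 2 * expansion t * trace (?P ** ?P) - 2 * trace (?P ** ?R) + - 2 * expansion t * (\<Sum>K\<in>{1..n-3}. (\<psi> K t)\<^sup>2)) (at t)"
    by (simp only:)
  moreover have "(\<lambda>s. trace (h s ** q s ** (h s ** q s)) + (\<Sum>K\<in>{1..n-3}. \<psi> K s * \<psi> K s)) = k_norm_sq"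
    by (simp add: fun_eq_iff k_norm_sq_def matrix_mul_assoc power2_eq_square)
  moreover have "- 2 * expansion t * trace (?P ** ?P) - 2 * trace (?P ** ?R) + - 2 * expansion t * (\<Sum>K\<in>{1..n-3}. (\<psi> K t)\<^sup>2)
      = - 2 * expansion t * k_norm_sq t - 2 * trace (h t ** q t ** h t ** ricci3 N a (g t) (h t))"
    by (simp add: k_norm_sq_def matrix_mul_assoc distrib_left)
  ultimately show ?thesis by (simp only:)
qed

text \<open>Once the momentum vanishes, the curvature terms in the derivatives of
  \<open>scalar3\<close> and \<open>k_norm_sq\<close> cancel, and the Hamiltonian defect satisfies
  \<open>H' = - 2 S H\<close> with \<open>S = expansion\<close>. Both constraints therefore persist
  by \<open>linear_ode_zero\<close>.\<close>

lemma constraints_propagate: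
  assumes sub: "{t1..t2} \<subseteq> I" and ev: "\<And>t. t \<in> {t1..t2} \<Longrightarrow> evolution t"
    and c1: "constraints t1" and t: "t \<in> {t1..t2}"
  shows "constraints t"
proof -
  have "continuous_on {t1..t2} expansion"
    using expansion_has_derivative ev sub
    by (intro continuous_at_imp_continuous_on ballI DERIV_isCont) blast
  then have "bounded (expansion ` {t1..t2})" by (intro compact_imp_bounded compact_continuous_image) auto
  then obtain M where "\<forall>x\<in>expansion ` {t1..t2}. norm x \<le> M" unfolding bounded_iff by blast
  then have M: "\<bar>expansion t\<bar> \<le> M" if "t \<in> {t1..t2}" for t using that by auto
  have mom: "momentum3 N a (h s ** q s) = 0" if s: "s \<in> {t1..t2}" for s
  proof (rule linear_ode_zero[of t1 t2 _ "\<lambda>s. - expansion s *\<^sub>R momentum3 N a (h s ** q s)" M])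
    fix u assume u: "u \<in> {t1..t2}"
    show "((\<lambda>s. momentum3 N a (h s ** q s)) has_vector_derivative - expansion u *\<^sub>R momentum3 N a (h u ** q u)) (at u within {t1..t2})"
      by (rule has_vector_derivative_at_within[OF momentum_has_derivative]) (use u sub ev in auto)
    show "norm (- expansion u *\<^sub>R momentum3 N a (h u ** q u)) \<le> M * norm (momentum3 N a (h u ** q u))"
      using M[OF u] by (simp add: mult_right_mono)
  qed (use c1 s in \<open>auto simp: constraints_def\<close>)
  let ?H = "\<lambda>s. scalar3 s + (expansion s)\<^sup>2 - k_norm_sq s"
  have "?H t = 0"
  proof (rule linear_ode_zero[of t1 t2 ?H "\<lambda>s. - 2 * expansion s * ?H s" "2 * M"])
    fix u assume u: "u \<in> {t1..t2}"
    then have uI: "u \<in> I" using sub by auto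
    have "(?H has_real_derivative - 2 * expansion u * ?H u) (at u)"
      by (auto intro!: derivative_eq_intros scalar3_has_derivative[OF uI] expansion_has_derivative[OF uI ev[OF u]]
          k_norm_sq_has_derivative[OF uI ev[OF u]] simp: mom[OF u] power2_eq_square algebra_simps)
    then show "(?H has_vector_derivative - 2 * expansion u * ?H u) (at u within {t1..t2})"
      unfolding has_real_derivative_iff_has_vector_derivative by (rule has_vector_derivative_at_within)
    show "norm (- 2 * expansion u * ?H u) \<le> 2 * M * norm (?H u)"
      using M[OF u] by (simp add: abs_mult mult_right_mono)
  qed (use c1 t in \<open>auto simp: constraints_def\<close>)
  then show ?thesis using mom[OF t] by (simp add: constraints_def)
qed

lemma scalar3_nonpos:
  assumes t: "t \<in> I" and ev: "evolution t" and IX: "\<not> bianchi_IX c"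
  shows "scalar3 t \<le> 0"
proof -
  interpret m: invariant_metric N a "g t" "h t" by (rule invariant_metric[OF t])
  show ?thesis unfolding scalar3_def
    by (rule m.scalar_curvature_nonpos[OF c_skew refl refl pos[OF t] jacobi_if_evolution[OF t ev] IX])
qed

lemma pos_def_h: "t \<in> I \<Longrightarrow> pos_def (h t)"
  using pos_def_inverse[OF pos gh(1) sym_h] by blast

lemma trace_sq_nonneg: "t \<in> I \<Longrightarrow> 0 \<le> trace (h t ** q t ** h t ** q t)"
  using trace_sq_weighted[where x = 0 and y = 0 and v = 0, OF pos_def_h gh _ sym_q] pos by (simp add: pos_def_def)

end

section \<open>Monotonicity and positivity of the expansion\<close>

lemma antiderivative_open_interval:
  fixes f :: "real \<Rightarrow> real"
  assumes I: "open I" "is_interval I" and f: "continuous_on I f"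
  obtains F where "\<And>t. t \<in> I \<Longrightarrow> (F has_real_derivative f t) (at t)"
proof (cases "I = {}")
  case False
  then obtain t0 where t0: "t0 \<in> I" by blast
  define F where "F t = (if t0 \<le> t then integral {t0..t} f else - integral {t..t0} f)" for t
  have "(F has_real_derivative f t) (at t)" if t: "t \<in> I" for t
  proof -
    obtain e0 e1 where e: "e0 > 0" "ball t0 e0 \<subseteq> I" "e1 > 0" "ball t e1 \<subseteq> I"
      using I(1) t0 t openE by metis
    \<comment> \<open>A compact interval in \<open>I\<close> with \<open>t0\<close> and
      \<open>t\<close> in its interior; on it \<open>F\<close> differs from the integral starting at
      \<open>c\<close> by a constant.\<close>
    define c d where "c = min (t0 - e0 / 2) (t - e1 / 2)" and "d = max (t0 + e0 / 2) (t + e1 / 2)"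
    have cd: "c < t0" "c < t" "t0 < d" "t < d" using e by (auto simp: c_def d_def)
    have "t0 - e0 / 2 \<in> I" "t - e1 / 2 \<in> I" "t0 + e0 / 2 \<in> I" "t + e1 / 2 \<in> I"
      using e by (auto simp: subset_iff dist_real_def)
    then have "c \<in> I" "d \<in> I" by (auto simp: c_def d_def min_def max_def)
    then have sub: "{c..d} \<subseteq> I" using interval_Icc_subset[OF I(2)] by blast
    have fc: "continuous_on {c..d} f" using f sub continuous_on_subset by blast
    have int: "f integrable_on {u..v}" if "c \<le> u" "v \<le> d" for u v
      by (rule integrable_continuous_interval[OF continuous_on_subset[OF fc]]) (use that in auto)
    have F: "F u = integral {c..u} f - integral {c..t0} f" if u: "u \<in> {c<..<d}" for u
    proof (cases "t0 \<le> u")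
      case True
      then have "integral {c..t0} f + integral {t0..u} f = integral {c..u} f"
        using u cd by (intro Henstock_Kurzweil_Integration.integral_combine int) auto
      then show ?thesis using True by (simp add: F_def)
    next
      case False
      then have "integral {c..u} f + integral {u..t0} f = integral {c..t0} f"
        using u cd by (intro Henstock_Kurzweil_Integration.integral_combine int) auto
      then show ?thesis using False by (simp add: F_def)
    qed
    have "((\<lambda>u. integral {c..u} f) has_real_derivative f t) (at t within {c..d})"
      by (rule integral_has_real_derivative[OF fc]) (use cd in auto)
    then have "((\<lambda>u. integral {c..u} f) has_real_derivative f t) (at t)"
      using cd at_within_interior[of t "{c..d}"] by auto
    then have "((\<lambda>u. integral {c..u} f - integral {c..t0} f) has_real_derivative f t - 0) (at t)"
      by (intro derivative_intros)
    then have "((\<lambda>u. integral {c..u} f - integral {c..t0} f) has_real_derivative f t) (at t)" by simp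
    then show ?thesis
      by (rule has_field_derivative_transform_within_open[of _ _ _ "{c<..<d}"]) (use cd F in auto)
  qed
  then show thesis using that by blast
qed (use that in auto)

locale vacuum_metric = homogeneous_metric +
  assumes interval_I: "is_interval I" and evolution: "\<And>t. t \<in> I \<Longrightarrow> evolution t"
    and constraints: "\<And>t. t \<in> I \<Longrightarrow> constraints t" and not_IX: "\<not> bianchi_IX c"
begin

lemma k_norm_sq_le: "t \<in> I \<Longrightarrow> k_norm_sq t \<le> (expansion t)\<^sup>2"
  using constraints scalar3_nonpos[OF _ evolution not_IX] by (fastforce simp: constraints_def)

lemma k_norm_sq_nonneg: "t \<in> I \<Longrightarrow> 0 \<le> k_norm_sq t"
  using trace_sq_nonneg by (auto simp: k_norm_sq_def intro!: add_nonneg_nonneg sum_nonneg)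

lemma expansion_deriv: "t \<in> I \<Longrightarrow> (expansion has_real_derivative - k_norm_sq t) (at t)"
  using expansion_has_derivative[OF _ evolution] constraints
  by (metis constraints_def add.commute minus_add_distrib uminus_add_conv_diff diff_conv_add_uminus)

lemma expansion_antimono: "s \<in> I \<Longrightarrow> t \<in> I \<Longrightarrow> s \<le> t \<Longrightarrow> expansion t \<le> expansion s"
  by (rule antimono_if_deriv_nonpos[OF interval_I has_field_derivative_at_within[OF expansion_deriv]])
    (auto intro: k_norm_sq_nonneg)

lemma expansion_continuous: "continuous_on I expansion"
  using expansion_deriv by (intro continuous_at_imp_continuous_on ballI DERIV_isCont) blast

text \<open>The bound \<open>S' \<ge> - S^2\<close> in integrated form. As \<open>S exp F\<close> is
  the derivative of \<open>exp F\<close>, it makes \<open>exp F\<close> convex; this gives both the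
  positivity of \<open>S\<close> and the linear growth of \<open>exp F\<close> that bounds the time
  along geodesics.\<close>

lemma expansion_lower_bound:
  assumes F: "\<And>t. t \<in> I \<Longrightarrow> (F has_real_derivative expansion t) (at t)" and st: "s \<in> I" "t \<in> I" "s \<le> t"
  shows "expansion s * exp (F s) \<le> expansion t * exp (F t)"
proof (rule mono_if_deriv_nonneg[OF interval_I _ _ st])
  fix u assume u: "u \<in> I"
  show "((\<lambda>t. expansion t * exp (F t)) has_real_derivative ((expansion u)\<^sup>2 - k_norm_sq u) * exp (F u)) (at u within I)"
    by (rule has_field_derivative_at_within)
      (auto intro!: derivative_eq_intros expansion_deriv[OF u] F[OF u] simp: power2_eq_square algebra_simps)
  show "0 \<le> ((expansion u)\<^sup>2 - k_norm_sq u) * exp (F u)" using k_norm_sq_le[OF u] by simp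
qed

text \<open>Towards the past \<open>S\<close> does not decrease; towards the future
  \<open>S exp F\<close> does not, and so cannot reach zero.\<close>

lemma expansion_pos:
  assumes t0: "t0 \<in> I" "expansion t0 > 0" and t: "t \<in> I"
  shows "expansion t > 0"
proof (cases "t \<le> t0")
  case True
  then show ?thesis using expansion_antimono[OF t t0(1)] t0(2) by simp
next
  case False
  obtain F where "\<And>t. t \<in> I \<Longrightarrow> (F has_real_derivative expansion t) (at t)"
    using antiderivative_open_interval[OF open_I interval_I expansion_continuous] by blast
  then have "expansion t0 * exp (F t0) \<le> expansion t * exp (F t)"
    using expansion_lower_bound[of F t0 t] t0 t False by auto
  moreover have "expansion t0 * exp (F t0) > 0" using t0 by simp
  ultimately have "expansion t * exp (F t) > 0" by linarith
  then show ?thesis by (simp add: zero_less_mult_iff)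
qed

text \<open>The operator norm of \<open>q\<close> with respect to \<open>g\<close> is at most
  \<open>|k|\<close>, which is at most \<open>S\<close>.\<close>

lemma quadratic_form_q_le:
  assumes t: "t \<in> I" and S: "expansion t \<ge> 0"
  shows "\<bar>v \<bullet> (q t *v v)\<bar> \<le> expansion t * (v \<bullet> (g t *v v))"
proof -
  have g: "pos_def (g t)" "transpose (g t) = g t" using pos[OF t] by (auto simp: pos_def_def)
  have p: "v \<bullet> (g t *v v) \<ge> 0" using g(1) by (cases "v = 0") (auto simp: pos_def_def less_imp_le)
  have "(v \<bullet> (q t *v v))\<^sup>2 \<le> trace (h t ** q t ** h t ** q t) * (v \<bullet> (g t *v v))\<^sup>2"
    by (rule quadratic_form_le_trace_sq[OF pos_def_h[OF t] gh[OF t] g(2) sym_q[OF t]])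
  also have "\<dots> \<le> (expansion t)\<^sup>2 * (v \<bullet> (g t *v v))\<^sup>2"
    using k_norm_sq_le[OF t] sum_nonneg[of "{1..n-3}" "\<lambda>K. (\<psi> K t)\<^sup>2"]
    by (intro mult_right_mono) (auto simp: k_norm_sq_def)
  finally have "\<bar>v \<bullet> (q t *v v)\<bar> \<le> \<bar>expansion t * (v \<bullet> (g t *v v))\<bar>"
    by (simp add: abs_le_square_iff power_mult_distrib)
  then show ?thesis using S p by simp
qed

end

section \<open>Smooth vacuum solutions as instances of the abstract setting\<close>

lemmas smooth_on_matrix_mult = smooth_on_bilinear[OF bounded_bilinear_matrix_mult]
lemmas smooth_on_trace = smooth_on_bounded_linear[OF bounded_linear_trace]
lemmas smooth_on_transpose = smooth_on_bounded_linear[OF bounded_linear_transpose]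
lemmas smooth_on_scaleR_const = smooth_on_bounded_linear[OF bounded_linear_scaleR_right]

lemma smooth_on_adj3:
  assumes "open S" "smooth_on S G" shows "smooth_on S (\<lambda>x. adj3 (G x))"
proof -
  have "smooth_on S (\<lambda>x. G x ** G x - trace (G x) *\<^sub>R G x
      + ((1 / 2) *\<^sub>R (trace (G x) * trace (G x) - trace (G x ** G x))) *\<^sub>R mat 1)"
    by (intro smooth_on_add smooth_on_diff smooth_on_scaleR smooth_on_scaleR_const smooth_on_mult
        smooth_on_matrix_mult smooth_on_trace smooth_on_const assms)
  then show ?thesis by (simp add: adj3_cayley_hamilton power2_eq_square)
qed

lemma smooth_on_det:
  assumes "open S" "smooth_on S G" shows "smooth_on S (\<lambda>x. det (G x :: real^3^3))"
proof -
  \<comment> \<open>The product of \<open>G\<close> and its adjugate is \<open>det G\<close> times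
    the identity, whose trace is three.\<close>
  have "smooth_on S (\<lambda>x. inverse 3 *\<^sub>R trace (G x ** adj3 (G x)))"
    by (intro smooth_on_scaleR_const smooth_on_matrix_mult smooth_on_trace smooth_on_adj3 assms)
  then show ?thesis by (simp add: mult_adj3)
qed

lemma bounded_linear_cross_mat: "bounded_linear cross_mat"
  unfolding linear_conv_bounded_linear[symmetric]
  by (rule linearI) (simp_all add: matrix3_defs)

lemma smooth_on_ricci3:
  assumes "open S" "smooth_on S G" "smooth_on S H"
  shows "smooth_on S (\<lambda>x. ricci3 N a (G x) (H x))"
proof -
  have \<tau>: "smooth_on S (\<lambda>x. brk_tau N (G x))"
    unfolding brk_tau_def divide_inverse
    by (intro smooth_on_mult smooth_on_trace smooth_on_matrix_mult smooth_on_const assms)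
  have \<beta>: "smooth_on S (\<lambda>x. brk_beta N (G x) (H x))"
    unfolding brk_beta_def by (intro smooth_on_diff smooth_on_scaleR \<tau> smooth_on_const assms)
  have s: "smooth_on S (\<lambda>x. H x *v a)"
    by (intro smooth_on_bounded_linear[OF bounded_linear_matrix_vector] assms)
  show ?thesis unfolding ricci3_def
    by (intro smooth_on_add smooth_on_diff smooth_on_scaleR_const smooth_on_scaleR smooth_on_mult smooth_on_adj3
        smooth_on_matrix_mult \<beta> s smooth_on_const assms smooth_on_bounded_linear[OF bounded_linear_inner_right]
        smooth_on_bounded_linear[OF bounded_linear_cross_mat])
qed

text \<open>The commutator is antisymmetric and the frame is linearly independent.\<close>

lemma structure_constants_skew:
  assumes "left_invariant_frame A e" "structure_constants A e c"
  shows "c i j k = - c j i k"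
proof -
  let ?w = "(\<chi> k. c i j k + c j i k) :: real^3"
  have "(\<Sum>k\<in>UNIV. ?w $ k * e k f p) = 0" if f: "smooth_at A f p" for f p
  proof -
    have "e i (e j f) p - e j (e i f) p = (\<Sum>k\<in>UNIV. c i j k * e k f p)"
      "e j (e i f) p - e i (e j f) p = (\<Sum>k\<in>UNIV. c j i k * e k f p)"
      using assms(2) f unfolding structure_constants_def by blast+
    then show ?thesis by (simp add: algebra_simps sum.distrib)
  qed
  then have "?w = 0" using assms(1) unfolding left_invariant_frame_def by blast
  then have "?w $ k = 0" by simp
  then show ?thesis by (simp add: add_eq_0_iff)
qed

definition curve_deriv :: "(real \<Rightarrow> 'b::real_normed_vector) \<Rightarrow> real \<Rightarrow> 'b" where
  "curve_deriv f t = frechet_derivative f (at t) 1"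

lemma smooth_curve_deriv:
  assumes "open S" "smooth_on S f"
  shows "t \<in> S \<Longrightarrow> (f has_vector_derivative curve_deriv f t) (at t)" "smooth_on S (curve_deriv f)"
  using smooth_on_real_derivative[OF assms] by (simp_all add: curve_deriv_def[abs_def])

text \<open>Cramer's rule, from which the smoothness of the inverse can be read off.\<close>

definition matrix_inverse3 :: "real^3^3 \<Rightarrow> real^3^3" where
  "matrix_inverse3 G = inverse (det G) *\<^sub>R adj3 G"

lemma pos_def_det: 
  fixes G :: "real^3^3"
  assumes "pos_def G" shows "det G > 0"
proof -
  obtain L where "G = transpose L ** L" "det L \<noteq> 0" by (rule cholesky3[OF assms])
  then show ?thesis by (simp add: det_mul det_transpose flip: power2_eq_square)
qed

lemma matrix_inverse3:
  fixes G :: "real^3^3"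
  assumes "pos_def G"
  shows "G ** matrix_inverse3 G = mat 1" "matrix_inverse3 G ** G = mat 1"
    "transpose (matrix_inverse3 G) = matrix_inverse3 G"
  using pos_def_det[OF assms] assms
  by (simp_all add: matrix_inverse3_def mult_adj3 transpose_adj3 pos_def_def)

lemma vacuum_solution_imp_vacuum_metric:
  fixes A :: "'g::topological_space chart set"
  assumes A: "smooth_atlas A" "\<And>i. smooth_vector_field A (e i)" and skew: "\<And>i j k. c i j k = - c j i k"
    and vac: "vacuum_solution n e c I g \<phi>" and IX: "\<not> bianchi_IX c"
  defines "q \<equiv> \<lambda>t. (1 / 2) *\<^sub>R curve_deriv g t"
  shows "vacuum_metric n A e c I g (\<lambda>t. matrix_inverse3 (g t)) q (curve_deriv q) \<phi>
    (\<lambda>K. curve_deriv (\<phi> K)) (\<lambda>K. curve_deriv (curve_deriv (\<phi> K)))"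
proof -
  let ?h = "\<lambda>t. matrix_inverse3 (g t)"
  have I: "open I" "is_interval I" and g: "smooth_on I g" and \<phi>: "\<And>K. K \<in> {1..n-3} \<Longrightarrow> smooth_on I (\<phi> K)"
    and pos: "\<And>t. t \<in> I \<Longrightarrow> pos_def (g t)"
    and ric: "\<And>p a b. p \<in> spacetime n I \<Longrightarrow> a \<in> all_idx n \<Longrightarrow> b \<in> all_idx n \<Longrightarrow> ricci n e c (metric_at g \<phi>) a b p = 0"
    using vac by (auto simp: vacuum_solution_def pos_def_def)
  note inv = matrix_inverse3[OF pos]
  have g': "(g has_vector_derivative 2 *\<^sub>R q t) (at t)" if "t \<in> I" for t
    using smooth_curve_deriv(1)[OF I(1) g that] by (simp add: q_def)
  have q: "smooth_on I q"
    unfolding q_def by (intro smooth_on_scaleR_const I smooth_curve_deriv(2) g)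
  have "smooth_on I ?h"
    unfolding matrix_inverse3_def using pos_def_det[OF pos]
    by (intro smooth_on_scaleR smooth_on_inverse smooth_on_det smooth_on_adj3 I g) force
  note h' = smooth_curve_deriv(1)[OF I(1) this]
  \<comment> \<open>The derivative of the inverse results from differentiating
    \<open>h g = 1\<close> and multiplying by \<open>h\<close> from the right.\<close>
  have h'': "(?h has_vector_derivative - 2 *\<^sub>R (?h t ** q t ** ?h t)) (at t)" if t: "t \<in> I" for t
  proof -
    have "((\<lambda>t. ?h t ** g t) has_vector_derivative ?h t ** (2 *\<^sub>R q t) + curve_deriv ?h t ** g t) (at t)"
      by (rule matrix_mult_has_derivative[OF h'[OF t] g'[OF t]])
    moreover have "((\<lambda>t. ?h t ** g t) has_vector_derivative 0) (at t)"
      by (rule has_vector_derivative_transform_within_open[OF has_vector_derivative_const I(1) t]) (simp add: inv)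
    ultimately have "?h t ** (2 *\<^sub>R q t) + curve_deriv ?h t ** g t = 0" by (rule vector_derivative_unique_at)
    then have "(?h t ** (2 *\<^sub>R q t) + curve_deriv ?h t ** g t) ** ?h t = 0" by (simp add: matrix_matrix_mult_def vec_eq_iff)
    then have "curve_deriv ?h t = - 2 *\<^sub>R (?h t ** q t ** ?h t)"
      using inv(1)[OF t] by (simp add: add_eq_0_iff flip: matrix_mul_assoc) 
    then show ?thesis using h'[OF t] by simp
  qed
  have sq: "transpose (q t) = q t" if t: "t \<in> I" for t
  proof -
    have "((\<lambda>t. transpose (g t)) has_vector_derivative transpose (2 *\<^sub>R q t)) (at t)"
      by (rule bounded_linear.has_vector_derivative[OF bounded_linear_transpose g'[OF t]])
    then have "(g has_vector_derivative transpose (2 *\<^sub>R q t)) (at t)"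
      by (rule has_vector_derivative_transform_within_open[OF _ I(1) t]) (use pos in \<open>auto simp: pos_def_def\<close>)
    then have "transpose (2 *\<^sub>R q t) = 2 *\<^sub>R q t" using g'[OF t] by (rule vector_derivative_unique_at)
    then show ?thesis by simp
  qed
  interpret homogeneous_metric n A e c I g ?h q "curve_deriv q" \<phi>
    "\<lambda>K. curve_deriv (\<phi> K)" "\<lambda>K. curve_deriv (curve_deriv (\<phi> K))"
    by (unfold_locales; (rule A skew I(1) pos inv sq g' h'' smooth_curve_deriv(1)[OF I(1) q], assumption?)?)
      (auto simp: has_real_derivative_iff_has_vector_derivative intro!: smooth_curve_deriv[OF I(1)] \<phi>)
  have EC: "evolution t \<and> constraints t" if t: "t \<in> I" for t
  proof -
    \<comment> \<open>Any event at time \<open>t\<close> will do; the zero function satisfies the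
      support condition on the flat coordinates.\<close>
    have "(t, undefined, \<lambda>_. 0) \<in> spacetime n I" using t by (simp add: spacetime_def)
    then show ?thesis using vacuum_iff[OF t, of undefined "\<lambda>_. 0"] ric by blast
  qed
  show ?thesis by unfold_locales (use EC I IX in auto)
qed

lemma (in homogeneous_metric) mean_curvature_eq:
  assumes t: "t \<in> I"
  shows "mean_curvature n g \<phi> t = - expansion t"
proof -
  have sf: "second_fundamental_form g \<phi> t a' b = - koszul_comp c g q \<phi> \<psi> t Time a' b"
    if "a' \<in> spatial_idx n" "b \<in> spatial_idx n" for a' b
    using metric_deriv[OF t, of a' b] that by (auto simp: second_fundamental_form_def all_idx_def)
  have "mean_curvature n g \<phi> t = (\<Sum>a'\<in>spatial_idx n. \<Sum>b\<in>spatial_idx n.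
      metric_comp (\<lambda>_. h t) (\<lambda>K t. - \<phi> K t) t a' b * - koszul_comp c g q \<phi> \<psi> t Time a' b)"
    unfolding mean_curvature_def
    by (intro sum.cong refl) (simp add: sf inverse_metric_comp(2)[of g t "h t", OF gh[OF t]])
  also have "\<dots> = - ((\<Sum>i\<in>UNIV. \<Sum>j\<in>UNIV. h t $ i $ j * q t $ i $ j) + (\<Sum>K\<in>{1..n-3}. \<psi> K t))"
  proof -
    have "(\<Sum>K\<in>{1..n-3}. exp (- (2 * \<phi> K t)) * (\<psi> K t * exp (2 * \<phi> K t))) = (\<Sum>K\<in>{1..n-3}. \<psi> K t)"
      by (intro sum.cong refl) (simp add: exp_minus)
    then show ?thesis unfolding sum_spatial_idx
      by (simp add: sum_negf if_distrib[of "\<lambda>x. x * _"] if_distrib[of "\<lambda>x. _ * x"] if_distrib[of uminus] cong: if_cong)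
  qed
  also have "(\<Sum>i\<in>UNIV. \<Sum>j\<in>UNIV. h t $ i $ j * q t $ i $ j) = trace (h t ** q t)"
    using symmetricD[OF sym_q[OF t]] by (simp add: trace_def matrix_mult_nth)
  finally show ?thesis by (simp add: expansion_def)
qed

section \<open>Global existence\<close>

lemma Ck_on_Un: "open S \<Longrightarrow> open T \<Longrightarrow> Ck_on k S f \<Longrightarrow> Ck_on k T f \<Longrightarrow> Ck_on k (S \<union> T) f"
  by (induction k arbitrary: f) (auto intro: continuous_on_open_Un)

lemma smooth_on_Un: "open S \<Longrightarrow> open T \<Longrightarrow> smooth_on S f \<Longrightarrow> smooth_on T f \<Longrightarrow> smooth_on (S \<union> T) f"
  unfolding smooth_on_def using Ck_on_Un by blast

text \<open>On \<open>I\<close> the glued function is the old one by definition, so that an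
  extension agrees with the given solution without further argument.\<close>

definition glue :: "real set \<Rightarrow> (real \<Rightarrow> 'b) \<Rightarrow> (real \<Rightarrow> 'b) \<Rightarrow> real \<Rightarrow> 'b" where
  "glue I f1 f2 t = (if t \<in> I then f1 t else f2 t)"

lemma glue_has_derivative:
  assumes "open I" "open J" and eq: "\<And>t. t \<in> I \<Longrightarrow> t \<in> J \<Longrightarrow> f1 t = f2 t"
    and d: "\<And>t. t \<in> I \<Longrightarrow> (f1 has_vector_derivative d1 t) (at t)" "\<And>t. t \<in> J \<Longrightarrow> (f2 has_vector_derivative d2 t) (at t)"
    and t: "t \<in> I \<union> J"
  shows "(glue I f1 f2 has_vector_derivative glue I d1 d2 t) (at t)"
proof (cases "t \<in> I")
  case True
  have "(glue I f1 f2 has_vector_derivative d1 t) (at t)"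
    by (rule has_vector_derivative_transform_within_open[OF d(1)[OF True] assms(1) True]) (simp add: glue_def)
  then show ?thesis using True by (simp add: glue_def)
next
  case False
  then have J: "t \<in> J" using t by simp
  have "(glue I f1 f2 has_vector_derivative d2 t) (at t)"
    by (rule has_vector_derivative_transform_within_open[OF d(2)[OF J] assms(2) J]) (simp add: glue_def eq)
  then show ?thesis using False by (simp add: glue_def)
qed

lemma glue_smooth:
  assumes "open I" "open J" and eq: "\<And>t. t \<in> I \<Longrightarrow> t \<in> J \<Longrightarrow> f1 t = f2 t"
    and "smooth_on I f1" "smooth_on J f2"
  shows "smooth_on (I \<union> J) (glue I f1 f2)"
proof (rule smooth_on_Un[OF assms(1,2)])
  show "smooth_on I (glue I f1 f2)" by (rule smooth_on_cong[OF assms(1) _ assms(4)]) (simp add: glue_def)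
  show "smooth_on J (glue I f1 f2)" by (rule smooth_on_cong[OF assms(2) _ assms(5)]) (simp add: glue_def eq)
qed

text \<open>The constant is the minimum of the form on the unit sphere.\<close>

lemma pos_def_lower_bound:
  fixes G :: "real^3^3"
  assumes "pos_def G"
  obtains m where "m > 0" "\<And>x. m * (x \<bullet> x) \<le> x \<bullet> (G *v x)"
proof -
  let ?f = "\<lambda>x :: real^3. x \<bullet> (G *v x)"
  have "continuous_on (sphere 0 1) ?f"
    by (intro continuous_intros matrix_vector_mult_linear_continuous_on)
  moreover have "(axis 1 1 :: real^3) \<in> sphere 0 1" by (simp add: norm_axis_1)
  ultimately obtain u where u: "u \<in> sphere 0 1" "\<And>x. x \<in> sphere 0 1 \<Longrightarrow> ?f u \<le> ?f x"
    using continuous_attains_inf[of "sphere 0 1" ?f] by (metis compact_sphere empty_iff)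
  have "u \<noteq> 0" using u(1) by auto
  then have "?f u > 0" using assms by (simp add: pos_def_def)
  moreover have "?f u * (x \<bullet> x) \<le> ?f x" for x
  proof (cases "x = 0")
    case False
    let ?n = "norm x"
    have "?f u \<le> ?f (x /\<^sub>R ?n)" by (rule u(2)) (use False in simp)
    also have "\<dots> = ?f x / ?n\<^sup>2" by (simp add: power2_eq_square field_simps)
    finally show ?thesis using False by (simp add: field_simps dot_square_norm)
  qed simp
  ultimately show thesis using that by blast
qed

lemma quadratic_form_bound: "\<bar>x \<bullet> (G *v x)\<bar> \<le> onorm ((*v) G) * (x \<bullet> x)" for G :: "real^3^3"
proof -
  have "\<bar>x \<bullet> (G *v x)\<bar> \<le> norm x * norm (G *v x)" by (rule Cauchy_Schwarz_ineq2)
  also have "\<dots> \<le> norm x * (onorm ((*v) G) * norm x)"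
    by (intro mult_left_mono onorm) auto
  finally show ?thesis by (simp add: dot_square_norm power2_eq_square mult_ac)
qed

text \<open>Polarisation bounds every entry by \<open>2 * M\<close>; three entries per row and three
  rows give the factor 18.\<close>

lemma norm_le_if_quadratic_form_bound:
  fixes G :: "real^3^3"
  assumes sym: "transpose G = G" and b: "\<And>x. \<bar>x \<bullet> (G *v x)\<bar> \<le> M * (x \<bullet> x)"
  shows "norm G \<le> 18 * M"
proof -
  have M: "M \<ge> 0" using b[of "axis 1 1"] by (simp add: inner_axis)
  have col: "(G *v axis j 1) $ i = G $ i $ j" for i j by (simp add: matrix_vector_mult_basis column_def)
  have d: "\<bar>G $ i $ i\<bar> \<le> M" for i using b[of "axis i 1"] by (simp add: inner_axis' inner_axis col)
  have "\<bar>G $ i $ j\<bar> \<le> 2 * M" for i j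
  proof (cases "i = j")
    case True then show ?thesis using d[of i] M by simp
  next
    case False
    let ?x = "axis i 1 + axis j 1 :: real^3"
    have "?x \<bullet> (G *v ?x) = G $ i $ i + G $ j $ j + 2 * G $ i $ j"
      using symmetricD[OF sym, of i j] by (simp add: inner_add_left inner_axis' col)
    moreover have "?x \<bullet> ?x = 2" using False by (simp add: inner_add_left inner_add_right inner_axis_axis)
    ultimately have "\<bar>G $ i $ i + G $ j $ j + 2 * G $ i $ j\<bar> \<le> M * 2" using b[of ?x] by (simp only:)
    then show ?thesis using d[of i] d[of j] by linarith
  qed
  then have "norm (G $ i) \<le> 3 * (2 * M)" for i
    using order_trans[OF norm_le_l1_cart[of "G $ i"] sum_bounded_above[of UNIV "\<lambda>j. \<bar>G $ i $ j\<bar>" "2 * M"]] by simp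
  then show ?thesis
    using order_trans[OF L2_set_le_sum[of UNIV "\<lambda>i. norm (G $ i)"] sum_bounded_above[of UNIV "\<lambda>i. norm (G $ i)" "3 * (2 * M)"]]
    by (simp add: norm_vec_def)
qed

text \<open>Symmetrising the equation for \<open>q\<close> keeps \<open>q\<close> symmetric before
  it is known that \<open>h\<close> remains the inverse of \<open>g\<close>. Along actual solutions
  it changes nothing.\<close>

definition symm :: "real^3^3 \<Rightarrow> real^3^3" where
  "symm Q = (1 / 2) *\<^sub>R (Q + transpose Q)"

lemma symm_eq: "transpose Q = Q \<Longrightarrow> symm Q = Q"
  by (simp add: symm_def flip: scaleR_2)

lemma transpose_symm: "transpose (symm Q) = symm Q"
  by (simp add: symm_def add.commute)

text \<open>The components of a state are \<open>g\<close>, \<open>h = g\<^sup>-\<^sup>1\<close>, \<open>q = g'/2\<close>, a function \<open>w\<close> with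
  \<open>\<phi>\<^sub>K' = \<psi>\<^sub>K(t\<^sub>0) w\<close> for all \<open>K\<close>, and an antiderivative of \<open>w\<close>. Including \<open>h\<close> makes the vector
  field polynomial.\<close>

definition vacuum_field :: "real^3^3 \<Rightarrow> real^3 \<Rightarrow> real \<Rightarrow>
  (real^3^3) \<times> (real^3^3) \<times> (real^3^3) \<times> real \<times> real \<Rightarrow> (real^3^3) \<times> (real^3^3) \<times> (real^3^3) \<times> real \<times> real" where
  "vacuum_field N a C = (\<lambda>(g, h, q, w, \<sigma>). (2 *\<^sub>R q, - 2 *\<^sub>R (h ** q ** h),
     symm (2 *\<^sub>R (q ** h ** q) - (trace (h ** q) + C * w) *\<^sub>R q - ricci3 N a g h),
     - (trace (h ** q) + C * w) * w, w))"

lemma smooth_vacuum_field: "smooth_on UNIV (vacuum_field N a C)"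
  unfolding vacuum_field_def case_prod_beta symm_def
  by (intro smooth_on_Pair smooth_on_scaleR_const smooth_on_scaleR smooth_on_minus smooth_on_add smooth_on_diff
      smooth_on_mult smooth_on_matrix_mult smooth_on_trace smooth_on_transpose smooth_on_ricci3
      smooth_on_fst smooth_on_snd smooth_on_ident smooth_on_const open_UNIV)

context vacuum_metric
begin

text \<open>For \<open>t \<ge> t0\<close> one has \<open>|g'(x, x)| \<le> 2 S(t0) g(x, x)\<close>,
  by \<open>quadratic_form_q_le\<close> and the monotonicity of \<open>S\<close>. Hence
  \<open>g(x, x)\<close> changes at most by the factor
  \<open>exp (2 S(t0) (b - t0))\<close>.\<close>

lemma metric_bounds:
  assumes t0: "t0 \<in> I" and b: "\<And>t. t \<in> I \<Longrightarrow> t < b" and S0: "expansion t0 > 0"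
  obtains m M where "m > 0" "\<And>t x. t \<in> I \<Longrightarrow> t0 \<le> t \<Longrightarrow> m * (x \<bullet> x) \<le> x \<bullet> (g t *v x)"
    "\<And>t x. t \<in> I \<Longrightarrow> t0 \<le> t \<Longrightarrow> x \<bullet> (g t *v x) \<le> M * (x \<bullet> x)"
proof -
  obtain m0 where m0: "m0 > 0" "\<And>x. m0 * (x \<bullet> x) \<le> x \<bullet> (g t0 *v x)"
    using pos_def_lower_bound[OF pos[OF t0]] by blast
  let ?M0 = "onorm ((*v) (g t0))" and ?s = "expansion t0"
  let ?J = "I \<inter> {t0..}"
  have J: "is_interval ?J" using interval_I by (auto simp: is_interval_1)
  have d: "((\<lambda>t. x \<bullet> (g t *v x)) has_real_derivative 2 * (x \<bullet> (q t *v x))) (at t within ?J)" if "t \<in> ?J" for t x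
  proof -
    have "((\<lambda>t. x \<bullet> (g t *v x)) has_vector_derivative x \<bullet> ((2 *\<^sub>R q t) *v x)) (at t within ?J)"
      using that by (intro bounded_linear.has_vector_derivative[OF bounded_linear_inner_right]
          bounded_linear.has_vector_derivative[OF bounded_linear_matrix_vector]
          has_vector_derivative_at_within[OF g_deriv]) auto
    then show ?thesis by (simp add: has_real_derivative_iff_has_vector_derivative)
  qed
  have g0: "x \<bullet> (g t *v x) \<ge> 0" if "t \<in> I" for t x
    using pos[OF that] by (cases "x = 0") (auto simp: pos_def_def less_imp_le)
  have le: "\<bar>x \<bullet> (q t *v x)\<bar> \<le> ?s * (x \<bullet> (g t *v x))" if "t \<in> ?J" for t x
  proof -
    have t: "t \<in> I" "expansion t > 0" "expansion t \<le> ?s"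
      using that expansion_pos[OF t0 S0] expansion_antimono[OF t0] by auto
    have "\<bar>x \<bullet> (q t *v x)\<bar> \<le> expansion t * (x \<bullet> (g t *v x))" using quadratic_form_q_le t by simp
    also have "\<dots> \<le> ?s * (x \<bullet> (g t *v x))" by (intro mult_right_mono t g0)
    finally show ?thesis .
  qed
  have up: "x \<bullet> (g t *v x) * exp (- 2 * ?s * t) \<le> x \<bullet> (g t0 *v x) * exp (- 2 * ?s * t0)"
    and lo: "x \<bullet> (g t0 *v x) * exp (2 * ?s * t0) \<le> x \<bullet> (g t *v x) * exp (2 * ?s * t)" if t: "t \<in> ?J" for t x
  proof -
    show "x \<bullet> (g t *v x) * exp (- 2 * ?s * t) \<le> x \<bullet> (g t0 *v x) * exp (- 2 * ?s * t0)"
    proof (rule antimono_if_deriv_nonpos[OF J, of "\<lambda>t. x \<bullet> (g t *v x) * exp (- 2 * ?s * t)"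
        "\<lambda>u. 2 * (x \<bullet> (q u *v x) - ?s * (x \<bullet> (g u *v x))) * exp (- 2 * ?s * u)"])
      fix u assume u: "u \<in> ?J"
      show "((\<lambda>t. x \<bullet> (g t *v x) * exp (- 2 * ?s * t)) has_real_derivative
        2 * (x \<bullet> (q u *v x) - ?s * (x \<bullet> (g u *v x))) * exp (- 2 * ?s * u)) (at u within ?J)"
        by (auto intro!: derivative_eq_intros d[OF u] simp: algebra_simps)
      show "2 * (x \<bullet> (q u *v x) - ?s * (x \<bullet> (g u *v x))) * exp (- 2 * ?s * u) \<le> 0"
      proof (rule mult_nonpos_nonneg)
        show "2 * (x \<bullet> (q u *v x) - ?s * (x \<bullet> (g u *v x))) \<le> 0" using le[OF u, of x] by (simp add: abs_le_iff)
      qed simp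
    qed (use t t0 in auto)
    show "x \<bullet> (g t0 *v x) * exp (2 * ?s * t0) \<le> x \<bullet> (g t *v x) * exp (2 * ?s * t)"
    proof (rule mono_if_deriv_nonneg[OF J, of "\<lambda>t. x \<bullet> (g t *v x) * exp (2 * ?s * t)"
        "\<lambda>u. 2 * (x \<bullet> (q u *v x) + ?s * (x \<bullet> (g u *v x))) * exp (2 * ?s * u)"])
      fix u assume u: "u \<in> ?J"
      show "((\<lambda>t. x \<bullet> (g t *v x) * exp (2 * ?s * t)) has_real_derivative
        2 * (x \<bullet> (q u *v x) + ?s * (x \<bullet> (g u *v x))) * exp (2 * ?s * u)) (at u within ?J)"
        by (auto intro!: derivative_eq_intros d[OF u] simp: algebra_simps)
      show "0 \<le> 2 * (x \<bullet> (q u *v x) + ?s * (x \<bullet> (g u *v x))) * exp (2 * ?s * u)"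
        using le[OF u, of x] by (intro mult_nonneg_nonneg) auto
    qed (use t t0 in auto)
  qed
  let ?E = "exp (2 * ?s * (b - t0))"
  have E: "exp (2 * ?s * (t - t0)) \<le> ?E" if "t \<in> ?J" for t
    using b[of t] that S0 by simp
  show thesis
  proof
    show "m0 / ?E > 0" using m0 by simp
    fix t x assume "t \<in> I" "t0 \<le> t"
    then have t: "t \<in> ?J" by simp
    have "m0 * (x \<bullet> x) \<le> x \<bullet> (g t0 *v x)" by (rule m0)
    also have "\<dots> \<le> x \<bullet> (g t *v x) * exp (2 * ?s * (t - t0))"
      using lo[OF t, of x] by (simp add: right_diff_distrib exp_diff field_simps)
    also have "\<dots> \<le> x \<bullet> (g t *v x) * ?E" using t by (intro mult_left_mono E g0) auto
    finally show "m0 / ?E * (x \<bullet> x) \<le> x \<bullet> (g t *v x)" by (simp add: field_simps)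
    have "x \<bullet> (g t *v x) \<le> x \<bullet> (g t0 *v x) * exp (2 * ?s * (t - t0))"
      using up[OF t, of x] by (simp add: right_diff_distrib exp_diff exp_minus field_simps)
    also have "\<dots> \<le> x \<bullet> (g t0 *v x) * ?E" using t t0 by (intro mult_left_mono E g0) auto
    also have "\<dots> \<le> (?M0 * (x \<bullet> x)) * ?E" using quadratic_form_bound[of x "g t0"] by (intro mult_right_mono) auto
    finally show "x \<bullet> (g t *v x) \<le> (?M0 * ?E) * (x \<bullet> x)" by (simp add: mult_ac)
  qed
qed

lemma metric_bounded:
  assumes t0: "t0 \<in> I" and b: "\<And>t. t \<in> I \<Longrightarrow> t < b" and S0: "expansion t0 > 0"
  obtains R m where "m > 0" "\<And>t. t \<in> I \<Longrightarrow> t0 \<le> t \<Longrightarrow> norm (g t) \<le> R \<and> norm (h t) \<le> R \<and> norm (q t) \<le> R"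
    "\<And>t x. t \<in> I \<Longrightarrow> t0 \<le> t \<Longrightarrow> m * (x \<bullet> x) \<le> x \<bullet> (g t *v x)"
proof -
  obtain m M where m: "m > 0" "\<And>t x. t \<in> I \<Longrightarrow> t0 \<le> t \<Longrightarrow> m * (x \<bullet> x) \<le> x \<bullet> (g t *v x)"
    and M: "\<And>t x. t \<in> I \<Longrightarrow> t0 \<le> t \<Longrightarrow> x \<bullet> (g t *v x) \<le> M * (x \<bullet> x)"
    using metric_bounds[OF assms] by metis
  \<comment> \<open>As quadratic forms \<open>g\<close>, \<open>h\<close> and \<open>q\<close> are
    bounded by \<open>M\<close>, \<open>1 / m\<close> and \<open>S(t0) M\<close>; the factor 18
    comes from \<open>norm_le_if_quadratic_form_bound\<close>.\<close>
  define R where "R = Max {18 * M, 18 * (1 / m), 18 * (expansion t0 * M)}"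
  have R: "18 * M \<le> R" "18 * (1 / m) \<le> R" "18 * (expansion t0 * M) \<le> R" by (simp_all add: R_def)
  have "norm (g t) \<le> R \<and> norm (h t) \<le> R \<and> norm (q t) \<le> R" if t: "t \<in> I" "t0 \<le> t" for t
  proof (intro conjI)
    have sg: "transpose (g t) = g t" using pos[OF t(1)] by (simp add: pos_def_def)
    have gp: "0 \<le> x \<bullet> (g t *v x)" for x using m(2)[OF t, of x] m(1) by (meson inner_ge_zero less_imp_le mult_nonneg_nonneg order_trans)
    show "norm (g t) \<le> R"
      using norm_le_if_quadratic_form_bound[OF sg, of M] gp M[OF t] R(1) by simp
    have S: "expansion t > 0" "expansion t \<le> expansion t0"
      using t expansion_pos[OF t0 S0] expansion_antimono[OF t0] by auto
    have "\<bar>x \<bullet> (q t *v x)\<bar> \<le> (expansion t0 * M) * (x \<bullet> x)" for x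
    proof -
      have "\<bar>x \<bullet> (q t *v x)\<bar> \<le> expansion t * (x \<bullet> (g t *v x))" using quadratic_form_q_le[OF t(1)] S by simp
      also have "\<dots> \<le> expansion t0 * (M * (x \<bullet> x))" using S M[OF t] gp by (intro mult_mono) auto
      finally show ?thesis by simp
    qed
    then show "norm (q t) \<le> R" using norm_le_if_quadratic_form_bound[OF sym_q[OF t(1)]] R(3) by fastforce
    have "\<bar>y \<bullet> (h t *v y)\<bar> \<le> (1 / m) * (y \<bullet> y)" for y
    proof -
      let ?x = "h t *v y"
      have gx: "g t *v ?x = y" by (simp add: matrix_vector_mul_assoc gh(1)[OF t(1)])
      have 1: "m * (norm ?x)\<^sup>2 \<le> ?x \<bullet> y" using m(2)[OF t, of ?x] by (simp add: gx dot_square_norm)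
      have 2: "?x \<bullet> y \<le> norm ?x * norm y" by (rule norm_cauchy_schwarz)
      have "m * norm ?x \<le> norm y"
      proof (cases "?x = 0")
        case False
        have "norm ?x * (m * norm ?x) \<le> norm ?x * norm y" using 1 2 by (simp add: power2_eq_square mult_ac)
        then show ?thesis using False by simp
      qed simp
      then have "norm ?x * norm y \<le> (norm y / m) * norm y" using m(1) by (intro mult_right_mono) (auto simp: field_simps)
      moreover have "y \<bullet> ?x \<ge> 0" using gp[of ?x] by (simp add: gx inner_commute)
      ultimately show ?thesis using 2 by (simp add: inner_commute dot_square_norm power2_eq_square)
    qed
    then show "norm (h t) \<le> R" using norm_le_if_quadratic_form_bound[OF sym_h[OF t(1)]] R(2) by fastforce
  qed
  then show thesis using that m by blast
qed

end

text \<open>The factor three stems from estimating the Euclidean norm by the sum of the three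
  entries.\<close>

lemma bounded_quadratic_form_norm: "\<bar>x \<bullet> (G *v x)\<bar> \<le> 3 * norm G * (x \<bullet> x)" for G :: "real^3^3"
proof -
  have "norm (G *v x) \<le> (\<Sum>i\<in>UNIV. \<bar>(G *v x) $ i\<bar>)" by (rule norm_le_l1_cart)
  also have "\<dots> \<le> (\<Sum>i\<in>(UNIV::3 set). norm G * norm x)"
  proof (rule sum_mono)
    fix i
    have "(G *v x) $ i = G $ i \<bullet> x" by (simp add: matrix_vector_mult_def inner_vec_def)
    then have "\<bar>(G *v x) $ i\<bar> \<le> norm (G $ i) * norm x" using Cauchy_Schwarz_ineq2 by metis
    also have "\<dots> \<le> norm G * norm x" by (intro mult_right_mono Finite_Cartesian_Product.norm_nth_le) auto
    finally show "\<bar>(G *v x) $ i\<bar> \<le> norm G * norm x" .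
  qed
  finally have "norm (G *v x) \<le> 3 * (norm G * norm x)" by simp
  then have "norm x * norm (G *v x) \<le> norm x * (3 * (norm G * norm x))" by (intro mult_left_mono) auto
  moreover have "\<bar>x \<bullet> (G *v x)\<bar> \<le> norm x * norm (G *v x)" by (rule Cauchy_Schwarz_ineq2)
  ultimately show ?thesis by (simp add: dot_square_norm power2_eq_square mult_ac)
qed

lemma constant_on_interval:
  fixes f :: "real \<Rightarrow> 'b::real_normed_vector"
  assumes "is_interval S" "\<And>t. t \<in> S \<Longrightarrow> (f has_vector_derivative 0) (at t within S)" "s \<in> S" "t \<in> S"
  shows "f t = f s"
proof -
  have "\<exists>c. \<forall>t\<in>S. f t = c"
    by (rule has_derivative_zero_constant) (use assms in \<open>auto simp: is_interval_convex has_vector_derivative_def\<close>)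
  then show ?thesis using assms by auto
qed

text \<open>The matrix \<open>h\<close> remains the inverse of \<open>g\<close> because \<open>gh - 1\<close> satisfies a homogeneous
  linear equation.\<close>

lemma vacuum_field_solution:
  assumes ab: "a' < b'" and Y: "\<And>t. t \<in> {a'..b'} \<Longrightarrow> (Y has_vector_derivative vacuum_field N a C (Y t)) (at t within {a'..b'})"
    and Ya: "Y a' = (g0, h0, q0, w0, s0)" "g0 ** h0 = mat 1" "transpose g0 = g0" "transpose q0 = q0"
  obtains gY hY qY wY sY where "\<And>t. Y t = (gY t, hY t, qY t, wY t, sY t)"
    "\<And>t. t \<in> {a'..b'} \<Longrightarrow> (gY has_vector_derivative 2 *\<^sub>R qY t) (at t within {a'..b'})"
    "\<And>t. t \<in> {a'..b'} \<Longrightarrow> (hY has_vector_derivative - 2 *\<^sub>R (hY t ** qY t ** hY t)) (at t within {a'..b'})"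
    "\<And>t. t \<in> {a'..b'} \<Longrightarrow> (qY has_vector_derivative symm (2 *\<^sub>R (qY t ** hY t ** qY t)
        - (trace (hY t ** qY t) + C * wY t) *\<^sub>R qY t - ricci3 N a (gY t) (hY t))) (at t within {a'..b'})"
    "\<And>t. t \<in> {a'..b'} \<Longrightarrow> (wY has_real_derivative - (trace (hY t ** qY t) + C * wY t) * wY t) (at t within {a'..b'})"
    "\<And>t. t \<in> {a'..b'} \<Longrightarrow> (sY has_real_derivative wY t) (at t within {a'..b'})"
    "\<And>t. t \<in> {a'..b'} \<Longrightarrow> transpose (gY t) = gY t \<and> transpose (qY t) = qY t \<and> transpose (hY t) = hY t
        \<and> gY t ** hY t = mat 1 \<and> hY t ** gY t = mat 1"
proof -
  define gY where "gY t = fst (Y t)" for t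
  define hY where "hY t = fst (snd (Y t))" for t
  define qY where "qY t = fst (snd (snd (Y t)))" for t
  define wY where "wY t = fst (snd (snd (snd (Y t))))" for t
  define sY where "sY t = snd (snd (snd (snd (Y t))))" for t
  let ?T = "{a'..b'}"
  have Yt: "Y t = (gY t, hY t, qY t, wY t, sY t)" for t
    by (simp add: gY_def hY_def qY_def wY_def sY_def)
  note bl = bounded_linear.has_vector_derivative
  note D1 = bl[OF bounded_linear_fst Y] and D2 = bl[OF bounded_linear_snd Y]
  note E1 = bl[OF bounded_linear_fst D2] and E2 = bl[OF bounded_linear_snd D2]
  note F1 = bl[OF bounded_linear_fst E2] and F2 = bl[OF bounded_linear_snd E2]
  note G1 = bl[OF bounded_linear_fst F2] and G2 = bl[OF bounded_linear_snd F2]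
  have g: "(gY has_vector_derivative 2 *\<^sub>R qY t) (at t within ?T)" if "t \<in> ?T" for t
    using D1[OF that] by (simp add: gY_def[abs_def, symmetric] vacuum_field_def case_prod_beta qY_def)
  have h: "(hY has_vector_derivative - 2 *\<^sub>R (hY t ** qY t ** hY t)) (at t within ?T)" if "t \<in> ?T" for t
    using E1[OF that] by (simp add: hY_def[abs_def, symmetric] vacuum_field_def case_prod_beta) (simp add: qY_def hY_def)
  have q: "(qY has_vector_derivative symm (2 *\<^sub>R (qY t ** hY t ** qY t)
        - (trace (hY t ** qY t) + C * wY t) *\<^sub>R qY t - ricci3 N a (gY t) (hY t))) (at t within ?T)" if "t \<in> ?T" for t
    using F1[OF that] by (simp add: qY_def[abs_def, symmetric] vacuum_field_def case_prod_beta) (simp add: qY_def hY_def gY_def wY_def)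
  have w: "(wY has_real_derivative - (trace (hY t ** qY t) + C * wY t) * wY t) (at t within ?T)" if "t \<in> ?T" for t
    using G1[OF that] unfolding has_real_derivative_iff_has_vector_derivative
    by (simp add: wY_def[abs_def, symmetric] vacuum_field_def case_prod_beta) (simp add: qY_def hY_def gY_def wY_def)
  have s: "(sY has_real_derivative wY t) (at t within ?T)" if "t \<in> ?T" for t
    using G2[OF that] unfolding has_real_derivative_iff_has_vector_derivative
    by (simp add: sY_def[abs_def, symmetric] vacuum_field_def case_prod_beta) (simp add: wY_def)
  have aT: "a' \<in> ?T" using ab by simp
  have init: "gY a' = g0" "hY a' = h0" "qY a' = q0" using Ya(1) by (simp_all add: gY_def hY_def qY_def)
  \<comment> \<open>The third component of the field is symmetrised, so the skew part of
    \<open>q\<close> is constant; then \<open>g' = 2 q\<close> keeps \<open>g\<close> symmetric as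
    well.\<close>
  have sq: "transpose (qY t) = qY t" if t: "t \<in> ?T" for t
  proof -
    have "qY t - transpose (qY t) = qY a' - transpose (qY a')"
    proof (rule constant_on_interval[of ?T "\<lambda>t. qY t - transpose (qY t)", OF is_interval_cc _ aT t])
      fix u assume u: "u \<in> ?T"
      show "((\<lambda>t. qY t - transpose (qY t)) has_vector_derivative 0) (at u within ?T)"
        using has_vector_derivative_diff[OF q[OF u] bl[OF bounded_linear_transpose q[OF u]]] by (simp only: transpose_symm diff_self)
    qed
    then show ?thesis by (simp add: init Ya)
  qed
  have sg: "transpose (gY t) = gY t" if t: "t \<in> ?T" for t
  proof -
    have "gY t - transpose (gY t) = gY a' - transpose (gY a')"
    proof (rule constant_on_interval[of ?T "\<lambda>t. gY t - transpose (gY t)", OF is_interval_cc _ aT t])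
      fix u assume u: "u \<in> ?T"
      show "((\<lambda>t. gY t - transpose (gY t)) has_vector_derivative 0) (at u within ?T)"
        using has_vector_derivative_diff[OF g[OF u] bl[OF bounded_linear_transpose g[OF u]]] by (simp add: sq[OF u])
    qed
    then show ?thesis by (simp add: init Ya)
  qed
  have qh: "continuous_on ?T (\<lambda>t. qY t ** hY t)"
    by (intro bounded_bilinear.continuous_on[OF bounded_bilinear_matrix_mult] continuous_on_vector_derivative[OF q]
        continuous_on_vector_derivative[OF h])
  obtain K where K': "0 \<le> K \<and> (\<forall>(A :: real^3^3) (B :: real^3^3). norm (A ** B) \<le> norm A * norm B * K)"
    using bounded_bilinear.nonneg_bounded[OF bounded_bilinear_matrix_mult] by (rule exE)
  note K = conjunct1[OF K'] conjunct2[OF K', rule_format]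
  have "bounded ((\<lambda>t. qY t ** hY t) ` ?T)"
    by (intro compact_imp_bounded compact_continuous_image qh) auto
  then obtain M where "\<forall>x\<in>(\<lambda>t. qY t ** hY t) ` ?T. norm x \<le> M" unfolding bounded_iff by blast
  then have M: "norm (qY t ** hY t) \<le> M" if "t \<in> ?T" for t using that by auto
  have gh: "gY t ** hY t - mat 1 = 0" if t: "t \<in> ?T" for t
  proof (rule linear_ode_zero[of a' b' "\<lambda>t. gY t ** hY t - mat 1" "\<lambda>t. - 2 *\<^sub>R ((gY t ** hY t - mat 1) ** (qY t ** hY t))" "2 * (M * K)"])
    fix u assume u: "u \<in> ?T"
    have "((\<lambda>t. gY t ** hY t - mat 1) has_vector_derivative
        (gY u ** (- 2 *\<^sub>R (hY u ** qY u ** hY u)) + (2 *\<^sub>R qY u) ** hY u) - 0) (at u within ?T)"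
      by (intro has_vector_derivative_diff has_vector_derivative_const matrix_mult_has_derivative g h u)
    moreover have "(gY u ** (- 2 *\<^sub>R (hY u ** qY u ** hY u)) + (2 *\<^sub>R qY u) ** hY u) - 0
        = - 2 *\<^sub>R ((gY u ** hY u - mat 1) ** (qY u ** hY u))"
      by (simp add: matrix_mul_assoc scaleR_diff_right)
    ultimately show "((\<lambda>t. gY t ** hY t - mat 1) has_vector_derivative - 2 *\<^sub>R ((gY u ** hY u - mat 1) ** (qY u ** hY u))) (at u within ?T)"
      by (simp only:)
    have "norm ((gY u ** hY u - mat 1) ** (qY u ** hY u)) \<le> norm (gY u ** hY u - mat 1) * norm (qY u ** hY u) * K" by (rule K(2))
    also have "\<dots> \<le> norm (gY u ** hY u - mat 1) * M * K" by (intro mult_right_mono mult_left_mono M u K) auto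
    finally show "norm (- 2 *\<^sub>R ((gY u ** hY u - mat 1) ** (qY u ** hY u))) \<le> 2 * (M * K) * norm (gY u ** hY u - mat 1)"
      by (simp add: mult_ac del: matrix_additive)
  qed (use t in \<open>auto simp: init Ya\<close>)
  have gh: "gY t ** hY t = mat 1" if "t \<in> ?T" for t using gh[OF that] by simp
  then have hg: "hY t ** gY t = mat 1" if "t \<in> ?T" for t using that matrix_left_right_inverse by blast
  have sh: "transpose (hY t) = hY t" if t: "t \<in> ?T" for t
  proof -
    have "transpose (hY t) = transpose (hY t) ** (gY t ** hY t)" by (simp add: gh[OF t])
    also have "\<dots> = transpose (transpose (gY t) ** hY t) ** hY t" by (simp add: matrix_transpose_mul matrix_mul_assoc)
    also have "\<dots> = hY t" by (simp add: sg[OF t] gh[OF t])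
    finally show ?thesis .
  qed
  show thesis using that[OF Yt g h q w s] sq sg sh gh hg by blast
qed

text \<open>As the state stays in a closed ball up to \<open>b = Sup I\<close>, the differential
  equation continues beyond \<open>b\<close>. The uniform lower bound \<open>m\<close> passes to the
  limit, so the metric is still positive definite at \<open>b\<close> and, by continuity, shortly
  after it.\<close>

lemma (in vacuum_metric) extension:
  assumes g: "smooth_on I g" and \<phi>: "\<And>K. K \<in> {1..n-3} \<Longrightarrow> smooth_on I (\<phi> K)"
    and t0: "t0 \<in> I" and S0: "expansion t0 > 0" and bdd: "bdd_above I"
  obtains I' g' \<phi>' where "vacuum_solution n e c I' g' \<phi>'" "I \<subseteq> I'" "\<exists>t'\<in>I'. \<forall>t\<in>I. t < t'"
    "\<forall>t\<in>I. g' t = g t \<and> (\<forall>K\<in>{1..n-3}. \<phi>' K t = \<phi> K t)"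
proof -
  define b where "b = Sup I"
  have lt: "t < b" if t: "t \<in> I" for t
  proof -
    obtain \<epsilon> where "\<epsilon> > 0" "ball t \<epsilon> \<subseteq> I" using open_I t unfolding open_contains_ball by blast
    then have "t + \<epsilon> / 2 \<in> I" by (auto simp: subset_iff dist_real_def)
    then have "t + \<epsilon> / 2 \<le> b" unfolding b_def by (rule cSup_upper[OF _ bdd])
    then show ?thesis using \<open>\<epsilon> > 0\<close> by simp
  qed
  have mem: "t \<in> I" if t: "t0 \<le> t" "t < b" for t
  proof -
    obtain u where "u \<in> I" "t < u" using t(2) t0 bdd less_cSup_iff[of I t] by (auto simp: b_def)
    then show ?thesis using interval_Icc_subset[OF interval_I t0 \<open>u \<in> I\<close>] t(1) by auto
  qed
  have t0b: "t0 < b" using lt[OF t0] .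
  obtain F where F: "\<And>t. t \<in> I \<Longrightarrow> (F has_real_derivative expansion t) (at t)"
    using antiderivative_open_interval[OF open_I interval_I expansion_continuous] by blast
  \<comment> \<open>An integrating factor: all \<open>\<psi> K\<close> satisfy the same equation
    \<open>\<psi>' = - S \<psi>\<close>, so that \<open>\<psi> K\<close> is \<open>w\<close> times
    its value at \<open>t0\<close>.\<close>
  define w where "w t = exp (F t0 - F t)" for t
  have w': "(w has_real_derivative - expansion t * w t) (at t)" if "t \<in> I" for t
    unfolding w_def[abs_def] by (auto intro!: derivative_eq_intros F[OF that])
  have "continuous_on I w" using w' by (intro continuous_at_imp_continuous_on ballI DERIV_isCont) blast
  then obtain G where G: "\<And>t. t \<in> I \<Longrightarrow> (G has_real_derivative w t) (at t)"
    using antiderivative_open_interval[OF open_I interval_I] by blast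
  define \<sigma> where "\<sigma> t = G t - G t0" for t
  have \<sigma>': "(\<sigma> has_real_derivative w t) (at t)" if "t \<in> I" for t
    unfolding \<sigma>_def[abs_def] by (auto intro!: derivative_eq_intros G[OF that])
  have \<psi>w: "\<psi> K t = \<psi> K t0 * w t" if K: "K \<in> {1..n-3}" and t: "t \<in> I" for K t
  proof -
    have "\<psi> K t * exp (F t) = \<psi> K t0 * exp (F t0)"
    proof (rule constant_on_interval[of I "\<lambda>t. \<psi> K t * exp (F t)", OF interval_I _ t0 t])
      fix u assume u: "u \<in> I"
      have "\<psi>' K u = - expansion u * \<psi> K u" using evolution[OF u] K by (simp add: evolution_def)
      then have "((\<lambda>t. \<psi> K t * exp (F t)) has_real_derivative 0) (at u)"
        by (auto intro!: derivative_eq_intros \<psi>_deriv[OF u K] F[OF u])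
      then show "((\<lambda>t. \<psi> K t * exp (F t)) has_vector_derivative 0) (at u within I)"
        unfolding has_real_derivative_iff_has_vector_derivative by (rule has_vector_derivative_at_within)
    qed
    then show ?thesis by (simp add: w_def exp_diff field_simps)
  qed
  have \<phi>\<sigma>: "\<phi> K t = \<phi> K t0 + \<psi> K t0 * \<sigma> t" if K: "K \<in> {1..n-3}" and t: "t \<in> I" for K t
  proof -
    have "\<phi> K t - \<psi> K t0 * \<sigma> t = \<phi> K t0 - \<psi> K t0 * \<sigma> t0"
    proof (rule constant_on_interval[of I "\<lambda>t. \<phi> K t - \<psi> K t0 * \<sigma> t", OF interval_I _ t0 t])
      fix u assume u: "u \<in> I"
      have "((\<lambda>t. \<phi> K t - \<psi> K t0 * \<sigma> t) has_real_derivative 0) (at u)"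
        by (auto intro!: derivative_eq_intros \<phi>_deriv[OF u K] \<sigma>'[OF u] simp: \<psi>w[OF K u])
      then show "((\<lambda>t. \<phi> K t - \<psi> K t0 * \<sigma> t) has_vector_derivative 0) (at u within I)"
        unfolding has_real_derivative_iff_has_vector_derivative by (rule has_vector_derivative_at_within)
    qed
    then show ?thesis by (simp add: \<sigma>_def)
  qed
  \<comment> \<open>The flat directions enter the evolution of the group metric only through the sum
    of all \<open>\<psi> K\<close>, which is \<open>C * w\<close>.\<close>
  define C where "C = (\<Sum>K\<in>{1..n-3}. \<psi> K t0)"
  have exp_C: "expansion t = trace (h t ** q t) + C * w t" if "t \<in> I" for t
    unfolding expansion_def C_def sum_distrib_right by (simp add: \<psi>w[OF _ that])
  have jac: "N *v a = 0" by (rule jacobi_if_evolution[OF t0 evolution[OF t0]])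
  have ric_sym: "transpose (ricci3 N a g1 h1) = ricci3 N a g1 h1"
    if "transpose g1 = g1" "transpose h1 = h1" "g1 ** h1 = mat 1" "h1 ** g1 = mat 1" for g1 h1
  proof -
    interpret m: invariant_metric N a g1 h1 by unfold_locales (use that in \<open>auto simp: transpose_bracket_sym\<close>)
    show ?thesis using m.ricci3_symmetric_iff jac by simp
  qed
  have q'_eq: "symm (2 *\<^sub>R (q1 ** h1 ** q1) - k *\<^sub>R q1 - ricci3 N a g1 h1) = 2 *\<^sub>R (q1 ** h1 ** q1) - k *\<^sub>R q1 - ricci3 N a g1 h1"
    if "transpose g1 = g1" "transpose h1 = h1" "g1 ** h1 = mat 1" "h1 ** g1 = mat 1" "transpose q1 = q1" for g1 h1 q1 k
    by (rule symm_eq) (simp add: ric_sym that matrix_transpose_mul matrix_mul_assoc)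
  define X where "X t = (g t, h t, q t, w t, \<sigma> t)" for t
  have X': "(X has_vector_derivative vacuum_field N a C (X t)) (at t)" if t: "t \<in> I" for t
  proof -
    have sg: "transpose (g t) = g t" using pos[OF t] by (simp add: pos_def_def)
    have "q' t = symm (2 *\<^sub>R (q t ** h t ** q t) - (trace (h t ** q t) + C * w t) *\<^sub>R q t - ricci3 N a (g t) (h t))"
      using evolution[OF t] by (simp add: evolution_def exp_C[OF t] q'_eq[OF sg sym_h[OF t] gh[OF t] sym_q[OF t]])
    moreover have "(X has_vector_derivative (2 *\<^sub>R q t, - 2 *\<^sub>R (h t ** q t ** h t), q' t, - expansion t * w t, w t)) (at t)"
      unfolding X_def[abs_def]
      by (intro has_vector_derivative_Pair g_deriv h_deriv q_deriv t
          w'[unfolded has_real_derivative_iff_has_vector_derivative] \<sigma>'[unfolded has_real_derivative_iff_has_vector_derivative])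
    ultimately show ?thesis by (simp add: vacuum_field_def X_def exp_C[OF t])
  qed
  obtain R m where m: "m > 0" "\<And>t x. t \<in> I \<Longrightarrow> t0 \<le> t \<Longrightarrow> m * (x \<bullet> x) \<le> x \<bullet> (g t *v x)"
    and R: "\<And>t. t \<in> I \<Longrightarrow> t0 \<le> t \<Longrightarrow> norm (g t) \<le> R \<and> norm (h t) \<le> R \<and> norm (q t) \<le> R"
    using metric_bounded[OF t0 lt S0] by metis
  have wb: "norm (w t) \<le> 1" if "t \<in> I" "t0 \<le> t" for t
  proof -
    have "w t \<le> w t0"
      by (rule antimono_if_deriv_nonpos[OF interval_I has_field_derivative_at_within[OF w']])
        (use that t0 expansion_pos[OF t0 S0] in \<open>auto simp: w_def mult_nonneg_nonneg less_imp_le\<close>)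
    then show ?thesis by (simp add: w_def)
  qed
  have \<sigma>b: "norm (\<sigma> t) \<le> b - t0" if t: "t \<in> I" "t0 \<le> t" for t
  proof -
    have "norm (\<sigma> t - \<sigma> t0) \<le> 1 * norm (t - t0)"
    proof (rule differentiable_bound[of "{t0..t}" \<sigma> "\<lambda>u. (*) (w u)"])
      have sub: "{t0..t} \<subseteq> I" by (rule interval_Icc_subset[OF interval_I t0 t(1)])
      show "(\<sigma> has_derivative (*) (w u)) (at u within {t0..t})" if "u \<in> {t0..t}" for u
        using has_field_derivative_at_within[OF \<sigma>'[of u]] that sub by (auto simp: has_field_derivative_def)
      show "onorm ((*) (w u)) \<le> 1" if "u \<in> {t0..t}" for u
        by (rule onorm_le) (use wb[of u] that sub in \<open>auto simp: abs_mult mult_left_le_one_le\<close>)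
    qed (use t in auto)
    then show ?thesis using lt[OF t(1)] t(2) by (simp add: \<sigma>_def)
  qed
  define R' where "R' = R + (R + (R + (1 + (b - t0))))"
  have XK: "X t \<in> cball 0 R'" if "t \<in> {t0..<b}" for t
  proof -
    have t: "t \<in> I" "t0 \<le> t" using that mem by auto
    have "norm (X t) \<le> norm (g t) + (norm (h t) + (norm (q t) + (norm (w t) + norm (\<sigma> t))))"
      unfolding X_def by (intro order_trans[OF norm_Pair_le] add_left_mono order_refl)
    also have "\<dots> \<le> R'" unfolding R'_def by (intro add_mono R[OF t, THEN conjunct1] R[OF t, THEN conjunct2, THEN conjunct1]
        R[OF t, THEN conjunct2, THEN conjunct2] wb \<sigma>b t)
    finally show ?thesis by simp
  qed
  have Xd: "(X has_vector_derivative vacuum_field N a C (X t)) (at t within {t0..<b})" if "t \<in> {t0..<b}" for t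
    using has_vector_derivative_at_within[OF X'] mem that by auto
  obtain \<delta> Y where \<delta>: "\<delta> > 0" and YX: "\<And>t. t \<in> {t0..<b} \<Longrightarrow> Y t = X t"
    and Y: "\<And>t. t \<in> {t0..b + \<delta>} \<Longrightarrow> (Y has_vector_derivative vacuum_field N a C (Y t)) (at t within {t0..b + \<delta>})"
    using ode_continuation[OF open_UNIV smooth_vacuum_field compact_cball subset_UNIV t0b XK Xd] by metis
  have t0\<delta>: "t0 < b + \<delta>" using t0b \<delta> by simp
  have Y0: "Y t0 = (g t0, h t0, q t0, w t0, \<sigma> t0)" using YX[of t0] t0b by (simp add: X_def)
  have sg0: "transpose (g t0) = g t0" using pos[OF t0] by (simp add: pos_def_def)
  let ?T = "{t0..b + \<delta>}"
  obtain gY hY qY wY sY where Yt: "\<And>t. Y t = (gY t, hY t, qY t, wY t, sY t)"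
    and gY: "\<And>t. t \<in> ?T \<Longrightarrow> (gY has_vector_derivative 2 *\<^sub>R qY t) (at t within ?T)"
    and hY: "\<And>t. t \<in> ?T \<Longrightarrow> (hY has_vector_derivative - 2 *\<^sub>R (hY t ** qY t ** hY t)) (at t within ?T)"
    and qY: "\<And>t. t \<in> ?T \<Longrightarrow> (qY has_vector_derivative symm (2 *\<^sub>R (qY t ** hY t ** qY t)
        - (trace (hY t ** qY t) + C * wY t) *\<^sub>R qY t - ricci3 N a (gY t) (hY t))) (at t within ?T)"
    and wY: "\<And>t. t \<in> ?T \<Longrightarrow> (wY has_real_derivative - (trace (hY t ** qY t) + C * wY t) * wY t) (at t within ?T)"
    and sY: "\<And>t. t \<in> ?T \<Longrightarrow> (sY has_real_derivative wY t) (at t within ?T)"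
    and symY: "\<And>t. t \<in> ?T \<Longrightarrow> transpose (gY t) = gY t \<and> transpose (qY t) = qY t \<and> transpose (hY t) = hY t
        \<and> gY t ** hY t = mat 1 \<and> hY t ** gY t = mat 1"
    using vacuum_field_solution[OF t0\<delta> Y Y0 gh(1)[OF t0] sg0 sym_q[OF t0]] by blast
  have eqY: "gY t = g t" "hY t = h t" "qY t = q t" "wY t = w t" "sY t = \<sigma> t" if "t \<in> {t0..<b}" for t
    using YX[OF that] by (simp_all add: Yt X_def)
  have gYc: "continuous_on ?T gY" by (rule continuous_on_vector_derivative[OF gY])
  have gYb: "m * (x \<bullet> x) \<le> x \<bullet> (gY b *v x)" for x
  proof -
    have "continuous_on ?T (\<lambda>t. x \<bullet> (gY t *v x))"
      by (intro continuous_intros bounded_linear.continuous_on[OF bounded_linear_matrix_vector] gYc)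
    then have c: "continuous_on (closure {t0..<b}) (\<lambda>t. x \<bullet> (gY t *v x))"
      by (rule continuous_on_subset) (use t0b \<delta> in auto)
    have "m * (x \<bullet> x) \<le> x \<bullet> (gY b *v x)"
      by (rule continuous_ge_on_closure[OF c, of b "m * (x \<bullet> x)"]) (use t0b m(2) mem eqY in auto)
    then show ?thesis .
  qed
  \<comment> \<open>\<open>bounded_quadratic_form_norm\<close> costs a factor three; subtracting
    \<open>3 * (m / 6)\<close> leaves half of the lower bound \<open>m\<close>.\<close>
  obtain \<delta>' where \<delta>': "0 < \<delta>'" "\<delta>' < \<delta>" and near: "\<And>t. b \<le> t \<Longrightarrow> t < b + \<delta>' \<Longrightarrow> norm (gY t - gY b) < m / 6"
  proof -
    have bT: "b \<in> ?T" using t0b \<delta> by simp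
    obtain d where d: "d > 0" "\<And>t. t \<in> ?T \<Longrightarrow> dist t b < d \<Longrightarrow> dist (gY t) (gY b) < m / 6"
      using gYc[unfolded continuous_on_iff] bT m(1) by (metis divide_pos_pos zero_less_numeral)
    show thesis
      by (rule that[of "min d (\<delta> / 2)"]) (use d \<delta> t0b in \<open>auto simp: dist_norm\<close>)
  qed
  have posY: "pos_def (gY t)" if t: "b \<le> t" "t < b + \<delta>'" for t
    unfolding pos_def_def
  proof (intro conjI allI impI)
    show "transpose (gY t) = gY t" using symY[of t] t t0b \<delta>' by auto
    fix x :: "real^3" assume "x \<noteq> 0"
    have "3 * norm (gY t - gY b) * (x \<bullet> x) \<le> 3 * (m / 6) * (x \<bullet> x)"
      using near[OF t] by (intro mult_right_mono) auto
    then have "\<bar>x \<bullet> ((gY t - gY b) *v x)\<bar> \<le> m / 2 * (x \<bullet> x)"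
      using bounded_quadratic_form_norm[of x "gY t - gY b"] by simp
    moreover have "x \<bullet> (gY t *v x) = x \<bullet> (gY b *v x) + x \<bullet> ((gY t - gY b) *v x)" by (simp add: inner_diff_right)
    moreover have "m / 2 * (x \<bullet> x) > 0" using m(1) \<open>x \<noteq> 0\<close> by simp
    ultimately show "x \<bullet> (gY t *v x) > 0" using gYb[of x] by simp
  qed
  \<comment> \<open>\<open>J\<close> meets \<open>I\<close> between \<open>t0\<close> and
    \<open>b\<close> and, as \<open>\<delta>' < \<delta>\<close>, lies in the interior of the domain
    of \<open>Y\<close>, where derivatives are two-sided.\<close>
  define J where "J = {t0<..<b + \<delta>'}"
  have J: "open J" by (simp add: J_def)
  have JT: "t \<in> ?T" "t \<in> interior ?T" if "t \<in> J" for t using that \<delta>' by (auto simp: J_def)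
  have IJ: "t \<in> {t0..<b}" if "t \<in> I" "t \<in> J" for t using that lt by (auto simp: J_def)
  have JI: "b \<le> t" "t < b + \<delta>'" if "t \<in> J" "t \<notin> I" for t using that mem[of t] by (auto simp: J_def intro: leI)
  define q'Y where "q'Y t = 2 *\<^sub>R (qY t ** hY t ** qY t) - (trace (hY t ** qY t) + C * wY t) *\<^sub>R qY t - ricci3 N a (gY t) (hY t)" for t
  have atJ: "at t within ?T = at t" if "t \<in> J" for t by (rule at_within_interior[OF JT(2)[OF that]])
  have dJ: "(gY has_vector_derivative 2 *\<^sub>R qY t) (at t)" "(hY has_vector_derivative - 2 *\<^sub>R (hY t ** qY t ** hY t)) (at t)"
      "(qY has_vector_derivative q'Y t) (at t)" "(wY has_real_derivative - (trace (hY t ** qY t) + C * wY t) * wY t) (at t)"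
      "(sY has_real_derivative wY t) (at t)" if t: "t \<in> J" for t
    using gY[OF JT(1)[OF t]] hY[OF JT(1)[OF t]] qY[OF JT(1)[OF t]] wY[OF JT(1)[OF t]] sY[OF JT(1)[OF t]] symY[OF JT(1)[OF t]]
    unfolding atJ[OF t] q'Y_def by (simp_all only: q'_eq)
  let ?I = "I \<union> J"
  let ?g = "glue I g gY" and ?h = "glue I h hY" and ?q = "glue I q qY" and ?q' = "glue I q' q'Y"
  let ?\<phi> = "\<lambda>K. glue I (\<phi> K) (\<lambda>t. \<phi> K t0 + \<psi> K t0 * sY t)" and ?\<psi> = "\<lambda>K. glue I (\<psi> K) (\<lambda>t. \<psi> K t0 * wY t)"
    and ?\<psi>' = "\<lambda>K. glue I (\<psi>' K) (\<lambda>t. \<psi> K t0 * (- (trace (hY t ** qY t) + C * wY t) * wY t))"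
  note glued = glue_has_derivative[OF open_I J]
  have intI': "is_interval ?I"
  proof -
    \<comment> \<open>The midpoint of \<open>t0\<close> and \<open>b\<close> lies in both intervals,
      so their union is connected.\<close>
    have "b - (b - t0) / 2 \<in> I \<inter> J" using t0b mem[of "b - (b - t0) / 2"] \<delta>' by (auto simp: J_def field_simps)
    then have "connected ?I"
      using interval_I by (intro connected_Un) (auto simp: is_interval_connected_1 J_def)
    then show ?thesis by (simp add: is_interval_connected_1)
  qed
  have sub: "I \<subseteq> ?I" by auto
  have gg: "(?g has_vector_derivative 2 *\<^sub>R ?q t) (at t)" if t: "t \<in> ?I" for t
    using glued[OF _ g_deriv dJ(1) t] eqY(1)[OF IJ] by (auto simp: glue_def)
  have hh: "(?h has_vector_derivative - 2 *\<^sub>R (?h t ** ?q t ** ?h t)) (at t)" if t: "t \<in> ?I" for t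
    using glued[OF _ h_deriv dJ(2) t] eqY(2)[OF IJ] by (auto simp: glue_def)
  have qq: "(?q has_vector_derivative ?q' t) (at t)" if t: "t \<in> ?I" for t
    using glued[OF _ q_deriv dJ(3) t] eqY(3)[OF IJ] by auto
  have pp: "(?\<phi> K has_real_derivative ?\<psi> K t) (at t)" if t: "t \<in> ?I" and K: "K \<in> {1..n-3}" for t K
    unfolding has_real_derivative_iff_has_vector_derivative
  proof (rule glued[OF _ _ _ t])
    fix u assume u: "u \<in> J"
    have "((\<lambda>t. \<phi> K t0 + \<psi> K t0 * sY t) has_real_derivative \<psi> K t0 * wY u) (at u)"
      by (auto intro!: derivative_eq_intros dJ(5)[OF u])
    then show "((\<lambda>t. \<phi> K t0 + \<psi> K t0 * sY t) has_vector_derivative \<psi> K t0 * wY u) (at u)"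
      by (simp only: has_real_derivative_iff_has_vector_derivative)
  qed (use \<phi>_deriv[OF _ K] \<phi>\<sigma>[OF K] eqY(5)[OF IJ] in \<open>auto simp: has_real_derivative_iff_has_vector_derivative\<close>)
  have ss: "(?\<psi> K has_real_derivative ?\<psi>' K t) (at t)" if t: "t \<in> ?I" and K: "K \<in> {1..n-3}" for t K
    unfolding has_real_derivative_iff_has_vector_derivative
  proof (rule glued[OF _ _ _ t])
    fix u assume u: "u \<in> J"
    have "((\<lambda>t. \<psi> K t0 * wY t) has_real_derivative \<psi> K t0 * (- (trace (hY u ** qY u) + C * wY u) * wY u)) (at u)"
      by (rule DERIV_cmult[OF dJ(4)[OF u]])
    then show "((\<lambda>t. \<psi> K t0 * wY t) has_vector_derivative \<psi> K t0 * (- (trace (hY u ** qY u) + C * wY u) * wY u)) (at u)"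
      by (simp only: has_real_derivative_iff_has_vector_derivative)
  qed (use \<psi>_deriv[OF _ K] \<psi>w[OF K] eqY(4)[OF IJ] in \<open>auto simp: has_real_derivative_iff_has_vector_derivative\<close>)
  interpret E: homogeneous_metric n A e c ?I ?g ?h ?q ?q' ?\<phi> ?\<psi> ?\<psi>'
  proof
    show "open ?I" using open_I J by blast
    show "pos_def (?g t)" if "t \<in> ?I" for t using that pos posY[OF JI] by (auto simp: glue_def)
    show "?g t ** ?h t = mat 1" "?h t ** ?g t = mat 1" "transpose (?h t) = ?h t" "transpose (?q t) = ?q t" if "t \<in> ?I" for t
      using that gh sym_h sym_q symY[OF JT(1)] by (auto simp: glue_def)
  qed (fact atlas field c_skew gg hh qq pp ss)+
  have sums: "E.expansion t = (if t \<in> I then expansion t else trace (hY t ** qY t) + C * wY t)" for t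
    unfolding E.expansion_def expansion_def by (simp add: glue_def C_def sum_distrib_right)
  have evE: "E.evolution t" if t: "t \<in> ?I" for t
  proof (cases "t \<in> I")
    case True
    then show ?thesis using evolution[OF True] unfolding E.evolution_def evolution_def sums by (simp add: glue_def)
  next
    case False
    then show ?thesis unfolding E.evolution_def sums by (simp add: glue_def q'Y_def)
  qed
  have coI: "E.constraints t" if t: "t \<in> I" for t
    using constraints[OF t] t
    unfolding E.constraints_def constraints_def sums E.scalar3_def scalar3_def E.k_norm_sq_def k_norm_sq_def
    by (simp add: glue_def)
  have coE: "E.constraints t" if t: "t \<in> ?I" for t
  proof (cases "t \<in> I")
    case True
    then show ?thesis by (rule coI)
  next
    case False
    then have tJ: "t \<in> J" "b \<le> t" using t JI by auto
    \<comment> \<open>The constraints are carried forward from \<open>t0\<close>, where the old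
      solution satisfies them.\<close>
    have sub: "{t0..t} \<subseteq> ?I" by (rule interval_Icc_subset[OF intI']) (use t0 t in auto)
    show ?thesis
      by (rule E.constraints_propagate[OF sub evE coI[OF t0]]) (use sub t0b tJ in auto)
  qed
  show thesis
  proof (rule that[of ?I ?g ?\<phi>])
    have Ys: "smooth_on J Y"
    proof (rule smooth_on_ode_solution[OF J open_UNIV smooth_vacuum_field])
      show "(Y has_vector_derivative vacuum_field N a C (Y t)) (at t)" if "t \<in> J" for t
        using Y[OF JT(1)[OF that]] by (simp only: atJ[OF that])
    qed simp
    have "smooth_on J (\<lambda>t. fst (Y t))" by (intro smooth_on_fst J Ys)
    then have gYs: "smooth_on J gY" by (simp add: Yt)
    have "smooth_on J (\<lambda>t. snd (snd (snd (snd (Y t)))))" by (intro smooth_on_snd J Ys)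
    then have sYs: "smooth_on J sY" by (simp add: Yt)
    have "smooth_on ?I ?g" by (rule glue_smooth[OF open_I J _ g gYs]) (use eqY(1)[OF IJ] in auto)
    moreover have "smooth_on ?I (?\<phi> K)" if K: "K \<in> {1..n-3}" for K
    proof (rule glue_smooth[OF open_I J _ \<phi>[OF K]])
      show "smooth_on J (\<lambda>t. \<phi> K t0 + \<psi> K t0 * sY t)"
        by (intro smooth_on_add smooth_on_mult smooth_on_const J sYs)
    qed (use \<phi>\<sigma>[OF K] eqY(5)[OF IJ] in auto)
    moreover have "ricci n e c (metric_at ?g ?\<phi>) a1 b1 p = 0"
      if p1: "p \<in> spacetime n ?I" and ab: "a1 \<in> all_idx n" "b1 \<in> all_idx n" for p a1 b1
    proof -
      obtain t x y where p: "p = (t, x, y)" "t \<in> ?I" using p1 by (auto simp: spacetime_def)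
      show ?thesis unfolding p(1) using E.vacuum_iff[OF p(2), of x y] evE[OF p(2)] coE[OF p(2)] ab by blast
    qed
    ultimately show "vacuum_solution n e c ?I ?g ?\<phi>"
      unfolding vacuum_solution_def using E.open_I intI' t0 E.pos by (auto simp: pos_def_def)
    show "\<exists>t'\<in>?I. \<forall>t\<in>I. t < t'"
      by (rule bexI[of _ b]) (use lt t0b \<delta>' in \<open>auto simp: J_def\<close>)
    show "\<forall>t\<in>I. ?g t = g t \<and> (\<forall>K\<in>{1..n-3}. ?\<phi> K t = \<phi> K t)" by (simp add: glue_def)
  qed (rule sub)
qed

section \<open>Curves in the Lie group\<close>

lemma Ck_on_local:
  assumes "\<And>x. x \<in> S \<Longrightarrow> \<exists>T. open T \<and> x \<in> T \<and> Ck_on k T f"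
  shows "Ck_on k S f"
  using assms
proof (induction k arbitrary: f)
  case 0
  have "isCont f x" if "x \<in> S" for x
    using 0[OF that] continuous_on_eq_continuous_at by auto
  then show ?case by (auto intro: continuous_at_imp_continuous_on)
next
  case (Suc k)
  have "f differentiable (at x)" if "x \<in> S" for x
    using Suc.prems[OF that] by auto
  moreover have "Ck_on k S (\<lambda>x. frechet_derivative f (at x) v)" for v
    by (rule Suc.IH) (use Suc.prems in fastforce)
  ultimately show ?case by simp
qed

lemma smooth_on_local:
  assumes "\<And>x. x \<in> S \<Longrightarrow> \<exists>T. open T \<and> x \<in> T \<and> smooth_on T f"
  shows "smooth_on S f"
  unfolding smooth_on_def
proof
  fix k show "Ck_on k S f"
    by (rule Ck_on_local) (use assms in \<open>unfold smooth_on_def, blast\<close>)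
qed

text \<open>The group part of \<open>has_velocity\<close>, isolated so that charts and translations
  can be treated without the other coordinates.\<close>

definition group_velocity ::
  "'g::topological_space chart set \<Rightarrow> (3 \<Rightarrow> 'g vector_field) \<Rightarrow> real set \<Rightarrow> (real \<Rightarrow> 'g) \<Rightarrow> (real \<Rightarrow> real^3) \<Rightarrow> bool" where
  "group_velocity A e J x v \<longleftrightarrow> (\<forall>s\<in>J. \<forall>f. smooth_at A f (x s) \<longrightarrow>
     ((\<lambda>r. f (x r)) has_real_derivative (\<Sum>i\<in>UNIV. v s $ i * e i f (x s))) (at s within J))"

lemma chartD:
  assumes "smooth_atlas A" "(U, \<phi>) \<in> A"
  shows "open U" "open (\<phi> ` U)" "continuous_on U \<phi>" "continuous_on (\<phi> ` U) (inv_into U \<phi>)" "inj_on \<phi> U"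
proof -
  have *: "open U \<and> open (\<phi> ` U) \<and> homeomorphism U (\<phi> ` U) \<phi> (inv_into U \<phi>)"
    using assms unfolding smooth_atlas_def by fastforce
  then show "open U" "open (\<phi> ` U)" "continuous_on U \<phi>" "continuous_on (\<phi> ` U) (inv_into U \<phi>)"
    by (auto simp: homeomorphism_def)
  show "inj_on \<phi> U" using * by (metis homeomorphism_def inj_on_inverseI)
qed

lemma open_chart_image:
  assumes "smooth_atlas A" "(U, \<phi>) \<in> A" "open W"
  shows "open (\<phi> ` (U \<inter> W))"
proof -
  note c = chartD[OF assms(1,2)]
  have "\<phi> ` (U \<inter> W) = \<phi> ` U \<inter> inv_into U \<phi> -` W"
    using c(5) by (auto simp: inv_into_f_f)
  then show ?thesis using continuous_open_preimage[OF c(4,2) assms(3)] by simp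
qed

text \<open>The function vanishes near \<open>p\<close>, so it is smooth at \<open>p\<close>
  whatever happens outside \<open>W\<close>; it serves to detect when a curve leaves
  \<open>W\<close>.\<close>

lemma smooth_at_nonmember:
  assumes A: "smooth_atlas A" and W: "open W" "p \<in> W"
  shows "smooth_at A (\<lambda>z. if z \<in> W then 0 else 1) p"
  unfolding smooth_at_def
proof (intro exI[of _ W] conjI ballI W)
  fix ch assume "ch \<in> A"
  then obtain U \<phi> where ch: "ch = (U, \<phi>)" "(U, \<phi>) \<in> A" by (cases ch) auto
  have "smooth_on (\<phi> ` (U \<inter> W)) ((\<lambda>z. if z \<in> W then 0 else 1 :: real) \<circ> inv_into U \<phi>)"
    by (rule smooth_on_cong[OF open_chart_image[OF A ch(2) W(1)] _ smooth_on_const[of _ 0]])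
      (use chartD[OF A ch(2)] open_chart_image[OF A ch(2) W(1)] in \<open>auto simp: inv_into_f_f\<close>)
  then show "case ch of (U, \<phi>) \<Rightarrow> smooth_on (\<phi> ` (U \<inter> W)) ((\<lambda>z. if z \<in> W then 0 else 1 :: real) \<circ> inv_into U \<phi>)"
    by (simp add: ch)
qed

text \<open>A curve with a velocity is continuous because indicator functions of open sets are smooth
  at the points of these sets.\<close>

lemma group_velocity_continuous:
  assumes A: "smooth_atlas A" and x: "group_velocity A e J x v"
  shows "continuous_on J x"
  unfolding continuous_on_def
proof (intro ballI topological_tendstoI)
  fix s W assume s: "s \<in> J" and W: "open W" "x s \<in> W"
  let ?f = "\<lambda>z. if z \<in> W then 0 else 1 :: real"
  have "((\<lambda>r. ?f (x r)) has_real_derivative (\<Sum>i\<in>UNIV. v s $ i * e i ?f (x s))) (at s within J)"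
    using x s smooth_at_nonmember[OF A W] unfolding group_velocity_def by blast
  then have "continuous (at s within J) (\<lambda>r. ?f (x r))"
    using DERIV_continuous by blast
  then have "((\<lambda>r. ?f (x r)) \<longlongrightarrow> ?f (x s)) (at s within J)" by (simp only: continuous_within)
  then have "eventually (\<lambda>r. ?f (x r) < 1) (at s within J)"
    by (rule order_tendstoD) (simp add: W)
  then show "eventually (\<lambda>r. x r \<in> W) (at s within J)"
    by eventually_elim (simp split: if_splits)
qed

lemma smooth_at_chart_component:
  assumes A: "smooth_atlas A" and U: "(U, \<phi>) \<in> A" "p \<in> U"
  shows "smooth_at A (\<lambda>z. \<phi> z $ j) p"
  unfolding smooth_at_def
proof (intro exI[of _ U] conjI ballI chartD(1)[OF A U(1)] U)
  fix ch assume "ch \<in> A"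
  then obtain V \<psi> where ch: "ch = (V, \<psi>)" "(V, \<psi>) \<in> A" by (cases ch) auto
  have "smooth_on (\<psi> ` (V \<inter> U)) (\<phi> \<circ> inv_into V \<psi>)"
    using A U(1) ch(2) unfolding smooth_atlas_def by fastforce
  then have "smooth_on (\<psi> ` (V \<inter> U)) (\<lambda>u. (\<phi> \<circ> inv_into V \<psi>) u $ j)"
    by (rule smooth_on_nth[OF open_chart_image[OF A ch(2) chartD(1)[OF A U(1)]]])
  then show "case ch of (V, \<psi>) \<Rightarrow> smooth_on (\<psi> ` (V \<inter> U)) ((\<lambda>z. \<phi> z $ j) \<circ> inv_into V \<psi>)"
    by (simp add: ch comp_def)
qed

text \<open>The components of the chart serve as test functions; this translates the abstract
  velocity into a derivative in Euclidean space.\<close>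

lemma chart_velocity:
  assumes A: "smooth_atlas A" and U: "(U, \<phi>) \<in> A"
    and \<xi>: "\<And>i p f. p \<in> U \<Longrightarrow> smooth_at A f p \<Longrightarrow>
      e i f p = frechet_derivative (f \<circ> inv_into U \<phi>) (at (\<phi> p)) (\<xi> i (\<phi> p))"
    and x: "group_velocity A e J x v" and s: "s \<in> J" "x s \<in> U"
  shows "((\<lambda>r. \<phi> (x r)) has_vector_derivative (\<Sum>i\<in>UNIV. v s $ i *\<^sub>R \<xi> i (\<phi> (x s)))) (at s within J)"
proof -
  note c = chartD[OF A U]
  have "((\<lambda>r. \<phi> (x r) $ j) has_real_derivative (\<Sum>i\<in>UNIV. v s $ i * \<xi> i (\<phi> (x s)) $ j)) (at s within J)" for j
  proof -
    note sm = smooth_at_chart_component[OF A U s(2), of j]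
    have "frechet_derivative ((\<lambda>z. \<phi> z $ j) \<circ> inv_into U \<phi>) (at (\<phi> (x s))) = (\<lambda>w. w $ j)"
    proof (rule frechet_derivative_at[symmetric])
      have "((\<lambda>w. w $ j) has_derivative (\<lambda>w. w $ j)) (at (\<phi> (x s)))"
        by (rule bounded_linear_imp_has_derivative[OF bounded_linear_vec_nth])
      then show "((\<lambda>z. \<phi> z $ j) \<circ> inv_into U \<phi> has_derivative (\<lambda>w. w $ j)) (at (\<phi> (x s)))"
        by (rule has_derivative_transform_within_open[OF _ c(2)]) (use s(2) c(5) in \<open>auto simp: inv_into_f_f\<close>)
    qed
    then have "e i (\<lambda>z. \<phi> z $ j) (x s) = \<xi> i (\<phi> (x s)) $ j" for i
      using \<xi>[OF s(2) sm] by simp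
    then show ?thesis using x s(1) sm unfolding group_velocity_def by fastforce
  qed
  then have "((\<lambda>r. \<phi> (x r) $ j) has_derivative (\<lambda>w. w * (\<Sum>i\<in>UNIV. v s $ i * \<xi> i (\<phi> (x s)) $ j))) (at s within J)" for j
    by (simp add: has_field_derivative_def mult_commute_abs)
  then show ?thesis
    unfolding has_vector_derivative_def
    by (subst has_derivative_componentwise_within) (auto simp: Basis_vec_def inner_axis)
qed

lemma group_velocity_from_chart:
  assumes A: "smooth_atlas A" and U: "(U, \<phi>) \<in> A"
    and \<xi>: "\<And>i p f. p \<in> U \<Longrightarrow> smooth_at A f p \<Longrightarrow>
      e i f p = frechet_derivative (f \<circ> inv_into U \<phi>) (at (\<phi> p)) (\<xi> i (\<phi> p))"
    and z: "\<And>s. s \<in> J \<Longrightarrow> z s \<in> \<phi> ` U"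
      "\<And>s. s \<in> J \<Longrightarrow> (z has_vector_derivative (\<Sum>i\<in>UNIV. v s $ i *\<^sub>R \<xi> i (z s))) (at s within J)"
  shows "group_velocity A e J (\<lambda>s. inv_into U \<phi> (z s)) v"
  unfolding group_velocity_def
proof (intro ballI allI impI)
  fix s f assume s: "s \<in> J" and f: "smooth_at A f (inv_into U \<phi> (z s))"
  let ?p = "inv_into U \<phi> (z s)"
  have p: "?p \<in> U" "\<phi> ?p = z s" using z(1)[OF s] by (auto simp: inv_into_into f_inv_into_f)
  obtain W where W: "open W" "?p \<in> W" "smooth_on (\<phi> ` (U \<inter> W)) (f \<circ> inv_into U \<phi>)"
    using f U unfolding smooth_at_def by fastforce
  have "z s \<in> \<phi> ` (U \<inter> W)" using p W(2) by force
  then have D: "((f \<circ> inv_into U \<phi>) has_derivative frechet_derivative (f \<circ> inv_into U \<phi>) (at (z s))) (at (z s))"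
    using smooth_on_frechet_derivative(1)[OF W(3)] by blast
  let ?D = "frechet_derivative (f \<circ> inv_into U \<phi>) (at (z s))"
  interpret D: linear ?D using D has_derivative_linear by blast
  have "((\<lambda>r. (f \<circ> inv_into U \<phi>) (z r)) has_derivative (\<lambda>r. ?D (r *\<^sub>R (\<Sum>i\<in>UNIV. v s $ i *\<^sub>R \<xi> i (z s))))) (at s within J)"
    by (rule has_derivative_compose[OF z(2)[OF s, unfolded has_vector_derivative_def] D])
  moreover have "?D (r *\<^sub>R (\<Sum>i\<in>UNIV. v s $ i *\<^sub>R \<xi> i (z s))) = (\<Sum>i\<in>UNIV. v s $ i * e i f ?p) * r" for r
    by (simp add: D.scaleR D.sum \<xi>[OF p(1) f] p(2) mult.commute)
  ultimately show "((\<lambda>r. f (inv_into U \<phi> (z r))) has_real_derivative (\<Sum>i\<in>UNIV. v s $ i * e i f ?p)) (at s within J)"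
    by (simp add: has_field_derivative_def)
qed

text \<open>In charts, \<open>f (a + z)\<close> is locally the coordinate expression of
  \<open>f\<close> composed with the group operation, whose first argument is frozen at
  \<open>a\<close>; both are smooth.\<close>

lemma smooth_at_translate:
  fixes A :: "'g::topological_group_add chart set"
  assumes G: "lie_group3 A" and f: "smooth_at A f (a + p)"
  shows "smooth_at A (\<lambda>z. f (a + z)) p"
proof -
  have A: "smooth_atlas A" using G by (simp add: lie_group3_def)
  obtain W where W: "open W" "a + p \<in> W"
    "\<And>V \<psi>. (V, \<psi>) \<in> A \<Longrightarrow> smooth_on (\<psi> ` (V \<inter> W)) (f \<circ> inv_into V \<psi>)"
    using f unfolding smooth_at_def by fastforce
  define W' where "W' = (\<lambda>z. a + z) -` W"
  have W': "open W'" "p \<in> W'"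
    unfolding W'_def using W by (auto intro!: open_vimage continuous_intros)
  obtain U0 \<phi>0 where U0: "(U0, \<phi>0) \<in> A" "a \<in> U0" using atlas_chart[OF A] by metis
  note c0 = chartD[OF A U0(1)]
  show ?thesis unfolding smooth_at_def
  proof (intro exI[of _ W'] conjI W' ballI)
    fix ch assume "ch \<in> A"
    then obtain U \<phi> where ch: "ch = (U, \<phi>)" and U: "(U, \<phi>) \<in> A" by (cases ch) auto
    note c = chartD[OF A U]
    have "smooth_on (\<phi> ` (U \<inter> W')) (\<lambda>u. f (a + inv_into U \<phi> u))"
    proof (rule smooth_on_local)
      fix u0 assume u0: "u0 \<in> \<phi> ` (U \<inter> W')"
      then have u0': "inv_into U \<phi> u0 \<in> U" "inv_into U \<phi> u0 \<in> W'" using c(5) by (auto simp: inv_into_f_f)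
      obtain V \<psi> where V: "(V, \<psi>) \<in> A" "a + inv_into U \<phi> u0 \<in> V" using atlas_chart[OF A] by metis
      note cV = chartD[OF A V(1)]
      let ?m = "\<lambda>(u, v). inv_into U0 \<phi>0 u + inv_into U \<phi> v"
      let ?E = "{(u, v). u \<in> \<phi>0 ` U0 \<and> v \<in> \<phi> ` U \<and> inv_into U0 \<phi>0 u + inv_into U \<phi> v \<in> V}"
      have sm: "smooth_on ?E (\<lambda>(u, v). \<psi> (inv_into U0 \<phi>0 u + inv_into U \<phi> v))"
        using G U0(1) U V(1) unfolding lie_group3_def by fastforce
      have "continuous_on (\<phi>0 ` U0 \<times> \<phi> ` U) ?m"
        unfolding case_prod_beta
        by (intro continuous_intros continuous_on_compose2[OF c0(4)] continuous_on_compose2[OF c(4)]) auto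
      then have "open ((\<phi>0 ` U0 \<times> \<phi> ` U) \<inter> ?m -` V)"
        by (rule continuous_open_preimage) (use c0(2) c(2) cV(1) in \<open>auto intro: open_Times\<close>)
      moreover have "(\<phi>0 ` U0 \<times> \<phi> ` U) \<inter> ?m -` V = ?E" by auto
      ultimately have oE: "open ?E" by simp
      let ?T = "\<phi> ` (U \<inter> ((\<lambda>z. a + z) -` (V \<inter> W)))"
      have oT: "open ?T"
        by (rule open_chart_image[OF A U]) (use cV(1) W(1) in \<open>auto intro!: open_vimage continuous_intros\<close>)
      have T: "inv_into U \<phi> u \<in> U" "a + inv_into U \<phi> u \<in> V" "a + inv_into U \<phi> u \<in> W" "u \<in> \<phi> ` U" if "u \<in> ?T" for u
        using that c(5) by (auto simp: inv_into_f_f)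
      have a0: "inv_into U0 \<phi>0 (\<phi>0 a) = a" using U0(2) c0(5) by (simp add: inv_into_f_f)
      have L: "smooth_on ?T (\<lambda>u. \<psi> (a + inv_into U \<phi> u))"
      proof -
        have "smooth_on ?T (\<lambda>u. (\<lambda>(u, v). \<psi> (inv_into U0 \<phi>0 u + inv_into U \<phi> v)) (\<phi>0 a, u))"
          by (rule smooth_on_compose[OF oT oE _ sm])
            (use T U0(2) oT in \<open>auto simp: a0 intro!: smooth_on_Pair smooth_on_const smooth_on_ident\<close>)
        then show ?thesis by (simp add: a0)
      qed
      have "smooth_on ?T (\<lambda>u. (f \<circ> inv_into V \<psi>) (\<psi> (a + inv_into U \<phi> u)))"
        by (rule smooth_on_compose[OF oT open_chart_image[OF A V(1) W(1)] _ W(3)[OF V(1)] L]) (use T in auto)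
      then have "smooth_on ?T (\<lambda>u. f (a + inv_into U \<phi> u))"
        by (rule smooth_on_cong[OF oT, rotated]) (use T(2) cV(5) in \<open>auto simp: inv_into_f_f\<close>)
      moreover have "u0 \<in> ?T" using u0 V(2) u0' c(5) by (auto simp: W'_def inv_into_f_f)
      ultimately show "\<exists>T. open T \<and> u0 \<in> T \<and> smooth_on T (\<lambda>u. f (a + inv_into U \<phi> u))" using oT by blast
    qed
    then show "case ch of (U, \<phi>) \<Rightarrow> smooth_on (\<phi> ` (U \<inter> W')) ((\<lambda>z. f (a + z)) \<circ> inv_into U \<phi>)"
      by (simp add: ch comp_def)
  qed
qed

text \<open>Left-invariant fields do not notice a left translation, so translated curves keep their
  frame velocity. Therefore one chart at the identity serves for the end of every geodesic.\<close>

lemma group_velocity_translate: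
  fixes A :: "'g::topological_group_add chart set"
  assumes G: "lie_group3 A" and e: "\<And>i. left_invariant A (e i)" and x: "group_velocity A e J x v"
  shows "group_velocity A e J (\<lambda>s. a + x s) v"
  unfolding group_velocity_def
proof (intro ballI allI impI)
  fix s f assume s: "s \<in> J" and f: "smooth_at A f (a + x s)"
  have "e i (\<lambda>z. f (a + z)) (x s) = e i f (a + x s)" for i
    using e[of i] f unfolding left_invariant_def by blast
  then show "((\<lambda>r. f (a + x r)) has_real_derivative (\<Sum>i\<in>UNIV. v s $ i * e i f (a + x s))) (at s within J)"
    using x s smooth_at_translate[OF G f] unfolding group_velocity_def by fastforce
qed

text \<open>At speed at most \<open>M\<close> in the chart the curve covers at most the distance
  \<open>M * (b - s1) < r\<close>. As chart coordinates only make sense while the curve is in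
  \<open>U\<close>, the proof excludes a first exit time.\<close>

lemma group_curve_stays_in_chart:
  fixes A :: "'g::t2_space chart set"
  assumes A: "smooth_atlas A" and U: "(U, \<phi>) \<in> A"
    and \<xi>: "\<And>i p f. p \<in> U \<Longrightarrow> smooth_at A f p \<Longrightarrow>
      e i f p = frechet_derivative (f \<circ> inv_into U \<phi>) (at (\<phi> p)) (\<xi> i (\<phi> p))"
    and x: "group_velocity A e {s1..<b} x v" and s1: "x s1 \<in> U"
    and ball: "cball (\<phi> (x s1)) r \<subseteq> \<phi> ` U" and r: "r > 0"
    and M: "\<And>s z. s \<in> {s1..<b} \<Longrightarrow> z \<in> cball (\<phi> (x s1)) r \<Longrightarrow> norm (\<Sum>i\<in>UNIV. v s $ i *\<^sub>R \<xi> i z) \<le> M"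
    and short: "M * (b - s1) < r" "M \<ge> 0" and s: "s \<in> {s1..<b}"
  shows "x s \<in> U \<and> \<phi> (x s) \<in> cball (\<phi> (x s1)) (M * (b - s1))"
proof -
  note c = chartD[OF A U]
  let ?z0 = "\<phi> (x s1)" and ?r' = "M * (b - s1)"
  define V where "V = inv_into U \<phi> ` ball ?z0 r"
  have bU: "ball ?z0 r \<subseteq> \<phi> ` U" using ball by auto
  have VU: "V \<subseteq> U" using bU by (auto simp: V_def inv_into_into)
  have Vz: "p \<in> V \<longleftrightarrow> p \<in> U \<and> \<phi> p \<in> ball ?z0 r" for p
  proof
    assume "p \<in> V"
    then obtain z where "z \<in> ball ?z0 r" "p = inv_into U \<phi> z" by (auto simp: V_def)
    then show "p \<in> U \<and> \<phi> p \<in> ball ?z0 r" using bU by (auto simp: inv_into_into f_inv_into_f)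
  next
    assume p: "p \<in> U \<and> \<phi> p \<in> ball ?z0 r"
    then have "p = inv_into U \<phi> (\<phi> p)" using c(5) by (simp add: inv_into_f_f)
    then show "p \<in> V" unfolding V_def using p by blast
  qed
  have "V = U \<inter> \<phi> -` ball ?z0 r" by (rule set_eqI) (simp add: Vz)
  then have oV: "open V" using continuous_open_preimage[OF c(3,1)] by simp
  have xc: "continuous_on {s1..<b} x" by (rule group_velocity_continuous[OF A x])
  have key: "\<phi> (x u) \<in> cball ?z0 ?r'" if u: "u \<in> {s1..<b}" and V: "\<And>w. w \<in> {s1..u} \<Longrightarrow> x w \<in> V" for u
  proof -
    have "norm (\<phi> (x u) - \<phi> (x s1)) \<le> M * norm (u - s1)"
    proof (rule differentiable_bound[of "{s1..u}" _ "\<lambda>w y. y *\<^sub>R (\<Sum>i\<in>UNIV. v w $ i *\<^sub>R \<xi> i (\<phi> (x w)))"])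
      fix w assume w: "w \<in> {s1..u}"
      then have w': "w \<in> {s1..<b}" "x w \<in> V" using u V by auto
      have "((\<lambda>r. \<phi> (x r)) has_vector_derivative (\<Sum>i\<in>UNIV. v w $ i *\<^sub>R \<xi> i (\<phi> (x w)))) (at w within {s1..<b})"
        by (rule chart_velocity[OF A U \<xi> x w'(1)]) (use w'(2) VU in auto)
      then show "((\<lambda>r. \<phi> (x r)) has_derivative (\<lambda>y. y *\<^sub>R (\<Sum>i\<in>UNIV. v w $ i *\<^sub>R \<xi> i (\<phi> (x w))))) (at w within {s1..u})"
        unfolding has_vector_derivative_def by (rule has_derivative_subset) (use u in auto)
      have "norm (\<Sum>i\<in>UNIV. v w $ i *\<^sub>R \<xi> i (\<phi> (x w))) \<le> M"
        by (rule M[OF w'(1)]) (use w'(2) Vz in auto)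
      then show "onorm (\<lambda>y. y *\<^sub>R (\<Sum>i\<in>UNIV. v w $ i *\<^sub>R \<xi> i (\<phi> (x w)))) \<le> M"
        by (intro onorm_le) (auto simp: mult.commute[of M] intro!: mult_left_mono)
    qed (use u in auto)
    also have "\<dots> \<le> ?r'" using u short(2) by (intro mult_left_mono) auto
    finally show ?thesis by (simp add: dist_norm norm_minus_commute)
  qed
  have inV: "x u \<in> V" if u: "u \<in> {s1..<b}" for u
  proof (rule ccontr)
    assume bad: "x u \<notin> V"
    define Z where "Z = {s1..u} \<inter> x -` (- V)"
    have "continuous_on {s1..u} x" by (rule continuous_on_subset[OF xc]) (use u in auto)
    then have "closed Z" unfolding Z_def by (rule continuous_closed_preimage) (use oV in auto)
    moreover have "bounded Z" by (rule bounded_subset[of "{s1..u}"]) (auto simp: Z_def)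
    ultimately have "compact Z" by (simp add: compact_eq_bounded_closed)
    moreover have "u \<in> Z" using bad u by (auto simp: Z_def)
    ultimately obtain \<tau> where \<tau>: "\<tau> \<in> Z" "\<And>w. w \<in> Z \<Longrightarrow> \<tau> \<le> w" using compact_attains_inf[of Z] by blast
    have \<tau>': "s1 \<le> \<tau>" "\<tau> \<le> u" "x \<tau> \<notin> V" using \<tau>(1) by (auto simp: Z_def)
    have "x s1 \<in> V" using s1 r by (simp add: Vz)
    then have "s1 < \<tau>" using \<tau>' by (cases "s1 = \<tau>") auto
    have before: "x w \<in> V" if "w \<in> {s1..<\<tau>}" for w
      using that \<tau>(2)[of w] \<tau>'(2) by (force simp: Z_def)
    \<comment> \<open>The preimage of the smaller closed ball is compact, hence closed in the
      Hausdorff group, so that it still contains the curve at the supposed exit time.\<close>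
    define B where "B = inv_into U \<phi> ` cball ?z0 ?r'"
    have B: "cball ?z0 ?r' \<subseteq> \<phi> ` U" "cball ?z0 ?r' \<subseteq> ball ?z0 r" using ball short by auto
    have "compact B" unfolding B_def
      by (intro compact_continuous_image continuous_on_subset[OF c(4)] B) auto
    then have "closed B" by (rule compact_imp_closed)
    have xB: "x w \<in> B" if w: "w \<in> {s1..<\<tau>}" for w
    proof -
      have "\<phi> (x w) \<in> cball ?z0 ?r'" by (rule key) (use w u \<tau>' before in auto)
      moreover have "x w = inv_into U \<phi> (\<phi> (x w))" using before[OF w] VU c(5) by (auto simp: inv_into_f_f)
      ultimately show ?thesis unfolding B_def by blast
    qed
    have "continuous_on {s1..\<tau>} x" by (rule continuous_on_subset[OF xc]) (use u \<tau>' in auto)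
    then have "closed ({s1..\<tau>} \<inter> x -` B)" by (rule continuous_closed_preimage) (use \<open>closed B\<close> in auto)
    then have "closure {s1..<\<tau>} \<subseteq> {s1..\<tau>} \<inter> x -` B" by (rule closure_minimal[rotated]) (use xB in auto)
    then have "\<tau> \<in> {s1..\<tau>} \<inter> x -` B" using \<open>s1 < \<tau>\<close> by (auto simp: subset_iff)
    then have "x \<tau> \<in> B" by simp
    then have "x \<tau> \<in> V" using B(2) by (auto simp: B_def V_def)
    then show False using \<tau>'(3) by blast
  qed
  show ?thesis using inV[OF s] VU key[OF s] inV s by auto
qed

section \<open>Causal geodesics\<close>

lemma bounded_bilinear_matrix_vector: "bounded_bilinear ((*v) :: real^3^3 \<Rightarrow> real^3 \<Rightarrow> real^3)"
  unfolding bilinear_conv_bounded_bilinear[symmetric] bilinear_def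
  by (auto intro!: linearI)

definition spatial_part :: "(idx \<Rightarrow> real) \<Rightarrow> real^3" where
  "spatial_part u = (\<chi> i. u (Grp i))"

definition christoffel_quad :: "(3 \<Rightarrow> 3 \<Rightarrow> 3 \<Rightarrow> real) \<Rightarrow> real^3^3 \<Rightarrow> real^3^3 \<Rightarrow> real^3 \<Rightarrow> real^3" where
  "christoffel_quad c g h w = (\<chi> k. \<Sum>i\<in>UNIV. \<Sum>j\<in>UNIV. christoffel3 c g h i j k * w $ i * w $ j)"

lemma has_vector_derivative_vec3:
  fixes f :: "real \<Rightarrow> real^3"
  assumes "\<And>i. ((\<lambda>r. f r $ i) has_real_derivative f' $ i) (at s within S)"
  shows "(f has_vector_derivative f') (at s within S)"
proof -
  have "((\<lambda>r. f r $ i) has_derivative (\<lambda>w. w * f' $ i)) (at s within S)" for i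
    using assms[of i] by (simp add: has_field_derivative_def mult_commute_abs)
  then show ?thesis
    unfolding has_vector_derivative_def
    by (subst has_derivative_componentwise_within) (auto simp: Basis_vec_def inner_axis)
qed

context homogeneous_metric
begin

abbreviation "connection_quad p u d \<equiv>
  (\<Sum>a'\<in>all_idx n. \<Sum>b\<in>all_idx n. connection n e c (metric_at g \<phi>) a' b d p * u a' * u b)"

lemma connection_quadratic:
  assumes t: "t \<in> I"
  shows "connection_quad (t, x, y) u Time = spatial_part u \<bullet> (q t *v spatial_part u) + (\<Sum>K\<in>{1..n-3}. \<psi> K t * (exp (2 * \<phi> K t) * (u (Flat K))\<^sup>2))"
    "connection_quad (t, x, y) u (Grp k) = ((2 * u Time) *\<^sub>R ((h t ** q t) *v spatial_part u) + christoffel_quad c (g t) (h t) (spatial_part u)) $ k"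
    "L \<in> {1..n-3} \<Longrightarrow> connection_quad (t, x, y) u (Flat L) = 2 * \<psi> L t * u Time * u (Flat L)"
proof -
  have G: "connection_quad (t, x, y) u d = (\<Sum>a'\<in>all_idx n. \<Sum>b\<in>all_idx n. connection_comp c g h q \<phi> \<psi> t a' b d * u a' * u b)"
    if "d \<in> all_idx n" for d
    by (intro sum.cong refl) (simp add: connection_eq[OF t _ _ that])
  note d = if_distrib[of "\<lambda>x. x * _"] if_distrib[of "\<lambda>x. _ * x"]
  show "connection_quad (t, x, y) u Time = spatial_part u \<bullet> (q t *v spatial_part u) + (\<Sum>K\<in>{1..n-3}. \<psi> K t * (exp (2 * \<phi> K t) * (u (Flat K))\<^sup>2))"
    unfolding G[OF idx_mem(1)] unfolding sum_all_idx
    by (simp add: d inner_vec_def matrix_vector_mult_def spatial_part_def sum_distrib_left power2_eq_square mult_ac cong: if_cong)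
  show "connection_quad (t, x, y) u (Grp k) = ((2 * u Time) *\<^sub>R ((h t ** q t) *v spatial_part u) + christoffel_quad c (g t) (h t) (spatial_part u)) $ k"
    unfolding G[OF idx_mem(2)] unfolding sum_all_idx
    by (simp add: d matrix_vector_mult_def spatial_part_def christoffel_quad_def sum_distrib_left sum.distrib mult_ac cong: if_cong)
  show "connection_quad (t, x, y) u (Flat L) = 2 * \<psi> L t * u Time * u (Flat L)" if L: "L \<in> {1..n-3}"
    using L unfolding G[OF idx_mem(3)[THEN iffD2, OF L]] unfolding sum_all_idx
    by (simp add: d mult_ac cong: if_cong)
qed

lemma norm_sq_eq:
  assumes t: "t \<in> I"
  shows "norm_sq n (metric_at g \<phi>) (t, x, y) u = - (u Time)\<^sup>2 + (spatial_part u \<bullet> (g t *v spatial_part u)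
    + (\<Sum>K\<in>{1..n-3}. exp (2 * \<phi> K t) * (u (Flat K))\<^sup>2))"
  unfolding norm_sq_def sum_all_idx metric_at_def
  by (simp add: if_distrib[of "\<lambda>x. x * _"] cong: if_cong)
    (simp add: inner_vec_def matrix_vector_mult_def spatial_part_def sum_distrib_left power2_eq_square mult_ac)

text \<open>Serves both to read off the equations of a given geodesic and to certify a continuation
  as a geodesic; the group part becomes one vector equation, independent of charts.\<close>

lemma geodesic_iff:
  "geodesic n A e c I (metric_at g \<phi>) J \<gamma> v \<longleftrightarrow>
     is_interval J \<and> (\<exists>a\<in>J. \<exists>b\<in>J. a < b) \<and> \<gamma> ` J \<subseteq> spacetime n I \<and>
     group_velocity A e J (\<lambda>s. fst (snd (\<gamma> s))) (\<lambda>s. spatial_part (v s)) \<and>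
     (\<forall>s\<in>J. let t = fst (\<gamma> s); w = spatial_part (v s) in
       ((\<lambda>r. fst (\<gamma> r)) has_real_derivative v s Time) (at s within J) \<and>
       ((\<lambda>r. v r Time) has_real_derivative
          - (w \<bullet> (q t *v w) + (\<Sum>K\<in>{1..n-3}. \<psi> K t * (exp (2 * \<phi> K t) * (v s (Flat K))\<^sup>2)))) (at s within J) \<and>
       ((\<lambda>r. spatial_part (v r)) has_vector_derivative
          - ((2 * v s Time) *\<^sub>R ((h t ** q t) *v w) + christoffel_quad c (g t) (h t) w)) (at s within J) \<and>
       (\<forall>K\<in>{1..n-3}. ((\<lambda>r. snd (snd (\<gamma> r)) K) has_real_derivative v s (Flat K)) (at s within J) \<and>
         ((\<lambda>r. v r (Flat K)) has_real_derivative - (2 * \<psi> K t * v s Time * v s (Flat K))) (at s within J)))"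
  (is "?L \<longleftrightarrow> ?R")
proof -
  have grp: "(\<forall>i. ((\<lambda>r. v r (Grp i)) has_real_derivative f' $ i) (at s within J)) \<longleftrightarrow>
      ((\<lambda>r. spatial_part (v r)) has_vector_derivative f') (at s within J)" for f' s
  proof
    assume "\<forall>i. ((\<lambda>r. v r (Grp i)) has_real_derivative f' $ i) (at s within J)"
    then show "((\<lambda>r. spatial_part (v r)) has_vector_derivative f') (at s within J)"
      by (intro has_vector_derivative_vec3) (simp add: spatial_part_def)
  next
    assume *: "((\<lambda>r. spatial_part (v r)) has_vector_derivative f') (at s within J)"
    show "\<forall>i. ((\<lambda>r. v r (Grp i)) has_real_derivative f' $ i) (at s within J)"
      using bounded_linear.has_vector_derivative[OF bounded_linear_vec_nth *]
      by (simp add: spatial_part_def has_real_derivative_iff_has_vector_derivative)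
  qed
  have all: "(\<forall>d\<in>all_idx n. P d) \<longleftrightarrow> P Time \<and> (\<forall>i. P (Grp i)) \<and> (\<forall>K\<in>{1..n-3}. P (Flat K))" for P
    by (auto simp: all_idx_def spatial_idx_def)
  show ?thesis
  proof (cases "\<gamma> ` J \<subseteq> spacetime n I")
    case True
    have geo: "(\<forall>d\<in>all_idx n. ((\<lambda>r. v r d) has_real_derivative
           - (\<Sum>a\<in>all_idx n. \<Sum>b\<in>all_idx n. connection n e c (metric_at g \<phi>) a b d (\<gamma> s) * v s a * v s b)) (at s within J))
        \<longleftrightarrow> (let t = fst (\<gamma> s); w = spatial_part (v s) in
          ((\<lambda>r. v r Time) has_real_derivative
          - (w \<bullet> (q t *v w) + (\<Sum>K\<in>{1..n-3}. \<psi> K t * (exp (2 * \<phi> K t) * (v s (Flat K))\<^sup>2)))) (at s within J) \<and>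
       ((\<lambda>r. spatial_part (v r)) has_vector_derivative
          - ((2 * v s Time) *\<^sub>R ((h t ** q t) *v w) + christoffel_quad c (g t) (h t) w)) (at s within J) \<and>
       (\<forall>K\<in>{1..n-3}. ((\<lambda>r. v r (Flat K)) has_real_derivative - (2 * \<psi> K t * v s Time * v s (Flat K))) (at s within J)))"
      if s: "s \<in> J" for s
    proof -
      obtain t x y where p: "\<gamma> s = (t, x, y)" by (cases "\<gamma> s")
      then have t: "t \<in> I" using True s by (force simp: spacetime_def)
      show ?thesis
        unfolding all p Let_def fst_conv connection_quadratic(1,2)[OF t] grp[symmetric]
        using connection_quadratic(3)[OF t] by simp
    qed
    show ?thesis
      unfolding geodesic_def has_velocity_def group_velocity_def using geo
      by (simp add: Let_def spatial_part_def ball_conj_distrib) blast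
  qed (simp add: geodesic_def)
qed

text \<open>The momentum conjugate to a flat coordinate, whose coordinate field is Killing.\<close>

lemma flat_momentum_constant:
  assumes geo: "geodesic n A e c I (metric_at g \<phi>) J \<gamma> v" and K: "K \<in> {1..n-3}" and s: "s \<in> J" "s' \<in> J"
  shows "exp (2 * \<phi> K (fst (\<gamma> s))) * v s (Flat K) = exp (2 * \<phi> K (fst (\<gamma> s'))) * v s' (Flat K)"
proof (rule constant_on_interval[of J "\<lambda>s. exp (2 * \<phi> K (fst (\<gamma> s))) * v s (Flat K)", OF _ _ s(2,1)])
  show "is_interval J" using geo by (simp add: geodesic_def)
  fix u assume u: "u \<in> J"
  have t: "fst (\<gamma> u) \<in> I" using geo u by (force simp: geodesic_def spacetime_def)
  have 1: "((\<lambda>r. fst (\<gamma> r)) has_real_derivative v u Time) (at u within J)"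
    and 2: "((\<lambda>r. v r (Flat K)) has_real_derivative - (2 * \<psi> K (fst (\<gamma> u)) * v u Time * v u (Flat K))) (at u within J)"
    using geo u K unfolding geodesic_iff Let_def by blast+
  have "((\<lambda>r. \<phi> K (fst (\<gamma> r))) has_real_derivative \<psi> K (fst (\<gamma> u)) * v u Time) (at u within J)"
    by (rule DERIV_chain2[OF \<phi>_deriv[OF t K] 1])
  then have "((\<lambda>s. exp (2 * \<phi> K (fst (\<gamma> s))) * v s (Flat K)) has_real_derivative 0) (at u within J)"
    using 2 by (auto intro!: derivative_eq_intros)
  then show "((\<lambda>s. exp (2 * \<phi> K (fst (\<gamma> s))) * v s (Flat K)) has_vector_derivative 0) (at u within J)"
    by (simp only: has_real_derivative_iff_has_vector_derivative)
qed

end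

context vacuum_metric
begin

text \<open>Let \<open>F\<close> be an antiderivative of \<open>S\<close>. As \<open>p S\<close>
  does not increase, \<open>F(t)\<close> grows at most linearly in the affine parameter, whereas
  \<open>exp F\<close> grows at least linearly in \<open>t\<close>. So \<open>t\<close> stays below
  some \<open>t2\<close>, and \<open>S \<ge> S(t2)\<close> bounds \<open>p\<close>.\<close>

lemma geodesic_estimates:
  assumes n: "n \<le> 9" and S: "\<And>t. t \<in> I \<Longrightarrow> expansion t > 0" and unb: "\<not> bdd_above I"
    and geo: "geodesic n A e c I (metric_at g \<phi>) J \<gamma> v"
    and causal: "\<And>s. s \<in> J \<Longrightarrow> norm_sq n (metric_at g \<phi>) (\<gamma> s) (v s) \<le> 0"
    and future: "\<And>s. s \<in> J \<Longrightarrow> v s Time > 0"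
    and s0: "s0 \<in> J" and r: "\<And>s. s \<in> J \<Longrightarrow> s \<le> r"
  obtains t1 t2 R where "t1 \<in> I" "t2 \<in> I" "\<And>s. s \<in> J \<Longrightarrow> s0 \<le> s \<Longrightarrow> fst (\<gamma> s) \<in> {t1..t2}"
    "\<And>s. s \<in> J \<Longrightarrow> s0 \<le> s \<Longrightarrow> \<bar>v s Time\<bar> \<le> R" "\<And>s. s \<in> J \<Longrightarrow> s0 \<le> s \<Longrightarrow> norm (spatial_part (v s)) \<le> R"
proof -
  have J: "is_interval J" using geo by (simp add: geodesic_def)
  let ?t = "\<lambda>s. fst (\<gamma> s)" and ?w = "\<lambda>s. spatial_part (v s)"
  have tI: "?t s \<in> I" if "s \<in> J" for s using geo that by (force simp: geodesic_def spacetime_def)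
  have t': "(?t has_real_derivative v s Time) (at s within J)"
    and v': "((\<lambda>r. v r Time) has_real_derivative
          - (?w s \<bullet> (q (?t s) *v ?w s) + (\<Sum>K\<in>{1..n-3}. \<psi> K (?t s) * (exp (2 * \<phi> K (?t s)) * (v s (Flat K))\<^sup>2)))) (at s within J)"
    if "s \<in> J" for s
    using geo that unfolding geodesic_iff Let_def by blast+
  have V: "?w s \<bullet> (g (?t s) *v ?w s) + (\<Sum>K\<in>{1..n-3}. exp (2 * \<phi> K (?t s)) * (v s (Flat K))\<^sup>2) \<le> (v s Time)\<^sup>2"
    if s: "s \<in> J" for s
  proof -
    obtain t x y where p: "\<gamma> s = (t, x, y)" by (cases "\<gamma> s")
    then have t: "t \<in> I" using tI[OF s] by simp
    show ?thesis using causal[OF s] norm_sq_eq[OF t, of x y "v s"] by (simp add: p)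
  qed
  have mono: "v s Time * expansion (?t s) \<le> v s0 Time * expansion (?t s0)" if s: "s \<in> J" "s0 \<le> s" for s
  proof (rule antimono_if_deriv_nonpos[OF J _ _ s0 s])
    fix u assume u: "u \<in> J"
    let ?Q = "?w u \<bullet> (q (?t u) *v ?w u) + (\<Sum>K\<in>{1..n-3}. \<psi> K (?t u) * (exp (2 * \<phi> K (?t u)) * (v u (Flat K))\<^sup>2))"
    have "((\<lambda>s. expansion (?t s)) has_real_derivative - k_norm_sq (?t u) * v u Time) (at u within J)"
      by (rule DERIV_chain2[OF expansion_deriv[OF tI[OF u]] t'[OF u]])
    then show "((\<lambda>s. v s Time * expansion (?t s)) has_real_derivative
        - (expansion (?t u) * ?Q + k_norm_sq (?t u) * (v u Time)\<^sup>2)) (at u within J)"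
      by (auto intro!: derivative_eq_intros v'[OF u] simp: power2_eq_square algebra_simps)
    \<comment> \<open>The dimension enters here: \<open>n \<le> 9\<close> leaves at most six flat
      directions.\<close>
    have "0 \<le> expansion (?t u) * ?Q + k_norm_sq (?t u) * (?w u \<bullet> (g (?t u) *v ?w u) + (\<Sum>K\<in>{1..n-3}. exp (2 * \<phi> K (?t u)) * (v u (Flat K))\<^sup>2))"
      unfolding expansion_def k_norm_sq_def
      by (rule expansion_inequality[OF pos_def_h[OF tI[OF u]] gh[OF tI[OF u]] _ sym_q[OF tI[OF u]]])
        (use pos[OF tI[OF u]] n in \<open>auto simp: pos_def_def\<close>)
    also have "\<dots> \<le> expansion (?t u) * ?Q + k_norm_sq (?t u) * (v u Time)\<^sup>2"
      using mult_left_mono[OF V[OF u] k_norm_sq_nonneg[OF tI[OF u]]] by linarith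
    finally show "- (expansion (?t u) * ?Q + k_norm_sq (?t u) * (v u Time)\<^sup>2) \<le> 0" by linarith
  qed
  define u0 where "u0 = v s0 Time * expansion (?t s0)"
  have u0: "u0 > 0" using future[OF s0] S[OF tI[OF s0]] by (simp add: u0_def)
  let ?t1 = "?t s0"
  obtain F where F: "\<And>t. t \<in> I \<Longrightarrow> (F has_real_derivative expansion t) (at t)"
    using antiderivative_open_interval[OF open_I interval_I expansion_continuous] by blast
  have F_le: "F (?t s) \<le> F ?t1 + u0 * (r - s0)" if s: "s \<in> J" "s0 \<le> s" for s
  proof -
    let ?J = "J \<inter> {s0..}"
    have "F (?t s) - u0 * s \<le> F (?t s0) - u0 * s0"
    proof (rule antimono_if_deriv_nonpos[of ?J "\<lambda>s. F (?t s) - u0 * s" "\<lambda>s. expansion (?t s) * v s Time - u0"])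
      fix u assume u: "u \<in> ?J"
      have "((\<lambda>s. F (?t s)) has_real_derivative expansion (?t u) * v u Time) (at u within ?J)"
        using DERIV_chain2[OF F[OF tI] t'] u DERIV_subset[of _ _ u J ?J] by blast
      then show "((\<lambda>s. F (?t s) - u0 * s) has_real_derivative expansion (?t u) * v u Time - u0) (at u within ?J)"
        by (auto intro!: derivative_eq_intros)
      show "expansion (?t u) * v u Time - u0 \<le> 0" using mono[of u] u by (simp add: u0_def mult.commute)
    qed (use is_interval_Int[OF J is_interval_ci[of s0]] s s0 in auto)
    moreover have "u0 * s \<le> u0 * r" using r[OF s(1)] u0 by simp
    ultimately show ?thesis unfolding right_diff_distrib by linarith
  qed
  have t_mono: "?t1 \<le> ?t s" if s: "s \<in> J" "s0 \<le> s" for s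
    by (rule mono_if_deriv_nonneg[OF J t' _ s0 s]) (use future in \<open>auto simp: less_imp_le\<close>)
  define k where "k = expansion ?t1 * exp (F ?t1)"
  have k: "k > 0" using S[OF tI[OF s0]] by (simp add: k_def)
  have grow: "k * (t - ?t1) \<le> exp (F t)" if t: "t \<in> I" "?t1 \<le> t" for t
  proof -
    let ?J = "I \<inter> {?t1..}"
    have "exp (F ?t1) - k * ?t1 \<le> exp (F t) - k * t"
    proof (rule mono_if_deriv_nonneg[of ?J "\<lambda>t. exp (F t) - k * t" "\<lambda>t. exp (F t) * expansion t - k"])
      fix u assume u: "u \<in> ?J"
      then have "((\<lambda>t. exp (F t) - k * t) has_real_derivative exp (F u) * expansion u - k) (at u)"
        by (auto intro!: derivative_eq_intros F)
      then show "((\<lambda>t. exp (F t) - k * t) has_real_derivative exp (F u) * expansion u - k) (at u within ?J)"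
        by (rule has_field_derivative_at_within)
      show "0 \<le> exp (F u) * expansion u - k"
        using expansion_lower_bound[of F ?t1 u] F tI[OF s0] u by (simp add: k_def mult.commute)
    qed (use is_interval_Int[OF interval_I is_interval_ci[of ?t1]] t tI[OF s0] in auto)
    moreover have "0 < exp (F ?t1)" by simp
    ultimately show ?thesis by (simp add: right_diff_distrib del: exp_gt_zero)
  qed
  \<comment> \<open>The time at which the linear lower bound \<open>k * (t - ?t1)\<close> for
    \<open>exp F\<close> reaches the upper bound that \<open>F_le\<close> provides.\<close>
  define t2 where "t2 = ?t1 + exp (F ?t1 + u0 * (r - s0)) / k"
  have t_le: "?t s \<le> t2" if s: "s \<in> J" "s0 \<le> s" for s
  proof -
    have "k * (?t s - ?t1) \<le> exp (F (?t s))" by (rule grow[OF tI[OF s(1)] t_mono[OF s]])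
    also have "\<dots> \<le> exp (F ?t1 + u0 * (r - s0))" using F_le[OF s] by simp
    finally show ?thesis using k by (simp add: t2_def field_simps)
  qed
  \<comment> \<open>\<open>t2\<close> belongs to \<open>I\<close> because \<open>I\<close> is an
    interval that is unbounded above.\<close>
  obtain t3 where "t3 \<in> I" "t2 < t3" using unb unfolding bdd_above_def by (meson not_le)
  moreover have "?t1 \<le> t2" using k by (simp add: t2_def)
  ultimately have t2: "t2 \<in> I" using interval_Icc_subset[OF interval_I tI[OF s0]] by fastforce
  have sub: "{?t1..t2} \<subseteq> I" by (rule interval_Icc_subset[OF interval_I tI[OF s0] t2])
  define R0 where "R0 = u0 / expansion t2"
  have v_le: "v s Time \<le> R0" if s: "s \<in> J" "s0 \<le> s" for s
  proof -
    have "expansion t2 \<le> expansion (?t s)" by (rule expansion_antimono[OF tI[OF s(1)] t2 t_le[OF s]])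
    then have "v s Time * expansion t2 \<le> v s Time * expansion (?t s)"
      using future[OF s(1)] by (intro mult_left_mono) auto
    also have "\<dots> \<le> u0" using mono[OF s] by (simp add: u0_def)
    finally have "v s Time * expansion t2 \<le> u0" .
    then show ?thesis using S[OF t2] by (simp add: R0_def field_simps)
  qed
  \<comment> \<open>Compactness of the time interval and of the unit sphere gives a lower bound for
    the metric that is uniform in \<open>t\<close>.\<close>
  obtain m where m: "m > 0" "\<And>t w. t \<in> {?t1..t2} \<Longrightarrow> m * (w \<bullet> w) \<le> w \<bullet> (g t *v w)"
  proof -
    let ?D = "{?t1..t2} \<times> sphere (0 :: real^3) 1" and ?f = "\<lambda>(t, w). w \<bullet> (g t *v w)"
    have "continuous_on {?t1..t2} g"
      using g_deriv sub by (intro continuous_at_imp_continuous_on ballI has_vector_derivative_continuous) blast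
    then have "continuous_on ?D ?f"
      unfolding case_prod_beta
      by (intro continuous_intros bounded_bilinear.continuous_on[OF bounded_bilinear_matrix_vector]
          continuous_on_compose2[of "{?t1..t2}" g _ fst]) auto
    moreover have "compact ?D" by (intro compact_Times) auto
    moreover have "(?t1, axis 1 1) \<in> ?D" using \<open>?t1 \<le> t2\<close> by (simp add: norm_axis_1)
    ultimately obtain p where p: "p \<in> ?D" "\<And>x. x \<in> ?D \<Longrightarrow> ?f p \<le> ?f x"
      using continuous_attains_inf[of ?D ?f] by blast
    obtain t0 w0 where tw: "p = (t0, w0)" "t0 \<in> {?t1..t2}" "norm w0 = 1" using p(1) by auto
    then have "w0 \<noteq> 0" by auto
    then have "?f p > 0" using pos[of t0] sub tw by (auto simp: pos_def_def)
    moreover have "?f p * (w \<bullet> w) \<le> w \<bullet> (g t *v w)" if t: "t \<in> {?t1..t2}" for t w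
    proof (cases "w = 0")
      case False
      let ?n = "norm w"
      have "?f p \<le> ?f (t, w /\<^sub>R ?n)" by (rule p(2)) (use t False in simp)
      also have "\<dots> = (w \<bullet> (g t *v w)) / ?n\<^sup>2" by (simp add: power2_eq_square field_simps)
      finally show ?thesis using False by (simp add: field_simps dot_square_norm)
    qed simp
    ultimately show thesis using that by blast
  qed
  have w_le: "norm (?w s) \<le> R0\<^sup>2 / m + 1" if s: "s \<in> J" "s0 \<le> s" for s
  proof -
    have "m * (?w s \<bullet> ?w s) \<le> ?w s \<bullet> (g (?t s) *v ?w s)"
      by (rule m(2)) (use t_mono[OF s] t_le[OF s] in simp)
    also have "\<dots> \<le> (v s Time)\<^sup>2"
      using V[OF s(1)] sum_nonneg[of "{1..n-3}" "\<lambda>K. exp (2 * \<phi> K (?t s)) * (v s (Flat K))\<^sup>2"] by simp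
    also have "\<dots> \<le> R0\<^sup>2" using v_le[OF s] future[OF s(1)] by (intro power_mono) auto
    finally have "(norm (?w s))\<^sup>2 \<le> R0\<^sup>2 / m" using m(1) by (simp add: dot_square_norm field_simps)
    \<comment> \<open>The inequality \<open>2 x \<le> x^2 + 1\<close> takes the place of a square
      root.\<close>
    moreover have "2 * norm (?w s) \<le> (norm (?w s))\<^sup>2 + 1"
      using sum_squares_ge_zero[of "norm (?w s) - 1" 0] by (simp add: power2_eq_square algebra_simps)
    moreover have "0 \<le> R0\<^sup>2 / m" using m(1) by simp
    ultimately show ?thesis by simp
  qed
  have R0: "R0 \<ge> 0" using v_le[OF s0] future[OF s0] by simp
  show thesis
  proof (rule that[OF tI[OF s0] t2, of "R0 + (R0\<^sup>2 / m + 1)"])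
    fix s assume s: "s \<in> J" "s0 \<le> s"
    show "fst (\<gamma> s) \<in> {?t1..t2}" using t_mono[OF s] t_le[OF s] by simp
    have "0 \<le> R0\<^sup>2 / m" using m(1) by simp
    then show "\<bar>v s Time\<bar> \<le> R0 + (R0\<^sup>2 / m + 1)" using v_le[OF s] future[OF s(1)] by simp
    show "norm (?w s) \<le> R0 + (R0\<^sup>2 / m + 1)" using w_le[OF s] R0 by simp
  qed
qed

end

section \<open>Gluing and continuing geodesics\<close>

lemma has_real_derivative_glue_left:
  assumes sub: "{s1..<s2} \<subseteq> J" and s: "s < s2" "s \<in> J" and f: "(f has_real_derivative D) (at s within J)"
  shows "((\<lambda>r. if r < s2 then f r else g r) has_real_derivative D) (at s within J \<union> {s1..b'})"
proof -
  have "at s within J \<union> {s1..b'} = at s within J"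
    by (rule at_within_nhd[of s "{..<s2}"]) (use s sub in auto)
  moreover have "((\<lambda>r. if r < s2 then f r else g r) has_real_derivative D) (at s within J)"
    by (rule has_field_derivative_transform_within[OF f, of "s2 - s"]) (use s in \<open>auto simp: dist_real_def\<close>)
  ultimately show ?thesis by simp
qed

lemma has_real_derivative_glue_right:
  assumes eq: "\<And>r. r \<in> J \<Longrightarrow> s1 \<le> r \<Longrightarrow> f r = g r" and J: "J \<subseteq> {..b'}" "{s1..<s2} \<subseteq> J" and s: "s1 < s2" "s2 \<le> s" "s \<le> b'"
    and g: "(g has_real_derivative D) (at s within {s1..b'})"
  shows "((\<lambda>r. if r < s2 then f r else g r) has_real_derivative D) (at s within J \<union> {s1..b'})"
proof -
  have "at s within J \<union> {s1..b'} = at s within {s1..b'}"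
    by (rule at_within_nhd[of s "{s1<..}"]) (use s J in auto)
  moreover have "((\<lambda>r. if r < s2 then f r else g r) has_real_derivative D) (at s within {s1..b'})"
    by (rule has_field_derivative_transform_within[OF g, of 1]) (use s eq J(2) in auto)
  ultimately show ?thesis by simp
qed

text \<open>The switch at \<open>s2\<close> happens inside the overlap: to the right of
  \<open>s1\<close> the curves agree wherever both are defined, so that near each parameter the
  glued curve coincides with one of the two.\<close>

lemma geodesic_glue:
  assumes geo: "geodesic n A e c I h J \<gamma> v" "geodesic n A e c I h {s1..b'} \<gamma>Y vY"
    and sub: "{s1..<s2} \<subseteq> J" "s1 < s2" "J \<subseteq> {..b'}" "s2 \<le> b'"
    and eq: "\<And>r. r \<in> J \<Longrightarrow> s1 \<le> r \<Longrightarrow> \<gamma> r = \<gamma>Y r" "\<And>r d. r \<in> J \<Longrightarrow> s1 \<le> r \<Longrightarrow> d \<in> all_idx n \<Longrightarrow> v r d = vY r d"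
  shows "geodesic n A e c I h (J \<union> {s1..b'}) (\<lambda>r. if r < s2 then \<gamma> r else \<gamma>Y r) (\<lambda>r. if r < s2 then v r else vY r)"
proof -
  let ?J = "J \<union> {s1..b'}" and ?\<gamma> = "\<lambda>r. if r < s2 then \<gamma> r else \<gamma>Y r" and ?v = "\<lambda>r. if r < s2 then v r else vY r"
  have J: "is_interval J" "\<exists>a\<in>J. \<exists>b\<in>J. a < b" using geo(1) by (auto simp: geodesic_def)
  have iJ: "is_interval ?J"
  proof -
    have "s1 \<in> J \<inter> {s1..b'}" using sub by auto
    then have "connected ?J"
      using J(1) by (intro connected_Un) (auto simp: is_interval_connected_1)
    then show ?thesis by (simp add: is_interval_connected_1)
  qed
  have cases: "(s < s2 \<and> s \<in> J) \<or> (s2 \<le> s \<and> s \<le> b' \<and> s \<in> {s1..b'})" if "s \<in> ?J" for s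
    using that sub by force
  have D: "((\<lambda>r. F (?\<gamma> r) (?v r)) has_real_derivative (if s < s2 then D1 else D2)) (at s within ?J)"
    if s: "s \<in> ?J" and d1: "s < s2 \<Longrightarrow> s \<in> J \<Longrightarrow> ((\<lambda>r. F (\<gamma> r) (v r)) has_real_derivative D1) (at s within J)"
      and d2: "s \<in> {s1..b'} \<Longrightarrow> s2 \<le> s \<Longrightarrow> ((\<lambda>r. F (\<gamma>Y r) (vY r)) has_real_derivative D2) (at s within {s1..b'})"
      and F: "\<And>r. r \<in> J \<Longrightarrow> s1 \<le> r \<Longrightarrow> F (\<gamma> r) (v r) = F (\<gamma>Y r) (vY r)" for s F D1 D2
  proof -
    have e: "(\<lambda>r. F (?\<gamma> r) (?v r)) = (\<lambda>r. if r < s2 then F (\<gamma> r) (v r) else F (\<gamma>Y r) (vY r))" by auto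
    show ?thesis using cases[OF s]
    proof
      assume c: "s < s2 \<and> s \<in> J"
      show ?thesis unfolding e
        using has_real_derivative_glue_left[OF sub(1) _ _ d1] c by simp
    next
      assume c: "s2 \<le> s \<and> s \<le> b' \<and> s \<in> {s1..b'}"
      show ?thesis unfolding e
        using has_real_derivative_glue_right[OF F sub(3,1,2) _ _ d2] c by simp
    qed
  qed
  have sp: "?\<gamma> ` ?J \<subseteq> spacetime n I"
  proof
    fix p assume "p \<in> ?\<gamma> ` ?J"
    then obtain s where "s \<in> ?J" "p = ?\<gamma> s" by blast
    then show "p \<in> spacetime n I" using cases[of s] geo by (auto simp: geodesic_def image_subset_iff)
  qed
  have vel: "has_velocity n A e ?J ?\<gamma> ?v"
    unfolding has_velocity_def
  proof (intro ballI conjI allI impI)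
    fix s assume s: "s \<in> ?J"
    show "((\<lambda>r. fst (?\<gamma> r)) has_real_derivative ?v s Time) (at s within ?J)"
      using D[OF s, of "\<lambda>p u. fst p" "v s Time" "vY s Time"] geo eq(1)
      by (auto simp: geodesic_def has_velocity_def split: if_splits)
    show "((\<lambda>r. snd (snd (?\<gamma> r)) K) has_real_derivative ?v s (Flat K)) (at s within ?J)" if K: "K \<in> {1..n-3}" for K
      using D[OF s, of "\<lambda>p u. snd (snd p) K" "v s (Flat K)" "vY s (Flat K)"] geo eq(1) K
      by (auto simp: geodesic_def has_velocity_def split: if_splits)
    fix f assume f: "smooth_at A f (fst (snd (?\<gamma> s)))"
    show "((\<lambda>r. f (fst (snd (?\<gamma> r)))) has_real_derivative
        (\<Sum>i\<in>UNIV. ?v s (Grp i) * e i f (fst (snd (?\<gamma> s))))) (at s within ?J)"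
      using D[OF s, of "\<lambda>p u. f (fst (snd p))" "\<Sum>i\<in>UNIV. v s (Grp i) * e i f (fst (snd (\<gamma> s)))"
          "\<Sum>i\<in>UNIV. vY s (Grp i) * e i f (fst (snd (\<gamma>Y s)))"] geo eq(1) f
      by (auto simp: geodesic_def has_velocity_def split: if_splits)
  qed
  have acc: "((\<lambda>r. ?v r d) has_real_derivative
      - (\<Sum>a\<in>all_idx n. \<Sum>b\<in>all_idx n. connection n e c h a b d (?\<gamma> s) * ?v s a * ?v s b)) (at s within ?J)"
    if s: "s \<in> ?J" and d: "d \<in> all_idx n" for s d
    using D[OF s, of "\<lambda>p u. u d" "- (\<Sum>a\<in>all_idx n. \<Sum>b\<in>all_idx n. connection n e c h a b d (\<gamma> s) * v s a * v s b)"
          "- (\<Sum>a\<in>all_idx n. \<Sum>b\<in>all_idx n. connection n e c h a b d (\<gamma>Y s) * vY s a * vY s b)"] geo eq(2) d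
    by (auto simp: geodesic_def split: if_splits)
  show ?thesis
    unfolding geodesic_def using iJ J(2) sp vel acc by blast
qed

text \<open>For parameter intervals that contain their right end point, agreement there follows by
  continuity.\<close>

lemma eq_at_right_end:
  fixes f g :: "real \<Rightarrow> 'b::t2_space"
  assumes "s1 < b" "continuous_on {s1..b} f" "continuous_on {s1..b} g" "\<And>s. s \<in> {s1..<b} \<Longrightarrow> f s = g s"
  shows "f b = g b"
proof -
  have ne: "at b within {s1..<b} \<noteq> bot"
    using assms(1) by (simp add: trivial_limit_within islimpt_Ico at_within_eq_bot_iff)
  have lim: "(F \<longlongrightarrow> F b) (at b within {s1..<b})" if "continuous_on {s1..b} F" for F :: "real \<Rightarrow> 'b"
  proof (rule tendsto_within_subset)
    show "(F \<longlongrightarrow> F b) (at b within {s1..b})" using that assms(1) by (simp add: continuous_on_def)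
  qed auto
  have "eventually (\<lambda>s. f s = g s) (at b within {s1..<b})"
    unfolding eventually_at_filter using assms(4) by auto
  then have "(f \<longlongrightarrow> g b) (at b within {s1..<b})"
    using lim[OF assms(3)] by (simp only: tendsto_cong)
  then show ?thesis by (rule tendsto_unique[OF ne lim[OF assms(2)]])
qed

text \<open>The state consists of \<open>t\<close>, \<open>dt/ds\<close>, the frame velocity
  \<open>w\<close> and the chart coordinates \<open>z\<close> of the group point. The flat
  velocities are determined by the conserved momenta and enter through \<open>\<rho> t\<close>
  alone; the flat coordinates are recovered by integration.\<close>

definition geodesic_field :: "(3 \<Rightarrow> 3 \<Rightarrow> 3 \<Rightarrow> real) \<Rightarrow> (real \<Rightarrow> real^3^3) \<Rightarrow> (real \<Rightarrow> real^3^3) \<Rightarrow> (real \<Rightarrow> real^3^3) \<Rightarrow>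
  (real \<Rightarrow> real) \<Rightarrow> (3 \<Rightarrow> real^3 \<Rightarrow> real^3) \<Rightarrow> real \<times> real \<times> (real^3) \<times> (real^3) \<Rightarrow> real \<times> real \<times> (real^3) \<times> (real^3)" where
  "geodesic_field c g h q \<rho> \<xi> = (\<lambda>(t, u, w, z). (u, - (w \<bullet> (q t *v w) + \<rho> t),
     - ((2 * u) *\<^sub>R ((h t ** q t) *v w) + christoffel_quad c (g t) (h t) w), \<Sum>i\<in>UNIV. w $ i *\<^sub>R \<xi> i z))"

lemma smooth_on_christoffel3:
  assumes "open S" "smooth_on S G" "smooth_on S H"
  shows "smooth_on S (\<lambda>x. christoffel3 c (G x) (H x) i j k)"
  unfolding christoffel3_def divide_inverse
  by (intro smooth_on_mult smooth_on_sum smooth_on_diff smooth_on_nth smooth_on_const assms)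

lemma smooth_geodesic_field:
  assumes I: "open I" and D: "open D" and "smooth_on I g" "smooth_on I h" "smooth_on I q" "smooth_on I \<rho>" "\<And>i. smooth_on D (\<xi> i)"
  shows "smooth_on (I \<times> UNIV \<times> UNIV \<times> D) (geodesic_field c g h q \<rho> \<xi>)"
proof -
  let ?O = "I \<times> (UNIV :: real set) \<times> (UNIV :: (real^3) set) \<times> D"
  have O: "open ?O" by (intro open_Times I D open_UNIV)
  have T: "smooth_on ?O (\<lambda>X. f (fst X))" if "smooth_on I f" for f :: "real \<Rightarrow> 'b::real_normed_vector"
    by (rule smooth_on_compose[OF O I _ that]) (auto intro!: smooth_on_fst smooth_on_ident O)
  have Z: "smooth_on ?O (\<lambda>X. \<xi> i (snd (snd (snd X))))" for i
    by (rule smooth_on_compose[OF O D _ assms(7)]) (auto intro!: smooth_on_snd smooth_on_ident O)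
  show ?thesis
    unfolding geodesic_field_def case_prod_beta christoffel_quad_def
    by (intro smooth_on_Pair smooth_on_minus smooth_on_add smooth_on_scaleR smooth_on_mult smooth_on_vec_lambda smooth_on_sum
        smooth_on_bilinear[OF bounded_bilinear_inner] smooth_on_bilinear[OF bounded_bilinear_matrix_vector]
        smooth_on_matrix_mult smooth_on_christoffel3 smooth_on_nth T Z smooth_on_fst smooth_on_snd smooth_on_ident smooth_on_const O assms)
qed

text \<open>A bounded affine parameter confines the state to a compact set: time, energy and
  velocity by \<open>geodesic_estimates\<close>, the group point by translation into a chart and by
  the shortness of the remaining parameter interval.\<close>

lemma geodesic_extendible:
  fixes A :: "'g::{topological_group_add, t2_space} chart set"
  assumes vm: "vacuum_metric n A e c I g h q q' \<phi> \<psi> \<psi>'"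
    and G: "lie_group3 A" and inv: "\<And>i. left_invariant A (e i)"
    and smooth: "smooth_on I g" "smooth_on I h" "smooth_on I q"
      "\<And>K. K \<in> {1..n-3} \<Longrightarrow> smooth_on I (\<phi> K)" "\<And>K. K \<in> {1..n-3} \<Longrightarrow> smooth_on I (\<psi> K)"
    and n: "n \<le> 9" and S: "\<And>t. t \<in> I \<Longrightarrow> homogeneous_metric.expansion n h q \<psi> t > 0" and unb: "\<not> bdd_above I"
    and geo: "geodesic n A e c I (metric_at g \<phi>) J \<gamma> v"
    and causal: "\<And>s. s \<in> J \<Longrightarrow> norm_sq n (metric_at g \<phi>) (\<gamma> s) (v s) \<le> 0"
    and future: "\<And>s. s \<in> J \<Longrightarrow> v s Time > 0" and bdd: "\<And>s. s \<in> J \<Longrightarrow> s \<le> r"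
  shows "\<not> future_inextendible n A e c I (metric_at g \<phi>) J \<gamma>"
proof -
  interpret vacuum_metric n A e c I g h q q' \<phi> \<psi> \<psi>' by (rule vm)
  have at: "smooth_atlas A" using G by (simp add: lie_group3_def)
  have J: "is_interval J" and sp: "\<gamma> ` J \<subseteq> spacetime n I" using geo by (auto simp: geodesic_def)
  obtain a0 b0 where ab0: "a0 \<in> J" "b0 \<in> J" "a0 < b0" using geo by (auto simp: geodesic_def)
  define b where "b = Sup J"
  have bJ: "bdd_above J" using bdd by (auto simp: bdd_above_def)
  have le_b: "s \<le> b" if "s \<in> J" for s unfolding b_def by (rule cSup_upper[OF that bJ])
  have a0b: "a0 < b" using le_b[OF ab0(2)] ab0 by simp
  have mem: "s \<in> J" if s: "a0 \<le> s" "s < b" for s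
  proof -
    obtain u where "u \<in> J" "s < u" using s(2) ab0(1) bJ less_cSup_iff[of J s] by (auto simp: b_def)
    then show ?thesis using interval_Icc_subset[OF J ab0(1) \<open>u \<in> J\<close>] s(1) by auto
  qed
  obtain t1 t2 R where t12: "t1 \<in> I" "t2 \<in> I" and est: "\<And>s. s \<in> J \<Longrightarrow> a0 \<le> s \<Longrightarrow> fst (\<gamma> s) \<in> {t1..t2}"
    "\<And>s. s \<in> J \<Longrightarrow> a0 \<le> s \<Longrightarrow> \<bar>v s Time\<bar> \<le> R" "\<And>s. s \<in> J \<Longrightarrow> a0 \<le> s \<Longrightarrow> norm (spatial_part (v s)) \<le> R"
    using geodesic_estimates[OF n S unb geo causal future ab0(1) bdd] by metis
  have R: "R \<ge> 0" using est(2)[OF ab0(1)] by simp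
  obtain U \<kappa> where U: "(U, \<kappa>) \<in> A" "0 \<in> U" using atlas_chart[OF at] by metis
  note ch = chartD[OF at U(1)]
  have "\<exists>\<xi>. smooth_on (\<kappa> ` U) \<xi> \<and> (\<forall>p\<in>U. \<forall>f. smooth_at A f p \<longrightarrow>
      e i f p = frechet_derivative (f \<circ> inv_into U \<kappa>) (at (\<kappa> p)) (\<xi> (\<kappa> p)))" for i
    using field[of i] U(1) unfolding smooth_vector_field_def by fastforce
  then obtain \<xi> where \<xi>s: "\<And>i. smooth_on (\<kappa> ` U) (\<xi> i)"
    and \<xi>: "\<And>i p f. p \<in> U \<Longrightarrow> smooth_at A f p \<Longrightarrow>
      e i f p = frechet_derivative (f \<circ> inv_into U \<kappa>) (at (\<kappa> p)) (\<xi> i (\<kappa> p))" by metis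
  let ?z0 = "\<kappa> 0"
  obtain rr where rr: "rr > 0" "cball ?z0 rr \<subseteq> \<kappa> ` U"
    using ch(2) U(2) open_contains_cball by (metis imageI)
  have "\<exists>B. \<forall>z\<in>cball ?z0 rr. norm (\<xi> i z) \<le> B" for i
  proof -
    have "bounded (\<xi> i ` cball ?z0 rr)"
      by (intro compact_imp_bounded compact_continuous_image compact_cball
          continuous_on_subset[OF smooth_on_imp_continuous_on[OF \<xi>s] rr(2)])
    then show ?thesis unfolding bounded_iff by blast
  qed
  then obtain B where B: "\<And>i z. z \<in> cball ?z0 rr \<Longrightarrow> norm (\<xi> i z) \<le> B i" by metis
  have B0: "B i \<ge> 0" for i using B[of ?z0 i] rr(1) order_trans[OF norm_ge_zero] by simp
  define M where "M = R * (\<Sum>i\<in>UNIV. B i)"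
  have M0: "M \<ge> 0" unfolding M_def using R B0 by (intro mult_nonneg_nonneg sum_nonneg) auto
  \<comment> \<open>So close to \<open>b\<close> that a curve of speed at most \<open>M\<close>
    travels less than \<open>rr\<close> until \<open>b\<close>; \<open>M + 1\<close> avoids a
    division by zero.\<close>
  define s1 where "s1 = max a0 (b - rr / (2 * (M + 1)))"
  have s1: "a0 \<le> s1" "s1 < b" using a0b rr(1) M0 by (auto simp: s1_def)
  have short: "M * (b - s1) < rr"
  proof -
    have "M * (b - s1) \<le> (M + 1) * (rr / (2 * (M + 1)))"
      using M0 s1 by (intro mult_mono) (auto simp: s1_def)
    also have "\<dots> < rr" using rr(1) M0 by (simp add: field_simps add_pos_nonneg)
    finally show ?thesis .
  qed
  have in_J: "s \<in> J" if "s \<in> {s1..<b}" for s using that mem s1 by auto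
  have s1J: "s1 \<in> J" using in_J s1 by simp
  define x where "x s = fst (snd (\<gamma> s))" for s
  define w where "w s = spatial_part (v s)" for s
  define t where "t s = fst (\<gamma> s)" for s
  have gvel: "group_velocity A e J x w" using geo unfolding geodesic_iff x_def w_def by blast
  have eqs: "(t has_real_derivative v s Time) (at s within J)"
      "((\<lambda>r. v r Time) has_real_derivative - (w s \<bullet> (q (t s) *v w s)
         + (\<Sum>K\<in>{1..n-3}. \<psi> K (t s) * (exp (2 * \<phi> K (t s)) * (v s (Flat K))\<^sup>2)))) (at s within J)"
      "(w has_vector_derivative - ((2 * v s Time) *\<^sub>R ((h (t s) ** q (t s)) *v w s) + christoffel_quad c (g (t s)) (h (t s)) (w s))) (at s within J)"
      "\<And>K. K \<in> {1..n-3} \<Longrightarrow> ((\<lambda>r. snd (snd (\<gamma> r)) K) has_real_derivative v s (Flat K)) (at s within J)"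
    if "s \<in> J" for s
    using geo that unfolding geodesic_iff Let_def t_def[abs_def] w_def[abs_def] by blast+
  define p where "p K = exp (2 * \<phi> K (t s1)) * v s1 (Flat K)" for K
  have flat: "v s (Flat K) = p K * exp (- 2 * \<phi> K (t s))" if K: "K \<in> {1..n-3}" and s: "s \<in> J" for K s
  proof -
    have "p K = exp (2 * \<phi> K (t s)) * v s (Flat K)"
      unfolding p_def t_def by (rule flat_momentum_constant[OF geo K s1J s])
    then show ?thesis by (simp add: exp_minus)
  qed
  \<comment> \<open>The translated curve starts at the identity, which is the centre of the chosen
    chart ball.\<close>
  define X where "X s = - x s1 + x s" for s
  have Xvel: "group_velocity A e {s1..<b} X w"
  proof -
    have "group_velocity A e {s1..<b} x w"
      unfolding group_velocity_def
    proof (intro ballI allI impI)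
      fix s f assume s: "s \<in> {s1..<b}" and f: "smooth_at A f (x s)"
      have "((\<lambda>r. f (x r)) has_real_derivative (\<Sum>i\<in>UNIV. w s $ i * e i f (x s))) (at s within J)"
        using gvel in_J[OF s] f unfolding group_velocity_def by blast
      then show "((\<lambda>r. f (x r)) has_real_derivative (\<Sum>i\<in>UNIV. w s $ i * e i f (x s))) (at s within {s1..<b})"
        by (rule DERIV_subset) (use in_J in auto)
    qed
    then show ?thesis unfolding X_def by (rule group_velocity_translate[OF G inv])
  qed
  have X0: "X s1 = 0" by (simp add: X_def)
  have speed: "norm (\<Sum>i\<in>UNIV. w s $ i *\<^sub>R \<xi> i z) \<le> M" if s: "s \<in> {s1..<b}" and z: "z \<in> cball (\<kappa> (X s1)) rr" for s z
  proof -
    have "norm (\<Sum>i\<in>UNIV. w s $ i *\<^sub>R \<xi> i z) \<le> (\<Sum>i\<in>UNIV. R * B i)"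
    proof (rule sum_norm_le)
      fix i
      have "\<bar>w s $ i\<bar> \<le> R" using component_le_norm_cart[of "w s" i] est(3)[OF in_J[OF s]] s s1 by (simp add: w_def)
      then show "norm (w s $ i *\<^sub>R \<xi> i z) \<le> R * B i"
        using B[of z i] z R by (simp add: X0 mult_mono)
    qed
    then show ?thesis by (simp add: M_def sum_distrib_left)
  qed
  have stay: "X s \<in> U \<and> \<kappa> (X s) \<in> cball ?z0 (M * (b - s1))" if s: "s \<in> {s1..<b}" for s
    using group_curve_stays_in_chart[OF at U(1) \<xi> Xvel _ _ rr(1) speed short M0 s] rr(2) U(2) by (simp add: X0)
  define \<rho> where "\<rho> t = (\<Sum>K\<in>{1..n-3}. \<psi> K t * (exp (2 * \<phi> K t) * (p K * exp (- 2 * \<phi> K t))\<^sup>2))" for t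
  have \<rho>s: "smooth_on I \<rho>"
  proof -
    have E: "smooth_on I (\<lambda>t. exp (k * \<phi> K t))" if "K \<in> {1..n-3}" for K k
      by (rule smooth_on_compose[OF open_I open_UNIV _ smooth_on_exp[OF open_UNIV]])
        (auto intro!: smooth_on_mult smooth_on_const smooth(4) open_I that simp: that[simplified])
    show ?thesis unfolding \<rho>_def power2_eq_square
      by (intro smooth_on_sum smooth_on_mult smooth_on_const E smooth(5) open_I)
  qed
  let ?O = "I \<times> (UNIV :: real set) \<times> (UNIV :: (real^3) set) \<times> \<kappa> ` U"
  let ?F = "geodesic_field c g h q \<rho> \<xi>"
  have O: "open ?O" by (intro open_Times open_I open_UNIV ch(2))
  have Fs: "smooth_on ?O ?F" by (rule smooth_geodesic_field[OF open_I ch(2) smooth(1-3) \<rho>s \<xi>s])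
  let ?K = "{t1..t2} \<times> cball (0::real) R \<times> cball (0::real^3) R \<times> cball ?z0 (M * (b - s1))"
  have K: "compact ?K" "?K \<subseteq> ?O"
    using interval_Icc_subset[OF interval_I t12] rr(2) short by (auto intro!: compact_Times)
  define Z where "Z s = (t s, v s Time, w s, \<kappa> (X s))" for s
  have ZK: "Z s \<in> ?K" if s: "s \<in> {s1..<b}" for s
    using est[OF in_J[OF s]] stay[OF s] s s1 by (simp add: Z_def t_def w_def dist_norm)
  have Z': "(Z has_vector_derivative ?F (Z s)) (at s within {s1..<b})" if s: "s \<in> {s1..<b}" for s
  proof -
    have sub: "{s1..<b} \<subseteq> J" using in_J by auto
    note e = eqs[OF in_J[OF s]]
    have "(\<Sum>K\<in>{1..n-3}. \<psi> K (t s) * (exp (2 * \<phi> K (t s)) * (v s (Flat K))\<^sup>2)) = \<rho> (t s)"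
      unfolding \<rho>_def by (intro sum.cong refl) (simp only: flat[OF _ in_J[OF s]])
    then have F: "?F (Z s) = (v s Time, - (w s \<bullet> (q (t s) *v w s)
         + (\<Sum>K\<in>{1..n-3}. \<psi> K (t s) * (exp (2 * \<phi> K (t s)) * (v s (Flat K))\<^sup>2))),
       - ((2 * v s Time) *\<^sub>R ((h (t s) ** q (t s)) *v w s) + christoffel_quad c (g (t s)) (h (t s)) (w s)),
       \<Sum>i\<in>UNIV. w s $ i *\<^sub>R \<xi> i (\<kappa> (X s)))" by (simp add: geodesic_field_def Z_def)
    have d1: "(t has_vector_derivative v s Time) (at s within {s1..<b})"
      using DERIV_subset[OF e(1) sub] by (simp only: has_real_derivative_iff_has_vector_derivative)
    have d2: "((\<lambda>r. v r Time) has_vector_derivative - (w s \<bullet> (q (t s) *v w s)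
         + (\<Sum>K\<in>{1..n-3}. \<psi> K (t s) * (exp (2 * \<phi> K (t s)) * (v s (Flat K))\<^sup>2)))) (at s within {s1..<b})"
      using DERIV_subset[OF e(2) sub] by (simp only: has_real_derivative_iff_has_vector_derivative)
    have d4: "((\<lambda>r. \<kappa> (X r)) has_vector_derivative (\<Sum>i\<in>UNIV. w s $ i *\<^sub>R \<xi> i (\<kappa> (X s)))) (at s within {s1..<b})"
      by (rule chart_velocity[OF at U(1) \<xi> Xvel s]) (use stay[OF s] in auto)
    show ?thesis unfolding F unfolding Z_def[abs_def]
      by (intro has_vector_derivative_Pair d1 d2 d4 has_vector_derivative_within_subset[OF e(3) sub])
  qed
  obtain \<delta> Y where \<delta>: "\<delta> > 0" and YZ: "\<And>s. s \<in> {s1..<b} \<Longrightarrow> Y s = Z s"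
    and YO: "\<And>s. s \<in> {s1..b + \<delta>} \<Longrightarrow> Y s \<in> ?O"
    and Y': "\<And>s. s \<in> {s1..b + \<delta>} \<Longrightarrow> (Y has_vector_derivative ?F (Y s)) (at s within {s1..b + \<delta>})"
    using ode_continuation[OF O Fs K s1(2) ZK Z'] by metis
  let ?T = "{s1..b + \<delta>}"
  define tY where "tY s = fst (Y s)" for s
  define uY where "uY s = fst (snd (Y s))" for s
  define wY where "wY s = fst (snd (snd (Y s)))" for s
  define zY where "zY s = snd (snd (snd (Y s)))" for s
  have Ys: "Y s = (tY s, uY s, wY s, zY s)" for s by (simp add: tY_def uY_def wY_def zY_def)
  have tYI: "tY s \<in> I" "zY s \<in> \<kappa> ` U" if "s \<in> ?T" for s using YO[OF that] by (auto simp: Ys)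
  note bl = bounded_linear.has_vector_derivative
  note D1 = bl[OF bounded_linear_fst Y'] and D2 = bl[OF bounded_linear_snd Y']
  note E1 = bl[OF bounded_linear_fst D2] and E2 = bl[OF bounded_linear_snd D2]
  note F1 = bl[OF bounded_linear_fst E2] and F2 = bl[OF bounded_linear_snd E2]
  have dt: "(tY has_vector_derivative uY s) (at s within ?T)" if "s \<in> ?T" for s
    using D1[OF that] by (simp add: tY_def[abs_def, symmetric]) (simp add: Ys geodesic_field_def)
  have du: "(uY has_vector_derivative - (wY s \<bullet> (q (tY s) *v wY s) + \<rho> (tY s))) (at s within ?T)" if "s \<in> ?T" for s
    using E1[OF that] by (simp add: uY_def[abs_def, symmetric]) (simp add: Ys geodesic_field_def)
  have dw: "(wY has_vector_derivative - ((2 * uY s) *\<^sub>R ((h (tY s) ** q (tY s)) *v wY s)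
      + christoffel_quad c (g (tY s)) (h (tY s)) (wY s))) (at s within ?T)" if "s \<in> ?T" for s
    using F1[OF that] by (simp add: wY_def[abs_def, symmetric]) (simp add: Ys geodesic_field_def)
  have dz: "(zY has_vector_derivative (\<Sum>i\<in>UNIV. wY s $ i *\<^sub>R \<xi> i (zY s))) (at s within ?T)" if "s \<in> ?T" for s
    using F2[OF that] by (simp add: zY_def[abs_def, symmetric]) (simp add: Ys geodesic_field_def)
  \<comment> \<open>The chart solution, translated back.\<close>
  define xY where "xY s = x s1 + inv_into U \<kappa> (zY s)" for s
  have xYvel: "group_velocity A e ?T xY wY"
    unfolding xY_def
    by (rule group_velocity_translate[OF G inv group_velocity_from_chart[OF at U(1) \<xi> tYI(2) dz]])
  define f where "f K s = p K * exp (- 2 * \<phi> K (tY s))" for K s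
  have dphi: "((\<lambda>s. \<phi> K (tY s)) has_real_derivative \<psi> K (tY s) * uY s) (at s within ?T)" if K: "K \<in> {1..n-3}" and s: "s \<in> ?T" for K s
  proof -
    have "(tY has_real_derivative uY s) (at s within ?T)"
      using dt[OF s] by (simp only: has_real_derivative_iff_has_vector_derivative)
    from DERIV_chain2[OF \<phi>_deriv[OF tYI(1)[OF s] K] this] show ?thesis .
  qed
  have df: "(f K has_real_derivative - (2 * \<psi> K (tY s) * uY s * f K s)) (at s within ?T)" if K: "K \<in> {1..n-3}" and s: "s \<in> ?T" for K s
    unfolding f_def[abs_def] by (auto intro!: derivative_eq_intros dphi[OF K s])
  \<comment> \<open>Zero outside the index range, as membership in \<open>spacetime\<close>
    requires.\<close>
  define yY where "yY s K = (if K \<in> {1..n-3} then snd (snd (\<gamma> s1)) K + integral {s1..s} (f K) else 0)" for s K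
  have dy: "((\<lambda>s. yY s K) has_real_derivative f K s) (at s within ?T)" if K: "K \<in> {1..n-3}" and s: "s \<in> ?T" for K s
  proof -
    have "continuous_on ?T (f K)" by (rule DERIV_continuous_on[OF df[OF K]])
    then have "((\<lambda>s. integral {s1..s} (f K)) has_real_derivative f K s) (at s within ?T)"
      by (rule integral_has_real_derivative[OF _ s])
    then have "((\<lambda>s. snd (snd (\<gamma> s1)) K + integral {s1..s} (f K)) has_real_derivative f K s) (at s within ?T)"
      by (auto intro!: derivative_eq_intros)
    then show ?thesis using K by (simp add: yY_def)
  qed
  define \<gamma>Y where "\<gamma>Y s = (tY s, xY s, yY s)" for s
  define vY where "vY s d = (case d of Time \<Rightarrow> uY s | Grp i \<Rightarrow> wY s $ i | Flat K \<Rightarrow> f K s)" for s d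
  have sY: "spatial_part (vY s) = wY s" for s by (simp add: spatial_part_def vY_def)
  have \<rho>Y: "(\<Sum>K\<in>{1..n-3}. \<psi> K (tY s) * (exp (2 * \<phi> K (tY s)) * (vY s (Flat K))\<^sup>2)) = \<rho> (tY s)" for s
    by (simp add: \<rho>_def vY_def f_def)
  have geoY: "geodesic n A e c I (metric_at g \<phi>) ?T \<gamma>Y vY"
    unfolding geodesic_iff Let_def sY \<rho>Y
  proof (intro conjI ballI)
    show "is_interval ?T" by (rule is_interval_cc)
    show "\<exists>a\<in>?T. \<exists>b\<in>?T. a < b" using s1 \<delta> by (intro bexI[of _ s1] bexI[of _ b]) auto
    show "\<gamma>Y ` ?T \<subseteq> spacetime n I" using tYI(1) by (auto simp: \<gamma>Y_def spacetime_def yY_def)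
    show "group_velocity A e ?T (\<lambda>s. fst (snd (\<gamma>Y s))) wY" using xYvel by (simp add: \<gamma>Y_def)
    fix s assume s: "s \<in> ?T"
    show "((\<lambda>r. fst (\<gamma>Y r)) has_real_derivative vY s Time) (at s within ?T)"
      using dt[OF s] by (simp add: \<gamma>Y_def vY_def has_real_derivative_iff_has_vector_derivative)
    show "((\<lambda>r. vY r Time) has_real_derivative - (wY s \<bullet> (q (fst (\<gamma>Y s)) *v wY s) + (\<Sum>K\<in>{1..n-3}. \<psi> K (fst (\<gamma>Y s)) * (exp (2 * \<phi> K (fst (\<gamma>Y s))) * (vY s (Flat K))\<^sup>2)))) (at s within ?T)"
      using du[OF s] \<rho>Y[of s] by (simp add: \<gamma>Y_def vY_def has_real_derivative_iff_has_vector_derivative)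
    show "(wY has_vector_derivative - ((2 * vY s Time) *\<^sub>R ((h (fst (\<gamma>Y s)) ** q (fst (\<gamma>Y s))) *v wY s)
        + christoffel_quad c (g (fst (\<gamma>Y s))) (h (fst (\<gamma>Y s))) (wY s))) (at s within ?T)"
      using dw[OF s] by (simp add: \<gamma>Y_def vY_def)
    show "((\<lambda>r. snd (snd (\<gamma>Y r)) K) has_real_derivative vY s (Flat K)) (at s within ?T)" if K: "K \<in> {1..n-3}" for K
      using dy[OF K s] by (simp add: \<gamma>Y_def vY_def)
    show "((\<lambda>r. vY r (Flat K)) has_real_derivative - (2 * \<psi> K (fst (\<gamma>Y s)) * vY s Time * vY s (Flat K))) (at s within ?T)"
      if K: "K \<in> {1..n-3}" for K
      using df[OF K s] by (simp add: \<gamma>Y_def vY_def)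
  qed
  have eq_lt: "t s = tY s \<and> v s Time = uY s \<and> w s = wY s \<and> x s = xY s" if s: "s \<in> {s1..<b}" for s
  proof -
    have "x s = x s1 + X s" by (simp add: X_def add.assoc[symmetric])
    also have "X s = inv_into U \<kappa> (\<kappa> (X s))" using stay[OF s] ch(5) by (simp add: inv_into_f_f)
    finally show ?thesis using YZ[OF s] by (simp add: Ys Z_def xY_def)
  qed
  \<comment> \<open>\<open>b\<close> itself may or may not belong to \<open>J\<close>; if it does,
    agreement at \<open>b\<close> follows by continuity.\<close>
  have eq: "t s = tY s \<and> v s Time = uY s \<and> w s = wY s \<and> x s = xY s" if s: "s \<in> J" "s1 \<le> s" for s
  proof (cases "s < b")
    case True
    then show ?thesis using eq_lt s by simp
  next
    case False
    then have bJ: "s = b" "b \<in> J" using le_b[OF s(1)] s by auto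
    have sub: "{s1..b} \<subseteq> J" by (rule interval_Icc_subset[OF J s1J bJ(2)])
    have subT: "{s1..b} \<subseteq> ?T" using \<delta> by auto
    have "t b = tY b"
      by (rule eq_at_right_end[OF s1(2)])
        (use eq_lt in \<open>auto intro: continuous_on_subset[OF DERIV_continuous_on[OF eqs(1)] sub] continuous_on_subset[OF continuous_on_vector_derivative[OF dt] subT]\<close>)
    moreover have "v b Time = uY b"
      by (rule eq_at_right_end[OF s1(2), of "\<lambda>r. v r Time"])
        (use eq_lt in \<open>auto intro: continuous_on_subset[OF DERIV_continuous_on[OF eqs(2)] sub] continuous_on_subset[OF continuous_on_vector_derivative[OF du] subT]\<close>)
    moreover have "w b = wY b"
      by (rule eq_at_right_end[OF s1(2)])
        (use eq_lt in \<open>auto intro: continuous_on_subset[OF continuous_on_vector_derivative[OF eqs(3)] sub] continuous_on_subset[OF continuous_on_vector_derivative[OF dw] subT]\<close>)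
    moreover have "x b = xY b"
      by (rule eq_at_right_end[OF s1(2)])
        (use eq_lt in \<open>auto intro: continuous_on_subset[OF group_velocity_continuous[OF at gvel] sub] continuous_on_subset[OF group_velocity_continuous[OF at xYvel] subT]\<close>)
    ultimately show ?thesis using bJ by simp
  qed
  have J_T: "J \<inter> {s1..} \<subseteq> ?T" using le_b \<delta> by force
  have eq_flat: "v s (Flat K) = f K s" if "s \<in> J" "s1 \<le> s" "K \<in> {1..n-3}" for s K
    using flat[OF that(3,1)] eq[OF that(1,2)] by (simp add: f_def)
  have eq_y: "snd (snd (\<gamma> s)) K = yY s K" if s: "s \<in> J" "s1 \<le> s" for s K
  proof (cases "K \<in> {1..n-3}")
    case True
    let ?J = "J \<inter> {s1..}"
    have "snd (snd (\<gamma> s)) K - yY s K = snd (snd (\<gamma> s1)) K - yY s1 K"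
    proof (rule constant_on_interval[of ?J "\<lambda>s. snd (snd (\<gamma> s)) K - yY s K"])
      fix u assume u: "u \<in> ?J"
      then have uT: "u \<in> ?T" using J_T by auto
      have "((\<lambda>s. snd (snd (\<gamma> s)) K) has_real_derivative f K u) (at u within ?J)"
        using DERIV_subset[OF eqs(4)[of u K], of ?J] u True eq_flat[of u K] by simp
      moreover have "((\<lambda>s. yY s K) has_real_derivative f K u) (at u within ?J)"
        using DERIV_subset[OF dy[OF True uT] J_T] .
      ultimately have "((\<lambda>s. snd (snd (\<gamma> s)) K - yY s K) has_real_derivative f K u - f K u) (at u within ?J)"
        by (rule DERIV_diff)
      then show "((\<lambda>s. snd (snd (\<gamma> s)) K - yY s K) has_vector_derivative 0) (at u within ?J)"
        by (simp add: has_real_derivative_iff_has_vector_derivative)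
    qed (use is_interval_Int[OF J is_interval_ci[of s1]] s s1J in auto)
    then show ?thesis using True by (simp add: yY_def)
  next
    case False
    then show ?thesis using sp s by (force simp: yY_def spacetime_def)
  qed
  \<comment> \<open>Any point strictly between \<open>s1\<close> and \<open>b\<close> could serve as
    the switch.\<close>
  define s2 where "s2 = (s1 + b) / 2"
  have s2: "s1 < s2" "s2 < b" using s1 by (auto simp: s2_def)
  have "geodesic n A e c I (metric_at g \<phi>) (J \<union> {s1..b + \<delta>}) (\<lambda>r. if r < s2 then \<gamma> r else \<gamma>Y r) (\<lambda>r. if r < s2 then v r else vY r)"
  proof (rule geodesic_glue[OF geo geoY])
    show "{s1..<s2} \<subseteq> J" using in_J s2 by auto
    show "J \<subseteq> {..b + \<delta>}" using le_b \<delta> by force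
    fix r assume r: "r \<in> J" "s1 \<le> r"
    show "\<gamma> r = \<gamma>Y r" using eq[OF r] eq_y[OF r] by (simp add: \<gamma>Y_def t_def x_def prod_eq_iff fun_eq_iff)
    fix d assume "d \<in> all_idx n"
    then show "v r d = vY r d"
    proof (cases d)
      case (Grp i)
      have "w r $ i = wY r $ i" using eq[OF r] by simp
      then show ?thesis by (simp add: Grp vY_def w_def spatial_part_def)
    qed (use eq[OF r] eq_flat[OF r] in \<open>auto simp: vY_def\<close>)
  qed (use s2 \<delta> in auto)
  moreover have "b + \<delta> \<in> J \<union> {s1..b + \<delta>}" "\<forall>s\<in>J. s < b + \<delta>" using s1 \<delta> le_b by force+
  moreover have "\<forall>s\<in>J. (if s < s2 then \<gamma> s else \<gamma>Y s) = \<gamma> s"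
    using eq eq_y s2 by (auto simp: \<gamma>Y_def t_def x_def prod_eq_iff fun_eq_iff)
  ultimately show ?thesis unfolding future_inextendible_def by blast
qed

theorem theorem5:
  fixes n :: nat
    and A :: "'g::{topological_group_add, t2_space, second_countable_topology} chart set"
    and e :: "3 \<Rightarrow> 'g vector_field"
    and c :: "3 \<Rightarrow> 3 \<Rightarrow> 3 \<Rightarrow> real"
    and I :: "real set"
    and g :: "real \<Rightarrow> real^3^3"
    and \<phi> :: "nat \<Rightarrow> real \<Rightarrow> real"
  assumes "3 \<le> n" and "n < 9"
    and "lie_group3 A"
    and "connected (UNIV :: 'g set)" and "simply_connected (UNIV :: 'g set)"
    and "left_invariant_frame A e"
    and "structure_constants A e c"
    and "\<not> bianchi_IX c" and "\<not> bianchi_VI (- 1 / 9) c"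
    and "vacuum_solution n e c I g \<phi>"
    and "\<exists>t\<in>I. expanding_at n g \<phi> t"
    and "future_maximal n e c I g \<phi>"
  shows "future_geodesically_complete n A e c I (metric_at g \<phi>)"
proof -
  have at: "smooth_atlas A" using assms(3) by (simp add: lie_group3_def)
  have fields: "smooth_vector_field A (e i)" "left_invariant A (e i)" for i
    using assms(6) by (auto simp: left_invariant_frame_def)
  have I: "open I" and g: "smooth_on I g" and \<phi>: "\<And>K. K \<in> {1..n-3} \<Longrightarrow> smooth_on I (\<phi> K)"
    and pos: "\<And>t. t \<in> I \<Longrightarrow> pos_def (g t)"
    using assms(10) by (auto simp: vacuum_solution_def pos_def_def)
  let ?h = "\<lambda>t. matrix_inverse3 (g t)" and ?q = "\<lambda>t. (1 / 2) *\<^sub>R curve_deriv g t" and ?\<psi> = "\<lambda>K. curve_deriv (\<phi> K)"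
  have vm: "vacuum_metric n A e c I g ?h ?q (curve_deriv ?q) \<phi> ?\<psi> (\<lambda>K. curve_deriv (curve_deriv (\<phi> K)))"
    by (rule vacuum_solution_imp_vacuum_metric[OF at fields(1) structure_constants_skew[OF assms(6,7)] assms(10,8)])
  interpret vacuum_metric n A e c I g ?h ?q "curve_deriv ?q" \<phi> ?\<psi> "\<lambda>K. curve_deriv (curve_deriv (\<phi> K))" by (rule vm)
  obtain t0 where t0: "t0 \<in> I" "expansion t0 > 0"
    using assms(11) mean_curvature_eq by (auto simp: expanding_at_def)
  \<comment> \<open>A solution on an interval bounded above could be extended, contrary to
    maximality.\<close>
  have unb: "\<not> bdd_above I"
  proof
    assume "bdd_above I"
    then obtain I' g' \<phi>' where "vacuum_solution n e c I' g' \<phi>'" "I \<subseteq> I'" "\<exists>t'\<in>I'. \<forall>t\<in>I. t < t'"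
      "\<forall>t\<in>I. g' t = g t \<and> (\<forall>K\<in>{1..n-3}. \<phi>' K t = \<phi> K t)"
      using extension[OF g \<phi> t0] by metis
    then show False using assms(12) unfolding future_maximal_def by blast
  qed
  have h: "smooth_on I ?h"
    unfolding matrix_inverse3_def using pos_def_det[OF pos]
    by (intro smooth_on_scaleR smooth_on_inverse smooth_on_det smooth_on_adj3 I g) force
  have q: "smooth_on I ?q" by (intro smooth_on_scaleR_const I smooth_curve_deriv(2) g)
  have \<psi>: "smooth_on I (?\<psi> K)" if "K \<in> {1..n-3}" for K by (rule smooth_curve_deriv(2)[OF I \<phi>[OF that]])
  have n: "n \<le> 9" using assms(2) by simp
  show ?thesis
    unfolding future_geodesically_complete_def
  proof (intro allI impI)
    fix J \<gamma> v r
    assume H: "geodesic n A e c I (metric_at g \<phi>) J \<gamma> v \<and>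
        ((\<forall>s\<in>J. timelike_vec n (metric_at g \<phi>) (\<gamma> s) (v s)) \<or> (\<forall>s\<in>J. null_vec n (metric_at g \<phi>) (\<gamma> s) (v s))) \<and>
        (\<forall>s\<in>J. v s Time > 0) \<and> future_inextendible n A e c I (metric_at g \<phi>) J \<gamma>"
    \<comment> \<open>Timelike and null geodesics are treated together.\<close>
    have causal: "norm_sq n (metric_at g \<phi>) (\<gamma> s) (v s) \<le> 0" if "s \<in> J" for s
      using H that by (auto simp: timelike_vec_def null_vec_def less_imp_le)
    show "\<exists>s\<in>J. r < s"
    proof (rule ccontr)
      assume "\<not> (\<exists>s\<in>J. r < s)"
      then have le: "s \<le> r" if "s \<in> J" for s using that by force
      have "\<not> future_inextendible n A e c I (metric_at g \<phi>) J \<gamma>"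
      proof (rule geodesic_extendible[OF vm assms(3) fields(2) g h q \<phi> \<psi> n expansion_pos[OF t0] unb])
        show "geodesic n A e c I (metric_at g \<phi>) J \<gamma> v" using H by blast
        show "v s Time > 0" if "s \<in> J" for s using H that by blast
      qed (use causal le in auto)
      then show False using H by blast
    qed
  qed
qed

end
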